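(* Let $n\ge 1$ and let $K_0,K_1\subset\mathbb{R}^n$ be convex Borel sets with $\gamma(K_i)>0$ for $i=0,1$. For every $t\in[0,1]$ set $K_t=(1-t)K_0+tK_1$ and $b_t=(1-t)b_{K_0}+tb_{K_1}$. Then for every $t\in[0,1]$, $$e^{|b_t|^2/(2n)}\gamma(K_t)^{1/n}\ \ge\ (1-t)\,e^{|b_{K_0}|^2/(2n)}\gamma(K_0)^{1/n}+t\,e^{|b_{K_1}|^2/(2n)}\gamma(K_1)^{1/n}.$$ Moreover, equality in this inequality at some $t\in(0,1)$ holds if and only if $\bar K_0=\bar K_1$; in this case, equality holds for every $t\in[0,1]$. In particular, if $b_{K_0}=b_{K_1}$, then $\gamma(K_t)^{1/n}\ge(1-t)\gamma(K_0)^{1/n}+t\gamma(K_1)^{1/n}$.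
   Context: $\gamma$ is the standard Gaussian measure on $\mathbb{R}^n$. For a convex Borel set $K$ with $\gamma(K)>0$, $\gamma_K(A)=\gamma(A\cap K)/\gamma(K)$ is the Gaussian measure conditioned on $K$ and $b_K=\int x\,\mathrm d\gamma_K(x)$ is its barycenter. $(1-t)K_0+tK_1=\{(1-t)x+ty:x\in K_0,\,y\in K_1\}$ is the Minkowski combination (a convex set, hence Lebesgue measurable). $\bar K$ denotes the closure of $K$. *)

theory Defs
  imports "HOL-Analysis.Analysis"
begin

text \<open>The Gaussian measure is taken on the Lebesgue sigma-algebra (not just the Borel sets), since a
  Minkowski combination of convex Borel sets is Lebesgue measurable but need not be Borel.\<close>

definition gauss_measure :: "(real ^ 'n) measure" where
  "gauss_measure = density lebesgue
     (\<lambda>x. ennreal ((2 * pi) powr (- (real CARD('n) / 2)) * exp (- (norm x)\<^sup>2 / 2)))"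

definition gauss_cond :: "(real ^ 'n) set \<Rightarrow> (real ^ 'n) measure" where
  "gauss_cond K = uniform_measure gauss_measure K"

definition barycenter :: "(real ^ 'n) set \<Rightarrow> real ^ 'n" where
  "barycenter K = (LINT x|gauss_cond K. x)"

definition minkowski_comb ::
  "real \<Rightarrow> 'a::real_vector set \<Rightarrow> 'a set \<Rightarrow> 'a set" where
  "minkowski_comb t A B = {(1 - t) *\<^sub>R x + t *\<^sub>R y | x y. x \<in> A \<and> y \<in> B}"

text \<open>Despite its name, the library's \<open>uniform_measure M A\<close> is the conditioning of an arbitrary
  measure \<open>M\<close> on \<open>A\<close>.\<close>

lemma measure_gauss_cond:
  fixes K A :: "(real ^ 'n) set"
  assumes "K \<in> sets lebesgue" "A \<in> sets lebesgue" "measure gauss_measure K > 0"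
  shows "measure (gauss_cond K) A = measure gauss_measure (A \<inter> K) / measure gauss_measure K"
proof -
  have "emeasure gauss_measure K \<noteq> 0" "emeasure gauss_measure K \<noteq> \<infinity>"
    using assms(3) by (auto simp: measure_def)
  then show ?thesis
    using measure_uniform_measure[of gauss_measure K A] assms(1,2)
    by (simp add: gauss_cond_def gauss_measure_def Int_commute)
qed

end

theory Submission
  imports Defs "HOL-Probability.Probability" "HOL-Complex_Analysis.Great_Picard"
begin

text \<open>Entropic (Sinkhorn) transport produces maps \<open>T_i\<close>, 1-Lipschitz gradients of convex functions, that push the
Gaussian measure \<open>\<gamma>\<close> forward to \<open>\<gamma>\<close> conditioned on \<open>K_i\<close>; contractivity comes from the Prekopa--Leindler
inequality. Ornstein--Uhlenbeck smoothing makes them differentiable with symmetric derivatives between \<open>0\<close> and the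
identity, and a Gaussian change of variables with Jensen's inequality yields
\<open>E ln det DT_i \<ge> ln \<gamma>(K_i) + E|T_i|^2 / 2 - n / 2\<close>, up to errors that vanish with the smoothing.

Let \<open>X_t = (1 - t) T_0 + t T_1\<close> and \<open>h(t) = Var(X_t) / 2 - E ln det DX_t\<close>. Simultaneous diagonalisation of the
derivatives and the Gaussian Poincare inequality, for which the constant 5/4 suffices, give
\<open>n h'' \<ge> h'^2 + (n / 2) Var(T_1 - T_0)\<close>, so \<open>exp (- h / n)\<close> is concave with a gap proportional to
\<open>Var(T_1 - T_0)\<close>. Since \<open>X_t\<close> takes values in the closure of \<open>K_t\<close>, changing variables along \<open>X_t\<close> bounds
\<open>\<gamma>(K_t)\<close> from below by this quantity, and \<open>E X_t = b_t\<close> supplies the exponential factor. In the equality case the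
gap forces \<open>T_1 - T_0\<close> to be constant, and comparing the Gaussian densities forces that constant to vanish.\<close>

text \<open>Contractivity of the Brenier map (Caffarelli) usually rests on regularity of the
  Monge-Ampere equation. Entropic transport avoids this: every iterate has an explicit formula, and
  being the 1-Lipschitz gradient of a convex function is reproduced exactly by one iteration at
  every temperature \<open>e\<close>, because \<open>1 / (1 + e) + e >= 1\<close>. Compactness then
  yields the maps.

  These maps are merely Lipschitz and satisfy no pointwise Monge-Ampere equation. A lower bound for
  the mean of ln det is enough, however, and it can be derived from averages over the smoothing
  kernel: what is nonlinear in the map is controlled by the Poincare inequality and by increments of
  a bounded monotone energy, which are negligible at suitable smoothing levels.

  The Poincare constant is not the sharp 1 but \<open>pi^2 / 8\<close>, from joining two independent
  points by a quarter circle. Rounded up to \<open>5 / 4\<close>, it is exactly what the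
  second-variation estimate tolerates: the budget there is
  \<open>13 / 10 = 1 / 20 + 5 / 4\<close>.\<close>

notation scaleR (infixr "*." 75)

abbreviation nsq :: "'a::real_normed_vector => real" where "nsq x \<equiv> (norm x)^2"

abbreviation nn_lborel :: "('a::euclidean_space => ennreal) => ennreal" (binder "\<integral>+" 10)
  where "nn_lborel f \<equiv> integral\<^sup>N lborel f"

abbreviation borel_funs :: "('a::topological_space => 'b::topological_space) set"
  where "borel_funs \<equiv> borel_measurable borel"

abbreviation converges :: "(nat => 'a::topological_space) => 'a => bool" (infix "---->" 60)
  where "X ----> L \<equiv> X \<longlonglongrightarrow> L"

abbreviation rot :: "real => 'a::real_vector => 'a => 'a"
  where "rot a x z \<equiv> a *. x + sqrt (1 - a^2) *. z"

abbreviation add_scalar :: "real ^ 'n ^ 'n => real => real ^ 'n ^ 'n" (infixl "+." 65)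
  where "A +. k \<equiv> A + k *. mat 1"

section \<open>The standard Gaussian measure\<close>

definition gauss_density :: "'a::euclidean_space => real" where
  "gauss_density x = (2 * pi) powr (- (real DIM('a) / 2)) * exp (- nsq x / 2)"

text \<open>Kept on the Borel sets of any Euclidean space, so that products and push-forwards stay
  within \<open>borel\<close>; the completed measure \<open>gauss_measure\<close> is compared with
  it only at the end.\<close>

definition gauss :: "'a::euclidean_space measure" where
  "gauss = density lborel (\<lambda>x. ennreal (gauss_density x))"

abbreviation gauss_mean :: "('a::euclidean_space => 'b::{banach, second_countable_topology}) => 'b" (binder "\<oint>" 10)
  where "gauss_mean f \<equiv> integral\<^sup>L gauss f"

abbreviation gauss2 :: "('a::euclidean_space \<times> 'b::euclidean_space) measure"
  where "gauss2 \<equiv> gauss \<Otimes>\<^sub>M gauss"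

lemma gauss_density_pos: "gauss_density x > 0" by (simp add: gauss_density_def)

lemma gauss_density_nonneg [simp]: "gauss_density x >= 0" using gauss_density_pos[of x] by simp

lemma gauss_density_prod:
  "gauss_density (x::'a::euclidean_space) = (\<Prod>b\<in>Basis. std_normal_density (x \<bullet> b))"
proof -
  have "(\<Prod>b\<in>(Basis::'a set). std_normal_density (x \<bullet> b)) =
      (1 / sqrt (2 * pi)) ^ DIM('a) * exp (\<Sum>b\<in>Basis. - (x \<bullet> b)\<^sup>2 / 2)"
    by (simp add: std_normal_density_def exp_sum power_divide prod_dividef)
  also have "(\<Sum>b\<in>Basis. - (x \<bullet> b)\<^sup>2 / 2) = - nsq x / 2" unfolding power2_norm_eq_inner
    by (subst euclidean_inner) (simp add: sum_negf power2_eq_square sum_divide_distrib)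
  also have "(1 / sqrt (2 * pi)) ^ DIM('a) = (2 * pi) powr (- (real DIM('a) / 2))"
    by (simp add: powr_half_sqrt[symmetric] power_divide powr_minus_divide powr_powr flip: powr_realpow)
  finally show ?thesis by (simp add: gauss_density_def)
qed

lemma gauss_density_measurable [measurable]: "gauss_density \<in> borel_funs"
  unfolding gauss_density_def[abs_def] by measurable

lemma sets_gauss [simp, measurable_cong]: "sets gauss = sets borel" by (simp add: gauss_def)

lemma space_gauss [simp]: "space gauss = UNIV" by (simp add: gauss_def)

lemma nn_integral_gauss:
  "f \<in> borel_funs ==> (\<integral>\<^sup>+x. f x \<partial>gauss) = (\<integral>+x. ennreal (gauss_density x) * f x)"
  unfolding gauss_def by (subst nn_integral_density) auto

lemma prob_space_gauss: "prob_space (gauss :: 'a::euclidean_space measure)"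
proof
  have 1: "(\<integral>+t. ennreal (std_normal_density t)) = 1"
    using nn_integral_eq_integral[of lborel std_normal_density] by simp
  have "emeasure gauss (space gauss :: 'a set)
      = (\<integral>\<^sup>+x. (\<Prod>b\<in>Basis. ennreal (std_normal_density (x \<bullet> b))) \<partial>(lborel :: 'a measure))"
    by (subst space_gauss, subst gauss_def, subst emeasure_density)
       (auto simp: gauss_density_prod prod_ennreal)
  also have "... = 1" by (subst nn_integral_lborel_prod) (auto simp: 1)
  finally show "emeasure gauss (space gauss :: 'a set) = 1" .
qed

interpretation gauss: prob_space "gauss :: 'a::euclidean_space measure" by (rule prob_space_gauss)

interpretation gauss2: pair_prob_space "gauss :: 'a::euclidean_space measure" "gauss :: 'b::euclidean_space measure" ..

lemma nn_integral_lborel_affine: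
  fixes f :: "'a::euclidean_space => ennreal"
  assumes [measurable]: "f \<in> borel_funs" and c: "c ~= 0"
  shows "(\<integral>+x. f x) = ennreal (\<bar>c\<bar> ^ DIM('a)) * (\<integral>+x. f (t + c *. x))" by (subst lborel_affine[OF c, of t])
     (simp add: nn_integral_density nn_integral_distr nn_integral_cmult)

text \<open>Cameron-Martin formula for translations: completing the square in
  \<open>gauss_density (x - p)\<close> produces the weight. Later it moves increments of the
  argument of a smoothed function onto the density.\<close>

lemma distr_gauss_shift:
  fixes p :: "'a::euclidean_space"
  shows "distr gauss borel (\<lambda>x. x + p) = density gauss (\<lambda>x. ennreal (exp (p \<bullet> x - nsq p / 2)))"
proof (rule measure_eqI)
  fix A :: "'a set" assume "A \<in> sets (distr gauss borel (\<lambda>x. x + p))"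
  then have [measurable]: "A \<in> sets borel" by simp
  have d: "gauss_density (x - p) = gauss_density x * exp (p \<bullet> x - nsq p / 2)" for x :: 'a unfolding gauss_density_def
    by (simp add: power2_norm_eq_inner algebra_simps inner_commute flip: exp_add add: diff_divide_distrib)
  have "emeasure (distr gauss borel (\<lambda>x. x + p)) A = (\<integral>\<^sup>+x. indicator A (x + p) \<partial>gauss)"
    by (simp add: nn_integral_distr flip: nn_integral_indicator)
  also have "... = (\<integral>+x. ennreal (gauss_density x) * indicator A (x + p))" by (subst nn_integral_gauss) auto
  also have "... = (\<integral>+x. ennreal (gauss_density (x - p)) * indicator A x)"
    using nn_integral_lborel_affine[where c=1 and t=p, of "\<lambda>x. ennreal (gauss_density (x - p)) * indicator A x"]
    by (simp add: add.commute)
  also have "... = (\<integral>\<^sup>+x. ennreal (exp (p \<bullet> x - nsq p / 2)) * indicator A x \<partial>gauss)"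
    by (subst nn_integral_gauss) (auto simp: d ennreal_mult' mult.assoc)
  also have "... = emeasure (density gauss (\<lambda>x. ennreal (exp (p \<bullet> x - nsq p / 2)))) A"
    by (subst emeasure_density) auto
  finally show "emeasure (distr gauss borel (\<lambda>x. x + p)) A = ..." .
qed simp

lemma integrable_gauss_shift:
  fixes f :: "'a::euclidean_space => 'b::{banach, second_countable_topology}"
  assumes [measurable]: "f \<in> borel_funs"
  shows "integrable gauss (\<lambda>x. f (x + p)) \<longleftrightarrow> integrable gauss (\<lambda>x. exp (p \<bullet> x - nsq p / 2) *. f x)"
proof -
  have "integrable gauss (\<lambda>x. f (x + p)) \<longleftrightarrow> integrable (distr gauss borel (\<lambda>x. x + p)) f"
    by (subst integrable_distr_eq) auto
  then show ?thesis unfolding distr_gauss_shift by (subst (asm) integrable_density) auto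
qed

lemma integral_gauss_shift:
  fixes f :: "'a::euclidean_space => 'b::{banach, second_countable_topology}"
  assumes [measurable]: "f \<in> borel_funs"
  shows "(\<oint>x. f (x + p)) = (\<oint>x. exp (p \<bullet> x - nsq p / 2) *. f x)"
proof -
  have "(\<oint>x. f (x + p)) = integral\<^sup>L (distr gauss borel (\<lambda>x. x + p)) f" by (subst integral_distr) auto
  then show ?thesis unfolding distr_gauss_shift by (subst (asm) integral_density) auto
qed

text \<open>The rotation splits into two affine substitutions in one variable each:
  \<open>c *. x + s *. y\<close> replaces \<open>x\<close> at fixed \<open>y\<close>, then
  \<open>y\<close> is replaced at fixed \<open>x\<close>. Each contributes the same factor
  \<open>d\<close>, on opposite sides, so the factors cancel. The second substitution divides by
  \<open>c\<close>, hence \<open>c > 0\<close>.\<close>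

lemma nn_integral_gauss_rotation:
  fixes F :: "'a::euclidean_space \<times> 'a => ennreal"
  assumes F[measurable]: "F \<in> borel_funs" and c: "c > 0" and cs: "c^2 + s^2 = (1::real)"
  shows "(\<integral>\<^sup>+p. F (c *. fst p + s *. snd p, c *. snd p - s *. fst p) \<partial>gauss2)
     = (\<integral>\<^sup>+p. F p \<partial>gauss2)"
proof -
  let ?g = "gauss_density :: 'a => real" and ?l = "lborel :: 'a measure"
  let ?P = "\<integral>\<^sup>+p. F (c *. fst p + s *. snd p, c *. snd p - s *. fst p) \<partial>gauss2"
  have F'[measurable]: "F \<in> borel_measurable (borel \<Otimes>\<^sub>M borel)" by (simp add: borel_prod)
  have pair: "(\<integral>\<^sup>+p. H p \<partial>gauss2) =
      (\<integral>+x. \<integral>+y. ennreal (?g x) * (ennreal (?g y) * H (x,y)))"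
    if [measurable]: "H \<in> borel_measurable (borel \<Otimes>\<^sub>M borel)" for H :: "'a \<times> 'a => ennreal"
  proof -
    have "(\<integral>\<^sup>+p. H p \<partial>gauss2) = (\<integral>\<^sup>+x. \<integral>\<^sup>+y. H (x,y) \<partial>gauss \<partial>gauss)" by (subst gauss.nn_integral_fst[symmetric]) auto
    also have "... = (\<integral>\<^sup>+x. \<integral>\<^sup>+y. ennreal (?g y) * H (x,y) \<partial>lborel \<partial>gauss)"
      by (intro nn_integral_cong, subst nn_integral_gauss) auto
    also have "... = (\<integral>+x. ennreal (?g x) * (\<integral>+y. ennreal (?g y) * H (x,y)))" by (subst nn_integral_gauss) auto
    finally show ?thesis by (subst nn_integral_cmult) auto
  qed
  have n: "norm (c *. x + s *. y) ^ 2 + norm (c *. y - s *. x) ^ 2 = norm x ^ 2 + norm y ^ 2" for x y :: 'a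
  proof -
    have "norm (c *. x + s *. y) ^ 2 + norm (c *. y - s *. x) ^ 2 = (c^2 + s^2) * (norm x ^ 2 + norm y ^ 2)"
      by (simp add: power2_norm_eq_inner) (simp add: power2_eq_square algebra_simps)
    then show ?thesis using cs by simp
  qed
  have g: "?g x * ?g y = ?g (c *. x + s *. y) * ?g (c *. y - s *. x)" for x y
    using n[of x y] by (simp add: gauss_density_def mult_exp_exp)
  define H where "H = (\<lambda>u v. ennreal (?g u * ?g v) * F (u, v))"
  have H[measurable]: "(\<lambda>p. H (fst p) (snd p)) \<in> borel_measurable (borel \<Otimes>\<^sub>M borel)" unfolding H_def by measurable
  have H2[measurable]: "(\<lambda>x. H (f x) (h x)) \<in> borel_measurable M" if "f \<in> borel_measurable M" "h \<in> borel_measurable M" for f h and M :: "'z measure"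
    using measurable_compose[OF measurable_Pair[OF that] H] by simp
  define d where "d = ennreal (\<bar>c\<bar> ^ DIM('a))"
  let ?h = "\<lambda>x y. H x ((1/c) *. (y - s *. x))" and ?H = "\<lambda>x y. H (c *. x + s *. y) (c *. y - s *. x)"
  have "?P
     = (\<integral>\<^sup>+x. \<integral>\<^sup>+y. ?H x y \<partial>?l \<partial>?l)"
    unfolding H_def g[symmetric] by (subst pair) (auto simp: ennreal_mult' mult.assoc)
  also have "... = (\<integral>\<^sup>+y. \<integral>\<^sup>+x. ?H x y \<partial>?l \<partial>?l)" by (rule lborel_pair.Fubini') simp
  also have "... = (\<integral>\<^sup>+y. \<integral>\<^sup>+x. H (s *. y + c *. x) ((1/c) *. (y - s *. (s *. y + c *. x))) \<partial>?l \<partial>?l)"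
  proof -
    have e: "(1/c) *. (y - s *. (s *. y + c *. x)) = c *. y - s *. x" for x y :: 'a
    proof -
      have "(1/c) *. (y - s *. (s *. y + c *. x)) = ((1 - s^2)/c) *. y - s *. x"
        using c by (simp add: algebra_simps power2_eq_square diff_divide_distrib)
      moreover have "(1 - s^2)/c = c" using cs c by (simp add: field_simps power2_eq_square)
      ultimately show ?thesis by simp
    qed
    show ?thesis unfolding e by (simp add: add.commute)
  qed
  also have "d * ... = (\<integral>\<^sup>+y. \<integral>\<^sup>+x. ?h x y \<partial>?l \<partial>?l)"
    using c by (subst nn_integral_cmult[symmetric], simp, intro nn_integral_cong)
       (subst nn_integral_lborel_affine[where c=c], auto simp: d_def)
  finally have 1: "d * ?P
     = (\<integral>\<^sup>+y. \<integral>\<^sup>+x. ?h x y \<partial>?l \<partial>?l)" .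
  have "(\<integral>\<^sup>+y. \<integral>\<^sup>+x. ?h x y \<partial>?l \<partial>?l) = (\<integral>\<^sup>+x. \<integral>\<^sup>+y. ?h x y \<partial>?l \<partial>?l)" by (rule lborel_pair.Fubini') simp
  also have "... = (\<integral>\<^sup>+x. d * (\<integral>\<^sup>+y. H x y \<partial>?l) \<partial>?l)"
  proof (intro nn_integral_cong)
    fix x :: 'a
    have "(\<integral>\<^sup>+y. ?h x y \<partial>?l) = d * (\<integral>\<^sup>+y. H x ((1/c) *. (s *. x + c *. y - s *. x)) \<partial>?l)"
      using c by (subst nn_integral_lborel_affine[where c=c and t="s *. x"]) (auto simp: d_def)
    then show "(\<integral>\<^sup>+y. ?h x y \<partial>?l) = d * (\<integral>\<^sup>+y. H x y \<partial>?l)" using c by simp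
  qed
  also have "... = d * (\<integral>\<^sup>+p. F p \<partial>gauss2)"
    by (subst pair) (auto simp: H_def ennreal_mult' mult.assoc nn_integral_cmult)
  finally have "d * ?P
     = d * (\<integral>\<^sup>+p. F p \<partial>gauss2)" using 1 by simp
  then show ?thesis using c by (auto simp: d_def ennreal_mult_cancel_left)
qed

lemma (in pair_prob_space) integral_fst_comp:
  fixes f :: "'a => 'c::{banach, second_countable_topology}"
  assumes f: "integrable M1 f"
  shows "integrable (M1 \<Otimes>\<^sub>M M2) (\<lambda>p. f (fst p))" "(\<integral>p. f (fst p) \<partial>(M1 \<Otimes>\<^sub>M M2)) = (\<integral>x. f x \<partial>M1)"
proof -
  have [measurable]: "f \<in> borel_measurable M1" using f by auto
  show i: "integrable (M1 \<Otimes>\<^sub>M M2) (\<lambda>p. f (fst p))"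
    using f by (subst integrable_distr_eq[symmetric, of fst _ M1]) (auto simp: M2.distr_pair_fst)
  show "(\<integral>p. f (fst p) \<partial>(M1 \<Otimes>\<^sub>M M2)) = (\<integral>x. f x \<partial>M1)"
      by (subst integral_distr[symmetric, of fst _ M1]) (auto simp: M2.distr_pair_fst)
qed

lemma (in pair_prob_space) integral_snd_comp:
  fixes f :: "'b => 'c::{banach, second_countable_topology}"
  assumes f: "integrable M2 f"
  shows "integrable (M1 \<Otimes>\<^sub>M M2) (\<lambda>p. f (snd p))" "(\<integral>p. f (snd p) \<partial>(M1 \<Otimes>\<^sub>M M2)) = (\<integral>x. f x \<partial>M2)"
proof -
  have [measurable]: "f \<in> borel_measurable M2" using f by auto
  have d: "distr (M1 \<Otimes>\<^sub>M M2) M2 snd = M2"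
  proof (rule measure_eqI)
    fix A assume A: "A \<in> sets (distr (M1 \<Otimes>\<^sub>M M2) M2 snd)"
    then have "snd -` A \<inter> space (M1 \<Otimes>\<^sub>M M2) = space M1 \<times> A"
      using sets.sets_into_space[of A M2] by (auto simp: space_pair_measure)
    then show "emeasure (distr (M1 \<Otimes>\<^sub>M M2) M2 snd) A = emeasure M2 A"
      using A by (simp add: emeasure_distr M2.emeasure_pair_measure_Times M1.emeasure_space_1)
  qed simp
  show "integrable (M1 \<Otimes>\<^sub>M M2) (\<lambda>p. f (snd p))"
    using f by (subst integrable_distr_eq[symmetric, of snd _ M2]) (auto simp: d)
  show "(\<integral>p. f (snd p) \<partial>(M1 \<Otimes>\<^sub>M M2)) = (\<integral>x. f x \<partial>M2)" by (subst integral_distr[symmetric, of snd _ M2]) (auto simp: d)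
qed

section \<open>Integrability, symmetries and second moments of the Gaussian measure\<close>

lemma exp_growth_bound:
  fixes r c :: real assumes "r >= 0" "c >= 0"
  shows "(1 + r)^2 * exp (c * r) <= exp ((c + 2)^2) * exp (r^2 / 4)"
proof -
  have "(1 + r)^2 <= (exp r)^2" using assms by (intro power_mono) auto
  then have "(1 + r)^2 * exp (c * r) <= (exp r)^2 * exp (c * r)" by (intro mult_right_mono) auto
  also have "... = exp ((c + 2) * r)" by (simp add: algebra_simps flip: exp_add exp_double)
  also have "(c + 2) * r <= (c + 2)^2 + r^2 / 4"
    using zero_le_power2[of "(c + 2) - r / 2"] by (simp add: power2_eq_square algebra_simps)
  finally show ?thesis by (simp add: exp_add)
qed

text \<open>The weight halves the quadratic exponent of the density, which becomes the density at
  \<open>x / sqrt 2\<close>; a dilation by \<open>sqrt 2\<close> then gives a finite value.\<close>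

lemma integrable_gauss_exp_sq: "integrable gauss (\<lambda>x::'a::euclidean_space. exp (nsq x / 4))"
proof -
  have "(\<integral>\<^sup>+x. ennreal (exp (nsq (x::'a) / 4)) \<partial>gauss) = (\<integral>+x. ennreal (gauss_density ((1 / sqrt 2) *. x :: 'a)))"
    by (subst nn_integral_gauss)
       (auto simp: gauss_density_def power_divide mult.assoc simp flip: ennreal_mult' exp_add)
  also have "... = ennreal (\<bar>sqrt 2\<bar> ^ DIM('a)) * (\<integral>+x. gauss_density (x::'a) * 1)"
    by (subst nn_integral_lborel_affine[where c="sqrt 2" and t=0]) auto
  also have "... = ennreal (\<bar>sqrt 2\<bar> ^ DIM('a))"
    using nn_integral_gauss[of "\<lambda>_::'a. 1 :: ennreal"] gauss.emeasure_space_1[where 'a='a] by simp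
  finally have "(\<integral>\<^sup>+x. ennreal (exp (nsq (x::'a) / 4)) \<partial>gauss) < \<infinity>" by simp
  then show ?thesis by (intro integrableI_nonneg) auto
qed

lemma integrable_gauss_growth:
  fixes f :: "'a::euclidean_space => 'b::{banach, second_countable_topology}"
  assumes [measurable]: "f \<in> borel_funs"
    and c: "c >= 0" and b: "!!x. norm (f x) <= C * ((1 + norm x)^2 * exp (c * norm x))"
  shows "integrable gauss f"
proof (rule Bochner_Integration.integrable_bound)
  show "integrable gauss (\<lambda>x::'a. C * (exp ((c + 2)^2) * exp (nsq x / 4)))"
    by (intro integrable_mult_right integrable_gauss_exp_sq)
  show "f \<in> borel_measurable gauss" by simp
  have "0 <= norm (f 0)" by simp
  also have "... <= C" using b[of 0] by simp
  finally have C: "C >= 0" .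
  show "AE x in gauss. norm (f x) <= norm (C * (exp ((c + 2)^2) * exp (nsq x / 4)))"
  proof (rule AE_I2)
    fix x
    have "norm (f x) <= C * ((1 + norm x)^2 * exp (c * norm x))" by (rule b)
    also have "... <= C * (exp ((c + 2)^2) * exp (nsq x / 4))"
      using C c by (intro mult_left_mono exp_growth_bound) auto
    finally show "norm (f x) <= norm (C * (exp ((c + 2)^2) * exp (nsq x / 4)))" by simp
  qed
qed

lemma integrable_gauss_quadratic:
  fixes f :: "'a::euclidean_space => 'b::{banach, second_countable_topology}"
  assumes [measurable]: "f \<in> borel_funs"
    and b: "!!x. norm (f x) <= C * (1 + norm x)^2"
  shows "integrable gauss f" by (rule integrable_gauss_growth[where c=0 and C=C]) (use b in auto)

lemma integrable_gauss_linear: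
  fixes f :: "'a::euclidean_space => 'b::{banach, second_countable_topology}"
  assumes [measurable]: "f \<in> borel_funs"
    and b: "!!x. norm (f x) <= C * (1 + norm x)"
  shows "integrable gauss f"
proof (rule integrable_gauss_quadratic[where C=C])
  fix x :: 'a
  have "0 <= norm (f 0)" by simp
  also have "... <= C" using b[of 0] by simp
  finally have C: "C >= 0" .
  have "(1 + norm x) * 1 <= (1 + norm x) * (1 + norm x)" by (intro mult_left_mono) auto
  then show "norm (f x) <= C * (1 + norm x)^2"
    using b[of x] C mult_left_mono[of "1 + norm x" "(1 + norm x)^2" C] by (simp add: power2_eq_square)
qed simp

text \<open>Coordinate sign changes preserve both \<open>lborel\<close> and the norm. Reversing all
  signs gives mean zero; reversing a single one makes distinct coordinates uncorrelated.\<close>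

lemma distr_gauss_sign:
  fixes c :: "'a::euclidean_space => real"
  assumes c: "!!j. j \<in> Basis ==> \<bar>c j\<bar> = 1"
  shows "distr gauss borel (\<lambda>x. \<Sum>j\<in>Basis. (c j * (x \<bullet> j)) *. j) = gauss"
proof -
  let ?T = "\<lambda>x::'a. \<Sum>j\<in>Basis. (c j * (x \<bullet> j)) *. j"
  have [measurable]: "?T \<in> borel_funs" by measurable
  have c2: "(c j)^2 = 1" if "j \<in> Basis" for j using c[OF that] by (metis power2_abs one_power2)
  have n: "norm (?T x) ^ 2 = norm x ^ 2" for x
  proof -
    have "norm (?T x) ^ 2 = (\<Sum>i\<in>Basis. (?T x \<bullet> i) * (?T x \<bullet> i))"
      unfolding power2_norm_eq_inner by (rule euclidean_inner)
    also have "... = (\<Sum>i\<in>Basis. (x \<bullet> i) * (x \<bullet> i))"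
      by (intro sum.cong refl) (simp add: power_mult_distrib c2 flip: power2_eq_square)
    also have "... = norm x ^ 2" unfolding power2_norm_eq_inner by (rule euclidean_inner[symmetric])
    finally show ?thesis .
  qed
  have "c j ~= 0" if "j \<in> Basis" for j using c[OF that] by auto
  then have "lborel = density (distr lborel borel ?T) (\<lambda>_. (\<Prod>j\<in>Basis. \<bar>c j\<bar>))"
    using lborel_affine_euclidean[of c 0] by simp
  also have "(\<Prod>j\<in>Basis. \<bar>c j\<bar>) = 1" using c by simp
  finally have l: "lborel = distr lborel borel ?T" by (simp add: density_1)
  have "distr gauss borel ?T = distr (density lborel (\<lambda>x. ennreal (gauss_density (?T x)))) borel ?T"
    unfolding gauss_def by (simp add: gauss_density_def n)
  also have "... = density (distr lborel borel ?T) (\<lambda>x. ennreal (gauss_density x))" by (subst density_distr) auto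
  also have "... = gauss" by (simp add: l[symmetric] gauss_def)
  finally show ?thesis .
qed

lemma integral_gauss_uminus:
  fixes f :: "'a::euclidean_space => 'b::{banach, second_countable_topology}"
  assumes [measurable]: "f \<in> borel_funs"
  shows "(\<oint>x. f (- x)) = (\<oint>x. f x)"
proof -
  have "distr gauss borel (\<lambda>x::'a. \<Sum>j\<in>Basis. ((-1) * (x \<bullet> j)) *. j) = gauss" by (rule distr_gauss_sign) simp
  moreover have "(\<lambda>x::'a. \<Sum>j\<in>Basis. ((-1) * (x \<bullet> j)) *. j) = uminus" by (simp add: sum_negf euclidean_representation)
  ultimately have "distr gauss borel (uminus :: 'a => 'a) = gauss" by simp
  then show ?thesis using integral_distr[of uminus gauss borel f] by simp
qed

lemma integral_gauss_id: "(\<oint>x. x) = (0::'a::euclidean_space)"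
proof -
  define m where "m = (\<integral>x. x \<partial>(gauss :: 'a measure))"
  have "- m = m" using integral_gauss_uminus[of "\<lambda>x::'a. x"] unfolding m_def by simp
  then have "m + - m = m + m" by (rule arg_cong)
  then have "2 *. m = 0" by (simp add: scaleR_2)
  then show ?thesis by (simp add: m_def)
qed

lemma integral_gauss_coord_sq:
  assumes i: "i \<in> (Basis :: 'a::euclidean_space set)"
  shows "(\<integral>x. (x \<bullet> i)^2 \<partial>(gauss :: 'a measure)) = 1"
proof -
  have 0: "(\<integral>+t. ennreal (std_normal_density t)) = 1"
    using nn_integral_eq_integral[of lborel std_normal_density] by simp
  have 2: "(\<integral>+t. ennreal (std_normal_density t) * ennreal (t^2)) = 1"
    using nn_integral_eq_integral[of lborel "\<lambda>x. std_normal_density x * x^2"] integrable_std_normal_moment[of 2]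
      integral_std_normal_moment_even[of 1] by (simp add: ennreal_mult')
  have "(\<integral>\<^sup>+x. ennreal ((x \<bullet> i)^2) \<partial>gauss) =
    (\<integral>\<^sup>+x. (\<Prod>b\<in>Basis. ennreal (std_normal_density (x \<bullet> b)) * (if b = i then ennreal ((x \<bullet> b)^2) else 1)) \<partial>(lborel :: 'a measure))"
    using i by (subst nn_integral_gauss)
       (auto simp: gauss_density_prod prod_ennreal prod.distrib)
  also have "... = (\<Prod>b\<in>Basis. \<integral>\<^sup>+t. ennreal (std_normal_density t) * (if b = i then ennreal (t^2) else 1) \<partial>lborel)"
    by (subst nn_integral_lborel_prod[where f="\<lambda>b t. ennreal (std_normal_density t) * (if b = i then ennreal (t^2) else 1)"]) auto
  also have "... = 1"
  proof (intro prod.neutral ballI)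
    fix b :: 'a
    show "(\<integral>+t. ennreal (std_normal_density t) * (if b = i then ennreal (t^2) else 1)) = 1"
      using 0 2 by (cases "b = i") simp_all
  qed
  finally show ?thesis by (subst integral_eq_nn_integral) auto
qed

lemma integral_gauss_coord_mult:
  assumes i: "i \<in> (Basis :: 'a::euclidean_space set)" and j: "j \<in> Basis"
  shows "(\<integral>x. (x \<bullet> i) * (x \<bullet> j) \<partial>(gauss :: 'a measure)) = (if i = j then 1 else 0)"
proof (cases "i = j")
  case True then show ?thesis using integral_gauss_coord_sq[OF i] by (simp add: power2_eq_square)
next
  case False
  let ?T = "\<lambda>x::'a. \<Sum>k\<in>Basis. ((if k = i then -1 else 1) * (x \<bullet> k)) *. k"
  have "(\<integral>x. (x \<bullet> i) * (x \<bullet> j) \<partial>(gauss :: 'a measure)) = (\<integral>x. (x \<bullet> i) * (x \<bullet> j) \<partial>(distr gauss borel ?T))"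
    by (subst distr_gauss_sign) auto
  also have "... = (\<oint>x. (?T x \<bullet> i) * (?T x \<bullet> j))" by (subst integral_distr) auto
  also have "... = (\<oint>x. - ((x \<bullet> i) * (x \<bullet> j)))" using i j False by (intro Bochner_Integration.integral_cong refl) simp
  finally show ?thesis using False by simp
qed

lemma integral_gauss_linear_sq:
  fixes L :: "'a::euclidean_space => 'b::euclidean_space"
  assumes L: "linear L"
  shows "(\<oint>x. nsq (L x)) = (\<Sum>i\<in>Basis. nsq (L i))"
    and "integrable gauss (\<lambda>x. nsq (L x))"
proof -
  have e: "nsq (L x) = (\<Sum>i\<in>Basis. \<Sum>j\<in>Basis. (L i \<bullet> L j) * ((x \<bullet> i) * (x \<bullet> j)))" for x
  proof -
    have "L x = (\<Sum>i\<in>Basis. (x \<bullet> i) *. L i)"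
      by (subst euclidean_representation[symmetric]) (simp add: linear_sum[OF L] linear_scale[OF L])
    then show ?thesis unfolding power2_norm_eq_inner by (simp add: inner_sum_right algebra_simps inner_commute)
  qed
  have i: "integrable gauss (\<lambda>x. (x \<bullet> i) * (x \<bullet> j))" if "i \<in> Basis" "j \<in> Basis" for i j :: 'a
  proof (rule integrable_gauss_quadratic[where C=1])
    fix x :: 'a
    have "\<bar>x \<bullet> i\<bar> * \<bar>x \<bullet> j\<bar> <= (1 + norm x) * (1 + norm x)"
      using Basis_le_norm[OF that(1), of x] Basis_le_norm[OF that(2), of x] by (intro mult_mono) auto
    then show "norm (x \<bullet> i * (x \<bullet> j)) <= 1 * (1 + norm x)^2" by (simp add: abs_mult power2_eq_square)
  qed simp
  show "integrable gauss (\<lambda>x. nsq (L x))" unfolding e using i by auto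
  have "(\<oint>x. nsq (L x)) = (\<Sum>i\<in>Basis. \<Sum>j\<in>Basis. (L i \<bullet> L j) * (if i = j then 1 else 0))"
    unfolding e using i by (simp add: integral_gauss_coord_mult)
  then show "(\<oint>x. nsq (L x)) = (\<Sum>i\<in>Basis. nsq (L i))"
    by (simp add: if_distrib[of "\<lambda>x. _ * x"] power2_norm_eq_inner cong: if_cong)
qed

lemma integral_gauss_norm_sq: "(\<oint>x. nsq (x::'a::euclidean_space)) = DIM('a)"
  using integral_gauss_linear_sq(1)[of "\<lambda>x::'a. x"] by (simp add: linear_iff)

lemma distr_gauss_rotation:
  assumes c: "c > 0" and cs: "c^2 + s^2 = (1::real)"
  shows "distr gauss2 gauss2 (\<lambda>p. (c *. fst p + s *. snd p, c *. snd p - s *. fst p))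
    = (gauss \<Otimes>\<^sub>M gauss :: ('a::euclidean_space \<times> 'a) measure)" (is "distr ?M ?M ?R = _")
proof (rule measure_eqI)
  have sb: "sets ?M = sets borel" by (simp add: borel_prod[symmetric])
  have [measurable]: "?R \<in> ?M \<rightarrow>\<^sub>M ?M" by measurable
  fix A assume A: "A \<in> sets (distr ?M ?M ?R)"
  then have [measurable]: "A \<in> sets ?M" by simp
  then have [measurable]: "A \<in> sets borel" using sb by simp
  have "emeasure (distr ?M ?M ?R) A = (\<integral>\<^sup>+p. indicator A p \<partial>distr ?M ?M ?R)" using A by simp
  also have "... = (\<integral>\<^sup>+p. indicator A (?R p) \<partial>?M)" by (subst nn_integral_distr) auto
  also have "... = (\<integral>\<^sup>+p. indicator A p \<partial>?M)" by (rule nn_integral_gauss_rotation[OF _ c cs]) auto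
  also have "... = emeasure ?M A" by (rule nn_integral_indicator) measurable
  finally show "emeasure (distr ?M ?M ?R) A = emeasure ?M A" .
qed simp

text \<open>The mixture is the first component of a rotated independent pair.\<close>

lemma distr_gauss_mix:
  assumes c: "a > 0" and cs: "a^2 + b^2 = (1::real)"
  shows "distr gauss2 borel (\<lambda>p. a *. fst p + b *. snd p) = (gauss :: 'a::euclidean_space measure)"
proof -
  let ?M = "gauss \<Otimes>\<^sub>M gauss :: ('a \<times> 'a) measure"
  have "gauss = distr ?M gauss fst" by (simp add: gauss.distr_pair_fst)
  also have "... = distr (distr ?M ?M (\<lambda>p. (a *. fst p + b *. snd p, a *. snd p - b *. fst p))) gauss fst"
    by (subst distr_gauss_rotation[OF assms]) simp
  also have "... = distr ?M gauss (\<lambda>p. a *. fst p + b *. snd p)" by (subst distr_distr) (auto simp: comp_def)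
  finally show ?thesis by (simp cong: distr_cong)
qed

section \<open>Gaussian Poincare inequality by rotation\<close>

lemma pi_squared_le: "pi^2 <= 10"
proof -
  \<comment> \<open>Euler's formula \<open>pi = 20 arctan (1/7) + 8 arctan (3/79)\<close> together
    with \<open>arctan x <= x\<close>. The bound \<open>pi^2 <= 10\<close> is what turns the
    constant \<open>pi^2 / 8\<close> into \<open>5 / 4\<close>.\<close>
  have "pi <= 20 / 7 + 24 / 79" using machin_Euler arctan_le_self[of "1/7"] arctan_le_self[of "3/79"] by simp
  then have "pi^2 <= (20 / 7 + 24 / 79)^2" by (intro power_mono) auto
  then show ?thesis by (simp add: power2_eq_square)
qed

lemma lipschitz_ident: "1-lipschitz_on UNIV (\<lambda>z. z)" by (rule lipschitz_onI) auto

lemma lipschitz_growth: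
  assumes "L-lipschitz_on UNIV f"
  shows "norm (f x) <= (norm (f 0) + L) * (1 + norm x)"
proof -
  have L: "L >= 0" using assms by (rule lipschitz_on_nonneg)
  have "norm (f x) <= norm (f 0) + norm (f x - f 0)" by (metis norm_triangle_sub)
  also have "norm (f x - f 0) <= L * norm x" using lipschitz_onD[OF assms, of x 0] by (simp add: dist_norm)
  finally have "norm (f x) <= norm (f 0) + L * norm x" by simp
  moreover have "0 <= norm (f 0) * norm x" by simp
  moreover have "(norm (f 0) + L) * (1 + norm x) = norm (f 0) + L * norm x + (norm (f 0) * norm x + L)"
    by (simp add: algebra_simps)
  ultimately show ?thesis using L by linarith
qed

lemma lipschitz_measurable:
  fixes f :: "'a::euclidean_space => 'b::euclidean_space"
  assumes "L-lipschitz_on UNIV f" shows "f \<in> borel_funs"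
  using lipschitz_on_continuous_on[OF assms] by (rule borel_measurable_continuous_onI)

lemma integrable_gauss_lipschitz:
  fixes f :: "'a::euclidean_space => 'b::euclidean_space"
  assumes "L-lipschitz_on UNIV f"
  shows "integrable gauss f" "integrable gauss (\<lambda>x. nsq (f x))"
proof -
  note [measurable] = lipschitz_measurable[OF assms]
  show "integrable gauss f" by (rule integrable_gauss_linear[OF _ lipschitz_growth[OF assms]]) simp
  show "integrable gauss (\<lambda>x. nsq (f x))"
  proof (rule integrable_gauss_quadratic[where C="(norm (f 0) + L)^2"])
    fix x show "norm (nsq (f x)) <= (norm (f 0) + L)^2 * (1 + norm x)^2"
      using power_mono[OF lipschitz_growth[OF assms, of x], of 2] by (simp add: power_mult_distrib)
  qed simp
qed

lemma (in prob_space) variance_expand: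
  fixes f :: "'a => 'b::euclidean_space"
  assumes i: "integrable M f" and i2: "integrable M (\<lambda>x. nsq (f x))"
  shows "(\<integral>x. nsq (f x - v) \<partial>M) = (\<integral>x. nsq (f x) \<partial>M) - 2 * ((\<integral>x. f x \<partial>M) \<bullet> v) + nsq v"
    and "integrable M (\<lambda>x. nsq (f x - v))"
proof -
  have e: "nsq (f x - v) = nsq (f x) - 2 * (f x \<bullet> v) + nsq v" for x
    by (simp add: power2_norm_eq_inner inner_simps inner_commute)
  show "integrable M (\<lambda>x. nsq (f x - v))" unfolding e using i i2 by auto
  show "(\<integral>x. nsq (f x - v) \<partial>M) = (\<integral>x. nsq (f x) \<partial>M) - 2 * ((\<integral>x. f x \<partial>M) \<bullet> v) + nsq v"
    unfolding e using i i2 by (simp add: prob_space)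
qed

lemma integrable_pair_norm_sq:
  "integrable gauss2 (\<lambda>p::'a::euclidean_space \<times> 'a. C * (nsq (fst p) + nsq (snd p)))"
proof -
  have i: "integrable gauss (\<lambda>x::'a. nsq x)"
    by (rule integrable_gauss_lipschitz(2)[where L=1]) (simp add: lipschitz_on_def)
  show ?thesis using gauss2.integral_fst_comp(1)[OF i] gauss2.integral_snd_comp(1)[OF i] by auto
qed

lemma norm_lincomb_sq_le:
  fixes x y :: "'a::real_inner"
  shows "nsq (a *. x + b *. y) <= 2 * (a^2 * nsq x + b^2 * nsq y)"
proof -
  have "nsq (a *. x + b *. y) + nsq (a *. x - b *. y) = 2 * (a^2 * nsq x + b^2 * nsq y)"
    unfolding power2_norm_eq_inner by (simp add: power2_eq_square algebra_simps)
  then show ?thesis using zero_le_power2[of "norm (a *. x - b *. y)"] by linarith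
qed

lemma power2_norm_sum_le:
  fixes v :: "'i => 'b::real_normed_vector"
  assumes "finite A"
  shows "nsq (\<Sum>k\<in>A. v k) <= real (card A) * (\<Sum>k\<in>A. nsq (v k))"
proof -
  have "nsq (\<Sum>k\<in>A. v k) <= (\<Sum>k\<in>A. norm (v k))^2" by (intro power_mono norm_sum) auto
  also have "... = (\<Sum>k\<in>A. 1 * norm (v k))^2" by simp
  also have "... <= (\<Sum>k\<in>A. 1^2) * (\<Sum>k\<in>A. nsq (v k))" by (rule Cauchy_Schwarz_ineq_sum)
  finally show ?thesis by simp
qed

lemma has_vector_derivative_iff_tendsto_at_zero:
  "(g has_vector_derivative v) (at x) \<longleftrightarrow> ((\<lambda>t. (g (x + t) - g x) /\<^sub>R t) \<longlongrightarrow> v) (at 0)"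
proof -
  have "\<forall>\<^sub>F t in at 0. norm (g (x + t) - g x - t *. v) / norm t = norm ((g (x + t) - g x) /\<^sub>R t - v)"
  proof (rule eventually_at_filter[THEN iffD2], rule always_eventually, intro allI impI)
    fix t :: real assume "t ~= 0"
    then have "(g (x + t) - g x) /\<^sub>R t - v = (g (x + t) - g x - t *. v) /\<^sub>R t" by (simp add: algebra_simps)
    then show "norm (g (x + t) - g x - t *. v) / norm t = norm ((g (x + t) - g x) /\<^sub>R t - v)"
      by (simp add: divide_inverse)
  qed
  from tendsto_cong[OF this, of 0] show ?thesis unfolding has_vector_derivative_def has_derivative_at
    by (simp add: bounded_linear_scaleR_left tendsto_norm_zero_iff Lim_null[of _ v])
qed

context
  fixes f :: "'a::euclidean_space => 'b::euclidean_space" and L :: real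
  assumes lip: "L-lipschitz_on UNIV f"
begin

lemma integrable_pair_lipschitz_diff:
  "integrable gauss2 (\<lambda>p. nsq (f (a *. fst p + b *. snd p) - f (c *. fst p + d *. snd p)))"
proof (rule Bochner_Integration.integrable_bound[OF integrable_pair_norm_sq[of "L^2 * (2 * ((a - c)^2 + (b - d)^2))"]])
  note [measurable] = lipschitz_measurable[OF lip]
  show "(\<lambda>p. nsq (f (a *. fst p + b *. snd p) - f (c *. fst p + d *. snd p))) \<in> borel_measurable gauss2" by measurable
  show "AE p in gauss \<Otimes>\<^sub>M gauss. norm (nsq (f (a *. fst p + b *. snd p) - f (c *. fst p + d *. snd p)))
     <= norm (L^2 * (2 * ((a - c)^2 + (b - d)^2)) * (nsq (fst p) + nsq (snd p)))"
  proof (rule AE_I2)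
    fix p :: "'a \<times> 'a"
    let ?u = "a *. fst p + b *. snd p" and ?v = "c *. fst p + d *. snd p"
    have "nsq (f ?u - f ?v) <= (L * norm (?u - ?v))^2"
      using lipschitz_onD[OF lip, of ?u ?v] by (intro power_mono) (auto simp: dist_norm)
    also have "?u - ?v = (a - c) *. fst p + (b - d) *. snd p" by (simp add: algebra_simps)
    also have "(L * norm ...)^2 <= L^2 * (2 * ((a - c)^2 * nsq (fst p) + (b - d)^2 * nsq (snd p)))"
      unfolding power_mult_distrib by (intro mult_left_mono norm_lincomb_sq_le) auto
    also have "... <= L^2 * (2 * (((a - c)^2 + (b - d)^2) * (nsq (fst p) + nsq (snd p))))"
      by (intro mult_left_mono) (auto simp: algebra_simps)
    finally show "norm (nsq (f ?u - f ?v))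
       <= norm (L^2 * (2 * ((a - c)^2 + (b - d)^2)) * (nsq (fst p) + nsq (snd p)))"
      by (simp only: mult.assoc real_norm_def abs_mult abs_power2 abs_numeral power_abs[symmetric] abs_of_nonneg add_nonneg_nonneg zero_le_power2)
  qed
qed

text \<open>\<open>fst p\<close> is joined to \<open>snd p\<close> by \<open>N\<close> equal
  rotations along a quarter circle. By rotation invariance all increments have the same law, so
  Cauchy-Schwarz for a sum of \<open>N\<close> terms bounds the whole by \<open>N * N\<close> times
  the first increment.\<close>

lemma gauss_rotation_chain:
  assumes N: "N > 0" and h: "h = pi / (2 * real N)"
  shows "(\<integral>p. nsq (f (fst p) - f (snd p)) \<partial>gauss2) <=
    (real N)^2 * (\<integral>p. nsq (f (fst p) - f (cos h *. fst p + sin h *. snd p)) \<partial>gauss2)"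
proof -
  let ?M = "gauss \<Otimes>\<^sub>M gauss :: ('a \<times> 'a) measure"
  note [measurable] = lipschitz_measurable[OF lip]
  define X where "X k p = cos (real k * h) *. fst p + sin (real k * h) *. snd p" for k and p :: "'a \<times> 'a"
  define D where "D k = (\<integral>p. nsq (f (X k p) - f (X (Suc k) p)) \<partial>?M)" for k
  have int: "integrable ?M (\<lambda>p. nsq (f (X k p) - f (X (Suc k) p)))" for k
    unfolding X_def by (rule integrable_pair_lipschitz_diff)
  have Nh: "real N * h = pi / 2" using N h by simp
  have D0: "D k = D 0" if k: "k < N" for k
  proof -
    let ?c = "cos (real k * h)" and ?s = "sin (real k * h)"
    let ?R = "\<lambda>p::'a \<times> 'a. (?c *. fst p + ?s *. snd p, ?c *. snd p - ?s *. fst p)"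
    have hpos: "h > 0" using N h by simp
    \<comment> \<open>Since \<open>k < N\<close>, the angle stays below a right angle, as rotation
      invariance is available for a positive cosine.\<close>
    have "real k * h < real N * h" using k hpos by simp
    moreover have "0 <= real k * h" using hpos by simp
    ultimately have c: "?c > 0" using Nh by (intro cos_gt_zero_pi) linarith+
    have e: "X (Suc k) p = cos h *. fst (?R p) + sin h *. snd (?R p)" for p
      by (simp add: X_def cos_add sin_add algebra_simps)
    have "D k = (\<integral>p. nsq (f (fst (?R p)) - f (cos h *. fst (?R p) + sin h *. snd (?R p))) \<partial>?M)"
      unfolding D_def e by (simp add: X_def)
    also have "... = (\<integral>p. nsq (f (fst p) - f (cos h *. fst p + sin h *. snd p)) \<partial>distr ?M ?M ?R)"
      by (subst integral_distr) auto
    also have "... = D 0" by (subst distr_gauss_rotation[OF c]) (auto simp: D_def X_def)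
    finally show ?thesis .
  qed
  have "(\<integral>p. nsq (f (fst p) - f (snd p)) \<partial>?M) <= (\<integral>p. real N * (\<Sum>k<N. nsq (f (X k p) - f (X (Suc k) p))) \<partial>?M)"
  proof (rule integral_mono)
    show "integrable ?M (\<lambda>p. nsq (f (fst p) - f (snd p)))" using integrable_pair_lipschitz_diff[of 1 0 0 1] by simp
    show "integrable ?M (\<lambda>p. real N * (\<Sum>k<N. nsq (f (X k p) - f (X (Suc k) p))))" using int by auto
    fix p :: "'a \<times> 'a"
    have "f (fst p) - f (snd p) = f (X 0 p) - f (X N p)" by (simp add: X_def Nh)
    also have "... = (\<Sum>k<N. f (X k p) - f (X (Suc k) p))"
      by (rule sum_lessThan_telescope'[of "\<lambda>k. f (X k p)", symmetric])
    finally show "nsq (f (fst p) - f (snd p)) <= real N * (\<Sum>k<N. nsq (f (X k p) - f (X (Suc k) p)))"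
      using power2_norm_sum_le[of "{..<N}" "\<lambda>k. f (X k p) - f (X (Suc k) p)"] by simp
  qed
  also have "... = real N * (\<Sum>k<N. D k)" using int by (simp add: D_def)
  also have "(\<Sum>k<N. D k) = real N * D 0" using sum.cong[OF refl D0, of "{..<N}"] by simp
  also have "real N * (real N * D 0) = (real N)^2 * D 0" by (simp add: power2_eq_square)
  finally show ?thesis by (simp add: D_def X_def)
qed

text \<open>As \<open>N\<close> grows, \<open>N\<close> times one increment tends, up to sign, to
  \<open>pi / 2\<close> times the derivative at \<open>fst p\<close> in the independent direction
  \<open>snd p\<close>. Averaging over that direction turns the squared norm into the sum over
  \<open>Basis\<close>.\<close>

lemma gauss_poincare_pair:
  assumes der: "!!x. (f has_derivative f' x) (at x)"
  shows "(\<integral>p. nsq (f (fst p) - f (snd p)) \<partial>gauss2) <= (pi / 2)^2 * (\<oint>x. (\<Sum>i\<in>Basis. nsq (f' x i)))"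
proof -
  let ?M = "gauss \<Otimes>\<^sub>M gauss :: ('a \<times> 'a) measure"
  note [measurable] = lipschitz_measurable[OF lip]
  define h where "h N = pi / (2 * real (Suc N))" for N
  define g where "g N p = (real (Suc N))^2 * nsq (f (fst p) - f (cos (h N) *. fst p + sin (h N) *. snd p))"
    for N and p :: "'a \<times> 'a"
  define G where "G p = (pi / 2)^2 * nsq (f' (fst p) (snd p))" for p
  have [measurable]: "g N \<in> borel_measurable ?M" for N unfolding g_def by measurable
  have h0: "h ----> 0" unfolding h_def by real_asymp
  have hpos: "h N > 0" for N by (simp add: h_def)
  have hN: "real (Suc N) = pi / 2 / h N" for N by (simp add: h_def)
  have lim: "(\<lambda>N. g N p) ----> G p" for p
  proof -
    let ?x = "fst p" and ?y = "snd p"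
    define c where "c t = cos t *. ?x + sin t *. ?y" for t
    have "((\<lambda>t. f (c t)) has_vector_derivative f' ?x ?y) (at 0)"
    proof -
      have "(c has_vector_derivative ?y) (at 0)" unfolding c_def by (auto intro!: derivative_eq_intros)
      moreover have "(f has_derivative f' ?x) (at (c 0))" using der by (simp add: c_def)
      ultimately show ?thesis
        using diff_chain_at[of c "\<lambda>t. t *. ?y" 0 f "f' ?x"] linear_scale[OF has_derivative_linear[OF der[of ?x]]]
        by (simp add: has_vector_derivative_def comp_def)
    qed
    then have "((\<lambda>t. (f (c t) - f ?x) /\<^sub>R t) \<longlongrightarrow> f' ?x ?y) (at 0)"
      by (simp add: has_vector_derivative_iff_tendsto_at_zero c_def)
    moreover have "filterlim h (at 0) sequentially"
      using h0 hpos by (auto simp: filterlim_at intro!: always_eventually less_imp_neq[symmetric])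
    ultimately have "(\<lambda>N. (f (c (h N)) - f ?x) /\<^sub>R h N) ----> f' ?x ?y"
      by (rule filterlim_compose[where g="\<lambda>t. (f (c t) - f ?x) /\<^sub>R t"])
    then have "(\<lambda>N. (pi / 2)^2 * nsq ((f (c (h N)) - f ?x) /\<^sub>R h N)) ----> G p"
      unfolding G_def by (intro tendsto_intros)
    moreover have "(pi / 2)^2 * nsq ((f (c (h N)) - f ?x) /\<^sub>R h N) = g N p" for N
      unfolding g_def c_def hN by (simp add: norm_minus_commute divide_simps)
    ultimately show ?thesis by simp
  qed
  have [measurable]: "G \<in> borel_measurable ?M" by (rule borel_measurable_LIMSEQ_metric[OF _ lim]) measurable
  \<comment> \<open>Both \<open>1 - cos (h N)\<close> and \<open>sin (h N)\<close> are at most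
    \<open>h N\<close> in absolute value. This cancels the factor \<open>(pi / 2 / h N)^2\<close>,
    so the domination is uniform in \<open>N\<close>.\<close>
  define B where "B = (pi / 2)^2 * L^2 * 2"
  have bound: "norm (g N p) <= B * (nsq (fst p) + nsq (snd p))" for N p
  proof -
    let ?u = "fst p" and ?v = "cos (h N) *. fst p + sin (h N) *. snd p"
    have "nsq (f ?u - f ?v) <= (L * norm (?u - ?v))^2"
      using lipschitz_onD[OF lip, of ?u ?v] by (intro power_mono) (auto simp: dist_norm)
    also have "?u - ?v = (1 - cos (h N)) *. fst p + (- sin (h N)) *. snd p" by (simp add: algebra_simps)
    also have "(L * norm ...)^2 <= L^2 * (2 * ((1 - cos (h N))^2 * nsq (fst p) + (- sin (h N))^2 * nsq (snd p)))"
      unfolding power_mult_distrib by (intro mult_left_mono norm_lincomb_sq_le) auto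
    also have "... <= L^2 * (2 * ((h N)^2 * nsq (fst p) + (h N)^2 * nsq (snd p)))"
    proof -
      have "\<bar>sin (h N)\<bar> <= \<bar>h N\<bar>" by (rule abs_sin_x_le_abs_x)
      then have s: "(sin (h N))^2 <= (h N)^2" by (simp add: abs_le_square_iff)
      have "(1 - cos (h N))^2 <= (1 - cos (h N))^2 + (sin (h N))^2" by simp
      also have "... = 2 - 2 * cos (h N)" by (simp add: power2_eq_square algebra_simps)
      also have "... = 4 * (sin (h N / 2))^2" using cos_double_sin[of "h N / 2"] by simp
      also have "... <= 4 * (h N / 2)^2"
        using abs_sin_x_le_abs_x[of "h N / 2"] by (intro mult_left_mono) (auto simp: abs_le_square_iff[symmetric])
      finally have "(1 - cos (h N))^2 <= (h N)^2" by (simp add: power_divide)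
      with s show ?thesis by (intro mult_left_mono add_mono mult_right_mono) auto
    qed
    finally have "nsq (f ?u - f ?v) <= L^2 * 2 * (h N)^2 * (nsq (fst p) + nsq (snd p))" by (simp add: algebra_simps)
    then have "(pi / 2 / h N)^2 * nsq (f ?u - f ?v) <= (pi / 2 / h N)^2 * (L^2 * 2 * (h N)^2 * (nsq (fst p) + nsq (snd p)))"
      by (rule mult_left_mono) simp
    also have "... = B * (nsq (fst p) + nsq (snd p))" using hpos[of N] by (simp add: B_def field_simps)
    finally show ?thesis unfolding g_def hN by simp
  qed
  have conv: "(\<lambda>N. \<integral>p. g N p \<partial>?M) ----> (\<integral>p. G p \<partial>?M)"
    by (rule integral_dominated_convergence[OF _ _ integrable_pair_norm_sq[of B]]) (simp_all add: lim bound[unfolded real_norm_def])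
  have Gi: "integrable ?M G"
    by (rule integrable_dominated_convergence[OF _ _ integrable_pair_norm_sq[of B], of _ g]) (simp_all add: lim bound[unfolded real_norm_def])
  have "(\<integral>p. nsq (f (fst p) - f (snd p)) \<partial>?M) <= (\<integral>p. G p \<partial>?M)"
  proof (rule LIMSEQ_le_const[OF conv], intro exI allI impI)
    fix N show "(\<integral>p. nsq (f (fst p) - f (snd p)) \<partial>?M) <= (\<integral>p. g N p \<partial>?M)"
      using gauss_rotation_chain[of "Suc N" "h N"] by (simp add: h_def g_def)
  qed
  also have "(\<integral>p. G p \<partial>?M) = (\<oint>x. \<oint>y. G (x, y))" using gauss2.integral_fst'[of G] Gi by simp
  also have "... = (\<oint>x. (pi / 2)^2 * (\<Sum>i\<in>Basis. nsq (f' x i)))"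
    using integral_gauss_linear_sq(1)[OF has_derivative_linear[OF der]] by (simp add: G_def)
  finally show ?thesis by simp
qed

lemma gauss_variance_pair:
  "(\<integral>p. nsq (f (fst p) - f (snd p)) \<partial>gauss2) = 2 * (\<oint>x. nsq (f x - (\<oint>y. f y)))"
proof -
  note i = integrable_gauss_lipschitz[OF lip]
  have ii: "integrable gauss2 (\<lambda>p. nsq (f (fst p) - f (snd p)))"
    using integrable_pair_lipschitz_diff[of 1 0 0 1] by simp
  have "(\<integral>p. nsq (f (fst p) - f (snd p)) \<partial>gauss2) = (\<oint>x. \<oint>y. nsq (f x - f y))"
    using gauss2.integral_fst'[OF ii] by simp
  also have "... = (\<oint>x. \<oint>y. nsq (f y - f x))" by (simp add: norm_minus_commute)
  also have "... = (\<oint>x. (\<oint>y. nsq (f y)) - 2 * ((\<oint>y. f y) \<bullet> f x) + nsq (f x))"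
    unfolding gauss.variance_expand(1)[OF i] ..
  also have "... = (\<oint>y. nsq (f y)) - 2 * ((\<oint>y. f y) \<bullet> (\<oint>y. f y)) + (\<oint>y. nsq (f y))"
    using i by (simp add: gauss.prob_space[unfolded space_gauss])
  also have "... = 2 * (\<oint>x. nsq (f x - (\<oint>y. f y)))"
    unfolding gauss.variance_expand(1)[OF i] by (simp add: power2_norm_eq_inner)
  finally show ?thesis .
qed

text \<open>The pair integral is twice the variance, which halves \<open>(pi / 2)^2\<close>;
  \<open>pi^2 <= 10\<close> does the rest.\<close>

lemma gauss_poincare:
  assumes der: "!!x. (f has_derivative f' x) (at x)"
  shows "(\<oint>x. nsq (f x - (\<oint>y. f y))) <= 5 / 4 * (\<oint>x. (\<Sum>i\<in>Basis. nsq (f' x i)))"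
proof -
  have "(pi / 2)^2 <= 5 / 2" using pi_squared_le by (simp add: power_divide)
  moreover have "0 <= (\<oint>x. (\<Sum>i\<in>Basis. nsq (f' x i)))" by (intro Bochner_Integration.integral_nonneg sum_nonneg) auto
  ultimately have "(pi / 2)^2 * (\<oint>x. (\<Sum>i\<in>Basis. nsq (f' x i))) <= 5 / 2 * (\<oint>x. (\<Sum>i\<in>Basis. nsq (f' x i)))"
    by (rule mult_right_mono)
  then show ?thesis using gauss_poincare_pair[OF der] gauss_variance_pair by linarith
qed

end

section \<open>Brunn-Minkowski inequality on the line\<close>

lemma lborel_inner_compact:
  fixes A :: "'a::euclidean_space set"
  assumes A: "A \<in> sets borel" and r: "r < emeasure lborel A"
  obtains K where "compact K" "K \<subseteq> A" "r < emeasure lborel K"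
proof -
  have "(SUP k. emeasure lborel (A \<inter> cball 0 (real k))) = emeasure lborel (\<Union>k. A \<inter> cball 0 (real k))"
    using A by (intro SUP_emeasure_incseq) (auto simp: incseq_def)
  also have "(\<Union>k. A \<inter> cball 0 (real k)) = A" using real_arch_simple by auto
  finally have "r < (SUP k. emeasure lborel (A \<inter> cball 0 (real k)))" using r by simp
  then obtain k where k: "r < emeasure lborel (A \<inter> cball 0 (real k))" unfolding less_SUP_iff by blast
  let ?S = "A \<inter> cball 0 (real k)"
  have fin: "emeasure lborel ?S < \<infinity>"
    using le_less_trans[OF emeasure_mono[of _ "cball 0 (real k)"] emeasure_lborel_cball_finite, of ?S] by simp
  define e where "e = emeasure lborel ?S - r"
  have "e > 0" using k by (simp add: e_def diff_gr0_ennreal)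
  moreover have "e < \<infinity>" using fin by (auto simp: e_def less_top[symmetric])
  ultimately obtain e' where e': "e = ennreal e'" "e' > 0" by (cases e) auto
  obtain T where T: "closed T" "T \<subseteq> ?S" "?S - T \<in> lmeasurable" "emeasure lebesgue (?S - T) < ennreal e'"
    using sets_lebesgue_inner_closed[of ?S e'] A e'(2) by auto
  have "compact T" using T bounded_cball[of 0 "real k"] by (meson bounded_subset compact_eq_bounded_closed le_inf_iff)
  have m: "emeasure lborel (?S - T) < e" using T A e'(1) by simp
  have "emeasure lborel ?S = emeasure lborel T + emeasure lborel (?S - T)"
    using T A by (subst plus_emeasure) (auto simp: Un_absorb1)
  then have s: "emeasure lborel ?S = emeasure lborel T + emeasure lborel (?S - T)" .
  have "r < emeasure lborel T"
  proof (rule ccontr)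
    assume n: "\<not> r < emeasure lborel T"
    then have "emeasure lborel ?S < r + e"
    proof -
      have "emeasure lborel T + emeasure lborel (?S - T) <= r + emeasure lborel (?S - T)"
        using n by (intro add_right_mono) simp
      also have "... < r + e" using m k fin by (subst ennreal_add_left_cancel_less) auto
      finally show ?thesis unfolding s .
    qed
    also have "r + e = emeasure lborel ?S" using k by (simp add: e_def)
    finally show False by simp
  qed
  then show ?thesis using that[of T] \<open>compact T\<close> T(2) by auto
qed

text \<open>For compact sets, two affine copies fit into \<open>C\<close>: \<open>(1 - t) A'\<close>
  translated by \<open>t * min B'\<close>, and \<open>t B'\<close> translated by
  \<open>(1 - t) * max A'\<close>. They lie on opposite sides of a single common point, so their
  lengths add up. Inner regularity covers Borel sets.\<close>

lemma brunn_minkowski_real: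
  fixes A B C :: "real set"
  assumes A: "A \<in> sets borel" "A ~= {}" and B: "B \<in> sets borel" "B ~= {}" and C: "C \<in> sets borel"
    and t: "0 < t" "t < 1" and sub: "!!a b. a \<in> A ==> b \<in> B ==> (1 - t) * a + t * b \<in> C"
  shows "ennreal (1 - t) * emeasure lborel A + ennreal t * emeasure lborel B <= emeasure lborel C"
proof -
  let ?\<mu> = "emeasure lborel"
  have comp: "ennreal (1 - t) * ?\<mu> A' + ennreal t * ?\<mu> B' <= ?\<mu> C"
    if A': "compact A'" "A' \<subseteq> A" "A' ~= {}" and B': "compact B'" "B' \<subseteq> B" "B' ~= {}" for A' B'
  proof -
    obtain b where b: "b \<in> B'" "!!y. y \<in> B' ==> b <= y" using compact_attains_inf[OF B'(1,3)] by blast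
    obtain a where a: "a \<in> A'" "!!y. y \<in> A' ==> y <= a" using compact_attains_sup[OF A'(1,3)] by blast
    have [measurable]: "A' \<in> sets borel" "B' \<in> sets borel" using A' B' by (auto intro: borel_compact)
    let ?P = "(\<lambda>x. t * b + (1 - t) * x) ` A'" and ?Q = "(\<lambda>x. (1 - t) * a + t * x) ` B'"
    have cPQ: "compact ?P" "compact ?Q" by (intro compact_continuous_image continuous_intros A' B')+
    have PQ: "?P \<in> sets borel" "?Q \<in> sets borel" using cPQ by (auto intro: borel_compact)
    let ?g = "\<lambda>(u :: real) c. (`) (\<lambda>x. u + c * x)"
    have sc: "?\<mu> (?g u c D) = ennreal c * ?\<mu> D"
      if c: "c > 0" and D: "D \<in> sets borel" "(?g u c D) \<in> sets borel" for u c :: real and D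
    proof -
      have "?\<mu> (?g u c D) = (\<integral>+y. indicator (?g u c D) y)" using D by simp
      also have "... = ennreal c * (\<integral>+y. indicator (?g u c D) (u + c * y))"
        using c D by (subst nn_integral_real_affine[where c=c and t=u]) auto
      also have "(\<lambda>y. indicator (?g u c D) (u + c * y) :: ennreal) = indicator D"
        using c by (auto simp: fun_eq_iff indicator_def)
      finally show ?thesis using D by simp
    qed
    have int: "?P \<inter> ?Q \<subseteq> {(1 - t) * a + t * b}"
    proof
      fix z assume z: "z \<in> ?P \<inter> ?Q"
      then obtain x where x: "x \<in> A'" "z = t * b + (1 - t) * x" by blast
      from z obtain y where y: "y \<in> B'" "z = (1 - t) * a + t * y" by blast
      have "(1 - t) * x <= (1 - t) * a" "t * b <= t * y" using a b x y t by auto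
      then have "z = (1 - t) * a + t * b" using x(2) y(2) by linarith
      then show "z \<in> {(1 - t) * a + t * b}" by simp
    qed
    have "ennreal (1 - t) * ?\<mu> A' + ennreal t * ?\<mu> B' = ?\<mu> ?P + ?\<mu> ?Q" using t PQ by (simp add: sc)
    also have "?\<mu> ?Q = ?\<mu> (?Q - {(1 - t) * a + t * b})" using PQ by (intro emeasure_Diff_null_set[symmetric]) auto
    also have "?\<mu> ?P + ... = ?\<mu> (?P \<union> (?Q - {(1 - t) * a + t * b}))" using PQ int by (intro plus_emeasure) auto
    also have "... <= ?\<mu> C"
    proof (rule emeasure_mono)
      show "?P \<union> (?Q - {(1 - t) * a + t * b}) \<subseteq> C"
      proof -
        have "t * b + (1 - t) * x \<in> C" if "x \<in> A'" for x using sub[of x b] that A' B' b by (auto simp: add.commute)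
        moreover have "(1 - t) * a + t * y \<in> C" if "y \<in> B'" for y using sub[of a y] that A' B' a by auto
        ultimately show ?thesis by blast
      qed
    qed (use C in auto)
    finally show ?thesis .
  qed
  let ?K = "\<lambda>D :: real set. {K. compact K \<and> K \<subseteq> D \<and> K ~= {}}"
  have SUP: "?\<mu> D = (SUP K\<in>?K D. ?\<mu> K)"
    if D: "D \<in> sets borel" "D ~= {}" for D :: "real set"
  proof (rule antisym)
    show "?\<mu> D <= (SUP K\<in>?K D. ?\<mu> K)"
    proof (rule dense_le)
      fix r assume "r < ?\<mu> D"
      then obtain K where K: "compact K" "K \<subseteq> D" "r < ?\<mu> K" by (rule lborel_inner_compact[OF D(1)])
      then have "K ~= {}" by auto
      with K show "r <= (SUP K\<in>?K D. ?\<mu> K)" by (intro SUP_upper2[of K]) auto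
    qed
  qed (use D in \<open>auto intro!: SUP_least emeasure_mono\<close>)
  \<comment> \<open>A constant summand can be moved into a supremum only if the index family is
    nonempty; this is where \<open>A\<close> and \<open>B\<close> have to be nonempty.\<close>
  have ne: "?K D ~= {}" if "D ~= {}" for D :: "real set" using that by auto
  show ?thesis unfolding SUP[OF A] SUP[OF B] SUP_mult_left_ennreal using comp by (auto intro!: SUP_least
        simp: ennreal_SUP_add_right[OF ne[OF B(2)]] ennreal_SUP_add_left[OF ne[OF A(2)], symmetric])
qed

section \<open>The Prekopa--Leindler inequality\<close>

text \<open>\<open>geo_le t u v w\<close> says \<open>u\<^sup>1\<^sup>-\<^sup>t v\<^sup>t \<le> w\<close> for extended nonnegative reals, which carry no real powers.\<close>

definition geo_le :: "real => ennreal => ennreal => ennreal => bool" where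
  "geo_le t u v w \<longleftrightarrow> (\<forall>r s. 0 <= r --> 0 <= s --> ennreal r <= u --> ennreal s <= v -->
     ennreal (r powr (1 - t) * s powr t) <= w)"

lemma geo_leD: "geo_le t u v w ==> 0 <= r ==> 0 <= s ==> ennreal r <= u ==> ennreal s <= v ==>
  ennreal (r powr (1 - t) * s powr t) <= w" by (simp add: geo_le_def)

lemma weighted_am_gm:
  fixes x y t :: real
  assumes "0 <= x" "0 <= y" "0 < t" "t < 1"
  shows "x powr (1 - t) * y powr t <= (1 - t) * x + t * y"
proof (cases "x = 0 \<or> y = 0")
  case True then show ?thesis using assms by auto
next
  case False
  then have xy: "x > 0" "y > 0" using assms by auto
  have "x powr (1 - t) * y powr t = exp ((1 - t) * ln x + t * ln y)" using xy by (simp add: powr_def exp_add)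
  also have "... <= (1 - t) * exp (ln x) + t * exp (ln y)"
    using convex_onD[OF exp_convex, of t "ln x" "ln y"] assms by simp
  finally show ?thesis using xy by simp
qed

text \<open>Dividing by the suprema \<open>A\<close> and \<open>B\<close> makes the superlevel sets
  of both functions nonempty for the same levels \<open>0 < l < 1\<close>, as Brunn-Minkowski
  requires. Layer-cake integration in \<open>l\<close> gives a bound by the arithmetic mean of the
  normalised integrals, and weighted AM-GM returns to the geometric mean.\<close>

lemma prekopa_leindler_real_bounded:
  fixes f g :: "real => real" and h :: "real => ennreal"
  assumes [measurable]: "f \<in> borel_funs" "g \<in> borel_funs" "h \<in> borel_funs"
    and t: "0 < t" "t < 1"
    and f0: "!!x. 0 <= f x" and g0: "!!x. 0 <= g x"
    and fM: "bdd_above (range f)" and gM: "bdd_above (range g)"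
    and le: "!!x y. ennreal (f x powr (1 - t) * g y powr t) <= h ((1 - t) * x + t * y)"
  shows "geo_le t (\<integral>+x. f x) (\<integral>+x. g x) (\<integral>+x. h x)"
proof -
  define A where "A = Sup (range f)"
  define B where "B = Sup (range g)"
  have fA: "f x <= A" and gB: "g x <= B" for x using fM gM by (auto simp: A_def B_def intro: cSUP_upper)
  show ?thesis
  proof (cases "A <= 0 \<or> B <= 0")
    case True
    then have "(\<forall>x. f x = 0) \<or> (\<forall>x. g x = 0)" using f0 g0 fA gB by (meson order_antisym order_trans)
    then show ?thesis by (auto simp: geo_le_def)
  next
    case False
    then have AB: "A > 0" "B > 0" by auto
    define C where "C = A powr (1 - t) * B powr t"
    have C: "C > 0" using AB by (simp add: C_def)
    let ?I = "{0<..<1::real}"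
    let ?L = "\<lambda>(F :: real => real) D. \<integral>\<^sup>+x. ennreal (F x / D) \<partial>lborel"
    have layer: "?L F D = (\<integral>+l. indicator ?I l * emeasure lborel {x. F x > l * D})"
      if [measurable]: "F \<in> borel_funs" and F: "!!x. 0 <= F x" "!!x. F x <= D" and D: "D > 0" for F and D :: real
    proof -
      let ?J = "\<lambda>x l. indicator {p. snd p \<in> ?I \<and> F (fst p) > snd p * D} (x, l) :: ennreal"
      have "?L F D = (\<integral>+x. (\<integral>+l. ?J x l))"
      proof (rule nn_integral_cong)
        fix x
        have "l < 1" if "l * D < F x" for l
          using that F(2)[of x] D by (metis less_le_trans mult_1 mult_less_cancel_right_pos)
        then have "(\<integral>+l. ?J x l) = (\<integral>+l. indicator {0<..<F x / D} l)"
          using D by (intro nn_integral_cong) (auto simp: indicator_def field_simps)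
        also have "... = ennreal (F x / D)" using F[of x] D by simp
        finally show "ennreal (F x / D) = (\<integral>+l. ?J x l)" by simp
      qed
      also have "... = (\<integral>+l. (\<integral>+x. ?J x l))" by (rule lborel_pair.Fubini') measurable
      also have "... = (\<integral>+l. (\<integral>+x. indicator ?I l * indicator {x. F x > l * D} x))"
        by (intro nn_integral_cong) (auto simp: indicator_def)
      finally show ?thesis by (simp add: nn_integral_cmult)
    qed
    let ?H = "\<integral>+l. indicator ?I l * emeasure lborel {x. ennreal (l * C) <= h x}"
    \<comment> \<open>For \<open>h\<close> the layer-cake formula is only an inequality:
      \<open>h\<close> may exceed \<open>C\<close> or be infinite, and levels \<open>l\<close> above
      1 are discarded.\<close>
    have hl: "ennreal C * ?H <= integral\<^sup>N lborel h"
    proof -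
      let ?J = "\<lambda>x l. indicator {p. snd p \<in> ?I \<and> ennreal (snd p * C) <= h (fst p)} (x, l) :: ennreal"
      let ?i = "\<lambda>x. \<integral>\<^sup>+l. ?J x l \<partial>lborel"
      have "ennreal C * ?H
         = ennreal C * (\<integral>+l. (\<integral>+x. ?J x l))"
      proof (intro arg_cong2[where f="(*)"] nn_integral_cong refl)
        fix l :: real
        have "emeasure lborel {x. ennreal (l * C) <= h x} = (\<integral>+x. indicator {x. ennreal (l * C) <= h x} x)"
          by (rule nn_integral_indicator[symmetric]) measurable
        then show "indicator ?I l * emeasure lborel {x. ennreal (l * C) <= h x} =
            (\<integral>+x. ?J x l)" by (cases "0 < l"; cases "l < 1") (simp_all add: indicator_def)
      qed
      also have "... = ennreal C * (\<integral>+x. ?i x)"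
        by (intro arg_cong2[where f="(*)"] lborel_pair.Fubini'[symmetric] refl) measurable
      also have "... = (\<integral>+x. ennreal C * ?i x)" by (rule nn_integral_cmult[symmetric]) measurable
      also have "... <= integral\<^sup>N lborel h"
      proof (rule nn_integral_mono)
        fix x
        show "ennreal C * ?i x <= h x"
        proof (cases "h x")
          case (real y)
          have "?i x <= (\<integral>+l. indicator {0..y / C} l)"
            using real C by (intro nn_integral_mono) (auto simp: indicator_def field_simps)
          also have "... = ennreal (y / C)" using real C by simp
          finally have "ennreal C * ?i x <= ennreal C * ennreal (y / C)" by (rule mult_left_mono) simp
          also have "... = h x" using real C by (simp add: ennreal_mult'[symmetric])
          finally show ?thesis .
        qed simp
      qed
      finally show ?thesis .
    qed
    have bm: "ennreal (1 - t) * emeasure lborel {x. f x > l * A} + ennreal t * emeasure lborel {x. g x > l * B}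
       <= emeasure lborel {x. ennreal (l * C) <= h x}" if l: "0 < l" "l < 1" for l
    proof (rule brunn_minkowski_real)
      have "l * A < A" "l * B < B" using l AB by auto
      then show "{x. f x > l * A} ~= {}" "{x. g x > l * B} ~= {}"
        using less_cSUP_iff[OF _ fM, of "l * A"] less_cSUP_iff[OF _ gM, of "l * B"] by (auto simp: A_def B_def)
      fix a b assume a: "a \<in> {x. f x > l * A}" and b: "b \<in> {x. g x > l * B}"
      have "l * C = (l * A) powr (1 - t) * (l * B) powr t" using l AB by (simp add: C_def powr_mult flip: powr_add)
      also have "... <= f a powr (1 - t) * g b powr t" using a b l AB t by (intro mult_mono powr_mono2) auto
      finally have "ennreal (l * C) <= ennreal (f a powr (1 - t) * g b powr t)" by (rule ennreal_leI)
      from order_trans[OF this le[of a b]] show "(1 - t) * a + t * b \<in> {x. ennreal (l * C) <= h x}" by simp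
    qed (use t in measurable)
    have main: "ennreal C * (ennreal (1 - t) * ?L f A + ennreal t * ?L g B) <= integral\<^sup>N lborel h"
    proof (rule order_trans[OF _ hl], rule mult_left_mono)
      have "ennreal (1 - t) * ?L f A + ennreal t * (?L g B)
        = (\<integral>+l. ennreal (1 - t) * (indicator ?I l * emeasure lborel {x. f x > l * A}) + ennreal t * (indicator ?I l * emeasure lborel {x. g x > l * B}))"
        using layer[of f A] layer[of g B] f0 g0 fA gB AB by (simp add: nn_integral_add nn_integral_cmult)
      also have "... <= ?H" using bm by (intro nn_integral_mono) (auto simp: indicator_def)
      finally show "ennreal (1 - t) * ?L f A + ennreal t * (?L g B)
         <= ?H" .
    qed simp
    show ?thesis unfolding geo_le_def
    proof (intro allI impI)
      fix r s :: real assume rs: "0 <= r" "0 <= s" and r: "ennreal r <= (\<integral>+x. f x)" and s: "ennreal s <= (\<integral>+x. g x)"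
      have dv: "ennreal (z / D) <= ?L F D"
        if z: "ennreal z <= (\<integral>+x. F x)" "0 <= z" and D: "D > 0" and [measurable]: "F \<in> borel_funs" and F: "!!x. 0 <= F x" for z D and F :: "real => real"
      proof -
        have "ennreal (z / D) = ennreal (1 / D) * ennreal z" using D z by (simp add: ennreal_mult'[symmetric])
        also have "... <= ennreal (1 / D) * (\<integral>+x. F x)" by (rule mult_left_mono[OF z(1)]) simp
        also have "... = ?L F D" using D F by (simp add: nn_integral_cmult[symmetric] ennreal_mult'[symmetric])
        finally show ?thesis .
      qed
      have "r powr (1 - t) * s powr t = C * ((r / A) powr (1 - t) * (s / B) powr t)"
        using AB rs by (simp add: C_def powr_divide)
      also have "... <= C * ((1 - t) * (r / A) + t * (s / B))"
        using C AB rs t by (intro mult_left_mono weighted_am_gm) auto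
      finally have "ennreal (r powr (1 - t) * s powr t) <= ennreal (C * ((1 - t) * (r / A) + t * (s / B)))" by (rule ennreal_leI)
      also have "... = ennreal C * (ennreal (1 - t) * ennreal (r / A) + ennreal t * ennreal (s / B))"
        using C AB rs t by (simp add: ennreal_plus[symmetric] flip: ennreal_mult' del: ennreal_plus)
      also have "... <= ennreal C * (ennreal (1 - t) * ?L f A + ennreal t * ?L g B)"
        using dv[OF r rs(1) AB(1)] dv[OF s rs(2) AB(2)] f0 g0 by (intro mult_left_mono add_mono) auto
      also note main
      finally show "ennreal (r powr (1 - t) * s powr t) <= integral\<^sup>N lborel h" .
    qed
  qed
qed

text \<open>Truncation at height \<open>k\<close> reduces to bounded functions. Since
  \<open>r\<close> may equal the integral of \<open>f\<close>, which truncated integrals reach only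
  in the limit, \<open>r\<close> and \<open>s\<close> are first shrunk by a factor
  \<open>l < 1\<close>, and \<open>l\<close> tends to 1 at the end.\<close>

lemma prekopa_leindler_real:
  fixes f g h :: "real => ennreal"
  assumes [measurable]: "f \<in> borel_funs" "g \<in> borel_funs" "h \<in> borel_funs"
    and t: "0 < t" "t < 1"
    and le: "!!x y. geo_le t (f x) (g y) (h ((1 - t) * x + t * y))"
  shows "geo_le t (\<integral>+x. f x) (\<integral>+x. g x) (\<integral>+x. h x)" unfolding geo_le_def
proof (intro allI impI)
  fix r s :: real
  assume rs: "0 <= r" "0 <= s" and r: "ennreal r <= (\<integral>+x. f x)" and s: "ennreal s <= (\<integral>+x. g x)"
  define F where "F k f x = enn2real (min (f x) (of_nat k))" for k :: nat and f :: "real => ennreal" and x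
  let ?I = "integral\<^sup>N lborel :: _ => ennreal" and ?J = "\<lambda>k f. \<integral>\<^sup>+x. F k f x \<partial>lborel"
  have F: "ennreal (F k f x) = min (f x) (of_nat k)" for k f x
    unfolding F_def by (rule ennreal_enn2real) (auto simp: min_less_iff_disj ennreal_of_nat_eq_real_of_nat)
  have [measurable]: "F k f \<in> borel_funs" if [measurable]: "f \<in> borel_funs" for k f unfolding F_def by measurable
  have F0: "0 <= F k f x" for k f x by (simp add: F_def)
  have Fb: "bdd_above (range (F k f))" for k f
  proof (rule bdd_aboveI2)
    fix x have "ennreal (F k f x) <= ennreal (real k)" unfolding F by (simp add: ennreal_of_nat_eq_real_of_nat)
    then show "F k f x <= real k" by simp
  qed
  have bounded: "geo_le t (?J k f) (?J k g) (?I h)" for k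
  proof (rule prekopa_leindler_real_bounded)
    fix x y
    show "ennreal (F k f x powr (1 - t) * F k g y powr t) <= h ((1 - t) * x + t * y)"
      by (rule geo_leD[OF le]) (auto simp: F F0)
  qed (use t F0 Fb in auto)
  have approx: "\<exists>k0. \<forall>k\<ge>k0. ennreal r' <= ?J k f"
    if r': "ennreal r' < ?I f" and [measurable]: "f \<in> borel_funs" for r' f
  proof -
    have "(SUP k. ?J k f) = (\<integral>+x. (SUP k. ennreal (F k f x)))"
      by (intro nn_integral_monotone_convergence_SUP[symmetric] incseq_SucI le_funI)
         (auto simp: F min_def intro: order_trans)
    also have "(\<lambda>x. SUP k. ennreal (F k f x)) = f"
    proof
      fix x show "(SUP k. ennreal (F k f x)) = f x"
      proof (rule antisym)
        show "f x <= (SUP k. ennreal (F k f x))"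
        proof (rule dense_le)
          fix y assume y: "y < f x"
          then have "y < top" by (rule less_le_trans) simp
          then obtain k where "y < of_nat k" using ennreal_Ex_less_of_nat by blast
          then have "y <= ennreal (F k f x)" using y by (simp add: F less_imp_le)
          then show "y <= (SUP k. ennreal (F k f x))" by (rule SUP_upper2[OF UNIV_I])
        qed
      qed (auto simp: F intro: SUP_least)
    qed
    finally have "ennreal r' < (SUP k. ?J k f)" using r' by simp
    then obtain k0 where k0: "ennreal r' < ?J k0 f" unfolding less_SUP_iff by blast
    have "ennreal r' <= ?J k f" if "k >= k0" for k
    proof -
      have "?J k0 f <= ?J k f" using that by (intro nn_integral_mono) (auto simp: F min_def intro: order_trans)
      with k0 show ?thesis by simp
    qed
    then show ?thesis by blast
  qed
  show "ennreal (r powr (1 - t) * s powr t) <= ?I h"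
  proof (cases "r = 0 \<or> s = 0")
    case True then show ?thesis by auto
  next
    case False
    then have rs': "r > 0" "s > 0" using rs by auto
    have le': "ennreal ((l * r) powr (1 - t) * (l * s) powr t) <= ?I h" if l: "0 < l" "l < 1" for l
    proof -
      have lr: "l * r < r" "l * s < s" using l rs' by auto
      have "ennreal (l * r) < ennreal r" "ennreal (l * s) < ennreal s" using lr rs' l by (auto simp: ennreal_less_iff)
      then have "ennreal (l * r) < ?I f" "ennreal (l * s) < ?I g" using r s by auto
      then obtain k1 k2 where "\<forall>k\<ge>k1. ennreal (l * r) <= ?J k f" "\<forall>k\<ge>k2. ennreal (l * s) <= ?J k g"
        using approx[of "l * r" f] approx[of "l * s" g] by auto
      then show ?thesis using geo_leD[OF bounded[of "max k1 k2"], of "l * r" "l * s"] l rs' by auto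
    qed
    have lim: "((\<lambda>l. ennreal ((l * r) powr (1 - t) * (l * s) powr t)) \<longlongrightarrow> ennreal ((1 * r) powr (1 - t) * (1 * s) powr t)) (at_left 1)"
      using rs' by (intro tendsto_ennrealI tendsto_intros) auto
    have ev: "eventually (\<lambda>l. ennreal ((l * r) powr (1 - t) * (l * s) powr t) <= ?I h) (at_left 1)"
      using eventually_at_left_real[of 0 "1::real"] le' by (auto elim: eventually_mono)
    show ?thesis using tendsto_upperbound[OF lim ev] by simp
  qed
qed

text \<open>Induction on the dimension: after integrating out the new coordinate, the
  one-dimensional case says that the three partial integrals satisfy the hypothesis in the remaining
  coordinates.\<close>

lemma prekopa_leindler_PiM:
  fixes f g h :: "('i => real) => ennreal"
  assumes I: "finite I" and t: "0 < t" "t < 1"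
    and f: "f \<in> borel_measurable (Pi\<^sub>M I (\<lambda>_. lborel))" and g: "g \<in> borel_measurable (Pi\<^sub>M I (\<lambda>_. lborel))"
    and h: "h \<in> borel_measurable (Pi\<^sub>M I (\<lambda>_. lborel))"
    and le: "!!x y. x \<in> extensional I ==> y \<in> extensional I ==> geo_le t (f x) (g y) (h (\<lambda>i\<in>I. (1 - t) * x i + t * y i))"
  shows "geo_le t (\<integral>\<^sup>+x. f x \<partial>Pi\<^sub>M I (\<lambda>_. lborel)) (\<integral>\<^sup>+x. g x \<partial>Pi\<^sub>M I (\<lambda>_. lborel)) (\<integral>\<^sup>+x. h x \<partial>Pi\<^sub>M I (\<lambda>_. lborel))"
  using I f g h le
proof (induction I arbitrary: f g h rule: finite_induct)
  case empty
  then show ?case by (simp add: nn_integral_count_space_finite PiM_empty)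
next
  case (insert i I)
  interpret product_sigma_finite "\<lambda>_::'i. lborel :: real measure" ..
  let ?M = "Pi\<^sub>M I (\<lambda>_. lborel :: real measure)"
  have meas: "(\<lambda>(x, y). k (x(i := y))) \<in> borel_measurable (?M \<Otimes>\<^sub>M lborel)"
    if "k \<in> borel_measurable (Pi\<^sub>M (insert i I) (\<lambda>_. lborel))" for k :: "('i => real) => ennreal"
    using measurable_compose[OF measurable_add_dim that] by (simp add: split_beta')
  have meas1: "(\<lambda>y. k (x(i := y))) \<in> borel_funs"
    if "k \<in> borel_measurable (Pi\<^sub>M (insert i I) (\<lambda>_. lborel))" "x \<in> extensional I" for k :: "('i => real) => ennreal" and x
    using measurable_Pair2[OF meas[OF that(1)], of x] that(2) by (simp add: space_PiM PiE_def)
  have meas2: "(\<lambda>x. \<integral>\<^sup>+y. k (x(i := y)) \<partial>lborel) \<in> borel_measurable ?M"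
    if "k \<in> borel_measurable (Pi\<^sub>M (insert i I) (\<lambda>_. lborel))" for k :: "('i => real) => ennreal"
    using sigma_finite_measure.borel_measurable_nn_integral[OF sigma_finite_lborel meas[OF that]] by simp
  have "geo_le t (\<integral>\<^sup>+x. \<integral>\<^sup>+y. f (x(i := y)) \<partial>lborel \<partial>?M) (\<integral>\<^sup>+x. \<integral>\<^sup>+y. g (x(i := y)) \<partial>lborel \<partial>?M) (\<integral>\<^sup>+x. \<integral>\<^sup>+y. h (x(i := y)) \<partial>lborel \<partial>?M)"
  proof (rule insert.IH)
    fix a b :: "'i => real" assume ab: "a \<in> extensional I" "b \<in> extensional I"
    let ?c = "\<lambda>j\<in>I. (1 - t) * a j + t * b j"
    have c: "?c \<in> extensional I" by simp
    show "geo_le t (\<integral>+y. f (a(i := y))) (\<integral>+y. g (b(i := y))) (\<integral>+y. h (?c(i := y)))"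
    proof (rule prekopa_leindler_real[OF meas1[OF insert.prems(1) ab(1)] meas1[OF insert.prems(2) ab(2)] meas1[OF insert.prems(3) c] t])
      fix y z
      have "?c(i := (1 - t) * y + t * z) = (\<lambda>j\<in>insert i I. (1 - t) * (a(i := y)) j + t * (b(i := z)) j)" by auto
      moreover have "a(i := y) \<in> extensional (insert i I)" "b(i := z) \<in> extensional (insert i I)" using ab by auto
      ultimately show "geo_le t (f (a(i := y))) (g (b(i := z))) (h (?c(i := (1 - t) * y + t * z)))"
        using insert.prems(4) by metis
    qed
  qed (rule meas2[OF insert.prems(1)] meas2[OF insert.prems(2)] meas2[OF insert.prems(3)])+
  then show ?case using insert.hyps insert.prems by (simp add: product_nn_integral_insert)
qed

theorem prekopa_leindler:
  fixes f g h :: "'a::euclidean_space => ennreal"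
  assumes [measurable]: "f \<in> borel_funs" "g \<in> borel_funs" "h \<in> borel_funs"
    and t: "0 < t" "t < 1"
    and le: "!!x y. geo_le t (f x) (g y) (h ((1 - t) *. x + t *. y))"
  shows "geo_le t (\<integral>+x. f x) (\<integral>+x. g x) (\<integral>+x. h x)"
proof -
  let ?M = "Pi\<^sub>M (Basis :: 'a set) (\<lambda>_. lborel :: real measure)"
  let ?T = "\<lambda>x. \<Sum>b\<in>(Basis :: 'a set). x b *. b"
  have [measurable]: "?T \<in> ?M \<rightarrow>\<^sub>M borel" by measurable
  have e: "(\<integral>+x. k x) = (\<integral>\<^sup>+x. k (?T x) \<partial>?M)" if [measurable]: "k \<in> borel_funs" for k :: "'a => ennreal"
    by (subst lborel_eq) (simp add: nn_integral_distr)
  show ?thesis unfolding e[OF assms(1)] e[OF assms(2)] e[OF assms(3)]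
  proof (rule prekopa_leindler_PiM[OF finite_Basis t])
    fix x y :: "'a => real"
    have "?T (\<lambda>i\<in>Basis. (1 - t) * x i + t * y i) = (1 - t) *. ?T x + t *. ?T y"
      by (simp add: scaleR_sum_right sum.distrib[symmetric] scaleR_add_left)
    then show "geo_le t (f (?T x)) (g (?T y)) (h (?T (\<lambda>i\<in>Basis. (1 - t) * x i + t * y i)))"
      using le[of "?T x" "?T y"] by simp
  qed auto
qed

section \<open>Convex functions with 1-Lipschitz gradient\<close>

definition one_smooth :: "('a::euclidean_space => real) => ('a => 'a) => bool" where
  "one_smooth \<phi> T \<longleftrightarrow> (\<forall>x y. 0 <= \<phi> y - \<phi> x - T x \<bullet> (y - x) \<and> \<phi> y - \<phi> x - T x \<bullet> (y - x) <= nsq (y - x) / 2)"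

lemma one_smoothD:
  assumes "one_smooth \<phi> T"
  shows "\<phi> x + T x \<bullet> (y - x) <= \<phi> y" "\<phi> y <= \<phi> x + T x \<bullet> (y - x) + nsq (y - x) / 2"
  using assms[unfolded one_smooth_def, rule_format, where x=x and y=y] by linarith+

text \<open>The Baillon-Haddad argument: a tangent plane at \<open>x\<close> lies below the
  quadratic majorant based at \<open>y\<close>. Evaluated at the best point, and added to the same
  estimate with \<open>x\<close> and \<open>y\<close> exchanged, this gives cocoercivity, which
  contains both monotonicity and the Lipschitz bound.\<close>

lemma one_smooth_firmly_nonexpansive:
  assumes "one_smooth \<phi> T"
  shows "nsq (T x - T y) <= (T x - T y) \<bullet> (x - y)"
proof -
  have half: "\<phi> x - \<phi> y + T x \<bullet> (y - x) + nsq (T x - T y) / 2 <= 0" for x y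
  proof -
    \<comment> \<open>The minimiser of the majorant based at \<open>y\<close> minus the tangent
      plane at \<open>x\<close>.\<close>
    define z where "z = y + (T x - T y)"
    have "\<phi> x + T x \<bullet> (z - x) <= \<phi> y + T y \<bullet> (z - y) + nsq (z - y) / 2"
      using one_smoothD[OF assms] by (meson order_trans)
    then show ?thesis
      unfolding z_def by (simp add: power2_norm_eq_inner inner_simps algebra_simps diff_divide_distrib add_divide_distrib)
  qed
  from half[of x y] half[of y x] show ?thesis by (simp add: norm_minus_commute inner_simps)
qed

lemma one_smooth_monotone: "one_smooth \<phi> T ==> 0 <= (T x - T y) \<bullet> (x - y)"
  using one_smooth_firmly_nonexpansive[of \<phi> T x y] zero_le_power2[of "norm (T x - T y)"] by linarith

lemma one_smooth_lipschitz:
  assumes "one_smooth \<phi> T" shows "1-lipschitz_on UNIV T"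
proof (rule lipschitz_onI)
  fix x y
  have "nsq (T x - T y) <= norm (T x - T y) * norm (x - y)"
    using one_smooth_firmly_nonexpansive[OF assms, of x y] norm_cauchy_schwarz[of "T x - T y" "x - y"] by linarith
  then have "norm (T x - T y) <= norm (x - y)" by (cases "T x = T y") (auto simp: power2_eq_square)
  then show "dist (T x) (T y) <= 1 * dist x y" by (simp add: dist_norm)
qed simp

lemma one_smooth_has_derivative:
  assumes "one_smooth \<phi> T" shows "(\<phi> has_derivative (\<lambda>v. T x \<bullet> v)) (at x)" unfolding has_derivative_at
proof (intro conjI)
  show "bounded_linear (\<lambda>v. T x \<bullet> v)" by (rule bounded_linear_inner_right)
  show "(\<lambda>h. norm (\<phi> (x + h) - \<phi> x - T x \<bullet> h) / norm h) \<midarrow>0\<rightarrow> 0"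
  proof (rule Lim_null_comparison)
    show "\<forall>\<^sub>F h in at 0. norm (norm (\<phi> (x + h) - \<phi> x - T x \<bullet> h) / norm h) <= norm h / 2"
    proof (rule always_eventually, rule allI)
      fix h
      have "norm (\<phi> (x + h) - \<phi> x - T x \<bullet> h) <= nsq h / 2"
        using one_smoothD[OF assms, where x=x and y="x + h"] by simp
      then show "norm (norm (\<phi> (x + h) - \<phi> x - T x \<bullet> h) / norm h) <= norm h / 2"
        by (cases "h = 0") (auto simp: divide_simps power2_eq_square)
    qed
    show "(\<lambda>h::'a. norm h / 2) \<midarrow>0\<rightarrow> 0" by (auto intro!: tendsto_eq_intros)
  qed
qed

lemma one_smooth_continuous: "one_smooth \<phi> T ==> continuous_on UNIV \<phi>"
  by (rule continuous_at_imp_continuous_on) (metis one_smooth_has_derivative has_derivative_continuous)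

lemma one_smooth_measurable:
  "one_smooth \<phi> T ==> \<phi> \<in> borel_funs" by (intro borel_measurable_continuous_onI one_smooth_continuous)

lemma one_smooth_growth:
  assumes "one_smooth \<phi> T"
  shows "\<bar>\<phi> x\<bar> <= (\<bar>\<phi> 0\<bar> + norm (T 0) + 1) * (1 + norm x)^2"
proof -
  have "\<bar>\<phi> x\<bar> <= \<bar>\<phi> 0\<bar> + \<bar>T 0 \<bullet> x\<bar> + nsq x / 2"
    using one_smoothD[OF assms, where x=0 and y=x] unfolding diff_zero by linarith
  also have "\<bar>T 0 \<bullet> x\<bar> <= norm (T 0) * norm x" by (rule Cauchy_Schwarz_ineq2)
  also have "\<bar>\<phi> 0\<bar> + norm (T 0) * norm x + nsq x / 2 <= (\<bar>\<phi> 0\<bar> + norm (T 0) + 1) * (1 + norm x)^2"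
  proof -
    have e: "(1 + norm x)^2 = 1 + 2 * norm x + nsq x" by (simp add: power2_sum)
    have "0 <= norm x" "0 <= nsq x" by auto
    then have l: "1 <= (1 + norm x)^2" "norm x <= (1 + norm x)^2" and c: "nsq x / 2 <= (1 + norm x)^2"
      unfolding e by linarith+
    have a: "\<bar>\<phi> 0\<bar> <= \<bar>\<phi> 0\<bar> * (1 + norm x)^2" using mult_left_mono[OF l(1), of "\<bar>\<phi> 0\<bar>"] by simp
    have b: "norm (T 0) * norm x <= norm (T 0) * (1 + norm x)^2" by (rule mult_left_mono[OF l(2)]) simp
    show ?thesis unfolding distrib_right using a b c by linarith
  qed
  finally show ?thesis by simp
qed

lemma one_smooth_integrable:
  assumes "one_smooth \<phi> T" shows "integrable gauss \<phi>"
proof (rule integrable_gauss_quadratic)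
  show "\<phi> \<in> borel_funs" by (rule one_smooth_measurable[OF assms])
  show "norm (\<phi> x) <= (\<bar>\<phi> 0\<bar> + norm (T 0) + 1) * (1 + norm x)^2" for x using one_smooth_growth[OF assms, of x] by simp
qed

lemma one_smooth_from_semiconcave:
  assumes sub: "!!x y. \<phi> x + T x \<bullet> (y - x) <= \<phi> y"
    and sc: "!!x y t. 0 < t ==> t < 1 ==>
      (1 - t) * \<phi> x + t * \<phi> y - t * (1 - t) * nsq (x - y) / 2 <= \<phi> ((1 - t) *. x + t *. y)"
  shows "one_smooth \<phi> T" unfolding one_smooth_def
proof (intro allI conjI)
  fix x y :: 'a
  show "0 <= \<phi> y - \<phi> x - T x \<bullet> (y - x)" using sub[of x y] by simp
  text \<open>Extend the segment from \<open>y\<close> to \<open>x\<close> slightly beyond \<open>x\<close> to \<open>z\<close>: semiconcavity on \<open>[z, y]\<close>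
    and the subgradient bound at \<open>z\<close> control \<open>\<phi> y\<close> from above.\<close>
  have bound: "\<phi> y - \<phi> x - T x \<bullet> (y - x) <= (1 + r) * nsq (y - x) / 2" if r: "r > 0" for r :: real
  proof -
    define z where "z = x - r *. (y - x)"
    define t where "t = r / (1 + r)"
    have t: "0 < t" "t < 1" "1 - t = 1 / (1 + r)" using r by (auto simp: t_def field_simps)
    have xe: "(1 - t) *. z + t *. y = x"
    proof -
      have "(1 + r) *. ((1 - t) *. z + t *. y) = z + r *. y"
        using r by (simp add: t(3) scaleR_add_right) (simp add: t_def)
      also have "... = (1 + r) *. x" by (simp add: z_def algebra_simps)
      finally show ?thesis using r by simp
    qed
    have zy: "z - y = - (1 + r) *. (y - x)" by (simp add: z_def algebra_simps)
    have "(1 - t) * \<phi> z + t * \<phi> y - t * (1 - t) * nsq (z - y) / 2 <= \<phi> x" using sc[OF t(1,2), of z y] unfolding xe .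
    moreover have "nsq (z - y) = (1 + r)^2 * nsq (y - x)" unfolding zy using r by (simp add: power_mult_distrib)
    moreover have "(1 - t) * (\<phi> x - r * (T x \<bullet> (y - x))) <= (1 - t) * \<phi> z"
      using t(2) sub[of x z] by (intro mult_left_mono) (simp_all add: z_def)
    ultimately have "(1 - t) * (\<phi> x - r * (T x \<bullet> (y - x))) + t * \<phi> y - t * (1 - t) * ((1 + r)^2 * nsq (y - x)) / 2 <= \<phi> x"
      by simp
    then have le: "(1 + r) * ((1 - t) * (\<phi> x - r * (T x \<bullet> (y - x))) + t * \<phi> y - t * (1 - t) * ((1 + r)^2 * nsq (y - x)) / 2) <= (1 + r) * \<phi> x"
      using r by (intro mult_left_mono) auto
    have rt: "(1 + r) * (1 - t) = 1" "(1 + r) * t = r" using r by (auto simp: t(3)) (simp add: t_def)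
    have "(1 + r) * ((1 - t) * P + t * Y - t * (1 - t) * ((1 + r)^2 * N) / 2)
        = ((1 + r) * (1 - t)) * P + ((1 + r) * t) * Y - ((1 + r) * t) * ((1 + r) * (1 - t)) * ((1 + r) * N) / 2" for P Y N
      by (simp add: power2_eq_square algebra_simps)
    with le have "(\<phi> x - r * (T x \<bullet> (y - x))) + r * \<phi> y - r * ((1 + r) * nsq (y - x)) / 2 <= (1 + r) * \<phi> x"
      unfolding rt by simp
    moreover have "P - r * s + r * Y - r * ((1 + r) * N) / 2 <= (1 + r) * P ==> r * (Y - P - s) <= r * ((1 + r) * N / 2)" for P s Y N :: real
      by (simp add: field_simps)
    ultimately have "r * (\<phi> y - \<phi> x - T x \<bullet> (y - x)) <= r * ((1 + r) * nsq (y - x) / 2)" by blast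
    then show ?thesis using r by simp
  qed
  have lim: "((\<lambda>r. (1 + r) * nsq (y - x) / 2) \<longlongrightarrow> (1 + 0) * nsq (y - x) / 2) (at_right 0)"
    by (intro tendsto_intros) auto
  have ev: "\<forall>\<^sub>F r in at_right 0. \<phi> y - \<phi> x - T x \<bullet> (y - x) <= (1 + r) * nsq (y - x) / 2"
    using eventually_at_right_less[of "0::real"] by (rule eventually_mono) (rule bound)
  show "\<phi> y - \<phi> x - T x \<bullet> (y - x) <= nsq (y - x) / 2" using tendsto_lowerbound[OF lim ev] by simp
qed

text \<open>The upper half of \<open>one_smooth\<close> says that
  \<open>nsq x / 2 - \<phi> x\<close> lies above its tangent planes; the linear terms of the tangent
  plane at the intermediate point cancel in the combination. This convexity, complementary to that
  of \<open>\<phi>\<close>, is what makes the Laplace transform of \<open>\<phi>\<close> strongly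
  convex.\<close>

lemma one_smooth_upper_convex:
  assumes "one_smooth \<phi> T" and t: "0 < t" "t < 1"
  shows "nsq ((1 - t) *. x + t *. y) / 2 - \<phi> ((1 - t) *. x + t *. y)
    <= (1 - t) * (nsq x / 2 - \<phi> x) + t * (nsq y / 2 - \<phi> y)"
proof -
  let ?z = "(1 - t) *. x + t *. y"
  have g: "\<phi> w - \<phi> ?z <= T ?z \<bullet> (w - ?z) + nsq (w - ?z) / 2" for w
    using one_smoothD(2)[OF assms(1), where x="?z" and y=w] by simp
  have n: "nsq (w - z) / 2 = nsq w / 2 - nsq z / 2 - z \<bullet> (w - z)" for w z :: 'a
    by (simp add: power2_norm_eq_inner inner_diff_right inner_commute)
  have g': "(T ?z - ?z) \<bullet> (w - ?z) >= (nsq ?z / 2 - \<phi> ?z) - (nsq w / 2 - \<phi> w)" for w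
    using g[of w] unfolding n by (simp add: inner_diff_left)
  have "(1 - t) * ((T ?z - ?z) \<bullet> (x - ?z)) + t * ((T ?z - ?z) \<bullet> (y - ?z)) = (T ?z - ?z) \<bullet> ((1 - t) *. (x - ?z) + t *. (y - ?z))"
    by (simp add: inner_add_right)
  also have "(1 - t) *. (x - ?z) + t *. (y - ?z) = 0" by (simp add: algebra_simps)
  finally have "0 = (1 - t) * ((T ?z - ?z) \<bullet> (x - ?z)) + t * ((T ?z - ?z) \<bullet> (y - ?z))" by simp
  moreover define k where "k w = nsq w / 2 - \<phi> w" for w
  have "(1 - t) * (k ?z - k x) + t * (k ?z - k y) <= (1 - t) * ((T ?z - ?z) \<bullet> (x - ?z)) + t * ((T ?z - ?z) \<bullet> (y - ?z))"
    using t unfolding k_def by (intro add_mono mult_left_mono g') auto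
  ultimately have "(1 - t) * (k ?z - k x) + t * (k ?z - k y) <= 0" by simp
  moreover have "(1 - t) * (k ?z - k x) + t * (k ?z - k y) = k ?z - ((1 - t) * k x + t * k y)"
    by (simp add: left_diff_distrib right_diff_distrib)
  ultimately have "k ?z <= (1 - t) * k x + t * k y" by simp
  then show ?thesis by (simp only: k_def)
qed

section \<open>Exponential Laplace transforms\<close>

text \<open>Legendre transform at temperature \<open>e\<close>: the supremum of
  \<open>x \<bullet> y - \<zeta> y\<close> over \<open>y\<close> is replaced with a logarithmic
  exponential average against \<open>\<nu>\<close>.\<close>

definition lap :: "real => 'a::euclidean_space measure => ('a => real) => 'a => real" where
  "lap e \<nu> \<zeta> x = e * ln (\<integral>y. exp ((x \<bullet> y - \<zeta> y) / e) \<partial>\<nu>)"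

text \<open>Mean of the Gibbs measure attached to \<open>x\<close>. It is the subgradient of
  \<open>lap\<close> at \<open>x\<close> and becomes the approximate transport map.\<close>

definition lap_mean :: "real => 'a::euclidean_space measure => ('a => real) => 'a => 'a" where
  "lap_mean e \<nu> \<zeta> x = (\<integral>y. exp ((x \<bullet> y - \<zeta> y) / e) *. y \<partial>\<nu>) /\<^sub>R (\<integral>y. exp ((x \<bullet> y - \<zeta> y) / e) \<partial>\<nu>)"

locale exp_moments = prob_space \<nu> for \<nu> :: "'a::euclidean_space measure" +
  assumes sets_nu [simp, measurable_cong]: "sets \<nu> = sets borel"
    and exp_int: "!!p. integrable \<nu> (\<lambda>y. exp (p \<bullet> y))"
begin

lemma space_nu [simp]: "space \<nu> = UNIV" using sets_eq_imp_space_eq[OF sets_nu] by simp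

text \<open>Polynomial moments are dominated by exponentials in the coordinate directions and their
  opposites, to which \<open>exp_int\<close> applies.\<close>

lemma norm_le_exp: "norm y <= (\<Sum>i\<in>Basis. exp (i \<bullet> y) + exp ((- i) \<bullet> y))" for y :: 'a
proof -
  have "norm y <= (\<Sum>i\<in>Basis. \<bar>y \<bullet> i\<bar>)" by (rule norm_le_l1)
  also have "... <= (\<Sum>i\<in>Basis. exp (i \<bullet> y) + exp ((- i) \<bullet> y))"
  proof (rule sum_mono)
    fix i :: 'a
    have "w <= exp w + exp (- w)" for w :: real using exp_ge_add_one_self[of w] exp_gt_zero[of "- w"] by linarith
    from this[of "i \<bullet> y"] this[of "- (i \<bullet> y)"] show "\<bar>y \<bullet> i\<bar> <= exp (i \<bullet> y) + exp ((- i) \<bullet> y)"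
      by (simp add: inner_commute)
  qed
  finally show ?thesis .
qed

lemma norm_sq_le_exp: "nsq y <= (\<Sum>i\<in>Basis. 2 * (exp (i \<bullet> y) + exp ((- i) \<bullet> y)))" for y :: 'a
proof -
  have "nsq y = (\<Sum>i\<in>Basis. (y \<bullet> i)^2)"
    unfolding power2_norm_eq_inner by (subst euclidean_inner) (simp add: power2_eq_square)
  also have "... <= (\<Sum>i\<in>Basis. 2 * (exp (i \<bullet> y) + exp ((- i) \<bullet> y)))"
  proof (rule sum_mono)
    fix i :: 'a
    have pos: "w^2 <= 2 * exp w" if "w >= 0" for w :: real using exp_lower_Taylor_quadratic[OF that] that by simp
    show "(y \<bullet> i)^2 <= 2 * (exp (i \<bullet> y) + exp ((- i) \<bullet> y))"
    proof (cases "y \<bullet> i >= 0")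
      case True
      then show ?thesis using pos[OF True] by (simp add: inner_commute add_increasing2)
    next
      case False
      then show ?thesis using pos[of "- (y \<bullet> i)"] by (simp add: inner_commute add_increasing)
    qed
  qed
  finally show ?thesis .
qed

lemma integrable_norm_sq: "integrable \<nu> (\<lambda>y. nsq y)"
proof (rule Bochner_Integration.integrable_bound)
  show "integrable \<nu> (\<lambda>y. \<Sum>i\<in>Basis. 2 * (exp (i \<bullet> y) + exp ((- i) \<bullet> y)))"
    by (intro Bochner_Integration.integrable_sum integrable_mult_right Bochner_Integration.integrable_add exp_int)
  show "AE y in \<nu>. norm (nsq y) <= norm (\<Sum>i\<in>Basis. 2 * (exp (i \<bullet> y) + exp ((- i) \<bullet> y)))"
    using norm_sq_le_exp by (auto intro!: order_trans[OF _ abs_ge_self])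
qed simp

lemma integrable_id: "integrable \<nu> (\<lambda>y. y)"
proof (rule Bochner_Integration.integrable_bound)
  show "integrable \<nu> (\<lambda>y. \<Sum>i\<in>Basis. (exp (i \<bullet> y) + exp ((- i) \<bullet> y)))"
    by (intro Bochner_Integration.integrable_sum Bochner_Integration.integrable_add exp_int)
  show "AE y in \<nu>. norm y <= norm (\<Sum>i\<in>Basis. exp (i \<bullet> y) + exp ((- i) \<bullet> y))"
    using norm_le_exp by (auto intro!: order_trans[OF _ abs_ge_self])
qed simp

end

text \<open>Throughout, \<open>\<zeta>\<close> has an affine minorant, so that its exponential Laplace transform is finite.\<close>

locale lap_context = exp_moments +
  fixes \<zeta> :: "'a => real" and e c :: real and q :: 'a
  assumes chi_meas [measurable]: "\<zeta> \<in> borel_funs" and e_pos: "e > 0"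
    and chi_lower: "!!y. c + q \<bullet> y <= \<zeta> y"
begin

abbreviation wt :: "'a => 'a => real" where "wt x y \<equiv> exp ((x \<bullet> y - \<zeta> y) / e)"

lemma wt_bound: "wt x y <= exp (- c / e) * exp (((x - q) /\<^sub>R e) \<bullet> y)"
proof -
  have "(x \<bullet> y - \<zeta> y) / e <= (x \<bullet> y - (c + q \<bullet> y)) / e" using chi_lower[of y] e_pos by (intro divide_right_mono) auto
  also have "... = - c / e + ((x - q) /\<^sub>R e) \<bullet> y" by (simp add: divide_inverse algebra_simps)
  finally show ?thesis by (simp flip: exp_add)
qed

lemma wt_integrable: "integrable \<nu> (wt x)"
proof (rule Bochner_Integration.integrable_bound)
  show "integrable \<nu> (\<lambda>y. exp (- c / e) * exp (((x - q) /\<^sub>R e) \<bullet> y))" by (intro integrable_mult_right exp_int)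
  show "AE y in \<nu>. norm (wt x y) <= norm (exp (- c / e) * exp (((x - q) /\<^sub>R e) \<bullet> y))" using wt_bound by simp
qed simp

lemma wt_integrable_id: "integrable \<nu> (\<lambda>y. wt x y *. y)"
proof (rule Bochner_Integration.integrable_bound)
  let ?b = "\<lambda>y. exp (- c / e) * (\<Sum>i\<in>Basis. exp (((x - q) /\<^sub>R e + i) \<bullet> y) + exp (((x - q) /\<^sub>R e - i) \<bullet> y))"
  show "integrable \<nu> ?b"
    by (intro integrable_mult_right Bochner_Integration.integrable_sum Bochner_Integration.integrable_add exp_int)
  have "norm (wt x y *. y) <= ?b y" for y
  proof -
    have "norm (wt x y *. y) <= (exp (- c / e) * exp (((x - q) /\<^sub>R e) \<bullet> y)) * (\<Sum>i\<in>Basis. exp (i \<bullet> y) + exp ((- i) \<bullet> y))"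
      using mult_mono[OF wt_bound[of x y] norm_le_exp[of y]] by simp
    also have "... = ?b y" by (simp add: sum_distrib_left exp_add exp_diff exp_minus divide_inverse algebra_simps)
    finally show ?thesis .
  qed
  then show "AE y in \<nu>. norm (wt x y *. y) <= norm (?b y)" by (auto intro!: order_trans[OF _ abs_ge_self])
qed simp

lemma wt_integral_pos: "(\<integral>y. wt x y \<partial>\<nu>) > 0"
proof -
  have "(\<integral>y. wt x y \<partial>\<nu>) ~= 0"
  proof
    assume "(\<integral>y. wt x y \<partial>\<nu>) = 0"
    then have "AE y in \<nu>. wt x y = 0" by (subst (asm) integral_nonneg_eq_0_iff_AE) (auto simp: wt_integrable)
    then show False by simp
  qed
  moreover have "(\<integral>y. wt x y \<partial>\<nu>) >= 0" by (intro Bochner_Integration.integral_nonneg) auto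
  ultimately show ?thesis by (metis order.not_eq_order_implies_strict)
qed

lemma exp_lap: "exp (lap e \<nu> \<zeta> x / e) = (\<integral>y. wt x y \<partial>\<nu>)" using wt_integral_pos e_pos by (simp add: lap_def)

text \<open>Jensen's inequality under the Gibbs measure at \<open>x\<close>: the tangent to
  \<open>exp\<close> at the mean exponent \<open>d \<bullet> ?m / e\<close> is integrated, and its
  linear term vanishes by the choice of \<open>?m\<close>.\<close>

lemma lap_subgradient: "lap e \<nu> \<zeta> x + lap_mean e \<nu> \<zeta> x \<bullet> (x' - x) <= lap e \<nu> \<zeta> x'"
proof -
  let ?Z = "\<integral>y. wt x y \<partial>\<nu>" and ?m = "lap_mean e \<nu> \<zeta> x"
  define d where "d = x' - x"
  have Z: "?Z > 0" by (rule wt_integral_pos)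
  have mZ: "(\<integral>y. wt x y *. y \<partial>\<nu>) = ?Z *. ?m" using Z by (simp add: lap_mean_def)
  have iw: "integrable \<nu> (\<lambda>y. wt x y * (d \<bullet> y))"
  proof -
    have "integrable \<nu> (\<lambda>y. d \<bullet> (wt x y *. y))" by (intro integrable_inner_right wt_integrable_id)
    then show ?thesis by simp
  qed
  have Iw: "(\<integral>y. wt x y * (d \<bullet> y) \<partial>\<nu>) = ?Z * (d \<bullet> ?m)"
  proof -
    have "(\<integral>y. wt x y * (d \<bullet> y) \<partial>\<nu>) = (\<integral>y. d \<bullet> (wt x y *. y) \<partial>\<nu>)" by simp
    also have "... = d \<bullet> (\<integral>y. wt x y *. y \<partial>\<nu>)" by (rule integral_inner_right[OF wt_integrable_id])
    finally show ?thesis by (simp add: mZ)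
  qed
  have pt: "exp (d \<bullet> ?m / e) * (wt x y + (wt x y * (d \<bullet> y) - (d \<bullet> ?m) * wt x y) / e) <= wt x' y" for y
  proof -
    have "wt x' y = wt x y * exp (d \<bullet> ?m / e) * exp ((d \<bullet> y - d \<bullet> ?m) / e)"
      by (simp add: d_def inner_diff_left diff_divide_distrib flip: exp_add)
    moreover have "1 + (d \<bullet> y - d \<bullet> ?m) / e <= exp ((d \<bullet> y - d \<bullet> ?m) / e)" by simp
    then have "wt x y * exp (d \<bullet> ?m / e) * (1 + (d \<bullet> y - d \<bullet> ?m) / e) <= wt x y * exp (d \<bullet> ?m / e) * exp ((d \<bullet> y - d \<bullet> ?m) / e)"
      by (intro mult_left_mono) auto
    ultimately show ?thesis by (simp add: algebra_simps)
  qed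
  have "exp (d \<bullet> ?m / e) * ?Z = (\<integral>y. exp (d \<bullet> ?m / e) * (wt x y + (wt x y * (d \<bullet> y) - (d \<bullet> ?m) * wt x y) / e) \<partial>\<nu>)"
    using wt_integrable[of x] iw Iw by simp
  also have "... <= (\<integral>y. wt x' y \<partial>\<nu>)" using wt_integrable iw by (intro integral_mono pt) auto
  finally have "ln (exp (d \<bullet> ?m / e) * ?Z) <= ln (\<integral>y. wt x' y \<partial>\<nu>)"
    using Z wt_integral_pos by (subst ln_le_cancel_iff) auto
  then have "d \<bullet> ?m / e + ln ?Z <= ln (\<integral>y. wt x' y \<partial>\<nu>)" using Z by (simp add: ln_mult)
  then have "e * (d \<bullet> ?m / e + ln ?Z) <= e * ln (\<integral>y. wt x' y \<partial>\<nu>)" using e_pos by simp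
  moreover have "e * (d \<bullet> ?m / e + ln ?Z) = lap e \<nu> \<zeta> x + ?m \<bullet> d"
    using e_pos by (simp add: lap_def distrib_left inner_commute)
  ultimately show ?thesis by (simp add: lap_def d_def)
qed

lemma lap_continuous: "continuous_on UNIV (lap e \<nu> \<zeta>)"
proof (rule convex_on_continuous)
  show "convex_on UNIV (lap e \<nu> \<zeta>)"
  proof (rule convex_onI)
    fix t :: real and x y :: 'a assume t: "0 < t" "t < 1"
    let ?z = "(1 - t) *. x + t *. y" and ?l = "lap e \<nu> \<zeta>" and ?m = "lap_mean e \<nu> \<zeta> ((1 - t) *. x + t *. y)"
    have "(1 - t) * (?l ?z + ?m \<bullet> (x - ?z)) + t * (?l ?z + ?m \<bullet> (y - ?z)) <= (1 - t) * ?l x + t * ?l y"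
      using t by (intro add_mono mult_left_mono lap_subgradient) auto
    moreover have "(1 - t) * (?l ?z + ?m \<bullet> (x - ?z)) + t * (?l ?z + ?m \<bullet> (y - ?z)) = ?l ?z + ?m \<bullet> ((1 - t) *. (x - ?z) + t *. (y - ?z))"
      by (simp add: algebra_simps)
    moreover have "(1 - t) *. (x - ?z) + t *. (y - ?z) = 0" by (simp add: algebra_simps)
    ultimately show "?l ?z <= (1 - t) * ?l x + t * ?l y" by simp
  qed simp
qed simp

lemma lap_measurable [measurable]: "lap e \<nu> \<zeta> \<in> borel_funs"
  by (rule borel_measurable_continuous_onI[OF lap_continuous])

end

section \<open>Strong convexity and semiconcavity of Laplace transforms\<close>

lemma integral_gauss_exp: "(\<oint>x. exp (p \<bullet> x)) = exp (nsq (p::'a::euclidean_space) / 2)"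
  and integrable_gauss_exp: "integrable gauss (\<lambda>x::'a. exp (p \<bullet> x))"
proof -
  have i: "integrable gauss (\<lambda>x::'a. exp (p \<bullet> x - nsq p / 2))"
    using integrable_gauss_shift[of "\<lambda>_::'a. 1 :: real" p] by simp
  have e: "exp (p \<bullet> x) = exp (nsq p / 2) * exp (p \<bullet> x - nsq p / 2)" for x by (simp flip: exp_add)
  show "integrable gauss (\<lambda>x. exp (p \<bullet> x))" unfolding e using i by simp
  have "(\<oint>x. exp (p \<bullet> x - nsq p / 2)) = 1"
    using integral_gauss_shift[of "\<lambda>_::'a. 1 :: real" p] gauss.prob_space[where 'a='a] by simp
  then show "(\<oint>x. exp (p \<bullet> x)) = exp (nsq p / 2)" unfolding e by simp
qed

interpretation gauss: exp_moments "gauss :: 'a::euclidean_space measure"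
  by unfold_locales (auto simp: integrable_gauss_exp)

text \<open>Log-concavity relative to the Gaussian density, in multiplicative form: in the
  application \<open>m\<close> vanishes outside a convex set, and there \<open>0 powr _ = 0\<close>
  makes the inequality trivial.\<close>

definition gauss_logconcave :: "('a::euclidean_space => real) => bool" where
  "gauss_logconcave m \<longleftrightarrow> m \<in> borel_funs \<and> (\<forall>x. 0 <= m x) \<and>
    (\<forall>a b t. 0 < t --> t < 1 -->
      m a powr (1 - t) * m b powr t * exp (t * (1 - t) * nsq (a - b) / 2) <= m ((1 - t) *. a + t *. b))"

lemma norm_sq_convex_comb:
  fixes a b :: "'a::real_inner"
  shows "nsq ((1 - t) *. a + t *. b) = (1 - t) * nsq a + t * nsq b - t * (1 - t) * nsq (a - b)"
  unfolding power2_norm_eq_inner by (simp add: algebra_simps)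

lemma inner_convex_comb:
  fixes a b x y :: "'a::real_inner"
  shows "((1 - t) *. x + t *. y) \<bullet> ((1 - t) *. a + t *. b) = (1 - t) * (x \<bullet> a) + t * (y \<bullet> b) - t * (1 - t) * ((x - y) \<bullet> (a - b))"
  by (simp add: algebra_simps)

context
  fixes e :: real and \<phi> :: "'a::euclidean_space => real" and T :: "'a => 'a"
  assumes e: "e > 0" and Q: "one_smooth \<phi> T"
begin

lemma lap_context_gauss: "lap_context gauss \<phi> e (\<phi> 0) (T 0)"
  using one_smoothD(1)[OF Q, where x=0] one_smooth_measurable[OF Q] e by unfold_locales auto

interpretation L: lap_context gauss \<phi> e "\<phi> 0" "T 0" by (rule lap_context_gauss)

text \<open>The substitution \<open>x = u + y / (1 + e)\<close> turns the semiconcavity of \<open>\<phi>\<close> into the strong convexity of its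
  exponential Laplace transform.\<close>

lemma lap_gauss_strongly_convex:
  assumes t: "0 < t" "t < 1"
  shows "lap e gauss \<phi> ((1 - t) *. a + t *. b)
    <= (1 - t) * lap e gauss \<phi> a + t * lap e gauss \<phi> b - (1 / (1 + e)) * (t * (1 - t) * nsq (a - b)) / 2"
proof -
  let ?l = "lap e gauss \<phi>"
  define c where "c = 1 / (1 + e)"
  have ce: "c * (1 + e) = 1" "c > 0" using e by (auto simp: c_def)
  note [measurable] = one_smooth_measurable[OF Q]
  define \<kappa> where "\<kappa> w = nsq w / 2 - \<phi> w" for w
  define K where "K y u = L.wt y (u + c *. y) * gauss_density (u + c *. y)" for y u
  have [measurable]: "K y \<in> borel_funs" for y unfolding K_def by measurable
  have K0: "K y u > 0" for y u by (simp add: K_def gauss_density_pos)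
  have IK: "(\<integral>+u. K y u) = ennreal (exp (?l y / e))" for y
  proof -
    have "(\<integral>+u. K y u) = (\<integral>+x. ennreal (gauss_density x) * ennreal (L.wt y x))"
      using nn_integral_lborel_affine[where c=1 and t="c *. y", of "\<lambda>x. ennreal (gauss_density x) * ennreal (L.wt y x)"]
      by (simp add: K_def ennreal_mult' mult.commute add.commute)
    also have "... = (\<integral>\<^sup>+x. ennreal (L.wt y x) \<partial>gauss)" by (rule nn_integral_gauss[symmetric]) measurable
    also have "... = ennreal (exp (?l y / e))"
      using nn_integral_eq_integral[OF L.wt_integrable[of y]] by (simp add: L.exp_lap)
    finally show ?thesis .
  qed
  \<comment> \<open>With \<open>c * (1 + e) = 1\<close> the cross terms in
    \<open>u \<bullet> y\<close> cancel. What remains is a quadratic in \<open>u\<close> alone, a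
    convex function of \<open>u + c *. y\<close>, and \<open>c * nsq y / (2 * e)\<close>, the source
    of the strong convexity.\<close>
  have lnK: "K y u = (2 * pi) powr (- (real DIM('a) / 2)) * exp (c * nsq y / (2 * e) - (1 + e) * nsq u / (2 * e) + \<kappa> (u + c *. y) / e)" for y u
  proof -
    have n: "nsq (u + c *. y) = nsq u + 2 * c * (u \<bullet> y) + c * c * nsq y"
      by (simp add: power2_norm_eq_inner inner_simps inner_commute)
    have "y \<bullet> (u + c *. y) = u \<bullet> y + c * nsq y" by (simp add: power2_norm_eq_inner inner_simps inner_commute)
    then have "(y \<bullet> (u + c *. y) - \<phi> (u + c *. y)) / e - nsq (u + c *. y) / 2
      = (u \<bullet> y + c * nsq y + \<kappa> (u + c *. y) - (1 + e) * (nsq u + 2 * c * (u \<bullet> y) + c * c * nsq y) / 2) / e"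
      unfolding \<kappa>_def n using e by (simp add: field_simps)
    also have "(1 + e) * (nsq u + 2 * c * (u \<bullet> y) + c * c * nsq y)
       = (1 + e) * nsq u + 2 * (c * (1 + e)) * (u \<bullet> y) + (c * (1 + e)) * c * nsq y" by (simp add: algebra_simps)
    also have "(u \<bullet> y + c * nsq y + \<kappa> (u + c *. y) - ((1 + e) * nsq u + 2 * (c * (1 + e)) * (u \<bullet> y) + (c * (1 + e)) * c * nsq y) / 2) / e
      = c * nsq y / (2 * e) - (1 + e) * nsq u / (2 * e) + \<kappa> (u + c *. y) / e"
      unfolding ce using e by (simp add: field_simps)
    finally show ?thesis unfolding K_def gauss_density_def by (simp flip: exp_add)
  qed
  let ?z = "(1 - t) *. a + t *. b"
  define d where "d = c * (t * (1 - t) * nsq (a - b)) / (2 * e)"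
  define E where "E y = exp (?l y / e)" for y
  have E0: "E y > 0" for y by (simp add: E_def)
  \<comment> \<open>Hoelder's inequality by hand: \<open>K a\<close> and \<open>K b\<close> are
    normalised by their integrals \<open>E a\<close> and \<open>E b\<close>, and weighted AM-GM is
    applied pointwise before integrating.\<close>
  define G where "G = exp (- d) * (E a powr (1 - t) * E b powr t)"
  have pt: "K ?z u <= G * ((1 - t) * (K a u / E a) + t * (K b u / E b))" for u
  proof -
    have k: "\<kappa> (u + c *. ?z) <= (1 - t) * \<kappa> (u + c *. a) + t * \<kappa> (u + c *. b)"
    proof -
      have "u + c *. ?z = (1 - t) *. (u + c *. a) + t *. (u + c *. b)" by (simp add: algebra_simps)
      then show ?thesis unfolding \<kappa>_def using one_smooth_upper_convex[OF Q t] by metis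
    qed
    let ?g = "(2 * pi) powr (- (real DIM('a) / 2))"
    have gp: "?g = ?g powr (1 - t) * ?g powr t" by (simp flip: powr_add)
    have "K ?z u <= ?g * exp (c * nsq ?z / (2 * e) - (1 + e) * nsq u / (2 * e) + ((1 - t) * \<kappa> (u + c *. a) + t * \<kappa> (u + c *. b)) / e)"
      unfolding lnK using k e by (intro mult_left_mono) (auto intro: divide_right_mono)
    also have "c * nsq ?z / (2 * e) - (1 + e) * nsq u / (2 * e) + ((1 - t) * \<kappa> (u + c *. a) + t * \<kappa> (u + c *. b)) / e
      = - d + (1 - t) * (c * nsq a / (2 * e) - (1 + e) * nsq u / (2 * e) + \<kappa> (u + c *. a) / e)
          + t * (c * nsq b / (2 * e) - (1 + e) * nsq u / (2 * e) + \<kappa> (u + c *. b) / e)"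
      unfolding norm_sq_convex_comb d_def using e by (simp add: field_simps)
    also have "?g * exp ... = exp (- d) * (K a u powr (1 - t) * K b u powr t)"
    proof -
      have "exp (- d + (1 - t) * \<alpha> + t * \<beta>) = exp (- d) * (exp \<alpha> powr (1 - t) * exp \<beta> powr t)" for \<alpha> \<beta>
        by (simp add: powr_def flip: exp_add)
      then show ?thesis unfolding lnK by (subst gp) (simp add: powr_mult)
    qed
    also have "K a u powr (1 - t) * K b u powr t = (E a powr (1 - t) * E b powr t) * ((K a u / E a) powr (1 - t) * (K b u / E b) powr t)"
      using E0[of a] E0[of b] by (simp add: powr_divide)
    also have "... <= (E a powr (1 - t) * E b powr t) * ((1 - t) * (K a u / E a) + t * (K b u / E b))"
      using E0[of a] E0[of b] K0[of a u] K0[of b u] t by (intro mult_left_mono weighted_am_gm) auto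
    finally show ?thesis by (simp add: G_def)
  qed
  let ?U = "\<lambda>u. ennreal ((1 - t) / E a) * ennreal (K a u) + ennreal (t / E b) * ennreal (K b u)"
  let ?q = "(1 - t) * (?l a / e) + t * (?l b / e)"
  have "ennreal (E ?z) = (\<integral>+u. K ?z u)" by (simp add: IK E_def)
  also have "... <= (\<integral>+u. ennreal G * ?U u)"
  proof (rule nn_integral_mono)
    fix u
    have "ennreal (K ?z u) <= ennreal (G * ((1 - t) / E a * K a u + t / E b * K b u))" using pt[of u] by (intro ennreal_leI) simp
    also have "... = ennreal G * ?U u"
      using t E0[of a] E0[of b] K0[of a u] K0[of b u] by (simp add: ennreal_mult[symmetric] ennreal_plus[symmetric] G_def del: ennreal_plus)
    finally show "ennreal (K ?z u) <= ennreal G * ?U u" .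
  qed
  also have "... = ennreal G * (ennreal ((1 - t) / E a) * ennreal (E a) + ennreal (t / E b) * ennreal (E b))"
    by (simp add: nn_integral_cmult nn_integral_add IK E_def)
  also have "... = ennreal G" using t E0[of a] E0[of b] by (simp add: ennreal_mult[symmetric] ennreal_plus[symmetric])
  finally have "E ?z <= G" by (subst (asm) ennreal_le_iff) (auto simp: G_def)
  then have "ln (E ?z) <= ln G" by (subst ln_le_cancel_iff) (auto simp: G_def E_def)
  also have "ln G = - d + ?q" by (simp add: G_def E_def ln_mult)
  finally have "?l ?z / e <= - d + ?q" by (simp add: E_def)
  then have "e * (?l ?z / e) <= e * (- d + ?q)" using e by (intro mult_left_mono) auto
  also have "... = (1 - t) * ?l a + t * ?l b - c * (t * (1 - t) * nsq (a - b)) / 2"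
    using e by (simp add: d_def field_simps)
  finally show ?thesis using e by (simp add: c_def)
qed

end

text \<open>Prekopa-Leindler for the integrands at \<open>x\<close>, at \<open>y\<close> and at
  their combination. Its hypothesis is a comparison of quadratic terms: the cross term
  \<open>(x - y) \<bullet> (a - b)\<close> has to be paid for by \<open>nsq (x - y)\<close>, by the
  strong convexity of \<open>\<psi>\<close> and by the Gaussian factor hidden in
  \<open>m\<close>.\<close>

lemma lap_semiconcave:
  fixes m :: "'a::euclidean_space => real" and \<psi> :: "'a => real"
  assumes L: "lap_context (density lborel m) \<psi> e c q" and m: "gauss_logconcave m"
    and sc: "!!a b t. 0 < t ==> t < 1 ==> \<psi> ((1 - t) *. a + t *. b)
      <= (1 - t) * \<psi> a + t * \<psi> b - (1 / (1 + e)) * (t * (1 - t) * nsq (a - b)) / 2"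
    and t: "0 < t" "t < 1"
  shows "(1 - t) * lap e (density lborel m) \<psi> x + t * lap e (density lborel m) \<psi> y - t * (1 - t) * nsq (x - y) / 2
    <= lap e (density lborel m) \<psi> ((1 - t) *. x + t *. y)"
proof -
  interpret lap_context "density lborel m" \<psi> e c q by (rule L)
  note e = e_pos
  have [measurable]: "m \<in> borel_funs" and m0: "!!x. 0 <= m x"
    and mlc: "!!a b. m a powr (1 - t) * m b powr t * exp (t * (1 - t) * nsq (a - b) / 2) <= m ((1 - t) *. a + t *. b)"
    using m t by (auto simp: gauss_logconcave_def)
  let ?l = "lap e (density lborel m) \<psi>" and ?z = "(1 - t) *. x + t *. y"
  define d where "d = t * (1 - t) * nsq (x - y) / (2 * e)"
  let ?W = "\<lambda>x v. wt x v * m v"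
  have I: "(\<integral>+v. ennreal (?W x v)) = ennreal (exp (?l x / e))" for x
  proof -
    have "(\<integral>+v. ennreal (?W x v)) = (\<integral>+v. ennreal (m v) * ennreal (wt x v))"
      using m0 by (simp add: ennreal_mult' mult.commute)
    also have "... = (\<integral>\<^sup>+v. ennreal (wt x v) \<partial>density lborel m)" by (subst nn_integral_density) auto
    also have "... = ennreal (exp (?l x / e))" using nn_integral_eq_integral[OF wt_integrable[of x]] by (simp add: exp_lap)
    finally show ?thesis .
  qed
  let ?p = "\<lambda>a b. (1 - t) *. a + t *. b" and ?N = "\<lambda>v. \<integral>\<^sup>+u. ennreal (wt v u * m u) \<partial>lborel"
  have pt: "(?W x a) powr (1 - t) * (?W y b) powr t <= exp d * (wt ?z (?p a b) * m (?p a b))" for a b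
  proof -
    let ?w = "(1 - t) *. a + t *. b"
    have "(?W x a) powr (1 - t) * (?W y b) powr t
      = exp ((1 - t) * ((x \<bullet> a - \<psi> a) / e) + t * ((y \<bullet> b - \<psi> b) / e)) * (m a powr (1 - t) * m b powr t)"
        by (simp add: powr_mult exp_add powr_def[of "exp _"])
    also have "... <= exp (d + (?z \<bullet> ?w - \<psi> ?w) / e + t * (1 - t) * nsq (a - b) / 2) * (m a powr (1 - t) * m b powr t)"
    proof (rule mult_right_mono)
      define X where "X = nsq (x - y)"
      define Y where "Y = nsq (a - b)"
      define D where "D = (x - y) \<bullet> (a - b)"
      define s where "s = t * (1 - t)"
      have s0: "s > 0" using t by (simp add: s_def)
      have "0 <= nsq ((x - y) - (a - b))" by simp
      also have "... = X - 2 * D + Y" unfolding X_def Y_def D_def power2_norm_eq_inner by (simp add: inner_simps inner_commute)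
      finally have XY: "2 * D <= X + Y" by simp
      \<comment> \<open>The coefficient of \<open>nsq (a - b)\<close>: \<open>1 / (1 + e)\<close>
        from the strong convexity of \<open>\<psi>\<close> and \<open>e\<close> from
        \<open>m\<close>. Their sum is at least 1, so the semiconcavity constant is 1 at every
        temperature.\<close>
      have "1 <= 1 / (1 + e) + e" using e by (simp add: field_simps)
      then have Y: "1 * Y <= (1 / (1 + e) + e) * Y" by (rule mult_right_mono) (simp add: Y_def)
      have "0 <= X / 2 - D + K / 2" if "1 * Y <= K" for K using XY that by linarith
      from this[OF Y] have "0 <= X / 2 - D + (1 / (1 + e) + e) * Y / 2" .
      then have "0 <= s * (X / 2 - D + (1 / (1 + e) + e) * Y / 2)" using s0 by simp
      also have "... = e * d - s * D + (1 / (1 + e)) * (s * Y) / 2 + e * (s * Y / 2)"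
        unfolding d_def X_def[symmetric] s_def[symmetric] using e by (simp add: algebra_simps add_divide_distrib)
      finally have 1: "0 <= e * d - s * D + (1 / (1 + e)) * (s * Y) / 2 + e * (s * Y / 2)" .
      have "(1 - t) * (x \<bullet> a - \<psi> a) + t * (y \<bullet> b - \<psi> b) <= e * d + (?z \<bullet> ?w - \<psi> ?w) + e * (s * Y / 2)"
        using 1 sc[OF t, of a b] unfolding inner_convex_comb Y_def[symmetric] D_def[symmetric] s_def[symmetric]
        by (simp add: algebra_simps)
      then have "((1 - t) * (x \<bullet> a - \<psi> a) + t * (y \<bullet> b - \<psi> b)) / e <= (e * d + (?z \<bullet> ?w - \<psi> ?w) + e * (s * Y / 2)) / e"
        using e by (intro divide_right_mono) auto
      also have "... = d + (?z \<bullet> ?w - \<psi> ?w) / e + s * Y / 2" using e by (simp add: add_divide_distrib)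
      also have "((1 - t) * (x \<bullet> a - \<psi> a) + t * (y \<bullet> b - \<psi> b)) / e = (1 - t) * ((x \<bullet> a - \<psi> a) / e) + t * ((y \<bullet> b - \<psi> b) / e)"
        by (simp add: add_divide_distrib)
      finally show "exp ((1 - t) * ((x \<bullet> a - \<psi> a) / e) + t * ((y \<bullet> b - \<psi> b) / e)) <= exp (d + (?z \<bullet> ?w - \<psi> ?w) / e + t * (1 - t) * nsq (a - b) / 2)"
        by (simp add: s_def Y_def)
    qed simp
    also have "... = exp d * wt ?z ?w * (m a powr (1 - t) * m b powr t * exp (t * (1 - t) * nsq (a - b) / 2))"
      by (simp add: exp_add)
    also have "... <= exp d * wt ?z ?w * m ?w" by (rule mult_left_mono[OF mlc]) simp
    finally show ?thesis by simp
  qed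
  have "geo_le t (?N x) (?N y) (\<integral>+v. ennreal (exp d * (?W ?z v)))"
  proof (rule prekopa_leindler[OF _ _ _ t])
    fix a b
    show "geo_le t (ennreal (?W x a)) (ennreal (?W y b)) (ennreal (exp d * (wt ?z (?p a b) * m (?p a b))))"
      unfolding geo_le_def
    proof (intro allI impI)
      fix r s :: real assume rs: "0 <= r" "0 <= s" "ennreal r <= ennreal (?W x a)" "ennreal s <= ennreal (?W y b)"
      then have "r <= ?W x a" "s <= ?W y b" using m0 by auto
      then have "r powr (1 - t) * s powr t <= (?W x a) powr (1 - t) * (?W y b) powr t"
        using rs t by (intro mult_mono powr_mono2) auto
      also note pt
      finally show "ennreal (r powr (1 - t) * s powr t) <= ennreal (exp d * (wt ?z (?p a b) * m (?p a b)))"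
        by (rule ennreal_leI)
    qed
  qed measurable
  also have "(\<integral>+v. ennreal (exp d * (?W ?z v))) = ennreal (exp d) * ?N ?z"
    by (subst nn_integral_cmult[symmetric]) (auto simp: ennreal_mult')
  finally have "geo_le t (ennreal (exp (?l x / e))) (ennreal (exp (?l y / e))) (ennreal (exp d) * ennreal (exp (?l ?z / e)))"
    unfolding I .
  then have "ennreal (exp (?l x / e) powr (1 - t) * exp (?l y / e) powr t) <= ennreal (exp d) * ennreal (exp (?l ?z / e))"
    by (rule geo_leD) auto
  also have "exp (?l x / e) powr (1 - t) * exp (?l y / e) powr t = exp ((1 - t) * (?l x / e) + t * (?l y / e))"
    by (simp add: powr_def exp_add)
  finally have "(1 - t) * (?l x / e) + t * (?l y / e) <= d + ?l ?z / e"
    by (simp add: ennreal_mult[symmetric] flip: exp_add)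
  then have "e * ((1 - t) * (?l x / e) + t * (?l y / e)) <= e * (d + ?l ?z / e)" using e by (intro mult_left_mono) auto
  also have "e * ((1 - t) * (?l x / e) + t * (?l y / e)) = (1 - t) * ?l x + t * ?l y" using e by (simp add: field_simps)
  also have "e * (d + ?l ?z / e) = t * (1 - t) * nsq (x - y) / 2 + ?l ?z" using e by (simp add: d_def field_simps)
  finally show ?thesis by simp
qed

text \<open>The right-hand side is the square of \<open>2 * sinh (w / 2)\<close>. A square is
  thereby bounded by exponentials, hence by values of \<open>lap\<close> at neighbouring
  points.\<close>

lemma square_le_cosh:
  fixes w :: real
  shows "w^2 <= exp w + exp (- w) - 2"
proof -
  have pos: "2 * a <= exp a - exp (- a)" if a: "a >= 0" for a :: real
  proof -
    \<comment> \<open>Taylor minorant of \<open>exp a\<close>. Since \<open>u - 1 / u\<close>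
      increases with \<open>u\<close>, it is enough to check the bound for \<open>s\<close> in place
      of \<open>exp a\<close>.\<close>
    define s where "s = 1 + a + a^2 / 2"
    have s: "s > 0" using a by (simp add: s_def add_pos_nonneg)
    have "s^2 - 1 - 2 * a * s = a ^ 4 / 4" unfolding s_def by (simp add: power2_eq_square power4_eq_xxxx field_simps)
    moreover have "0 <= a ^ 4 / 4" by simp
    ultimately have "0 <= s^2 - 1 - 2 * a * s" by linarith
    then have "(s^2 - 1 - 2 * a * s) / s >= 0" using s by simp
    then have "2 * a <= s - 1 / s" using s by (simp add: diff_divide_distrib power2_eq_square)
    moreover have "s <= exp a" using exp_lower_Taylor_quadratic[OF a] by (simp add: s_def)
    moreover have "exp (- a) <= 1 / s" using \<open>s <= exp a\<close> s by (simp add: exp_minus divide_simps)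
    ultimately show ?thesis by linarith
  qed
  have "(2 * (\<bar>w\<bar> / 2))^2 <= (exp (\<bar>w\<bar> / 2) - exp (- (\<bar>w\<bar> / 2)))^2" by (intro power_mono pos) auto
  also have "... = exp \<bar>w\<bar> + exp (- \<bar>w\<bar>) - 2"
  proof -
    have "exp (\<bar>w\<bar> / 2) * exp (\<bar>w\<bar> / 2) = exp \<bar>w\<bar>" "exp (- (\<bar>w\<bar> / 2)) * exp (- (\<bar>w\<bar> / 2)) = exp (- \<bar>w\<bar>)"
      "exp (\<bar>w\<bar> / 2) * exp (- (\<bar>w\<bar> / 2)) = 1" by (simp_all flip: exp_add)
    moreover have "(A - B)^2 = A * A - 2 * (A * B) + B * B" for A B :: real
      by (simp add: power2_eq_square algebra_simps)
    ultimately show ?thesis by simp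
  qed
  finally show ?thesis by (cases "w >= 0") auto
qed

context lap_context
begin

text \<open>The spread of the Gibbs measure is read off from a second difference of
  \<open>lap\<close>, which \<open>one_smooth\<close> bounds. With step \<open>sqrt e\<close> the
  exponents stay of order one, and each coordinate contributes at most
  \<open>2 * exp (1 / 2) - 2 <= 2\<close> times \<open>e\<close>.\<close>

lemma lap_variance:
  assumes Q: "one_smooth (lap e \<nu> \<zeta>) (lap_mean e \<nu> \<zeta>)"
  shows "integrable \<nu> (\<lambda>y. wt x y * nsq (y - lap_mean e \<nu> \<zeta> x))"
    and "(\<integral>y. wt x y * nsq (y - lap_mean e \<nu> \<zeta> x) \<partial>\<nu>) <= 2 * e * DIM('a) * exp (lap e \<nu> \<zeta> x / e)"
proof -
  let ?T = "lap_mean e \<nu> \<zeta> x" and ?l = "lap e \<nu> \<zeta>"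
  define B where "B i y = e * (exp (- (sqrt e * (?T \<bullet> i) / e)) * wt (x + sqrt e *. i) y + exp (sqrt e * (?T \<bullet> i) / e) * wt (x - sqrt e *. i) y - 2 * wt x y)" for i y
  have Bi: "integrable \<nu> (B i)" for i unfolding B_def using wt_integrable by auto
  have pt: "wt x y * ((y - ?T) \<bullet> i)^2 <= B i y" for i y
  proof -
    define w where "w = ((y - ?T) \<bullet> i) / sqrt e"
    have w: "w = sqrt e * ((y - ?T) \<bullet> i) / e" using e_pos by (simp add: w_def field_simps)
    have "((y - ?T) \<bullet> i)^2 = e * w^2" using e_pos by (simp add: w_def power_divide)
    then have "wt x y * ((y - ?T) \<bullet> i)^2 <= wt x y * (e * (exp w + exp (- w) - 2))"
      using e_pos square_le_cosh[of w] by (intro mult_left_mono) auto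
    also have "... = B i y"
    proof -
      have "wt x y * exp w = exp (- (sqrt e * (?T \<bullet> i) / e)) * wt (x + sqrt e *. i) y"
        unfolding w by (simp add: inner_commute[of i] add_divide_distrib diff_divide_distrib algebra_simps flip: exp_add)
      moreover have "wt x y * exp (- w) = exp (sqrt e * (?T \<bullet> i) / e) * wt (x - sqrt e *. i) y"
        unfolding w by (simp add: inner_commute[of i] add_divide_distrib diff_divide_distrib algebra_simps flip: exp_add)
      ultimately show ?thesis unfolding B_def by (simp add: algebra_simps)
    qed
    finally show ?thesis .
  qed
  have IB: "(\<integral>y. B i y \<partial>\<nu>) <= 2 * e * exp (?l x / e)" if i: "i \<in> Basis" for i
  proof -
    have up: "exp (- (?T \<bullet> u) / e) * exp (?l (x + u) / e) <= exp (?l x / e) * exp (1 / 2)" if u: "nsq u = e" for u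
    proof -
      have "?l (x + u) <= ?l x + ?T \<bullet> u + e / 2" using one_smoothD(2)[OF Q, where x=x and y="x + u"] u by simp
      then have "(- (?T \<bullet> u) + ?l (x + u)) / e <= (?l x + e / 2) / e" using e_pos by (intro divide_right_mono) auto
      then have "- (?T \<bullet> u) / e + ?l (x + u) / e <= ?l x / e + 1 / 2" using e_pos by (simp add: add_divide_distrib diff_divide_distrib)
      then show ?thesis by (simp flip: exp_add)
    qed
    have u: "nsq (sqrt e *. i) = e" "nsq (- (sqrt e *. i)) = e" using i e_pos by auto
    have "(\<integral>y. B i y \<partial>\<nu>) = e * (exp (- (sqrt e * (?T \<bullet> i) / e)) * exp (?l (x + sqrt e *. i) / e) + exp (sqrt e * (?T \<bullet> i) / e) * exp (?l (x - sqrt e *. i) / e) - 2 * exp (?l x / e))"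
      unfolding B_def exp_lap using wt_integrable by simp
    also have "... <= e * (exp (?l x / e) * exp (1 / 2) + exp (?l x / e) * exp (1 / 2) - 2 * exp (?l x / e))"
      using up[OF u(1)] up[OF u(2)] e_pos by (intro mult_left_mono diff_right_mono add_mono) auto
    also have "... <= e * (exp (?l x / e) * 2 + exp (?l x / e) * 2 - 2 * exp (?l x / e))"
      using e_pos exp_half_le2 by (intro mult_left_mono diff_right_mono add_mono) auto
    finally show ?thesis by simp
  qed
  have n: "wt x y * nsq (y - ?T) = (\<Sum>i\<in>Basis. wt x y * ((y - ?T) \<bullet> i)^2)" for y
    unfolding power2_norm_eq_inner by (subst euclidean_inner) (simp add: power2_eq_square sum_distrib_left)
  have le: "wt x y * nsq (y - ?T) <= (\<Sum>i\<in>Basis. B i y)" for y unfolding n by (intro sum_mono pt)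
  show i: "integrable \<nu> (\<lambda>y. wt x y * nsq (y - ?T))"
  proof (rule Bochner_Integration.integrable_bound)
    show "integrable \<nu> (\<lambda>y. \<Sum>i\<in>Basis. B i y)" using Bi by auto
    show "AE y in \<nu>. norm (wt x y * nsq (y - ?T)) <= norm (\<Sum>i\<in>Basis. B i y)"
      using le by (auto intro!: order_trans[OF _ abs_ge_self])
  qed measurable
  have "(\<integral>y. wt x y * nsq (y - ?T) \<partial>\<nu>) <= (\<integral>y. (\<Sum>i\<in>Basis. B i y) \<partial>\<nu>)" using i Bi le by (intro integral_mono) auto
  also have "... = (\<Sum>i\<in>Basis. \<integral>y. B i y \<partial>\<nu>)" using Bi by simp
  also have "... <= (\<Sum>i\<in>(Basis :: 'a set). 2 * e * exp (?l x / e))" by (intro sum_mono IB)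
  finally show "(\<integral>y. wt x y * nsq (y - ?T) \<partial>\<nu>) <= 2 * e * DIM('a) * exp (?l x / e)" by (simp add: algebra_simps)
qed

lemma lap_lower:
  assumes i: "integrable \<nu> \<zeta>"
  shows "x \<bullet> (\<integral>y. y \<partial>\<nu>) - (\<integral>y. \<zeta> y \<partial>\<nu>) <= lap e \<nu> \<zeta> x"
proof -
  let ?m = "x \<bullet> (\<integral>y. y \<partial>\<nu>) - (\<integral>y. \<zeta> y \<partial>\<nu>)"
  have ii: "integrable \<nu> (\<lambda>y. x \<bullet> y - \<zeta> y)" using i integrable_id by auto
  have m: "(\<integral>y. x \<bullet> y - \<zeta> y \<partial>\<nu>) = ?m" using i integrable_id by simp
  have "exp (?m / e) = (\<integral>y. exp (?m / e) * (1 + ((x \<bullet> y - \<zeta> y) - ?m) / e) \<partial>\<nu>)"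
    using ii m by (simp add: prob_space[unfolded space_nu])
  also have "... <= (\<integral>y. wt x y \<partial>\<nu>)"
  proof (rule integral_mono)
    show "integrable \<nu> (\<lambda>y. exp (?m / e) * (1 + ((x \<bullet> y - \<zeta> y) - ?m) / e))" using ii by auto
    show "integrable \<nu> (wt x)" by (rule wt_integrable)
    fix y
    have "exp (?m / e) * (1 + ((x \<bullet> y - \<zeta> y) - ?m) / e) <= exp (?m / e) * exp (((x \<bullet> y - \<zeta> y) - ?m) / e)"
      by (intro mult_left_mono exp_ge_add_one_self) auto
    also have "... = wt x y" by (simp add: diff_divide_distrib flip: exp_add)
    finally show "exp (?m / e) * (1 + ((x \<bullet> y - \<zeta> y) - ?m) / e) <= wt x y" .
  qed
  finally have "exp (?m / e) <= exp (lap e \<nu> \<zeta> x / e)" by (simp add: exp_lap)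
  then show ?thesis using e_pos by (simp add: divide_le_cancel)
qed

end

lemma lap_gauss_upper:
  assumes "lap_context gauss \<zeta> e c q"
  shows "lap e gauss \<zeta> x <= - c + nsq (x - q) / (2 * e)"
proof -
  interpret lap_context gauss \<zeta> e c q by (rule assms)
  have "(\<oint>y. wt x y) <= (\<oint>y. exp (- c / e) * exp (((x - q) /\<^sub>R e) \<bullet> y))"
    by (intro integral_mono wt_integrable integrable_mult_right integrable_gauss_exp wt_bound)
  also have "... = exp (- c / e) * exp (nsq ((x - q) /\<^sub>R e) / 2)"
    by (simp only: integral_mult_right_zero integral_gauss_exp)
  also have "nsq ((x - q) /\<^sub>R e) / 2 = nsq (x - q) / (2 * e * e)" by (simp add: power2_eq_square[of e] divide_simps)
  also have "exp (- c / e) * exp (nsq (x - q) / (2 * e * e)) = exp (- c / e + nsq (x - q) / (2 * e * e))"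
    by (rule exp_add[symmetric])
  finally have "lap e gauss \<zeta> x / e <= - c / e + nsq (x - q) / (2 * e * e)" by (simp flip: exp_lap)
  then have "e * (lap e gauss \<zeta> x / e) <= e * (- c / e + nsq (x - q) / (2 * e * e))"
    using e_pos by (intro mult_left_mono) auto
  then show ?thesis using e_pos by (simp add: right_diff_distrib)
qed

text \<open>The density \<open>?p\<close> of the plan is integrated in both orders. Over
  \<open>\<nu>1\<close> it gives exactly 1 for every \<open>y\<close>, because \<open>?k\<close> is
  the normalisation; over \<open>\<nu>2\<close> it gives the density of the other marginal, which
  therefore has total mass 1.\<close>

lemma lap_marginal:
  assumes 1: "lap_context \<nu>1 \<zeta> e c q" and 2: "lap_context \<nu>2 (lap e \<nu>1 \<zeta>) e c' q'"
  shows "integrable \<nu>1 (\<lambda>x. exp ((lap e \<nu>2 (lap e \<nu>1 \<zeta>) x - \<zeta> x) / e))"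
    and "(\<integral>x. exp ((lap e \<nu>2 (lap e \<nu>1 \<zeta>) x - \<zeta> x) / e) \<partial>\<nu>1) = 1"
    and "integrable (\<nu>1 \<Otimes>\<^sub>M \<nu>2) (\<lambda>p. exp ((fst p \<bullet> snd p - \<zeta> (fst p) - lap e \<nu>1 \<zeta> (snd p)) / e))"
proof -
  interpret A: lap_context \<nu>1 \<zeta> e c q by (rule 1)
  interpret B: lap_context \<nu>2 "lap e \<nu>1 \<zeta>" e c' q' by (rule 2)
  interpret pair_sigma_finite \<nu>1 \<nu>2 by unfold_locales
  let ?k = "lap e \<nu>1 \<zeta>" and ?z = "lap e \<nu>2 (lap e \<nu>1 \<zeta>)"
  let ?p = "\<lambda>x y. exp ((x \<bullet> y - \<zeta> x - ?k y) / e)"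
  have in2: "(\<integral>\<^sup>+y. ennreal (?p x y) \<partial>\<nu>2) = ennreal (exp ((?z x - \<zeta> x) / e))" for x
  proof -
    have "(\<integral>\<^sup>+y. ennreal (?p x y) \<partial>\<nu>2) = (\<integral>\<^sup>+y. ennreal (exp (- \<zeta> x / e)) * ennreal (B.wt x y) \<partial>\<nu>2)"
    proof -
      have "(x \<bullet> y - \<zeta> x - ?k y) / e = - \<zeta> x / e + (x \<bullet> y - ?k y) / e" for y by (simp add: diff_divide_distrib)
      then show ?thesis by (simp only: exp_add) (simp add: ennreal_mult')
    qed
    also have "... = ennreal (exp (- \<zeta> x / e)) * ennreal (exp (?z x / e))"
      using nn_integral_eq_integral[OF B.wt_integrable[of x]] by (simp add: nn_integral_cmult B.exp_lap)
    finally show ?thesis by (simp add: diff_divide_distrib flip: ennreal_mult' exp_add)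
  qed
  have in1: "(\<integral>\<^sup>+x. ennreal (?p x y) \<partial>\<nu>1) = 1" for y
  proof -
    have "(\<integral>\<^sup>+x. ennreal (?p x y) \<partial>\<nu>1) = (\<integral>\<^sup>+x. ennreal (exp (- ?k y / e)) * ennreal (A.wt y x) \<partial>\<nu>1)"
    proof -
      have "(x \<bullet> y - \<zeta> x - ?k y) / e = - ?k y / e + (y \<bullet> x - \<zeta> x) / e" for x by (simp add: diff_divide_distrib inner_commute)
      then show ?thesis by (simp only: exp_add) (simp add: ennreal_mult')
    qed
    also have "... = ennreal (exp (- ?k y / e)) * ennreal (exp (?k y / e))"
      using nn_integral_eq_integral[OF A.wt_integrable[of y]] by (simp add: nn_integral_cmult A.exp_lap)
    finally show ?thesis by (simp flip: ennreal_mult' exp_add)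
  qed
  have "(\<integral>\<^sup>+x. ennreal (exp ((?z x - \<zeta> x) / e)) \<partial>\<nu>1) = (\<integral>\<^sup>+x. \<integral>\<^sup>+y. ennreal (?p x y) \<partial>\<nu>2 \<partial>\<nu>1)" by (simp add: in2)
  also have "... = (\<integral>\<^sup>+y. \<integral>\<^sup>+x. ennreal (?p x y) \<partial>\<nu>1 \<partial>\<nu>2)" by (rule Fubini'[symmetric]) measurable
  also have "... = 1" by (simp add: in1 B.emeasure_space_1[unfolded B.space_nu])
  finally have tot: "(\<integral>\<^sup>+x. ennreal (exp ((?z x - \<zeta> x) / e)) \<partial>\<nu>1) = 1" .
  show "integrable \<nu>1 (\<lambda>x. exp ((?z x - \<zeta> x) / e))" by (rule integrableI_nonneg) (auto simp: tot)
  show "(\<integral>x. exp ((?z x - \<zeta> x) / e) \<partial>\<nu>1) = 1" by (subst integral_eq_nn_integral) (auto simp: tot)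
  show "integrable (\<nu>1 \<Otimes>\<^sub>M \<nu>2) (\<lambda>p. ?p (fst p) (snd p))"
  proof (rule integrableI_nonneg)
    have "(\<integral>\<^sup>+p. ennreal (?p (fst p) (snd p)) \<partial>(\<nu>1 \<Otimes>\<^sub>M \<nu>2)) = (\<integral>\<^sup>+x. \<integral>\<^sup>+y. ennreal (?p x y) \<partial>\<nu>2 \<partial>\<nu>1)"
      by (subst B.nn_integral_fst[symmetric]) auto
    also have "... = 1" unfolding in2 by (rule tot)
    finally show "(\<integral>\<^sup>+p. ennreal (?p (fst p) (snd p)) \<partial>(\<nu>1 \<Otimes>\<^sub>M \<nu>2)) < \<infinity>" by simp
  qed auto
qed

text \<open>\<open>u <= exp u - 1\<close> for the logarithm \<open>u\<close> of the marginal density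
  of total mass 1. This is the monotonicity behind the dual objective.\<close>

lemma lap_marginal_le:
  assumes 1: "lap_context \<nu>1 \<zeta> e c q" and 2: "lap_context \<nu>2 (lap e \<nu>1 \<zeta>) e c' q'"
    and i: "integrable \<nu>1 \<zeta>" "integrable \<nu>1 (lap e \<nu>2 (lap e \<nu>1 \<zeta>))"
  shows "(\<integral>x. lap e \<nu>2 (lap e \<nu>1 \<zeta>) x \<partial>\<nu>1) <= (\<integral>x. \<zeta> x \<partial>\<nu>1)"
proof -
  interpret A: lap_context \<nu>1 \<zeta> e c q by (rule 1)
  let ?z = "lap e \<nu>2 (lap e \<nu>1 \<zeta>)"
  note m = lap_marginal[OF 1 2]
  have "(\<integral>x. (?z x - \<zeta> x) / e \<partial>\<nu>1) <= (\<integral>x. exp ((?z x - \<zeta> x) / e) - 1 \<partial>\<nu>1)"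
  proof (rule integral_mono)
    fix x show "(?z x - \<zeta> x) / e <= exp ((?z x - \<zeta> x) / e) - 1" using exp_ge_add_one_self[of "(?z x - \<zeta> x) / e"] by linarith
  qed (use i m in auto)
  also have "... = 0" using m by (simp add: A.prob_space[unfolded A.space_nu])
  finally show ?thesis using i A.e_pos by (simp add: divide_le_0_iff)
qed

section \<open>Contractive gradient maps from entropic transport\<close>

text \<open>The Sinkhorn iteration for entropic transport from the Gaussian measure to \<open>\<mu>\<close> at temperature \<open>e\<close>.\<close>

locale sinkhorn =
  fixes m :: "'a::euclidean_space => real" and e :: real and \<mu> :: "'a measure"
  assumes lc: "gauss_logconcave m" and e_pos: "e > 0" and mu: "\<mu> = density lborel (\<lambda>x. ennreal (m x))"
    and moments: "exp_moments \<mu>"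
begin

sublocale M: exp_moments \<mu> by (rule moments)

abbreviation psi :: "('a => real) => 'a => real" where "psi \<phi> \<equiv> lap e gauss \<phi>"

abbreviation step :: "('a => real) => 'a => real" where "step \<phi> \<equiv> lap e \<mu> (psi \<phi>)"

lemma psi_context:
  assumes Q: "one_smooth \<phi> T"
  shows "lap_context \<mu> (psi \<phi>) e (psi \<phi> 0) (lap_mean e gauss \<phi> 0)"
proof -
  interpret L: lap_context gauss \<phi> e "\<phi> 0" "T 0" by (rule lap_context_gauss[OF e_pos Q])
  show ?thesis using L.lap_subgradient[of 0] e_pos by unfold_locales auto
qed

text \<open>The class of potentials is invariant at fixed temperature: semiconcavity of
  \<open>\<phi>\<close> becomes strong convexity of \<open>psi \<phi>\<close>, and log-concavity of
  \<open>m\<close> turns that back into semiconcavity. Contractivity is thus present at every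
  iterate, before any limit.\<close>

lemma step_one_smooth:
  assumes Q: "one_smooth \<phi> T"
  shows "one_smooth (step \<phi>) (lap_mean e \<mu> (psi \<phi>))"
proof (rule one_smooth_from_semiconcave)
  interpret P: lap_context \<mu> "psi \<phi>" e "psi \<phi> 0" "lap_mean e gauss \<phi> 0" by (rule psi_context[OF Q])
  show "step \<phi> x + lap_mean e \<mu> (psi \<phi>) x \<bullet> (y - x) <= step \<phi> y" for x y by (rule P.lap_subgradient)
  show "(1 - t) * step \<phi> x + t * step \<phi> y - t * (1 - t) * nsq (x - y) / 2 <= step \<phi> ((1 - t) *. x + t *. y)"
    if "0 < t" "t < 1" for x y t
    using lap_semiconcave[OF psi_context[OF Q, unfolded mu] lc lap_gauss_strongly_convex[OF e_pos Q] that] unfolding mu .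
qed

lemma psi_integrable:
  assumes Q: "one_smooth \<phi> T"
  shows "integrable \<mu> (psi \<phi>)" and "- (\<oint>x. \<phi> x) <= psi \<phi> y"
proof -
  note LC = lap_context_gauss[OF e_pos Q]
  interpret L: lap_context gauss \<phi> e "\<phi> 0" "T 0" by (rule LC)
  have low: "- (\<oint>x. \<phi> x) <= psi \<phi> y" for y
    using L.lap_lower[OF one_smooth_integrable[OF Q], of y] by (simp add: integral_gauss_id)
  show "- (\<oint>x. \<phi> x) <= psi \<phi> y" by (rule low)
  have up: "psi \<phi> y <= \<bar>\<phi> 0\<bar> + nsq (y - T 0) / (2 * e)" for y using lap_gauss_upper[OF LC, of y] by linarith
  show "integrable \<mu> (psi \<phi>)"
  proof (rule Bochner_Integration.integrable_bound)
    show "integrable \<mu> (\<lambda>y. \<bar>\<integral>x. \<phi> x \<partial>gauss\<bar> + (\<bar>\<phi> 0\<bar> + nsq (y - T 0) / (2 * e)))"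
      using M.variance_expand(2)[OF M.integrable_id M.integrable_norm_sq] by auto
    show "AE y in \<mu>. norm (psi \<phi> y) <= norm (\<bar>\<integral>x. \<phi> x \<partial>gauss\<bar> + (\<bar>\<phi> 0\<bar> + nsq (y - T 0) / (2 * e)))"
    proof (rule AE_I2)
      fix y
      have "0 <= nsq (y - T 0) / (2 * e)" using e_pos by simp
      then show "norm (psi \<phi> y) <= norm (\<bar>\<integral>x. \<phi> x \<partial>gauss\<bar> + (\<bar>\<phi> 0\<bar> + nsq (y - T 0) / (2 * e)))"
        unfolding real_norm_def using low[of y] up[of y] by linarith
    qed
  qed simp
qed

definition phi :: "nat => 'a => real" where "phi k = (step ^^ k) (\<lambda>_. 0)"

lemma phi_Suc: "phi (Suc k) = step (phi k)" by (simp add: phi_def)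

lemma phi_one_smooth: "\<exists>T. one_smooth (phi k) T"
proof (induction k)
  case 0 show ?case by (rule exI[of _ "\<lambda>_. 0"]) (simp add: phi_def one_smooth_def)
next
  case (Suc k) then show ?case unfolding phi_Suc using step_one_smooth by blast
qed

text \<open>Otherwise the dual objective \<open>F\<close> would drop by \<open>\<eta>\<close> at
  every step, whereas Jensen's inequality keeps it nonnegative. One such step takes the place of
  convergence of the iteration.\<close>

lemma exists_small_step:
  assumes \<eta>: "\<eta> > 0"
  shows "\<exists>k. (\<oint>x. phi k x) - (\<oint>x. phi (Suc k) x) <= \<eta>"
proof (rule ccontr)
  assume "\<not> ?thesis"
  then have big: "(\<oint>x. phi k x) - (\<oint>x. phi (Suc k) x) > \<eta>" for k by (auto simp: not_le)
  define F where "F k = (\<oint>x. phi k x) + (\<integral>y. psi (phi k) y \<partial>\<mu>)" for k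
  have F0: "F k >= 0" for k
  proof -
    obtain T where Q: "one_smooth (phi k) T" using phi_one_smooth by blast
    have "(\<integral>y. - (\<oint>x. phi k x) \<partial>\<mu>) <= (\<integral>y. psi (phi k) y \<partial>\<mu>)" by (intro integral_mono psi_integrable[OF Q]) auto
    then show ?thesis by (simp add: F_def M.prob_space[unfolded M.space_nu])
  qed
  have dec: "F (Suc k) <= F k - \<eta>" for k
  proof -
    obtain T where Q: "one_smooth (phi k) T" using phi_one_smooth by blast
    obtain T' where Q': "one_smooth (phi (Suc k)) T'" using phi_one_smooth by blast
    have "(\<integral>y. lap e gauss (lap e \<mu> (psi (phi k))) y \<partial>\<mu>) <= (\<integral>y. psi (phi k) y \<partial>\<mu>)"
    proof (rule lap_marginal_le[OF psi_context[OF Q]])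
      show "lap_context gauss (step (phi k)) e (step (phi k) 0) (lap_mean e \<mu> (psi (phi k)) 0)"
        by (rule lap_context_gauss[OF e_pos step_one_smooth[OF Q]])
    qed (use psi_integrable(1)[OF Q] psi_integrable(1)[OF Q'] in \<open>simp_all add: phi_Suc\<close>)
    then show ?thesis using big[of k] by (simp add: F_def phi_Suc)
  qed
  have "F k <= F 0 - real k * \<eta>" for k
  proof (induction k)
    case (Suc k) then show ?case using dec[of k] by (simp add: algebra_simps)
  qed simp
  then have "real k * \<eta> <= F 0" for k using F0[of k] by (smt (verit))
  moreover obtain k :: nat where "F 0 / \<eta> < real k" using reals_Archimedean2 by blast
  ultimately show False using \<eta> by (metis linorder_not_less pos_divide_less_eq)
qed

text \<open>At a step where the dual objective barely moves, both marginals of the entropic plan are nearly correct,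
  and the plan concentrates at distance \<open>O(sqrt e)\<close> from the graph of its barycentric projection.\<close>

lemma approximate_transport:
  "\<exists>\<phi> T. one_smooth \<phi> T \<and> (\<forall>f. (\<forall>y. \<bar>f y\<bar> <= 1) --> 1-lipschitz_on UNIV f -->
     \<bar>(\<oint>x. f (T x)) - (\<integral>y. f y \<partial>\<mu>)\<bar> <= (4 + real DIM('a)) * sqrt e)"
proof -
  \<comment> \<open>A gap of \<open>e * e\<close> becomes \<open>e\<close> after division by the
    temperature: \<open>ent\<close> below bounds the relative entropy of the Gaussian with respect
    to the first marginal of the plan.\<close>
  obtain k where k: "(\<oint>x. phi k x) - (\<oint>x. phi (Suc k) x) <= e * e" using exists_small_step[of "e * e"] e_pos by auto
  obtain T0 where Q: "one_smooth (phi k) T0" using phi_one_smooth by blast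
  define \<phi> where "\<phi> = phi k"
  define \<phi>' where "\<phi>' = step \<phi>"
  define T where "T = lap_mean e \<mu> (psi \<phi>)"
  note Q = Q[folded \<phi>_def]
  have Q': "one_smooth \<phi>' T" unfolding \<phi>'_def T_def by (rule step_one_smooth[OF Q])
  interpret P: lap_context \<mu> "psi \<phi>" e "psi \<phi> 0" "lap_mean e gauss \<phi> 0" by (rule psi_context[OF Q])
  interpret L: lap_context gauss \<phi> e "\<phi> 0" "T0 0" by (rule lap_context_gauss[OF e_pos Q])
  interpret GM: pair_sigma_finite gauss \<mu> by unfold_locales
  \<comment> \<open>\<open>p\<close> is the density of the entropic plan. Its second marginal is
    exactly \<open>\<mu>\<close>; its first has density \<open>w\<close>, whose distance from 1
    remains to be estimated.\<close>
  define w where "w x = exp ((\<phi>' x - \<phi> x) / e)" for x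
  define p where "p x y = exp ((x \<bullet> y - \<phi> x - psi \<phi> y) / e)" for x y
  note marg = lap_marginal[OF lap_context_gauss[OF e_pos Q] psi_context[OF Q]]
  have wi: "integrable gauss w" and w1: "(\<oint>x. w x) = 1" using marg(1,2) by (simp_all add: w_def[abs_def] \<phi>'_def)
  have pint: "integrable (gauss \<Otimes>\<^sub>M \<mu>) (\<lambda>q. p (fst q) (snd q))" using marg(3) by (simp add: p_def)
  have wpos: "w x > 0" for x by (simp add: w_def)
  have p0: "p x y > 0" for x y by (simp add: p_def)
  have pP: "p x y = exp (- \<phi> x / e) * P.wt x y" for x y by (simp add: p_def diff_divide_distrib flip: exp_add)
  have pL: "p x y = exp (- psi \<phi> y / e) * L.wt y x" for x y
    by (simp add: p_def diff_divide_distrib inner_commute flip: exp_add)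
  have wE: "w x = exp (- \<phi> x / e) * exp (step \<phi> x / e)" for x
    by (simp add: w_def \<phi>'_def diff_divide_distrib flip: exp_add)
  have py: "(\<integral>y. p x y \<partial>\<mu>) = w x" "integrable \<mu> (p x)" for x
    unfolding pP wE P.exp_lap using P.wt_integrable[of x] by auto
  have px: "(\<oint>x. p x y) = 1" "integrable gauss (\<lambda>x. p x y)" for y
  proof -
    have "(\<oint>x. p x y) = exp (- psi \<phi> y / e) * exp (psi \<phi> y / e)" unfolding pL L.exp_lap by simp
    then show "(\<oint>x. p x y) = 1" by (simp flip: exp_add)
    show "integrable gauss (\<lambda>x. p x y)" unfolding pL by (intro integrable_mult_right L.wt_integrable)
  qed
  have phi_i: "integrable gauss \<phi>" "integrable gauss \<phi>'" using Q Q' by (auto intro: one_smooth_integrable)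
  note [measurable] = one_smooth_measurable[OF Q] one_smooth_measurable[OF Q'] lipschitz_measurable[OF one_smooth_lipschitz[OF Q']]
  have [measurable]: "w \<in> borel_funs" unfolding w_def by measurable
  have ent: "(\<oint>x. - (\<phi>' x - \<phi> x) / e) <= e"
  proof -
    have "(\<oint>x. - (\<phi>' x - \<phi> x) / e) = ((\<oint>x. \<phi> x) - (\<oint>x. \<phi>' x)) / e" using phi_i by simp
    also have "... <= e * e / e" using k e_pos by (intro divide_right_mono) (auto simp: \<phi>'_def \<phi>_def phi_Suc)
    finally show ?thesis by simp
  qed
  define \<theta> where "\<theta> = sqrt e"
  have \<theta>: "\<theta> > 0" "\<theta> * \<theta> = e" using e_pos by (auto simp: \<theta>_def)
  let ?u = "\<lambda>x. (w x - 1 - (\<phi>' x - \<phi> x) / e) / (2 * \<theta>) + \<theta> * (1 + w x)"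
  \<comment> \<open>A pointwise substitute for Pinsker's inequality. With \<open>s\<close> the
    square root of \<open>w x\<close>, \<open>(1 - s)^2\<close> is at most
    \<open>w x - 1 - ln (w x)\<close>; \<open>1 - w x\<close> factors as
    \<open>(1 - s) * (1 + s)\<close> and is split by Young's inequality with weight
    \<open>\<theta>\<close>. After integration both parts are of order
    \<open>sqrt e\<close>.\<close>
  have tv: "\<bar>1 - w x\<bar> <= ?u x" for x
  proof -
    define s where "s = exp ((\<phi>' x - \<phi> x) / e / 2)"
    have s: "s > 0" "w x = s * s" by (simp_all add: s_def w_def flip: exp_add)
    have "1 + (\<phi>' x - \<phi> x) / e / 2 <= s" unfolding s_def by simp
    then have a: "(1 - s)^2 <= w x - 1 - (\<phi>' x - \<phi> x) / e" using s by (simp add: power2_eq_square algebra_simps)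
    have b: "(1 + s)^2 <= 2 * (1 + w x)"
      using s zero_le_power2[of "1 - s"] by (simp add: power2_eq_square algebra_simps)
    have "0 <= (A - B)^2 ==> 2 * (A * B) <= A^2 + B^2" for A B :: real by (simp add: power2_eq_square algebra_simps)
    from this[of "\<bar>1 - s\<bar>" "\<theta> * (1 + s)"]
    have "2 * \<theta> * (\<bar>1 - s\<bar> * (1 + s)) <= (1 - s)^2 + \<theta>^2 * (1 + s)^2" by (simp add: power_mult_distrib mult_ac)
    then have "\<bar>1 - s\<bar> * (1 + s) <= (1 - s)^2 / (2 * \<theta>) + \<theta> * (1 + s)^2 / 2"
      using \<theta>(1) by (simp add: field_simps power2_eq_square)
    moreover have "\<bar>1 - w x\<bar> = \<bar>1 - s\<bar> * (1 + s)"
    proof -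
      have "1 - w x = (1 - s) * (1 + s)" by (simp add: s algebra_simps)
      then show ?thesis using s by (simp add: abs_mult)
    qed
    moreover have "(1 - s)^2 / (2 * \<theta>) <= (w x - 1 - (\<phi>' x - \<phi> x) / e) / (2 * \<theta>)"
      using a \<theta> by (intro divide_right_mono) auto
    moreover have "\<theta> * (1 + s)^2 / 2 <= \<theta> * (1 + w x)" using mult_left_mono[OF b, of \<theta>] \<theta> by simp
    ultimately show ?thesis by linarith
  qed
  have bi: "integrable gauss (\<lambda>x. ?u x)" using wi phi_i by auto
  have bv: "(\<oint>x. ?u x) <= 3 * \<theta>"
  proof -
    have "(\<oint>x. ?u x)
      = (\<oint>x. - (\<phi>' x - \<phi> x) / e) / (2 * \<theta>) + 2 * \<theta>"
      using wi phi_i w1 gauss.prob_space[where 'a='a] by (simp add: diff_divide_distrib)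
    also have "... <= e / (2 * \<theta>) + 2 * \<theta>" using ent \<theta> by (intro add_right_mono divide_right_mono) auto
    also have "e / (2 * \<theta>) = \<theta> / 2" using \<theta> by auto
    finally show ?thesis using \<theta> by simp
  qed
  show ?thesis
  proof (intro exI[of _ \<phi>'] exI[of _ T] conjI Q' allI impI)
    fix f :: "'a => real" assume f1: "\<forall>y. \<bar>f y\<bar> <= 1" and fl: "1-lipschitz_on UNIV f"
    note [measurable] = lipschitz_measurable[OF fl]
    let ?m = "\<integral>y. f y \<partial>\<mu>" and ?q = "\<lambda>x. \<integral>y. f y * p x y \<partial>\<mu>" and ?v = "\<lambda>x y. p x y * nsq (y - T x)" and ?g = "\<lambda>x. f (T x) * w x"
    have fT: "integrable gauss (\<lambda>x. f (T x))" by (rule gauss.integrable_const_bound[where B=1]) (use f1 in auto)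
    have fTw: "integrable gauss (\<lambda>x. ?g x)"
      by (rule Bochner_Integration.integrable_bound[OF wi]) (use f1 wpos in \<open>auto simp: abs_mult less_imp_le intro!: mult_left_le_one_le\<close>)
    have "\<bar>(\<oint>x. f (T x)) - (\<oint>x. ?g x)\<bar> = \<bar>\<integral>x. f (T x) * (1 - w x) \<partial>gauss\<bar>" using fT fTw by (simp add: algebra_simps)
    also have "... <= (\<oint>x. \<bar>f (T x) * (1 - w x)\<bar>)" by simp
    also have "... <= (\<oint>x. ?u x)"
    proof (rule integral_mono[OF _ bi])
      show "integrable gauss (\<lambda>x. \<bar>f (T x) * (1 - w x)\<bar>)" using fT fTw by (simp add: right_diff_distrib)
      fix x
      have "\<bar>f (T x) * (1 - w x)\<bar> <= 1 * \<bar>1 - w x\<bar>" unfolding abs_mult using f1 by (intro mult_right_mono) auto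
      then show "\<bar>f (T x) * (1 - w x)\<bar> <= ?u x" using tv[of x] by simp
    qed
    also note bv
    finally have A: "\<bar>(\<oint>x. f (T x)) - (\<oint>x. ?g x)\<bar> <= 3 * \<theta>" .
    have fp: "integrable (gauss \<Otimes>\<^sub>M \<mu>) (\<lambda>(x, y). f y * p x y)" by (rule Bochner_Integration.integrable_bound[OF pint])
         (use f1 p0 in \<open>auto simp: abs_mult less_imp_le split_beta' p_def intro!: mult_left_le_one_le\<close>)
    have fy: "integrable \<mu> (\<lambda>y. f y * p x y)" for x by (rule Bochner_Integration.integrable_bound[OF py(2)[of x]])
         (use f1 p0 in \<open>auto simp: abs_mult less_imp_le p_def intro!: mult_left_le_one_le\<close>)
    have "?m = (\<integral>y. \<integral>x. f y * p x y \<partial>gauss \<partial>\<mu>)" using px by simp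
    also have "... = (\<oint>x. ?q x)" by (rule GM.Fubini_integral[OF fp])
    finally have fmu: "?m = (\<oint>x. ?q x)" .
    have fyi: "integrable gauss (\<lambda>x. ?q x)" using GM.integrable_fst[OF fp] .
    \<comment> \<open>Given \<open>x\<close>, the plan concentrates around \<open>T x\<close> by
      \<open>lap_variance\<close>; Young's inequality with the same \<open>\<theta>\<close> converts
      the second moment into the first one needed for a Lipschitz \<open>f\<close>. Adding the
      \<open>3 * \<theta>\<close> from the marginal gives the constant
      \<open>4 + DIM('a)\<close>.\<close>
    have pt: "\<bar>?g x - ?q x\<bar> <= (real DIM('a) + 1) * \<theta> * w x" for x
    proof -
      have vi: "integrable \<mu> (\<lambda>y. ?v x y)" and v: "(\<integral>y. ?v x y \<partial>\<mu>) <= 2 * e * DIM('a) * w x"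
      proof -
        note pv = P.lap_variance[OF step_one_smooth[OF Q], of x, folded T_def]
        show "integrable \<mu> (\<lambda>y. ?v x y)" unfolding pP using pv(1) by (simp add: mult.assoc)
        have "(\<integral>y. ?v x y \<partial>\<mu>) = exp (- \<phi> x / e) * (\<integral>y. P.wt x y * nsq (y - T x) \<partial>\<mu>)"
          unfolding pP by (simp add: mult.assoc)
        also have "... <= exp (- \<phi> x / e) * (2 * e * DIM('a) * exp (step \<phi> x / e))"
          by (rule mult_left_mono[OF pv(2)]) simp
        finally show "(\<integral>y. ?v x y \<partial>\<mu>) <= 2 * e * DIM('a) * w x" unfolding wE by (simp add: algebra_simps)
      qed
      have "?g x - ?q x = (\<integral>y. (f (T x) - f y) * p x y \<partial>\<mu>)" using py[of x] fy[of x] by (simp add: left_diff_distrib)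
      also have "\<bar>...\<bar> <= (\<integral>y. \<bar>(f (T x) - f y) * p x y\<bar> \<partial>\<mu>)" by simp
      also have "... <= (\<integral>y. (?v x y) / (2 * \<theta>) + \<theta> / 2 * p x y \<partial>\<mu>)"
      proof (rule integral_mono)
        show "integrable \<mu> (\<lambda>y. \<bar>(f (T x) - f y) * p x y\<bar>)"
          using py(2)[of x] fy[of x] by (simp add: left_diff_distrib)
        show "integrable \<mu> (\<lambda>y. (?v x y) / (2 * \<theta>) + \<theta> / 2 * p x y)" using vi py(2)[of x] by auto
        fix y
        define r where "r = norm (y - T x)"
        have "\<bar>f (T x) - f y\<bar> <= r"
          using lipschitz_onD[OF fl, of "T x" y] by (simp add: r_def dist_norm norm_minus_commute)
        moreover have "r <= r^2 / (2 * \<theta>) + \<theta> / 2"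
          using \<theta>(1) zero_le_power2[of "r - \<theta>"] by (simp add: field_simps power2_eq_square)
        ultimately have "\<bar>f (T x) - f y\<bar> * p x y <= (r^2 / (2 * \<theta>) + \<theta> / 2) * p x y"
          using p0[of x y] by (intro mult_right_mono) auto
        then show "\<bar>(f (T x) - f y) * p x y\<bar> <= (?v x y) / (2 * \<theta>) + \<theta> / 2 * p x y"
        proof -
          have a: "\<bar>(f (T x) - f y) * p x y\<bar> = \<bar>f (T x) - f y\<bar> * p x y" using p0[of x y] by (simp only: abs_mult abs_of_pos)
          show "\<bar>f (T x) - f y\<bar> * p x y <= (r^2 / (2 * \<theta>) + \<theta> / 2) * p x y ==> ?thesis"
            unfolding a by (simp add: r_def distrib_right) (simp add: mult.commute)
        qed
      qed
      also have "... = (\<integral>y. ?v x y \<partial>\<mu>) / (2 * \<theta>) + \<theta> / 2 * w x" using vi py[of x] by simp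
      also have "... <= (2 * e * DIM('a) * w x) / (2 * \<theta>) + \<theta> / 2 * w x"
        using v \<theta> by (intro add_right_mono divide_right_mono) auto
      also have "(2 * e * DIM('a) * w x) / (2 * \<theta>) = \<theta> * DIM('a) * w x" using \<theta> by auto
      also have "\<theta> * DIM('a) * w x + \<theta> / 2 * w x <= (real DIM('a) + 1) * \<theta> * w x"
      proof -
        have "0 <= \<theta> * w x" using \<theta> wpos[of x] by simp
        then show ?thesis by (simp add: algebra_simps)
      qed
      finally show ?thesis .
    qed
    have "\<bar>(\<oint>x. ?g x) - ?m\<bar> = \<bar>\<integral>x. ?g x - ?q x \<partial>gauss\<bar>" unfolding fmu using fTw fyi by simp
    also have "... <= (\<oint>x. \<bar>?g x - ?q x\<bar>)" by simp
    also have "... <= (\<oint>x. (real DIM('a) + 1) * \<theta> * w x)" using fTw fyi wi by (intro integral_mono pt) auto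
    also have "... = (real DIM('a) + 1) * \<theta>" using w1 by simp
    finally have "\<bar>(\<oint>x. ?g x) - ?m\<bar> <= (real DIM('a) + 1) * \<theta>" .
    with A have "\<bar>(\<oint>x. f (T x)) - ?m\<bar> <= 3 * \<theta> + (real DIM('a) + 1) * \<theta>" by linarith
    then show "\<bar>(\<oint>x. f (T x)) - ?m\<bar> <= (4 + real DIM('a)) * sqrt e" by (simp add: \<theta>_def algebra_simps)
  qed
qed

end

section \<open>Compactness and the limit of zero temperature\<close>

lemma cutoff_lipschitz:
  fixes g :: "'a::metric_space => real"
  assumes "L-lipschitz_on UNIV g"
  shows "L-lipschitz_on UNIV (\<lambda>y. min 1 (max 0 (g y)))"
proof (rule lipschitz_onI)
  fix x y
  have "\<bar>min 1 (max 0 (g x)) - min 1 (max 0 (g y))\<bar> <= \<bar>g x - g y\<bar>" by simp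
  also have "... <= L * dist x y" using lipschitz_onD[OF assms, of x y] by (simp add: dist_real_def)
  finally show "dist (min 1 (max 0 (g x))) (min 1 (max 0 (g y))) <= L * dist x y" by (simp add: dist_real_def)
qed (use assms in \<open>auto dest: lipschitz_on_nonneg\<close>)

lemma norm_minus_const_lipschitz: "1-lipschitz_on UNIV (\<lambda>y::'a::real_normed_vector. norm y - R)"
  by (rule lipschitz_onI) (auto simp: dist_norm norm_triangle_ineq3)

text \<open>Closed sets form an intersection-stable generator, and their indicators are limits of
  Lipschitz cut-offs of the distance function.\<close>

lemma measure_eqI_lipschitz:
  fixes M N :: "'a::euclidean_space measure"
  assumes "prob_space M" "prob_space N" and [simp, measurable_cong]: "sets M = sets borel" "sets N = sets borel"
    and eq: "!!f L. (!!y. \<bar>f y\<bar> <= 1) ==> L-lipschitz_on UNIV f ==> (\<integral>y. f y \<partial>M) = (\<integral>y. (f y :: real) \<partial>N)"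
  shows "M = N"
proof (rule measure_eqI_generator_eq[of "Collect closed" UNIV _ _ "\<lambda>_. UNIV"])
  interpret M: prob_space M by fact
  interpret N: prob_space N by fact
  have sp: "space M = UNIV" "space N = UNIV"
    using sets_eq_imp_space_eq[of M borel] sets_eq_imp_space_eq[of N borel] by auto
  show "Int_stable (Collect closed :: 'a set set)" by (auto simp: Int_stable_def)
  show "sets M = sigma_sets UNIV (Collect closed)" "sets N = sigma_sets UNIV (Collect closed)"
    by (simp_all add: borel_eq_closed)
  show "emeasure M UNIV ~= \<infinity>" by simp
  fix C :: "'a set" assume "C \<in> Collect closed"
  then have C: "closed C" by simp
  show "emeasure M C = emeasure N C"
  proof (cases "C = {}")
    case False
    define f where "f k y = min 1 (max 0 (1 - real k * infdist y C))" for k y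
    have fl: "(real k)-lipschitz_on UNIV (f k)" for k unfolding f_def
    proof (intro cutoff_lipschitz lipschitz_onI)
      fix x y :: 'a
      have "\<bar>real k * infdist y C - real k * infdist x C\<bar> = real k * \<bar>infdist y C - infdist x C\<bar>"
        by (simp add: abs_mult flip: right_diff_distrib)
      also have "... <= real k * dist x y"
        using infdist_triangle_abs[of y C x] by (intro mult_left_mono) (auto simp: dist_commute)
      finally show "dist (1 - real k * infdist x C) (1 - real k * infdist y C) <= real k * dist x y"
        by (simp add: dist_real_def)
    qed simp
    have f1: "\<bar>f k y\<bar> <= 1" for k y by (auto simp: f_def)
    have lim: "(\<lambda>k. f k y) ----> indicator C y" for y
    proof (cases "y \<in> C")
      case True then show ?thesis by (simp add: f_def)
    next
      case False
      then have d: "infdist y C > 0" using C \<open>C ~= {}\<close> by (simp add: infdist_pos_not_in_closed)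
      obtain k0 :: nat where k0: "1 / infdist y C < real k0" using reals_Archimedean2 by blast
      have "f k y = 0" if "k >= k0" for k
      proof -
        have "1 / infdist y C <= real k" using k0 that by linarith
        then have "1 <= real k * infdist y C" using d by (simp add: divide_le_eq)
        then show ?thesis by (simp add: f_def)
      qed
      then have "\<forall>\<^sub>F k in sequentially. f k y = 0" using eventually_ge_at_top[of k0] by (rule eventually_mono[rotated])
      then show ?thesis using False by (simp add: tendsto_eventually)
    qed
    have meas: "f k \<in> borel_funs" for k by (rule lipschitz_measurable[OF fl])
    have conv: "(\<lambda>k. \<integral>y. f k y \<partial>P) ----> measure P C"
      if "prob_space P" and [simp, measurable_cong]: "sets P = sets borel" for P
    proof -
      interpret P: prob_space P by fact
      have "(\<lambda>k. \<integral>y. f k y \<partial>P) ----> (\<integral>y. indicator C y \<partial>P)" by (rule integral_dominated_convergence[where w="\<lambda>_. 1"])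
           (use C meas lim f1 in \<open>auto simp: borel_closed intro!: borel_measurable_indicator\<close>)
      then show ?thesis using C by simp
    qed
    have "measure M C = measure N C"
    proof (rule LIMSEQ_unique)
      show "(\<lambda>k. \<integral>y. f k y \<partial>M) ----> measure M C" by (rule conv[OF assms(1) assms(3)])
      show "(\<lambda>k. \<integral>y. f k y \<partial>M) ----> measure N C" unfolding eq[OF f1 fl] by (rule conv[OF assms(2) assms(4)])
    qed
    then show ?thesis by (simp add: M.emeasure_eq_measure N.emeasure_eq_measure)
  qed simp
qed auto

text \<open>Arzela-Ascoli without a compact domain: a diagonal subsequence converges on a countable
  dense set, and the common Lipschitz constant carries the Cauchy property to all points.\<close>

lemma pointwise_convergent_subsequence:
  fixes T :: "nat => 'a::euclidean_space => 'a"
  assumes lip: "!!k. 1-lipschitz_on UNIV (T k)" and B: "!!k. norm (T k 0) <= B"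
  obtains r T' where "strict_mono (r :: nat => nat)" "!!x. (\<lambda>k. T (r k) x) ----> T' x"
proof -
  obtain D :: "'a set" where D: "countable D" "!!U. open U ==> U ~= {} ==> \<exists>d\<in>D. d \<in> U"
    using countable_dense_exists by auto
  \<comment> \<open>Division by \<open>1 + norm x\<close> makes the bound independent of
    \<open>x\<close>, as the diagonal selection asks for.\<close>
  have bd: "norm (T k x /\<^sub>R (1 + norm x)) <= B + 1" for k x
  proof -
    have "0 <= B" using B[of 0] norm_ge_zero order_trans by blast
    have "norm (T k x) <= (norm (T k 0) + 1) * (1 + norm x)" by (rule lipschitz_growth[OF lip])
    also have "... <= (B + 1) * (1 + norm x)" using B by (intro mult_right_mono) auto
    finally have "norm (T k x) / (1 + norm x) <= B + 1" by (simp add: divide_le_eq add_pos_nonneg)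
    then show ?thesis by (simp add: divide_inverse mult.commute)
  qed
  obtain r where r: "strict_mono (r :: nat => nat)" "!!x. x \<in> D ==> \<exists>l. (\<lambda>n. T (r n) x /\<^sub>R (1 + norm x)) ----> l"
    using function_convergent_subsequence[OF D(1), of "\<lambda>n x. T n x /\<^sub>R (1 + norm x)" "B + 1"] bd by metis
  have cD: "Cauchy (\<lambda>n. T (r n) x)" if xD: "x \<in> D" for x
  proof -
    obtain l where "(\<lambda>n. T (r n) x /\<^sub>R (1 + norm x)) ----> l" using r(2)[OF xD] by blast
    then have "(\<lambda>n. (1 + norm x) *. (T (r n) x /\<^sub>R (1 + norm x))) ----> (1 + norm x) *. l" by (intro tendsto_intros)
    moreover have "1 + norm x ~= 0" by (metis add_pos_nonneg norm_ge_zero order_less_irrefl zero_less_one)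
    ultimately show ?thesis by (auto intro: LIMSEQ_imp_Cauchy)
  qed
  have "Cauchy (\<lambda>n. T (r n) x)" for x
  proof (rule metric_CauchyI)
    fix e :: real assume e: "e > 0"
    obtain d where d: "d \<in> D" "d \<in> ball x (e / 3)" using D(2)[of "ball x (e / 3)"] e by auto
    obtain M where M: "!!m n. m >= M ==> n >= M ==> dist (T (r m) d) (T (r n) d) < e / 3"
      using metric_CauchyD[OF cD[OF d(1)], of "e / 3"] e by auto
    show "\<exists>M. \<forall>m\<ge>M. \<forall>n\<ge>M. dist (T (r m) x) (T (r n) x) < e"
    proof (intro exI allI impI)
      fix m n assume mn: "m >= M" "n >= M"
      have l: "dist (T (r j) x) (T (r j) d) < e / 3" for j using lipschitz_onD[OF lip, of x d "r j"] d(2) by simp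
      have "dist (T (r m) x) (T (r n) x) <= dist (T (r m) x) (T (r m) d) + dist (T (r m) d) (T (r n) d) + dist (T (r n) d) (T (r n) x)"
        by (meson add_right_mono dist_triangle order_trans)
      then show "dist (T (r m) x) (T (r n) x) < e" using l[of m] l[of n] M[OF mn] by (simp add: dist_commute)
    qed
  qed
  then have "\<exists>l. (\<lambda>n. T (r n) x) ----> l" for x by (simp add: Cauchy_convergent_iff convergent_def)
  then obtain T' where "!!x. (\<lambda>k. T (r k) x) ----> T' x" by metis
  then show ?thesis using that r(1) by blast
qed

text \<open>Caffarelli's contraction theorem, reached through the temperatures
  \<open>1 / (k + 1)\<close>. The approximate maps share the Lipschitz constant 1, so compactness
  only requires that their values at 0 stay bounded.\<close>

theorem contractive_transport_exists:
  fixes m :: "'a::euclidean_space => real"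
  assumes lc: "gauss_logconcave m" and mu: "\<mu> = density lborel (\<lambda>x. ennreal (m x))" and moments: "exp_moments \<mu>"
  obtains \<phi> T where "one_smooth \<phi> T" "distr gauss borel T = \<mu>"
proof -
  interpret M: exp_moments \<mu> by (rule moments)
  define \<delta> where "\<delta> k = (4 + real DIM('a)) * sqrt (1 / real (Suc k))" for k
  have \<delta>0: "\<delta> ----> 0"
  proof -
    have "(\<lambda>k. (4 + real DIM('a)) * sqrt (1 / real (Suc k))) ----> (4 + real DIM('a)) * sqrt 0"
      by (intro tendsto_intros) (use LIMSEQ_inverse_real_of_nat in \<open>simp add: inverse_eq_divide\<close>)
    then show ?thesis by (simp add: \<delta>_def[abs_def])
  qed
  have "\<exists>\<phi> T. one_smooth \<phi> T \<and> (\<forall>f. (\<forall>y. \<bar>f y\<bar> <= 1) --> 1-lipschitz_on UNIV f -->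
     \<bar>(\<oint>x. f (T x)) - (\<integral>y. f y \<partial>\<mu>)\<bar> <= \<delta> k)" for k
  proof -
    interpret sinkhorn m "1 / real (Suc k)" \<mu> by unfold_locales (use lc mu in auto)
    show ?thesis unfolding \<delta>_def by (rule approximate_transport)
  qed
  then obtain \<phi> T where Q: "!!k. one_smooth (\<phi> k) (T k)"
    and ap: "!!k f. (!!y. \<bar>f y\<bar> <= 1) ==> 1-lipschitz_on UNIV f ==> \<bar>(\<oint>x. f (T k x)) - (\<integral>y. f y \<partial>\<mu>)\<bar> <= \<delta> k" by metis
  define f where "f R y = min 1 (max 0 (norm y - R))" for R and y :: 'a
  have fl: "1-lipschitz_on UNIV (f R)" for R unfolding f_def by (intro cutoff_lipschitz norm_minus_const_lipschitz)
  have f1: "\<bar>f R y\<bar> <= 1" for R y by (auto simp: f_def)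
  have "(\<lambda>j. \<integral>y. f (real j) y \<partial>\<mu>) ----> (\<integral>y. 0 \<partial>\<mu>)"
  proof (rule integral_dominated_convergence[where w="\<lambda>_. 1"])
    show "AE y in \<mu>. (\<lambda>j. f (real j) y) ----> 0"
    proof (rule AE_I2)
      fix y :: 'a
      obtain j0 :: nat where "norm y <= real j0" using real_arch_simple by blast
      then have "f (real j) y = 0" if "j >= j0" for j using that by (simp add: f_def)
      then show "(\<lambda>j. f (real j) y) ----> 0" by (intro tendsto_eventually) (auto simp: eventually_sequentially)
    qed
  qed (use lipschitz_measurable[OF fl] f1 in auto)
  then have "\<forall>\<^sub>F j in sequentially. (\<integral>y. f (real j) y \<partial>\<mu>) < 1 / 4" by (rule order_tendstoD) simp
  then obtain j where j: "(\<integral>y. f (real j) y \<partial>\<mu>) < 1 / 4" by (auto simp: eventually_sequentially)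
  let ?C = "\<lambda>i. cball (0 :: 'a) (real i)"
  have "(\<lambda>i. measure gauss (?C i)) ----> measure gauss (\<Union>i. ?C i)"
    by (intro gauss.finite_Lim_measure_incseq) (auto simp: incseq_def)
  also have "(\<Union>i. ?C i) = UNIV" using real_arch_simple by auto
  finally have "(\<lambda>i. measure gauss (?C i)) ----> 1" using gauss.prob_space[where 'a='a] by simp
  then have "\<forall>\<^sub>F i in sequentially. 1 / 2 < measure gauss (?C i)" by (rule order_tendstoD) simp
  then obtain i where i: "1 / 2 < measure gauss (?C i)" by (auto simp: eventually_sequentially)
  have "\<forall>\<^sub>F k in sequentially. \<delta> k < 1 / 4" using \<delta>0 by (rule order_tendstoD) simp
  then obtain k0 where k0: "!!k. k >= k0 ==> \<delta> k < 1 / 4" by (auto simp: eventually_sequentially)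
  \<comment> \<open>The ball of radius \<open>i\<close> carries more than half of the Gaussian mass.
    If \<open>norm (T k 0)\<close> exceeded \<open>B\<close>, the 1-Lipschitz map would send this
    ball beyond radius \<open>j + 1\<close>, where the cut-off equals 1, and its mean would exceed
    1/2. By the choice of \<open>j\<close> and \<open>k0\<close> it is below
    \<open>1 / 4 + 1 / 4\<close>.\<close>
  define B where "B = real j + 1 + real i"
  have TB: "norm (T k 0) <= B" if k: "k >= k0" for k
  proof (rule ccontr)
    assume n: "\<not> norm (T k 0) <= B"
    have one: "f (real j) (T k x) = 1" if "x \<in> ?C i" for x
    proof -
      have "norm (T k 0 - T k x) <= norm x"
        using lipschitz_onD[OF one_smooth_lipschitz[OF Q], of 0 x k] by (simp add: dist_norm)
      then have "norm (T k 0) - norm x <= norm (T k x)" using norm_triangle_ineq2[of "T k 0" "T k x"] by linarith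
      then show ?thesis using n that by (simp add: f_def B_def)
    qed
    have [measurable]: "T k \<in> borel_funs" "f (real j) \<in> borel_funs"
      by (rule lipschitz_measurable[OF one_smooth_lipschitz[OF Q]], rule lipschitz_measurable[OF fl])
    have "(\<oint>x. indicator (?C i) x) <= (\<oint>x. f (real j) (T k x))"
    proof (rule integral_mono[where f="indicator (?C i)"])
      show "integrable gauss (indicator (?C i) :: 'a => real)" by (simp add: gauss.emeasure_eq_measure)
      show "integrable gauss (\<lambda>x. f (real j) (T k x))"
        by (rule gauss.integrable_const_bound[where B=1]) (use f1 in auto)
      show "indicator (?C i) x <= f (real j) (T k x)" for x using one[of x] by (auto simp: indicator_def f_def)
    qed
    then have "1 / 2 < (\<oint>x. f (real j) (T k x))" using i by simp
    moreover have "\<bar>(\<oint>x. f (real j) (T k x)) - (\<integral>y. f (real j) y \<partial>\<mu>)\<bar> <= \<delta> k" by (rule ap[OF f1 fl])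
    ultimately show False using j k0[OF k] by linarith
  qed
  obtain r T' where r: "strict_mono (r :: nat => nat)" and lim: "!!x. (\<lambda>k. T (r k + k0) x) ----> T' x"
    using pointwise_convergent_subsequence[of "\<lambda>k. T (k + k0)" B] TB one_smooth_lipschitz[OF Q] by auto
  define s where "s k = r k + k0" for k
  have s: "strict_mono s" using r by (simp add: s_def strict_mono_def)
  have lim: "(\<lambda>k. T (s k) x) ----> T' x" for x using lim by (simp add: s_def)
  text \<open>The normalised potentials converge because they are line integrals of their gradients.\<close>
  define \<phi>' where "\<phi>' k x = \<phi> (s k) x - \<phi> (s k) 0" for k x
  have "Cauchy (\<lambda>k. \<phi>' k x)" for x
  proof (rule metric_CauchyI)
    fix e :: real assume e: "e > 0"
    obtain N0 :: nat where N0: "nsq x / 2 / (e / 3) < real N0" using reals_Archimedean2 by blast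
    define N where "N = Suc N0"
    have N: "N > 0" "nsq x / (2 * real N) < e / 3"
    proof -
      have "nsq x / 2 / (e / 3) < real N" using N0 by (simp add: N_def)
      then have "nsq x / 2 < real N * (e / 3)" using e by (simp add: pos_divide_less_eq)
      then show "nsq x / (2 * real N) < e / 3" by (simp add: N_def field_simps)
    qed (simp add: N_def)
    define X where "X i = (real i / real N) *. x" for i
    have X: "X (Suc i) - X i = (1 / real N) *. x" for i
      by (simp add: X_def flip: scaleR_diff_left diff_divide_distrib)
    define S where "S k = (\<Sum>i<N. T (s k) (X i) \<bullet> (X (Suc i) - X i))" for k
    have close: "\<bar>\<phi>' k x - S k\<bar> <= nsq x / (2 * real N)" for k
    proof -
      let ?d = "\<lambda>i. \<phi> (s k) (X (Suc i)) - \<phi> (s k) (X i) - T (s k) (X i) \<bullet> (X (Suc i) - X i)"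
      have "\<phi>' k x = (\<Sum>i<N. \<phi> (s k) (X (Suc i)) - \<phi> (s k) (X i))"
        unfolding sum_lessThan_telescope[of "\<lambda>i. \<phi> (s k) (X i)"] using N(1) by (simp add: \<phi>'_def X_def)
      then have "\<phi>' k x - S k = (\<Sum>i<N. ?d i)" by (simp add: S_def sum_subtractf)
      then have "\<bar>\<phi>' k x - S k\<bar> <= (\<Sum>i<N. \<bar>?d i\<bar>)" by (simp only: sum_abs)
      also have "... <= (\<Sum>i<N. nsq ((1 / real N) *. x) / 2)"
      proof (rule sum_mono)
        fix i
        have "0 <= ?d i"
          "?d i <= nsq (X (Suc i) - X i) / 2" using Q[of "s k"] unfolding one_smooth_def by blast+
        then show "\<bar>?d i\<bar> <= nsq ((1 / real N) *. x) / 2" unfolding X by simp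
      qed
      also have "... = nsq x / (2 * real N)" by (simp add: power_divide power2_eq_square[of "real N"])
      finally show ?thesis .
    qed
    have "(\<lambda>k. S k) ----> (\<Sum>i<N. T' (X i) \<bullet> (X (Suc i) - X i))" unfolding S_def by (intro tendsto_intros lim)
    then have "Cauchy S" by (rule LIMSEQ_imp_Cauchy)
    then obtain M where M: "!!m n. m >= M ==> n >= M ==> dist (S m) (S n) < e / 3"
      using metric_CauchyD[of S "e / 3"] e by auto
    show "\<exists>M. \<forall>m\<ge>M. \<forall>n\<ge>M. dist (\<phi>' m x) (\<phi>' n x) < e"
    proof (intro exI allI impI)
      fix a b assume ab: "a >= M" "b >= M"
      show "dist (\<phi>' a x) (\<phi>' b x) < e"
        using close[of a] close[of b] M[OF ab] N(2) unfolding dist_real_def by linarith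
    qed
  qed
  then have "\<exists>l. (\<lambda>n. \<phi>' n x) ----> l" for x by (simp add: Cauchy_convergent_iff convergent_def)
  then obtain \<Phi> where \<Phi>: "!!x. (\<lambda>k. \<phi>' k x) ----> \<Phi> x" by metis
  \<comment> \<open>\<open>one_smooth\<close> contains no derivative, so both inequalities pass to
    pointwise limits.\<close>
  have Q': "one_smooth \<Phi> T'" unfolding one_smooth_def
  proof (intro allI)
    fix x y
    let ?p = "\<lambda>k. \<phi>' k y - \<phi>' k x - T (s k) x \<bullet> (y - x)" and ?P = "\<Phi> y - \<Phi> x - T' x \<bullet> (y - x)"
    have lm: "?p ----> ?P" by (intro tendsto_intros \<Phi> lim)
    have "0 <= ?p k \<and> ?p k <= nsq (y - x) / 2" for k using Q[of "s k"] by (simp add: one_smooth_def \<phi>'_def)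
    then show "0 <= ?P \<and> ?P <= nsq (y - x) / 2"
      using LIMSEQ_le_const[OF lm, of 0] LIMSEQ_le_const2[OF lm, of "nsq (y - x) / 2"] by blast
  qed
  have [measurable]: "T k \<in> borel_funs" for k by (rule lipschitz_measurable[OF one_smooth_lipschitz[OF Q]])
  have [measurable]: "T' \<in> borel_funs" by (rule lipschitz_measurable[OF one_smooth_lipschitz[OF Q']])
  have "distr gauss borel T' = \<mu>"
  proof (rule measure_eqI_lipschitz)
    show "prob_space (distr gauss borel T')" by (rule gauss.prob_space_distr) simp
    show "prob_space \<mu>" by (rule M.prob_space_axioms)
    fix f :: "'a => real" and L assume f1: "!!y. \<bar>f y\<bar> <= 1" and fl: "L-lipschitz_on UNIV f"
    note [measurable] = lipschitz_measurable[OF fl]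
    have L0: "L >= 0" by (rule lipschitz_on_nonneg[OF fl])
    define g where "g y = f y / (1 + L)" for y
    have g1: "\<bar>g y\<bar> <= 1" for y
    proof -
      have "\<bar>f y\<bar> / (1 + L) <= 1 / 1" using f1[of y] L0 by (intro frac_le) auto
      then show ?thesis using L0 by (simp add: g_def)
    qed
    have gl: "1-lipschitz_on UNIV g"
    proof (rule lipschitz_onI)
      fix x y
      have "\<bar>f x - f y\<bar> <= L * dist x y" using lipschitz_onD[OF fl, of x y] by (simp add: dist_real_def)
      also have "... <= (1 + L) * dist x y" by (intro mult_right_mono) auto
      finally have "\<bar>f x - f y\<bar> / (1 + L) <= dist x y" using L0 by (simp add: divide_le_eq mult.commute)
      then show "dist (g x) (g y) <= 1 * dist x y" using L0 by (simp add: g_def dist_real_def flip: diff_divide_distrib)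
    qed simp
    have [measurable]: "g \<in> borel_funs" by (rule lipschitz_measurable[OF gl])
    have c: "continuous_on UNIV g" by (rule lipschitz_on_continuous_on[OF gl])
    have "(\<lambda>k. \<integral>x. g (T (s k) x) \<partial>gauss) ----> (\<oint>x. g (T' x))"
    proof (rule integral_dominated_convergence[where w="\<lambda>_. 1"])
      show "AE x in gauss. (\<lambda>k. g (T (s k) x)) ----> g (T' x)" using continuous_on_tendsto_compose[OF c lim] by auto
    qed (use g1 in auto)
    moreover have "(\<lambda>k. \<integral>x. g (T (s k) x) \<partial>gauss) ----> (\<integral>y. g y \<partial>\<mu>)"
    proof (rule LIM_zero_cancel, rule Lim_null_comparison)
      show "\<forall>\<^sub>F k in sequentially. norm ((\<oint>x. g (T (s k) x)) - (\<integral>y. g y \<partial>\<mu>)) <= (\<delta> \<circ> s) k"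
        using ap[OF g1 gl] by (intro always_eventually) simp
      show "(\<delta> \<circ> s) ----> 0" by (rule LIMSEQ_subseq_LIMSEQ[OF \<delta>0 s])
    qed
    ultimately have "(\<oint>x. g (T' x)) = (\<integral>y. g y \<partial>\<mu>)" by (rule LIMSEQ_unique)
    then have "(\<oint>x. f (T' x)) = (\<integral>y. f y \<partial>\<mu>)" using L0 by (simp add: g_def)
    then show "(\<integral>y. f y \<partial>distr gauss borel T') = (\<integral>y. f y \<partial>\<mu>)" by (simp add: integral_distr)
  qed simp_all
  with Q' show ?thesis by (rule that)
qed

section \<open>Ornstein--Uhlenbeck smoothing\<close>

text \<open>Mehler's formula for the Ornstein-Uhlenbeck semigroup with
  \<open>a = exp (- time)\<close>: values of \<open>a\<close> near 1 mean little smoothing, and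
  times add as the parameters multiply.\<close>

definition ou :: "real => ('a::euclidean_space => 'b::euclidean_space) => 'a => 'b" where
  "ou a f x = (\<oint>z. f (rot a x z))"

text \<open>Gaussian integration by parts, so that \<open>f\<close> itself is never differentiated.
  The normalisation leaves out the chain-rule factor: \<open>a *. oud a f x\<close> is the
  derivative of \<open>ou a f\<close>, and for differentiable \<open>f\<close> \<open>oud\<close> is
  the smoothed derivative.\<close>

definition oud :: "real => ('a::euclidean_space => 'b::euclidean_space) => 'a => 'a => 'b" where
  "oud a f x v = (1 / sqrt (1 - a^2)) *. (\<oint>z. (z \<bullet> v) *. f (rot a x z))"

lemma lipschitz_affine:
  assumes "L-lipschitz_on UNIV (f :: 'a::real_normed_vector => 'b::metric_space)"
  shows "(L * \<bar>b\<bar>)-lipschitz_on UNIV (\<lambda>z. f (c + b *. z))"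
proof (rule lipschitz_onI)
  fix x y
  have "dist (f (c + b *. x)) (f (c + b *. y)) <= L * dist (c + b *. x) (c + b *. y)"
    by (rule lipschitz_onD[OF assms]) auto
  then show "dist (f (c + b *. x)) (f (c + b *. y)) <= L * \<bar>b\<bar> * dist x y"
    by (simp add: dist_norm scaleR_diff_right[symmetric])
qed (use lipschitz_on_nonneg[OF assms] in auto)

lemma has_derivativeI_quadratic:
  fixes f :: "'a::real_normed_vector => 'b::real_normed_vector"
  assumes L: "bounded_linear L" and d: "\<delta> > 0" and b: "!!h. norm h <= \<delta> ==> norm (f (x + h) - f x - L h) <= C * nsq h"
  shows "(f has_derivative L) (at x)" unfolding has_derivative_at
proof (intro conjI L)
  show "(\<lambda>h. norm (f (x + h) - f x - L h) / norm h) \<midarrow>0\<rightarrow> 0"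
  proof (rule Lim_null_comparison)
    have "\<forall>\<^sub>F h in at 0. norm h < \<delta>" unfolding eventually_at using d by auto
    then show "\<forall>\<^sub>F h in at 0. norm (norm (f (x + h) - f x - L h) / norm h) <= C * norm h"
    proof eventually_elim
      case (elim h)
      then show ?case using b[of h] by (cases "h = 0") (auto simp: divide_simps power2_eq_square)
    qed
    show "(\<lambda>h::'a. C * norm h) \<midarrow>0\<rightarrow> 0" by (auto intro!: tendsto_eq_intros)
  qed
qed

lemma exp_quadratic_bound:
  fixes u :: real shows "\<bar>exp u - 1 - u\<bar> <= u^2 * exp \<bar>u\<bar>"
proof -
  obtain t where t: "\<bar>t\<bar> <= \<bar>u\<bar>" "exp u = (\<Sum>m<2. u ^ m / fact m) + exp t / fact 2 * u ^ 2"
    using Maclaurin_exp_le[of u 2] by auto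
  then have "exp u - 1 - u = exp t / 2 * u^2" by (simp add: numeral_2_eq_2)
  then have "\<bar>exp u - 1 - u\<bar> = \<bar>exp t / 2 * u^2\<bar>" by (rule arg_cong)
  also have "... = u^2 * (exp t / 2)" by simp
  also have "... <= u^2 * exp \<bar>u\<bar>"
  proof (rule mult_left_mono)
    have "exp t <= exp \<bar>u\<bar>" using t(1) by simp
    then show "exp t / 2 <= exp \<bar>u\<bar>" using exp_gt_zero[of t] by linarith
  qed simp
  finally show ?thesis .
qed

text \<open>Second-order Taylor remainder in \<open>p\<close> of the Cameron-Martin weight, with a
  factor in \<open>z\<close> that is integrable against the Gaussian. For \<open>norm p <= 1\<close>
  the exponent grows at most linearly in \<open>norm z\<close>.\<close>

lemma gauss_kernel_bound:
  fixes p z :: "'a::euclidean_space"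
  assumes p: "norm p <= 1"
  shows "\<bar>exp (p \<bullet> z - nsq p / 2) - 1 - p \<bullet> z\<bar> <= nsq p * (4 * ((1 + norm z)^2 * exp (norm z)) )"
proof -
  define u where "u = p \<bullet> z - nsq p / 2"
  have pz: "\<bar>p \<bullet> z\<bar> <= norm p * norm z" by (rule Cauchy_Schwarz_ineq2)
  have pp: "nsq p / 2 <= norm p / 2" using p by (simp add: power2_eq_square mult_left_le)
  have u1: "\<bar>u\<bar> <= norm p * (1 / 2 + norm z)"
  proof -
    have "norm p * (1 / 2 + norm z) = norm p / 2 + norm p * norm z" by (simp add: distrib_left)
    then show ?thesis unfolding u_def using pz pp zero_le_power2[of "norm p"] by linarith
  qed
  also have "... <= 1 * (1 / 2 + norm z)" using p by (intro mult_right_mono) auto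
  finally have u2: "\<bar>u\<bar> <= 1 / 2 + norm z" by simp
  have "\<bar>u\<bar> <= norm p * (1 + norm z)" using u1 by (rule order_trans) (intro mult_left_mono, auto)
  then have u3: "u^2 <= nsq p * (1 + norm z)^2"
    using power_mono[of "\<bar>u\<bar>" "norm p * (1 + norm z)" 2] by (simp add: power_mult_distrib)
  have "exp \<bar>u\<bar> <= exp (1 / 2) * exp (norm z)" using u2 by (simp flip: exp_add)
  also have "... <= 2 * exp (norm z)" using exp_half_le2 by (intro mult_right_mono) auto
  finally have u4: "exp \<bar>u\<bar> <= 2 * exp (norm z)" .
  have "\<bar>exp u - 1 - u\<bar> <= u^2 * exp \<bar>u\<bar>" by (rule exp_quadratic_bound)
  also have "... <= (nsq p * (1 + norm z)^2) * (2 * exp (norm z))" using u3 u4 by (intro mult_mono) auto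
  finally have a: "\<bar>exp u - 1 - u\<bar> <= 2 * (nsq p * ((1 + norm z)^2 * exp (norm z)))" by simp
  have "1 * 1 <= (1 + norm z)^2 * exp (norm z)" by (intro mult_mono one_le_power) auto
  then have "nsq p * 1 <= nsq p * ((1 + norm z)^2 * exp (norm z))" by (intro mult_left_mono) auto
  then have c: "nsq p / 2 <= 2 * (nsq p * ((1 + norm z)^2 * exp (norm z)))"
    using zero_le_power2[of "norm p"] by linarith
  have "\<bar>exp u - 1 - p \<bullet> z\<bar> <= \<bar>exp u - 1 - u\<bar> + nsq p / 2"
  proof -
    have "exp u - 1 - p \<bullet> z = (exp u - 1 - u) - nsq p / 2" by (simp add: u_def)
    then show ?thesis using abs_triangle_ineq4[of "exp u - 1 - u" "nsq p / 2"] by simp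
  qed
  with a c show ?thesis unfolding u_def by simp
qed

context
  fixes f :: "'a::euclidean_space => 'b::euclidean_space" and L a :: real
  assumes lip: "L-lipschitz_on UNIV f" and a: "0 < a" "a < 1"
begin

lemma ou_b_pos: "0 < sqrt (1 - a^2)" and ou_b_sq: "(sqrt (1 - a^2))^2 = 1 - a^2" and ou_ab: "a^2 + (sqrt (1 - a^2))^2 = 1"
proof -
  have "a^2 < 1" using a by (simp add: abs_square_less_1)
  then show "0 < sqrt (1 - a^2)" "(sqrt (1 - a^2))^2 = 1 - a^2" "a^2 + (sqrt (1 - a^2))^2 = 1" by auto
qed

lemma ou_inner_lipschitz: "(L * \<bar>sqrt (1 - a^2)\<bar>)-lipschitz_on UNIV (\<lambda>z. f (rot a x z))"
  by (rule lipschitz_affine[OF lip])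

lemma ou_integrable: "integrable gauss (\<lambda>z. f (rot a x z))"
  by (rule integrable_gauss_lipschitz(1)[OF ou_inner_lipschitz])

lemma oud_integrable: "integrable gauss (\<lambda>z. (z \<bullet> v) *. f (rot a x z))"
proof -
  let ?f = "\<lambda>z. f (rot a x z)"
  note [measurable] = lipschitz_measurable[OF ou_inner_lipschitz[of x]]
  obtain C where C: "!!z. norm (?f z) <= C * (1 + norm z)" using lipschitz_growth[OF ou_inner_lipschitz[of x]] by blast
  show ?thesis
  proof (rule integrable_gauss_quadratic[where C="norm v * C"])
    fix z
    have "norm ((z \<bullet> v) *. ?f z) <= (norm z * norm v) * (C * (1 + norm z))"
      using C[of z] Cauchy_Schwarz_ineq2[of z v] by (simp add: mult_mono)
    also have "... = norm v * ((C * (1 + norm z)) * norm z)" by simp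
    also have "... <= norm v * ((C * (1 + norm z)) * (1 + norm z))"
      using order_trans[OF norm_ge_zero C[of z]] by (intro mult_left_mono) auto
    finally show "norm ((z \<bullet> v) *. ?f z) <= norm v * C * (1 + norm z)^2" by (simp add: power2_eq_square)
  qed measurable
qed

lemma oud_linear: "linear (oud a f x)"
proof (rule linearI)
  fix v w :: 'a and c :: real
  show "oud a f x (v + w) = oud a f x v + oud a f x w" unfolding oud_def inner_add_right scaleR_add_left
    by (simp add: Bochner_Integration.integral_add[OF oud_integrable oud_integrable] scaleR_add_right)
  show "oud a f x (c *. v) = c *. oud a f x v"
  proof -
    have "(\<oint>z. (z \<bullet> (c *. v)) *. f (rot a x z))
      = (\<oint>z. c *. ((z \<bullet> v) *. f (rot a x z)))" by simp
    also have "... = c *. (\<oint>z. (z \<bullet> v) *. f (rot a x z))" by (rule integral_scaleR_right)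
    finally show ?thesis by (simp add: oud_def)
  qed
qed

text \<open>Moving \<open>x\<close> by \<open>h\<close> amounts to moving \<open>z\<close> by
  \<open>p = (a / sqrt (1 - a^2)) *. h\<close>, and Cameron-Martin transfers this shift to the
  density. Only the weight is expanded, with \<open>f\<close> as a factor of linear growth.\<close>

lemma ou_has_derivative: "(ou a f has_derivative (\<lambda>v. a *. oud a f x v)) (at x)"
proof -
  let ?b = "sqrt (1 - a^2)"
  let ?f = "\<lambda>z. f (rot a x z)"
  note [measurable] = lipschitz_measurable[OF ou_inner_lipschitz[of x]]
  obtain C where C: "!!z. norm (?f z) <= C * (1 + norm z)" using lipschitz_growth[OF ou_inner_lipschitz[of x]] by blast
  have C0: "C >= 0" using order_trans[OF norm_ge_zero C[of 0]] by simp
  define K where "K z = 4 * ((1 + norm z)^2 * exp (norm z)) * (C * exp (norm z))" for z :: 'a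
  have fK: "norm (?f z) <= C * exp (norm z)" for z
    using C[of z] C0 mult_left_mono[of "1 + norm z" "exp (norm z)" C] exp_ge_add_one_self[of "norm z"] by linarith
  have Ki: "integrable gauss K" by (rule integrable_gauss_growth[where c=2 and C="4 * C"])
       (auto simp: K_def[abs_def] C0 exp_double power2_eq_square[of "exp _"])
  have lin: "bounded_linear (\<lambda>v. a *. oud a f x v)"
    by (intro bounded_linear_compose[OF bounded_linear_scaleR_right] linear_conv_bounded_linear[THEN iffD1] oud_linear)
  show ?thesis
  proof (rule has_derivativeI_quadratic[OF lin])
    show "?b / a > 0" using ou_b_pos a by simp
    fix h :: 'a assume h: "norm h <= ?b / a"
    define p where "p = (a / ?b) *. h"
    have np: "norm p = a / ?b * norm h" using a ou_b_pos by (simp add: p_def)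
    have p1: "norm p <= 1" unfolding np using h a ou_b_pos by (simp add: field_simps)
    have bp: "?b *. p = a *. h" using ou_b_pos by (simp add: p_def)
    have shift: "ou a f (x + h) = (\<oint>z. exp (p \<bullet> z - nsq p / 2) *. ?f z)"
    proof -
      have "ou a f (x + h) = (\<oint>z. ?f (z + p))" unfolding ou_def by (simp add: bp algebra_simps)
      also have "... = (\<oint>z. exp (p \<bullet> z - nsq p / 2) *. ?f z)" by (rule integral_gauss_shift) measurable
      finally show ?thesis .
    qed
    have si: "integrable gauss (\<lambda>z. exp (p \<bullet> z - nsq p / 2) *. ?f z)"
    proof -
      have "integrable gauss (\<lambda>z. ?f (z + p))"
      proof -
        have "(\<lambda>z. ?f (z + p)) = (\<lambda>z. f ((rot a x p) + ?b *. z))" by (simp add: algebra_simps)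
        then show ?thesis using integrable_gauss_lipschitz(1)[OF lipschitz_affine[OF lip]] by simp
      qed
      then show ?thesis by (subst (asm) integrable_gauss_shift) auto
    qed
    have dv: "a *. oud a f x h = (\<oint>z. (p \<bullet> z) *. ?f z)"
    proof -
      have "a *. oud a f x h = (a / ?b) *. (\<oint>z. (z \<bullet> h) *. ?f z)" by (simp add: oud_def)
      also have "... = (\<oint>z. (a / ?b) *. ((z \<bullet> h) *. ?f z))" by (rule integral_scaleR_right[symmetric])
      finally show ?thesis by (simp add: p_def inner_commute)
    qed
    have di: "integrable gauss (\<lambda>z. (p \<bullet> z) *. ?f z)" using oud_integrable[of p x] by (simp add: inner_commute)
    have "ou a f (x + h) - ou a f x - a *. oud a f x h =
        (\<oint>z. (exp (p \<bullet> z - nsq p / 2) - 1 - p \<bullet> z) *. ?f z)"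
      unfolding shift dv ou_def[of a f x] using si di ou_integrable[of x] by (simp add: scaleR_diff_left)
    also have "norm ... <= (\<oint>z. nsq p * K z)"
    proof (rule Bochner_Integration.integral_norm_bound_integral)
      show "integrable gauss (\<lambda>z. (exp (p \<bullet> z - nsq p / 2) - 1 - p \<bullet> z) *. ?f z)"
        using si di ou_integrable[of x] by (simp add: scaleR_diff_left)
      show "integrable gauss (\<lambda>z. nsq p * K z)" using Ki by simp
      fix z
      have "norm ((exp (p \<bullet> z - nsq p / 2) - 1 - p \<bullet> z) *. ?f z) <= (nsq p * (4 * ((1 + norm z)^2 * exp (norm z)))) * (C * exp (norm z))"
        unfolding norm_scaleR using gauss_kernel_bound[OF p1, of z] fK[of z] by (intro mult_mono) auto
      then show "norm ((exp (p \<bullet> z - nsq p / 2) - 1 - p \<bullet> z) *. ?f z) <= nsq p * K z" by (simp add: K_def)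
    qed
    also have "... = (\<oint>z. K z) * (a / ?b)^2 * nsq h" unfolding np power_mult_distrib by simp
    finally show "norm (ou a f (x + h) - ou a f x - a *. oud a f x h) <= (\<oint>z. K z) * (a / ?b)^2 * nsq h" .
  qed
qed

lemma ou_lipschitz: "(L * a)-lipschitz_on UNIV (ou a f)"
proof (rule lipschitz_onI)
  fix x y :: 'a
  let ?y = "\<lambda>x z. a *. x + sqrt (1 - a^2) *. z"
  have "norm (ou a f x - ou a f y) = norm (\<oint>z. f (?y x z) - f (?y y z))" unfolding ou_def using ou_integrable by simp
  also have "... <= (\<integral>z. L * a * dist x y \<partial>(gauss :: 'a measure))"
  proof (rule Bochner_Integration.integral_norm_bound_integral[where g="\<lambda>_. L * a * dist x y"])
    show "integrable gauss (\<lambda>z. f (?y x z) - f (?y y z))" using ou_integrable by auto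
    fix z :: 'a
    have "dist (f (?y x z)) (f (?y y z)) <= L * dist (?y x z) (?y y z)" by (rule lipschitz_onD[OF lip]) auto
    also have "dist (?y x z) (?y y z) = a * dist x y" using a by (simp add: dist_norm flip: scaleR_diff_right)
    finally show "norm (f (?y x z) - f (?y y z)) <= L * a * dist x y" by (simp add: dist_norm)
  qed auto
  also have "... = L * a * dist x y" using gauss.prob_space[where 'a='a] by simp
  finally show "dist (ou a f x) (ou a f y) <= L * a * dist x y" by (simp add: dist_norm)
qed (use lipschitz_on_nonneg[OF lip] a in auto)

lemma integral_ou: "(\<oint>x. ou a f x) = (\<oint>x. f x)"
proof -
  note [measurable] = lipschitz_measurable[OF lip]
  have fi: "integrable gauss f" by (rule integrable_gauss_lipschitz(1)[OF lip])
  let ?g = "\<lambda>p :: 'a \<times> 'a. f (a *. fst p + sqrt (1 - a^2) *. snd p)"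
  have d: "distr gauss2 borel (\<lambda>p. a *. fst p + sqrt (1 - a^2) *. snd p) = (gauss :: 'a measure)"
    by (rule distr_gauss_mix[OF a(1) ou_ab])
  have gi: "integrable gauss2 ?g" using fi by (subst (asm) d[symmetric]) (subst (asm) integrable_distr_eq, auto)
  have "(\<oint>x. f x) = (\<integral>p. ?g p \<partial>gauss2)" by (subst d[symmetric]) (subst integral_distr, auto)
  also have "... = (\<oint>x. ou a f x)" using gauss2.integral_fst'[OF gi] by (simp add: ou_def)
  finally show ?thesis by simp
qed

lemma oud_lipschitz: "norm (oud a f x v - oud a f y v) <= (L * a * norm v / sqrt (1 - a^2)) * (\<oint>z. norm (z::'a)) * norm (x - y)"
proof -
  let ?b = "sqrt (1 - a^2)"
  let ?D = "\<lambda>z. f (rot a x z) - f (rot a y z)"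
  have ni: "integrable gauss (\<lambda>z::'a. norm z)" by (rule integrable_gauss_linear[where C=1]) auto
  have "oud a f x v - oud a f y v = (1 / ?b) *. (\<oint>z. (z \<bullet> v) *. ?D z)"
    unfolding oud_def using oud_integrable by (simp add: scaleR_diff_right)
  also have "norm ... <= (1 / ?b) * (\<oint>z. norm v * L * a * norm (x - y) * norm (z::'a))" unfolding norm_scaleR
  proof (rule mult_mono)
    show "norm (\<oint>z. (z \<bullet> v) *. ?D z) <= (\<oint>z. norm v * L * a * norm (x - y) * norm (z::'a))"
    proof (rule Bochner_Integration.integral_norm_bound_integral)
      show "integrable gauss (\<lambda>z. (z \<bullet> v) *. ?D z)" using oud_integrable by (simp add: scaleR_diff_right)
      show "integrable gauss (\<lambda>z. norm v * L * a * norm (x - y) * norm (z::'a))" using ni by simp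
      fix z :: 'a
      have "dist (f (rot a x z)) (f (rot a y z)) <= L * dist (rot a x z) (rot a y z)"
        by (rule lipschitz_onD[OF lip]) auto
      also have "dist (rot a x z) (rot a y z) = a * norm (x - y)"
        using a by (simp add: dist_norm flip: scaleR_diff_right)
      finally have "norm (?D z) <= L * (a * norm (x - y))" by (simp add: dist_norm)
      then have "\<bar>z \<bullet> v\<bar> * norm (?D z) <= (norm z * norm v) * (L * (a * norm (x - y)))"
        using Cauchy_Schwarz_ineq2[of z v] by (intro mult_mono) auto
      then show "norm ((z \<bullet> v) *. ?D z) <= norm v * L * a * norm (x - y) * norm z" by (simp add: mult_ac)
    qed
  qed (use ou_b_pos in auto)
  finally show ?thesis by (simp add: algebra_simps)
qed

lemma oud_continuous: "continuous_on UNIV (\<lambda>x. oud a f x v)"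
proof (rule lipschitz_on_continuous_on)
  show "((L * a * norm v / sqrt (1 - a^2)) * (\<oint>z. norm (z::'a)))-lipschitz_on UNIV (\<lambda>x. oud a f x v)"
  proof (rule lipschitz_onI)
    show "dist (oud a f x v) (oud a f y v) <= L * a * norm v / sqrt (1 - a^2) * (\<oint>z. norm (z::'a)) * dist x y" for x y
      unfolding dist_norm by (rule oud_lipschitz)
    have "0 <= (\<oint>z. norm (z::'a))" by (intro Bochner_Integration.integral_nonneg) simp
    then show "0 <= L * a * norm v / sqrt (1 - a^2) * (\<oint>z. norm (z::'a))"
      using lipschitz_on_nonneg[OF lip] a ou_b_pos by (intro mult_nonneg_nonneg divide_nonneg_nonneg norm_ge_zero) (auto simp del: real_sqrt_ge_0_iff real_sqrt_gt_0_iff)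
  qed
qed

end

section \<open>Derivatives of smoothed gradient maps\<close>

lemma has_derivative_directional:
  fixes f :: "'a::real_normed_vector => 'b::real_normed_vector"
  assumes "(f has_derivative f') (at x)"
  shows "((\<lambda>t. (f (x + t *. v) - f x) /\<^sub>R t) \<longlongrightarrow> f' v) (at 0)"
proof -
  have "((\<lambda>t. x + t *. v) has_derivative (\<lambda>t. t *. v)) (at 0)" by (auto intro!: derivative_eq_intros)
  moreover have "(f has_derivative f') (at (x + 0 *. v))" using assms by simp
  ultimately have "((\<lambda>t. f (x + t *. v)) has_derivative (\<lambda>t. f' (t *. v))) (at 0)" by (rule has_derivative_compose)
  then have "((\<lambda>t. f (x + t *. v)) has_vector_derivative f' v) (at 0)"
    by (simp add: has_vector_derivative_def linear_scale[OF has_derivative_linear[OF assms]])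
  then show ?thesis by (simp add: has_vector_derivative_iff_tendsto_at_zero)
qed

lemma lipschitz_derivative_bound:
  assumes lip: "L-lipschitz_on UNIV f" and d: "(f has_derivative f') (at x)"
  shows "norm (f' v) <= L * norm v"
proof (rule tendsto_upperbound[OF tendsto_norm[OF has_derivative_directional[OF d, of v]]])
  show "\<forall>\<^sub>F t in at 0. norm ((f (x + t *. v) - f x) /\<^sub>R t) <= L * norm v"
  proof (rule eventually_at_filter[THEN iffD2], rule always_eventually, intro allI impI)
    fix t :: real assume t: "t ~= 0"
    have "norm (f (x + t *. v) - f x) <= L * (\<bar>t\<bar> * norm v)"
      using lipschitz_onD[OF lip, of "x + t *. v" x] by (simp add: dist_norm)
    then have "norm (f (x + t *. v) - f x) / \<bar>t\<bar> <= L * (\<bar>t\<bar> * norm v) / \<bar>t\<bar>" by (rule divide_right_mono) simp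
    also have "... = L * norm v" using t by simp
    finally show "norm ((f (x + t *. v) - f x) /\<^sub>R t) <= L * norm v" by (simp add: divide_inverse mult.commute)
  qed
qed simp

lemma monotone_derivative_nonneg:
  fixes f :: "'a::euclidean_space => 'a"
  assumes m: "!!x y. 0 <= (f x - f y) \<bullet> (x - y)" and d: "(f has_derivative f') (at x)"
  shows "0 <= f' v \<bullet> v"
proof (rule tendsto_lowerbound)
  show "((\<lambda>t. ((f (x + t *. v) - f x) /\<^sub>R t) \<bullet> v) \<longlongrightarrow> f' v \<bullet> v) (at 0)"
    by (intro tendsto_intros has_derivative_directional[OF d])
  show "\<forall>\<^sub>F t in at 0. 0 <= ((f (x + t *. v) - f x) /\<^sub>R t) \<bullet> v"
  proof (rule eventually_at_filter[THEN iffD2], rule always_eventually, intro allI impI)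
    fix t :: real assume t: "t ~= 0"
    have "0 <= t * ((f (x + t *. v) - f x) \<bullet> v)" using m[of "x + t *. v" x] by simp
    then have "0 <= t * ((f (x + t *. v) - f x) \<bullet> v) / (t * t)" by (rule divide_nonneg_nonneg) simp
    also have "t * ((f (x + t *. v) - f x) \<bullet> v) / (t * t) = ((f (x + t *. v) - f x) /\<^sub>R t) \<bullet> v"
      using t by (simp add: divide_inverse)
    finally show "0 <= ((f (x + t *. v) - f x) /\<^sub>R t) \<bullet> v" .
  qed
qed simp

lemma one_smooth_derivative_symmetric:
  assumes Q: "one_smooth \<psi> S" and d: "(S has_derivative S') (at x)"
  shows "S' v \<bullet> w = v \<bullet> S' w"
proof -
  have lin: "linear S'" by (rule has_derivative_linear[OF d])
  text \<open>Both sides are limits of the same second difference quotient of \<open>\<psi>\<close>.\<close>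
  let ?Q = "\<lambda>h v w. \<bar>\<psi> (x + h *. v + h *. w) - \<psi> (x + h *. v) - \<psi> (x + h *. w) + \<psi> x - h * h * (S' v \<bullet> w)\<bar>"
  have key: "\<exists>\<delta>>0. \<forall>h. 0 < h --> h < \<delta> -->
      ?Q h v w <= h * h * (2 * e * (norm v + norm w) * norm w)"
    if e: "e > 0" for e v w
  proof -
    obtain \<delta>0 where \<delta>0: "\<delta>0 > 0" "!!u. norm u < \<delta>0 ==> norm (S (x + u) - S x - S' u) <= e * norm u"
    proof -
      obtain r where "r > 0" "\<forall>y. norm (y - x) < r --> norm (S y - S x - S' (y - x)) <= e * norm (y - x)"
        using d[unfolded has_derivative_at_alt] e by blast
      then show ?thesis using that[of r] by (metis add_diff_cancel_left')
    qed
    define \<delta> where "\<delta> = \<delta>0 / (norm v + norm w + 1)"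
    have vw: "norm v + norm w + 1 > 0" by (simp add: add_nonneg_pos)
    have "?Q h v w <= h * h * (2 * e * (norm v + norm w) * norm w)"
      if h: "0 < h" "h < \<delta>" for h
    proof -
      define k where "k t = \<psi> (x + h *. v + t *. w) - \<psi> (x + t *. w)" for t
      have dk: "(k has_real_derivative (S (x + h *. v + t *. w) - S (x + t *. w)) \<bullet> w) (at t)" for t
      proof -
        have p: "((\<lambda>t. \<psi> (c + t *. w)) has_real_derivative S (c + t *. w) \<bullet> w) (at t)" for c
        proof -
          have "((\<lambda>t. c + t *. w) has_derivative (\<lambda>s. s *. w)) (at t)" by (auto intro!: derivative_eq_intros)
          from has_derivative_compose[OF this one_smooth_has_derivative[OF Q]]
          show ?thesis by (simp add: has_field_derivative_def mult.commute[of _ "S _ \<bullet> w"])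
        qed
        show ?thesis unfolding k_def[abs_def] inner_diff_left by (intro DERIV_diff p)
      qed
      obtain \<xi> where \<xi>: "0 < \<xi>" "\<xi> < h" "k h - k 0 = (h - 0) * ((S (x + h *. v + \<xi> *. w) - S (x + \<xi> *. w)) \<bullet> w)"
        using MVT2[OF h(1) dk] by blast
      have hb: "h * (norm v + norm w) < \<delta>0"
      proof -
        have "h * (norm v + norm w) <= h * (norm v + norm w + 1)" using h by simp
        also have "... < \<delta>0" using h(2) vw by (simp add: \<delta>_def pos_less_divide_eq)
        finally show ?thesis .
      qed
      let ?n = "norm v + norm w"
      have n1: "norm (h *. v + \<xi> *. w) <= h * ?n"
      proof -
        have "norm (h *. v + \<xi> *. w) <= h * norm v + \<xi> * norm w"
          using norm_triangle_ineq[of "h *. v" "\<xi> *. w"] h \<xi> by simp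
        also have "... <= h * norm v + h * norm w" using \<xi> by (intro add_left_mono mult_right_mono) auto
        finally show ?thesis by (simp add: distrib_left)
      qed
      have n2: "norm (\<xi> *. w) <= h * ?n"
      proof -
        have "\<xi> * norm w <= h * norm w" using \<xi> by (intro mult_right_mono) auto
        also have "... <= h * ?n" using h by (intro mult_left_mono) auto
        finally show ?thesis using \<xi> by simp
      qed
      let ?d = "S (x + h *. v + \<xi> *. w) - S (x + \<xi> *. w) - h *. S' v" and ?r = "\<lambda>u. S (x + u) - S x - S' u"
      have "norm (?r (h *. v + \<xi> *. w)) <= e * (h * ?n)"
        using order_trans[OF \<delta>0(2) mult_left_mono[OF n1]] n1 hb e by auto
      moreover have "norm (?r (\<xi> *. w)) <= e * (h * ?n)"
        using order_trans[OF \<delta>0(2) mult_left_mono[OF n2]] n2 hb e by auto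
      moreover have "?d =
         (?r (h *. v + \<xi> *. w)) - (?r (\<xi> *. w))" by (simp add: linear_add[OF lin] linear_scale[OF lin] add.assoc)
      ultimately have n3: "norm ?d <= 2 * (e * (h * ?n))" by (smt (verit) norm_triangle_ineq4)
      have "\<psi> (x + h *. v + h *. w) - \<psi> (x + h *. v) - \<psi> (x + h *. w) + \<psi> x - h * h * (S' v \<bullet> w)
        = h * (?d \<bullet> w)" using \<xi>(3) by (simp add: k_def algebra_simps)
      also have "\<bar>...\<bar> = h * \<bar>?d \<bullet> w\<bar>" using h by (simp add: abs_mult)
      also have "... <= h * (2 * (e * (h * ?n)) * norm w)"
        using h order_trans[OF Cauchy_Schwarz_ineq2 mult_right_mono[OF n3 norm_ge_zero]] by (intro mult_left_mono) auto
      finally show ?thesis by (simp add: mult_ac)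
    qed
    moreover have "\<delta> > 0" using \<delta>0 vw by (simp add: \<delta>_def)
    ultimately show ?thesis by blast
  qed
  have le: "\<bar>S' v \<bullet> w - S' w \<bullet> v\<bar> <= e * (2 * (norm v + norm w) * (norm v + norm w))" if e: "e > 0" for e
  proof -
    obtain \<delta>1 where \<delta>1: "\<delta>1 > 0" "!!h. 0 < h ==> h < \<delta>1 ==>
      ?Q h v w <= h * h * (2 * e * (norm v + norm w) * norm w)" using key[OF e, of v w] by blast
    obtain \<delta>2 where \<delta>2: "\<delta>2 > 0" "!!h. 0 < h ==> h < \<delta>2 ==>
      ?Q h w v <= h * h * (2 * e * (norm w + norm v) * norm v)" using key[OF e, of w v] by blast
    define h where "h = min \<delta>1 \<delta>2 / 2"
    have h: "0 < h" "h < \<delta>1" "h < \<delta>2" using \<delta>1(1) \<delta>2(1) by (auto simp: h_def)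
    have c: "x + h *. w + h *. v = x + h *. v + h *. w" by simp
    have "\<bar>h * h * (S' v \<bullet> w) - h * h * (S' w \<bullet> v)\<bar> <= h * h * (2 * e * (norm v + norm w) * norm w) + h * h * (2 * e * (norm w + norm v) * norm v)"
      using \<delta>1(2)[OF h(1,2)] \<delta>2(2)[OF h(1,3)] unfolding c by linarith
    also have "... = h * h * (e * (2 * (norm v + norm w) * (norm v + norm w)))" by (simp add: algebra_simps)
    finally have "\<bar>h * h * (S' v \<bullet> w - S' w \<bullet> v)\<bar> <= h * h * (e * (2 * (norm v + norm w) * (norm v + norm w)))"
      by (simp add: right_diff_distrib)
    then show ?thesis using h(1) by (simp add: abs_mult)
  qed
  have "\<bar>S' v \<bullet> w - S' w \<bullet> v\<bar> <= 0"
  proof (rule field_le_epsilon)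
    fix e :: real assume e: "e > 0"
    define M where "M = 2 * (norm v + norm w) * (norm v + norm w)"
    have M: "M >= 0" by (simp add: M_def)
    have "\<bar>S' v \<bullet> w - S' w \<bullet> v\<bar> <= e / (M + 1) * M"
    proof -
      have "e / (M + 1) > 0" using e M by simp
      from le[OF this] show ?thesis unfolding M_def .
    qed
    also have "... <= e" using e M by (simp add: field_simps)
    finally show "\<bar>S' v \<bullet> w - S' w \<bullet> v\<bar> <= 0 + e" by simp
  qed
  then show ?thesis by (simp add: inner_commute)
qed

text \<open>The defining inequalities are averaged over \<open>z\<close>; increments of the argument
  are scaled by \<open>a < 1\<close>. So the smoothed map is again a gradient, which is where
  symmetry and nonnegativity of \<open>oud\<close> come from.\<close>

lemma one_smooth_ou:
  assumes Q: "one_smooth \<phi> T" and a: "0 < a" "a < 1"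
  shows "one_smooth (ou a \<phi>) (\<lambda>x. a *. ou a T x)" unfolding one_smooth_def
proof (intro allI)
  fix x y :: 'a
  let ?b = "sqrt (1 - a^2)"
  note [measurable] = one_smooth_measurable[OF Q]
  have i: "integrable gauss (\<lambda>z. \<phi> (c + ?b *. z))" for c
  proof (rule integrable_gauss_quadratic)
    define K where "K = \<bar>\<phi> 0\<bar> + norm (T 0) + 1"
    have K: "K >= 0" by (simp add: K_def)
    show "norm (\<phi> (c + ?b *. z)) <= (K * (1 + norm c)^2) * (1 + norm z)^2" for z
    proof -
      have b1: "\<bar>?b\<bar> <= 1" using a by (simp add: abs_square_le_1)
      have "norm (c + ?b *. z) <= norm c + \<bar>?b\<bar> * norm z" using norm_triangle_ineq[of c "?b *. z"] by simp
      also have "... <= norm c + 1 * norm z" using b1 by (intro add_left_mono mult_right_mono) auto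
      finally have "1 + norm (c + ?b *. z) <= (1 + norm c) * (1 + norm z)"
      proof -
        have "(1 + norm c) * (1 + norm z) = 1 + norm c + norm z + norm c * norm z" by (simp add: algebra_simps)
        then show "norm (c + ?b *. z) <= norm c + 1 * norm z ==> ?thesis"
          using mult_nonneg_nonneg[OF norm_ge_zero norm_ge_zero, of c z] by linarith
      qed
      then have "(1 + norm (c + ?b *. z))^2 <= ((1 + norm c) * (1 + norm z))^2" by (intro power_mono) auto
      then have "K * (1 + norm (c + ?b *. z))^2 <= K * ((1 + norm c)^2 * (1 + norm z)^2)"
        using K by (intro mult_left_mono) (auto simp: power_mult_distrib)
      then show ?thesis using one_smooth_growth[OF Q, of "c + ?b *. z"] by (simp add: K_def)
    qed
  qed measurable
  have iT: "integrable gauss (\<lambda>z. T (rot a x z) \<bullet> (a *. (y - x)))"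
    by (intro integrable_inner_left ou_integrable[OF one_smooth_lipschitz[OF Q] a])
  define D where "D z = \<phi> (rot a y z) - \<phi> (rot a x z) - T (rot a x z) \<bullet> (a *. (y - x))" for z
  have Di: "integrable gauss D" unfolding D_def[abs_def] using i iT by auto
  have ID: "(\<oint>z. D z) = ou a \<phi> y - ou a \<phi> x - (a *. ou a T x) \<bullet> (y - x)"
  proof -
    have "(\<oint>z. D z) = ou a \<phi> y - ou a \<phi> x - (\<oint>z. T (rot a x z) \<bullet> (a *. (y - x)))"
      unfolding D_def ou_def using i iT by simp
    also have "(\<oint>z. T (rot a x z) \<bullet> (a *. (y - x))) = ou a T x \<bullet> (a *. (y - x))"
      unfolding ou_def by (rule integral_inner_left[OF ou_integrable[OF one_smooth_lipschitz[OF Q] a]])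
    finally show ?thesis by simp
  qed
  have "0 <= D z \<and> D z <= nsq (y - x) / 2" for z
  proof -
    have e: "(rot a y z) - (rot a x z) = a *. (y - x)" by (simp add: algebra_simps)
    have "a^2 <= 1" using a by (simp add: abs_square_le_1)
    then have "nsq (a *. (y - x)) / 2 <= nsq (y - x) / 2"
      using mult_right_mono[of "a^2" 1 "nsq (y - x)"] by (simp add: power_mult_distrib)
    then show ?thesis
      using Q[unfolded one_smooth_def, rule_format, of "rot a y z" "rot a x z"] unfolding D_def e by linarith
  qed
  then have D: "0 <= D z" "D z <= nsq (y - x) / 2" for z by auto
  have "(\<oint>z. D z) <= (\<integral>z. nsq (y - x) / 2 \<partial>(gauss::'a measure))"
    by (rule integral_mono[OF Di]) (simp_all only: D gauss.integrable_const)
  moreover have "0 <= (\<oint>z. D z)" by (intro Bochner_Integration.integral_nonneg D)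
  ultimately show "0 <= ou a \<phi> y - ou a \<phi> x - (a *. ou a T x) \<bullet> (y - x) \<and> ou a \<phi> y - ou a \<phi> x - (a *. ou a T x) \<bullet> (y - x) <= nsq (y - x) / 2"
    unfolding ID using gauss.prob_space[where 'a='a] by simp
qed

lemma oud_symmetric:
  assumes Q: "one_smooth \<phi> T" and a: "0 < a" "a < 1"
  shows "oud a T x v \<bullet> w = v \<bullet> oud a T x w"
proof -
  have "((\<lambda>x. a *. ou a T x) has_derivative (\<lambda>v. a *. (a *. oud a T x v))) (at x)"
    by (intro has_derivative_scaleR_right ou_has_derivative[OF one_smooth_lipschitz[OF Q] a])
  from one_smooth_derivative_symmetric[OF one_smooth_ou[OF Q a] this, of v w] show ?thesis using a by simp
qed

lemma oud_norm_le:
  assumes lip: "L-lipschitz_on UNIV f" and a: "0 < a" "a < 1"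
  shows "norm (oud a f x v) <= L * norm v"
proof -
  have "norm (a *. oud a f x v) <= L * a * norm v"
    by (rule lipschitz_derivative_bound[OF ou_lipschitz[OF lip a] ou_has_derivative[OF lip a]])
  then show ?thesis using a by simp
qed

lemma oud_nonneg:
  assumes Q: "one_smooth \<phi> T" and a: "0 < a" "a < 1"
  shows "0 <= oud a T x v \<bullet> v"
proof -
  have d: "((\<lambda>x. a *. ou a T x) has_derivative (\<lambda>v. a *. (a *. oud a T x v))) (at x)"
    by (intro has_derivative_scaleR_right ou_has_derivative[OF one_smooth_lipschitz[OF Q] a])
  have "0 <= (a *. (a *. oud a T x v)) \<bullet> v"
    by (rule monotone_derivative_nonneg[OF one_smooth_monotone[OF one_smooth_ou[OF Q a]] d])
  then have "a * a * 0 <= a * a * (oud a T x v \<bullet> v)" by simp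
  then show ?thesis using mult_le_cancel_left_pos[OF mult_pos_pos[OF a(1) a(1)]] by blast
qed

text \<open>Difference quotients of \<open>f\<close> are bounded by the Lipschitz constant, so they
  may be averaged before passing to the limit. This reconciles the definition by parts with the
  smoothed derivative.\<close>

lemma oud_of_derivative:
  fixes f :: "'a::euclidean_space => 'b::euclidean_space"
  assumes lip: "L-lipschitz_on UNIV f" and a: "0 < a" "a < 1" and d: "!!x. (f has_derivative f' x) (at x)"
  shows "integrable gauss (\<lambda>z. f' (rot a x z) v)"
    and "oud a f x v = (\<oint>z. f' (rot a x z) v)"
proof -
  let ?b = "sqrt (1 - a^2)"
  note [measurable] = lipschitz_measurable[OF lip]
  let ?h = "\<lambda>n. 1 / real (Suc n)" and ?y = "\<lambda>z. a *. x + sqrt (1 - a^2) *. z"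
  define g where "g n z = (f (?y z + ?h n *. v) - f (?y z)) /\<^sub>R (?h n)" for n and z
  have h0: "filterlim ?h (at 0) sequentially"
    using LIMSEQ_inverse_real_of_nat by (auto simp: filterlim_at inverse_eq_divide)
  have lim: "(\<lambda>n. g n z) ----> f' (?y z) v" for z
    unfolding g_def by (rule filterlim_compose[OF has_derivative_directional[OF d] h0])
  have [measurable]: "g n \<in> borel_funs" for n unfolding g_def by measurable
  have [measurable]: "(\<lambda>z. f' (?y z) v) \<in> borel_funs" by (rule borel_measurable_LIMSEQ_metric[OF _ lim]) measurable
  have bd: "norm (g n z) <= L * norm v" for n z
  proof -
    have "norm (f (?y z + ?h n *. v) - f (?y z)) <= L * (?h n * norm v)"
      using lipschitz_onD[OF lip, of "?y z + ?h n *. v" "?y z"] by (simp add: dist_norm)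
    then have "real (Suc n) * norm (f (?y z + ?h n *. v) - f (?y z)) <= real (Suc n) * (L * (?h n * norm v))"
      by (rule mult_left_mono) simp
    also have "... = L * norm v" by simp
    finally show ?thesis unfolding g_def by simp
  qed
  show "integrable gauss (\<lambda>z. f' (?y z) v)"
  proof (rule gauss.integrable_const_bound[where B="L * norm v"])
    show "AE z in gauss. norm (f' (?y z) v) <= L * norm v" by (intro AE_I2 lipschitz_derivative_bound[OF lip d])
  qed simp
  have conv: "(\<lambda>n. \<integral>z. g n z \<partial>gauss) ----> (\<oint>z. f' (?y z) v)"
    by (rule integral_dominated_convergence[where w="\<lambda>_. L * norm v"]) (use bd lim in auto)
  have "(\<oint>z. g n z) = (ou a f (x + ?h n *. ((1 / a) *. v)) - ou a f x) /\<^sub>R (?h n)" for n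
  proof -
    have "a *. (x + ?h n *. ((1 / a) *. v)) = a *. x + ?h n *. v" using a by (simp add: scaleR_add_right)
    then have "ou a f (x + ?h n *. ((1 / a) *. v)) = (\<oint>z. f (?y z + ?h n *. v))"
      unfolding ou_def by (simp add: add_ac)
    moreover have "integrable gauss (\<lambda>z. f (?y z + ?h n *. v))"
      using integrable_gauss_lipschitz(1)[OF lipschitz_affine[OF lip], of "a *. x + ?h n *. v" ?b] by (simp add: add_ac)
    ultimately show ?thesis unfolding g_def ou_def[of a f x] using ou_integrable[OF lip a, of x] by simp
  qed
  moreover have "(\<lambda>n. (ou a f (x + ?h n *. ((1 / a) *. v)) - ou a f x) /\<^sub>R (?h n)) ----> a *. oud a f x ((1 / a) *. v)"
    by (rule filterlim_compose[OF has_derivative_directional[OF ou_has_derivative[OF lip a]] h0])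
  moreover have "a *. oud a f x ((1 / a) *. v) = oud a f x v" using a by (simp add: linear_scale[OF oud_linear[OF lip a]])
  ultimately have "(\<lambda>n. \<integral>z. g n z \<partial>gauss) ----> oud a f x v" by simp
  with conv show "oud a f x v = (\<oint>z. f' (?y z) v)" by (rule LIMSEQ_unique[symmetric])
qed

text \<open>The two independent noises combine into one of the right variance;
  \<open>\<alpha>\<close> and \<open>\<beta>\<close> are their normalised weights.\<close>

lemma ou_semigroup:
  fixes f :: "'a::euclidean_space => 'b::euclidean_space"
  assumes lip: "L-lipschitz_on UNIV f" and q: "0 < q" "q < 1" and r: "0 < r" "r < 1"
  shows "ou (q * r) f x = ou q (ou r f) x"
proof -
  note [measurable] = lipschitz_measurable[OF lip]
  let ?bq = "sqrt (1 - q^2)" and ?br = "sqrt (1 - r^2)" and ?s = "sqrt (1 - (q * r)^2)"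
  have qr: "0 < q * r" "q * r < 1" using q r mult_strict_mono[of q 1 r 1] by auto
  have s: "?s > 0" "?s^2 = 1 - (q * r)^2" using ou_b_pos[OF lip qr] by auto
  have bq: "?bq > 0" "?bq^2 = 1 - q^2" using ou_b_pos[OF lip q] by auto
  have br: "?br > 0" "?br^2 = 1 - r^2" using ou_b_pos[OF lip r] by auto
  define \<alpha> where "\<alpha> = r * ?bq / ?s"
  define \<beta> where "\<beta> = ?br / ?s"
  have \<alpha>: "\<alpha> > 0" using r bq s by (simp add: \<alpha>_def)
  have "\<alpha>^2 + \<beta>^2 = (r^2 * ?bq^2 + ?br^2) / ?s^2" by (simp add: \<alpha>_def \<beta>_def power_divide power_mult_distrib add_divide_distrib)
  also have "... = (1 - (q * r)^2) / (1 - (q * r)^2)" unfolding s(2) bq(2) br(2) by (simp add: algebra_simps)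
  also have "... = 1" using s by simp
  finally have ab: "\<alpha>^2 + \<beta>^2 = 1" .
  let ?g = "\<lambda>w. f ((q * r) *. x + ?s *. w)"
  have d: "distr gauss2 borel (\<lambda>p. \<alpha> *. fst p + \<beta> *. snd p) = (gauss :: 'a measure)"
    by (rule distr_gauss_mix[OF \<alpha> ab])
  have gi: "integrable gauss2 (\<lambda>p. ?g (\<alpha> *. fst p + \<beta> *. snd p))"
    using ou_integrable[OF lip qr, of x] by (subst (asm) d[symmetric]) (subst (asm) integrable_distr_eq, auto)
  have "ou (q * r) f x = (\<integral>w. ?g w \<partial>distr gauss2 borel (\<lambda>p. \<alpha> *. fst p + \<beta> *. snd p))"
    unfolding d by (simp add: ou_def)
  also have "... = (\<integral>p. ?g (\<alpha> *. fst p + \<beta> *. snd p) \<partial>gauss2)" by (subst integral_distr) auto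
  also have "... = (\<oint>z. \<oint>w. ?g (\<alpha> *. z + \<beta> *. w))" using gauss2.integral_fst'[OF gi] by simp
  also have "... = ou q (ou r f) x"
  proof -
    have "(q * r) *. x + ?s *. (\<alpha> *. z + \<beta> *. w) = r *. (q *. x + ?bq *. z) + ?br *. w" for z w
      using s by (simp add: \<alpha>_def \<beta>_def scaleR_add_right)
    then show ?thesis by (simp add: ou_def)
  qed
  finally show ?thesis .
qed

text \<open>Differentiating the semigroup identity. This is a martingale property: the derivative
  under stronger smoothing is an average of derivatives under weaker smoothing. Strict positivity,
  the energy identity and the Jensen argument for \<open>ln det\<close> all use it.\<close>

lemma oud_semigroup:
  fixes f :: "'a::euclidean_space => 'b::euclidean_space"
  assumes lip: "L-lipschitz_on UNIV f" and q: "0 < q" "q < 1" and r: "0 < r" "r < 1"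
  shows "integrable gauss (\<lambda>z. oud r f (rot q x z) v)"
    and "oud (q * r) f x v = (\<oint>z. oud r f (rot q x z) v)"
proof -
  have qr: "0 < q * r" "q * r < 1" using q r mult_strict_mono[of q 1 r 1] by auto
  note lr = ou_lipschitz[OF lip r] and dr = ou_has_derivative[OF lip r]
  have i: "integrable gauss (\<lambda>z. r *. oud r f (rot q x z) v)"
    and e: "oud q (ou r f) x v = (\<oint>z. r *. oud r f (rot q x z) v)" using oud_of_derivative[OF lr q dr] by auto
  have "integrable gauss (\<lambda>z. (1 / r) *. (r *. oud r f (rot q x z) v))" by (rule integrable_scaleR_right[OF i])
  then show "integrable gauss (\<lambda>z. oud r f (rot q x z) v)" using r by simp
  have "ou (q * r) f = ou q (ou r f)" using ou_semigroup[OF lip q r] by auto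
  then have "(ou (q * r) f has_derivative (\<lambda>v. q *. oud q (ou r f) x v)) (at x)"
    using ou_has_derivative[OF lr q, of x] by simp
  then have "(\<lambda>v. q *. oud q (ou r f) x v) = (\<lambda>v. (q * r) *. oud (q * r) f x v)"
    by (rule has_derivative_unique[OF _ ou_has_derivative[OF lip qr]])
  then have "q *. oud q (ou r f) x v = (q * r) *. oud (q * r) f x v" by (rule fun_cong)
  then have "q *. (r *. (\<oint>z. oud r f (rot q x z) v)) = q *. (r *. oud (q * r) f x v)" by (simp add: e)
  then show "oud (q * r) f x v = (\<oint>z. oud r f (rot q x z) v)" using q r by simp
qed

lemma ou_close:
  fixes f :: "'a::euclidean_space => 'b::euclidean_space"
  assumes lip: "L-lipschitz_on UNIV f" and a: "0 < a" "a < 1"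
  shows "norm (ou a f x - f x) <= L * ((1 - a) * norm x + sqrt (1 - a^2) * (\<oint>z. norm (z::'a)))"
proof -
  let ?b = "sqrt (1 - a^2)"
  note [measurable] = lipschitz_measurable[OF lip]
  have ni: "integrable gauss (\<lambda>z::'a. norm z)" by (rule integrable_gauss_linear[where C=1]) auto
  have L0: "L >= 0" by (rule lipschitz_on_nonneg[OF lip])
  have "ou a f x - f x = (\<oint>z. f (rot a x z) - f x)"
    unfolding ou_def using ou_integrable[OF lip a, of x] gauss.prob_space[where 'a='a] by simp
  also have "norm ... <= (\<oint>z. L * ((1 - a) * norm x + ?b * norm (z::'a)))"
  proof (rule Bochner_Integration.integral_norm_bound_integral)
    show "integrable gauss (\<lambda>z. f (rot a x z) - f x)" using ou_integrable[OF lip a, of x] by auto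
    show "integrable gauss (\<lambda>z::'a. L * ((1 - a) * norm x + ?b * norm z))" using ni by auto
    fix z :: 'a
    have "norm (f (rot a x z) - f x) <= L * norm ((rot a x z) - x)"
      using lipschitz_onD[OF lip, of "rot a x z" x] by (simp add: dist_norm)
    also have "(rot a x z) - x = ?b *. z - (1 - a) *. x" by (simp add: algebra_simps)
    also have "L * norm ... <= L * ((1 - a) * norm x + ?b * norm z)"
    proof (rule mult_left_mono[OF _ L0])
      have "norm (?b *. z - (1 - a) *. x) <= norm (?b *. z) + norm ((1 - a) *. x)" by (rule norm_triangle_ineq4)
      then show "norm (?b *. z - (1 - a) *. x) <= (1 - a) * norm x + ?b * norm z" using a ou_b_pos[OF lip a] by simp
    qed
    finally show "norm (f (rot a x z) - f x) <= L * ((1 - a) * norm x + ?b * norm z)" .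
  qed
  also have "... = L * ((1 - a) * norm x + ?b * (\<oint>z. norm (z::'a)))" using ni gauss.prob_space[where 'a='a] by simp
  finally show ?thesis .
qed

lemma ou_tendsto:
  fixes f :: "'a::euclidean_space => 'b::euclidean_space"
  assumes lip: "L-lipschitz_on UNIV f"
  shows "((\<lambda>a. ou a f x) \<longlongrightarrow> f x) (at_left 1)"
proof (rule LIM_zero_cancel, rule Lim_null_comparison)
  show "\<forall>\<^sub>F a in at_left 1. norm (ou a f x - f x) <= L * ((1 - a) * norm x + sqrt (1 - a^2) * (\<oint>z. norm (z::'a)))"
    using eventually_at_left_real[of 0 "1::real"] by (auto elim!: eventually_mono intro!: ou_close[OF lip])
  have "((\<lambda>a. L * ((1 - a) * norm x + sqrt (1 - a^2) * (\<oint>z. norm (z::'a)))) \<longlongrightarrow> L * ((1 - 1) * norm x + sqrt (1 - 1^2) * (\<oint>z. norm (z::'a)))) (at_left 1)"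
    by (intro tendsto_intros)
  then show "((\<lambda>a. L * ((1 - a) * norm x + sqrt (1 - a^2) * (\<oint>z. norm (z::'a)))) \<longlongrightarrow> 0) (at_left 1)" by simp
qed

lemma gauss_full_support:
  fixes f :: "'a::euclidean_space => real"
  assumes c: "continuous_on UNIV f" and nn: "!!x. 0 <= f x" and i: "integrable gauss f" and z: "(\<oint>x. f x) = 0"
  shows "f x = 0"
proof (rule ccontr)
  assume "f x ~= 0"
  then have pos: "f x > 0" using nn[of x] by simp
  have [measurable]: "f \<in> borel_funs" by (rule borel_measurable_continuous_onI[OF c])
  have "AE y in gauss. f y = 0" using z i nn by (subst (asm) integral_nonneg_eq_0_iff_AE) auto
  then have "AE y in lborel. f y = 0" unfolding gauss_def by (subst (asm) AE_density) (auto simp: gauss_density_pos)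
  then have "AE y in lborel. y \<notin> {y. f y > 0}" by eventually_elim simp
  moreover have op: "open {y. f y > 0}" using c by (intro open_Collect_less) auto
  ultimately have "emeasure lborel {y. f y > 0} = 0" by (subst (asm) AE_iff_measurable[OF _ refl]) auto
  then have "negligible {y. f y > 0}" by (simp add: negligible_iff_emeasure0)
  then have "{y. f y > 0} = {}" using op open_not_negligible by blast
  then show False using pos by auto
qed

text \<open>If the form vanished at one point, the martingale property and full support would make
  it vanish everywhere at each level \<open>r\<close> between \<open>a\<close> and 1. Symmetry and
  nonnegativity then force \<open>oud r T y w \<bullet> v = 0\<close> for all \<open>w\<close>, so
  \<open>ou r T\<close> is constant along \<open>v\<close>; letting \<open>r\<close> tend to 1, so
  is \<open>T\<close>, against \<open>nc\<close>.\<close>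

lemma oud_pos:
  assumes Q: "one_smooth \<phi> T" and a: "0 < a" "a < 1" and v: "v ~= 0"
    and nc: "!!v c. v ~= 0 ==> \<exists>x. T x \<bullet> v ~= c"
  shows "0 < oud a T x v \<bullet> v"
proof (rule ccontr)
  note lip = one_smooth_lipschitz[OF Q]
  assume "\<not> ?thesis"
  then have z: "oud a T x v \<bullet> v = 0" using oud_nonneg[OF Q a, of x v] by linarith
  have const: "ou r T y \<bullet> v = ou r T 0 \<bullet> v" if r: "a < r" "r < 1" for r y
  proof -
    define q where "q = a / r"
    have r0: "0 < r" using a r by linarith
    have q: "0 < q" "q < 1" "q * r = a" using a r r0 by (auto simp: q_def)
    have "oud a T x v = (\<oint>z. oud r T (rot q x z) v)" using oud_semigroup(2)[OF lip q(1,2) r0 r(2)] q(3) by simp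
    then have z': "(\<oint>z. oud r T (rot q x z) v \<bullet> v) = 0" using z oud_semigroup(1)[OF lip q(1,2) r0 r(2)] by simp
    have fz: "oud r T (rot q x z) v \<bullet> v = 0" for z
    proof (rule gauss_full_support[OF _ _ _ z'])
      show "continuous_on UNIV (\<lambda>z. oud r T (rot q x z) v \<bullet> v)"
        by (intro continuous_intros continuous_on_compose2[OF oud_continuous[OF lip r0 r(2)]]) auto
    qed (use oud_nonneg[OF Q r0 r(2)] oud_semigroup(1)[OF lip q(1,2) r0 r(2)] in auto)
    have q0: "sqrt (1 - q^2) > 0" by (rule ou_b_pos[OF lip q(1,2)])
    have zero: "oud r T y v \<bullet> v = 0" for y
    proof -
      have "q *. x + sqrt (1 - q^2) *. ((y - q *. x) /\<^sub>R sqrt (1 - q^2)) = y" using q0 by simp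
      then show ?thesis using fz[of "(y - q *. x) /\<^sub>R sqrt (1 - q^2)"] by metis
    qed
    have zero': "oud r T y w \<bullet> v = 0" for y w
    proof (rule ccontr)
      let ?B = "\<lambda>u w. oud r T y u \<bullet> w"
      assume n: "?B w v ~= 0"
      have lin: "linear (oud r T y)" by (rule oud_linear[OF lip r0 r(2)])
      \<comment> \<open>With the quadratic coefficient zero, the form at \<open>w + s *. v\<close>
        is affine in \<open>s\<close>; this \<open>s\<close> gives it the value -1.\<close>
      define s where "s = - (?B w w + 1) / (2 * ?B w v)"
      have "0 <= ?B (w + s *. v) (w + s *. v)" by (rule oud_nonneg[OF Q r0 r(2)])
      also have "... = ?B w w + s * ?B w v + s * ?B v w + s * s * ?B v v"
        by (simp add: linear_add[OF lin] linear_scale[OF lin] algebra_simps)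
      also have "?B v w = ?B w v" using oud_symmetric[OF Q r0 r(2), of y v w] by (simp add: inner_commute)
      also have "?B w w + s * ?B w v + s * ?B w v + s * s * ?B v v = - 1" using n zero[of y] by (simp add: s_def)
      finally show False by simp
    qed
    have "\<exists>c. \<forall>y\<in>UNIV. ou r T y \<bullet> v = c"
    proof (rule has_derivative_zero_constant[of UNIV "\<lambda>y. ou r T y \<bullet> v"])
      fix y
      have "((\<lambda>y. ou r T y \<bullet> v) has_derivative (\<lambda>w. (r *. oud r T y w) \<bullet> v)) (at y)"
        by (intro has_derivative_inner_left ou_has_derivative[OF lip r0 r(2)])
      then show "((\<lambda>y. ou r T y \<bullet> v) has_derivative (\<lambda>h. 0)) (at y within UNIV)" by (simp add: zero')
    qed simp
    then obtain c where "!!y. ou r T y \<bullet> v = c" by auto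
    then show ?thesis by simp
  qed
  have "T y \<bullet> v = T 0 \<bullet> v" for y
  proof (rule tendsto_unique)
    show "((\<lambda>r. ou r T y \<bullet> v) \<longlongrightarrow> T y \<bullet> v) (at_left 1)" by (intro tendsto_intros ou_tendsto[OF lip])
    have "\<forall>\<^sub>F r in at_left 1. ou r T 0 \<bullet> v = ou r T y \<bullet> v"
      by (rule eventually_mono[OF eventually_at_left_real[OF a(2)]], rule const[symmetric]) auto
    moreover have "((\<lambda>r. ou r T 0 \<bullet> v) \<longlongrightarrow> T 0 \<bullet> v) (at_left 1)" by (intro tendsto_intros ou_tendsto[OF lip])
    ultimately show "((\<lambda>r. ou r T y \<bullet> v) \<longlongrightarrow> T 0 \<bullet> v) (at_left 1)" by (rule Lim_transform_eventually[rotated])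
  qed simp
  then show False using nc[OF v, of "T 0 \<bullet> v"] by simp
qed

section \<open>Positive definite matrices\<close>

definition pos_def :: "real ^ 'n ^ 'n => bool" where
  "pos_def A \<longleftrightarrow> transpose A = A \<and> (\<forall>v. v ~= 0 --> 0 < v \<bullet> (A *v v))"

definition diag_mat :: "('n => real) => real ^ 'n ^ 'n" where
  "diag_mat d = (\<chi> i j. if i = j then d i else 0)"

definition hs_norm_sq :: "real ^ 'n ^ 'n => real" where
  "hs_norm_sq A = (\<Sum>i\<in>UNIV. \<Sum>j\<in>UNIV. (A $ i $ j)^2)"

lemma matrix_inv_mult:
  fixes A :: "real ^ 'n ^ 'n"
  assumes "invertible A" shows "A ** matrix_inv A = mat 1" "matrix_inv A ** A = mat 1"
  using someI_ex[OF assms[unfolded invertible_def]] unfolding matrix_inv_def by auto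

lemma matrix_inv_eqI:
  fixes A B :: "real ^ 'n ^ 'n"
  assumes "A ** B = mat 1" "B ** A = mat 1" shows "matrix_inv A = B"
proof -
  have "invertible A" using assms by (auto simp: invertible_def)
  then have "matrix_inv A = matrix_inv A ** (A ** B)" "matrix_inv A ** A = mat 1"
    using assms matrix_inv_mult by simp_all
  then show ?thesis by (metis matrix_mul_assoc matrix_mul_lid)
qed

lemma inner_matrix_transpose: "u \<bullet> (P *v v) = (transpose P *v u) \<bullet> v" for P :: "real ^ 'n ^ 'n"
  by (metis dot_lmul_matrix vector_transpose_matrix transpose_transpose)

lemma symmetric_matrix_inner: "transpose A = A ==> u \<bullet> (A *v v) = (A *v u) \<bullet> (v :: real ^ 'n)"
  by (simp add: inner_matrix_transpose)

lemma pos_def_symmetric: "pos_def A ==> transpose A = A"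
  and pos_def_pos: "pos_def A ==> v ~= 0 ==> 0 < v \<bullet> (A *v v)" by (auto simp: pos_def_def)

text \<open>Along \<open>u + s *. w\<close> the form has no quadratic term in \<open>s\<close>, so a
  nonzero linear term would make it negative; the chosen \<open>s\<close> gives -1.\<close>

lemma psd_form_zero:
  fixes C :: "real ^ 'n ^ 'n"
  assumes sym: "transpose C = C" and S: "subspace S" and psd: "!!x. x \<in> S ==> 0 <= x \<bullet> (C *v x)"
    and w: "w \<in> S" "w \<bullet> (C *v w) = 0" and u: "u \<in> S"
  shows "u \<bullet> (C *v w) = 0"
proof (rule ccontr)
  assume n: "u \<bullet> (C *v w) ~= 0"
  define s where "s = - (u \<bullet> (C *v u) + 1) / (2 * (u \<bullet> (C *v w)))"
  have "u + s *. w \<in> S" using S u w by (simp add: subspace_add subspace_scale)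
  then have "0 <= (u + s *. w) \<bullet> (C *v (u + s *. w))" by (rule psd)
  also have "... = u \<bullet> (C *v u) + s * (u \<bullet> (C *v w)) + s * (w \<bullet> (C *v u)) + s * s * (w \<bullet> (C *v w))"
    by (simp add: algebra_simps)
  also have "w \<bullet> (C *v u) = u \<bullet> (C *v w)" using symmetric_matrix_inner[OF sym, of w u] by (simp add: inner_commute)
  also have "u \<bullet> (C *v u) + s * (u \<bullet> (C *v w)) + s * (u \<bullet> (C *v w)) + s * s * (w \<bullet> (C *v w)) = - 1"
    using n w by (simp add: s_def)
  finally show False by simp
qed

text \<open>A maximiser \<open>w0\<close> of the Rayleigh quotient of \<open>B\<close> against
  \<open>M\<close> on the unit sphere of \<open>S\<close>: with the maximal value
  \<open>\<beta>\<close>, \<open>\<beta> *. M - B\<close> is nonnegative on \<open>S\<close> and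
  zero at \<open>w0\<close>, so \<open>w0\<close> lies in its kernel relative to
  \<open>S\<close>.\<close>

lemma generalized_eigenvector:
  fixes M B :: "real ^ 'n ^ 'n"
  assumes M: "pos_def M" and B: "transpose B = B" and S: "subspace S" and ne: "u0 \<in> S" "u0 ~= 0"
  obtains w \<beta> where "w \<in> S" "w \<bullet> (M *v w) = 1" "!!u. u \<in> S ==> u \<bullet> (B *v w) = \<beta> * (u \<bullet> (M *v w))"
proof -
  define K where "K = S \<inter> sphere 0 1"
  have cK: "compact K" unfolding K_def using closed_subspace[OF S] by (intro closed_Int_compact) auto
  have "u0 /\<^sub>R norm u0 \<in> K" using ne S by (simp add: K_def subspace_scale)
  then have Kne: "K ~= {}" by auto
  have Kn0: "x ~= 0" if "x \<in> K" for x using that by (auto simp: K_def)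
  have "continuous_on K (\<lambda>x. (x \<bullet> (B *v x)) / (x \<bullet> (M *v x)))"
  proof (intro continuous_intros)
    show "\<forall>x\<in>K. x \<bullet> (M *v x) ~= 0" using pos_def_pos[OF M Kn0] by fastforce
  qed
  then obtain w0 where w0: "w0 \<in> K" "!!x. x \<in> K ==> (x \<bullet> (B *v x)) / (x \<bullet> (M *v x)) <= (w0 \<bullet> (B *v w0)) / (w0 \<bullet> (M *v w0))"
    using continuous_attains_sup[OF cK Kne] by blast
  define \<beta> where "\<beta> = (w0 \<bullet> (B *v w0)) / (w0 \<bullet> (M *v w0))"
  have w0p: "0 < w0 \<bullet> (M *v w0)" using pos_def_pos[OF M Kn0[OF w0(1)]] .
  define C where "C = \<beta> *. M - B"
  have Cv: "x \<bullet> (C *v y) = \<beta> * (x \<bullet> (M *v y)) - x \<bullet> (B *v y)" for x y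
    by (simp add: C_def matrix_vector_mult_diff_rdistrib inner_diff_right scaleR_matrix_vector_assoc[symmetric])
  have symC: "transpose C = C" using B pos_def_symmetric[OF M] by (auto simp: C_def transpose_def vec_eq_iff)
  have psd: "0 <= x \<bullet> (C *v x)" if x: "x \<in> S" for x
  proof (cases "x = 0")
    case False
    define y where "y = x /\<^sub>R norm x"
    have y: "y \<in> K" using x False S by (simp add: y_def K_def subspace_scale)
    have "(y \<bullet> (B *v y)) / (y \<bullet> (M *v y)) <= \<beta>" unfolding \<beta>_def by (rule w0(2)[OF y])
    then have "y \<bullet> (B *v y) <= \<beta> * (y \<bullet> (M *v y))" using pos_def_pos[OF M Kn0[OF y]] by (simp add: divide_le_eq)
    then have "0 <= y \<bullet> (C *v y)" by (simp add: Cv)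
    then have "0 <= (norm x * norm x) * (y \<bullet> (C *v y))" by simp
    also have "... = x \<bullet> (C *v x)" by (simp add: y_def matrix_vector_mult_scaleR field_simps)
    finally show ?thesis .
  qed simp
  have w0S: "w0 \<in> S" using w0 by (simp add: K_def)
  have w0C: "w0 \<bullet> (C *v w0) = 0" using w0p by (simp add: Cv \<beta>_def)
  define r where "r = sqrt (w0 \<bullet> (M *v w0))"
  have r: "r > 0" "r * r = w0 \<bullet> (M *v w0)" using w0p by (auto simp: r_def)
  show ?thesis
  proof (rule that[of "w0 /\<^sub>R r" \<beta>])
    show "w0 /\<^sub>R r \<in> S" using w0S S by (simp add: subspace_scale)
    show "(w0 /\<^sub>R r) \<bullet> (M *v (w0 /\<^sub>R r)) = 1" using r w0p by (simp add: matrix_vector_mult_scaleR field_simps)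
    fix u assume u: "u \<in> S"
    have "u \<bullet> (C *v w0) = 0" by (rule psd_form_zero[OF symC S _ w0S w0C u]) (rule psd)
    then show "u \<bullet> (B *v (w0 /\<^sub>R r)) = \<beta> * (u \<bullet> (M *v (w0 /\<^sub>R r)))" by (simp add: Cv matrix_vector_mult_scaleR)
  qed
qed

text \<open>Each new vector is found in the \<open>M\<close>-orthogonal complement \<open>S\<close>
  of those already present, which is nontrivial by a dimension count.\<close>

lemma generalized_eigenbasis:
  fixes M B :: "real ^ 'n ^ 'n"
  assumes M: "pos_def M" and B: "transpose B = B" and k: "k <= CARD('n)"
  shows "\<exists>W. finite W \<and> card W = k \<and> (\<forall>w\<in>W. w \<bullet> (M *v w) = 1 \<and> (\<exists>\<beta>. B *v w = \<beta> *. (M *v w)))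
     \<and> (\<forall>w\<in>W. \<forall>w'\<in>W. w ~= w' --> w \<bullet> (M *v w') = 0)" using k
proof (induction k)
  case 0 then show ?case by (intro exI[of _ "{}"]) auto
next
  case (Suc k)
  then obtain W where W: "finite W" "card W = k" "!!w. w \<in> W ==> w \<bullet> (M *v w) = 1"
    "!!w. w \<in> W ==> \<exists>\<beta>. B *v w = \<beta> *. (M *v w)" "!!w w'. w \<in> W ==> w' \<in> W ==> w ~= w' ==> w \<bullet> (M *v w') = 0" by auto
  note symM = pos_def_symmetric[OF M]
  have Msym: "u \<bullet> (M *v v) = v \<bullet> (M *v u)" for u v
    using symmetric_matrix_inner[OF symM, of u v] by (simp add: inner_commute)
  have Bsym: "u \<bullet> (B *v v) = v \<bullet> (B *v u)" for u v
    using symmetric_matrix_inner[OF B, of u v] by (simp add: inner_commute)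
  define S where "S = {u. \<forall>w\<in>W. u \<bullet> (M *v w) = 0}"
  have S: "subspace S" by (auto simp: S_def subspace_def inner_add_left)
  have "dim ((\<lambda>w. M *v w) ` W) <= card ((\<lambda>w. M *v w) ` W)" using W by (intro dim_le_card') auto
  also have "... <= k" using card_image_le[OF W(1)] W(2) by simp
  also have "... < DIM(real ^ 'n)" using Suc.prems by simp
  finally obtain u0 where u0: "u0 ~= 0" "!!y. y \<in> span ((\<lambda>w. M *v w) ` W) ==> orthogonal u0 y"
    using orthogonal_to_subspace_exists by blast
  have "u0 \<in> S" unfolding S_def using u0(2)[OF span_base] by (auto simp: orthogonal_def)
  then obtain w \<beta> where w: "w \<in> S" "w \<bullet> (M *v w) = 1" and eig: "!!u. u \<in> S ==> u \<bullet> (B *v w) = \<beta> * (u \<bullet> (M *v w))"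
    using generalized_eigenvector[OF M B S _ u0(1)] by blast
  have wW: "w \<bullet> (M *v x) = 0" "x \<bullet> (M *v w) = 0" if "x \<in> W" for x using w that by (auto simp: S_def Msym[of x w])
  \<comment> \<open>So far the eigenvector equation is tested only against \<open>S\<close>.
    Splitting \<open>u\<close> along \<open>W\<close> extends it to all \<open>u\<close>: elements
    of \<open>W\<close> are eigenvectors and \<open>M\<close>-orthogonal to \<open>w\<close>, so
    both sides vanish on them.\<close>
  have "u \<bullet> (B *v w) = u \<bullet> (\<beta> *. (M *v w))" for u
  proof -
    define u' where "u' = u - (\<Sum>x\<in>W. (u \<bullet> (M *v x)) *. x)"
    have "u' \<in> S" unfolding S_def
    proof (intro CollectI ballI)
      fix x assume x: "x \<in> W"
      have "(\<Sum>y\<in>W. (u \<bullet> (M *v y)) *. y) \<bullet> (M *v x) = (\<Sum>y\<in>W. (u \<bullet> (M *v y)) * (y \<bullet> (M *v x)))"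
        by (simp add: inner_sum_left)
      also have "... = (\<Sum>y\<in>W. if y = x then u \<bullet> (M *v x) else 0)" using W x by (intro sum.cong) auto
      also have "... = u \<bullet> (M *v x)" using W x by simp
      finally show "u' \<bullet> (M *v x) = 0" by (simp add: u'_def inner_diff_left)
    qed
    then have 1: "u' \<bullet> (B *v w) = \<beta> * (u' \<bullet> (M *v w))" by (rule eig)
    have 2: "x \<bullet> (B *v w) = 0" if xW: "x \<in> W" for x
    proof -
      obtain m where "B *v x = m *. (M *v x)" using W(4)[OF xW] by blast
      then show ?thesis using wW[OF xW] by (simp add: Bsym[of x w])
    qed
    have u: "u = u' + (\<Sum>x\<in>W. (u \<bullet> (M *v x)) *. x)" by (simp add: u'_def)
    have "u \<bullet> (B *v w) = u' \<bullet> (B *v w)" by (subst u) (simp add: inner_add_left inner_sum_left 2)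
    moreover have "u \<bullet> (M *v w) = u' \<bullet> (M *v w)" by (subst u) (simp add: inner_add_left inner_sum_left wW)
    ultimately show ?thesis using 1 by simp
  qed
  then have ew: "B *v w = \<beta> *. (M *v w)" by (subst vector_eq_ldot[symmetric]) blast
  have nW: "w \<notin> W" using wW(1)[of w] w(2) by auto
  show ?case
  proof (intro exI[of _ "insert w W"] conjI)
    show "card (insert w W) = Suc k" using W nW by simp
    show "\<forall>v\<in>insert w W. v \<bullet> (M *v v) = 1 \<and> (\<exists>\<beta>. B *v v = \<beta> *. (M *v v))" using W w ew by auto
    show "\<forall>v\<in>insert w W. \<forall>v'\<in>insert w W. v ~= v' --> v \<bullet> (M *v v') = 0" using W wW by auto
  qed (use W in simp)
qed

lemma matrix_congruence_entry:
  "(R ** A ** transpose R) $ i $ j = (R $ i) \<bullet> (A *v (R $ j))" for R A :: "real ^ 'n ^ 'n"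
  by (simp add: matrix_matrix_mult_def matrix_vector_mult_def transpose_def inner_vec_def sum_distrib_left mult_ac)
     (subst sum.swap, simp)

text \<open>The rows of \<open>R\<close> are an \<open>M\<close>-orthonormal basis of generalised
  eigenvectors. Congruence by \<open>R\<close> takes \<open>M\<close> to the identity and
  \<open>B\<close> to a diagonal matrix, and \<open>P\<close> undoes it.\<close>

theorem simultaneous_diagonalization:
  fixes M B :: "real ^ 'n ^ 'n"
  assumes M: "pos_def M" and B: "transpose B = B"
  obtains P :: "real ^ 'n ^ 'n" and d where "invertible P" "M = P ** transpose P" "B = P ** diag_mat d ** transpose P"
proof -
  obtain W where W: "finite W" "card W = CARD('n)" "!!w. w \<in> W ==> w \<bullet> (M *v w) = 1"
    "!!w. w \<in> W ==> \<exists>\<beta>. B *v w = \<beta> *. (M *v w)" "!!w w'. w \<in> W ==> w' \<in> W ==> w ~= w' ==> w \<bullet> (M *v w') = 0"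
    using generalized_eigenbasis[OF M B order_refl] by auto
  obtain f where f: "bij_betw f (UNIV :: 'n set) W" using finite_same_card_bij[of "UNIV :: 'n set" W] W(1,2) by auto
  have fW: "f i \<in> W" for i using f by (auto simp: bij_betw_def)
  have fi: "f i = f j \<longleftrightarrow> i = j" for i j using f by (auto simp: bij_betw_def inj_on_def)
  obtain \<beta> where \<beta>: "!!w. w \<in> W ==> B *v w = \<beta> w *. (M *v w)" using W(4) by metis
  define R where "R = (\<chi> i. f i)"
  have RM: "R ** M ** transpose R = mat 1"
    unfolding vec_eq_iff matrix_congruence_entry using W fW fi by (auto simp: R_def mat_def)
  have RB: "R ** B ** transpose R = diag_mat (\<lambda>i. \<beta> (f i))"
    unfolding vec_eq_iff matrix_congruence_entry using W fW fi by (auto simp: R_def diag_mat_def \<beta>)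
  have inv: "invertible R" using RM by (metis invertible_right_inverse matrix_mul_assoc)
  define P where "P = matrix_inv R"
  have PR: "P ** R = mat 1" "R ** P = mat 1" using matrix_inv_mult[OF inv] by (simp_all add: P_def)
  have PRt: "transpose R ** transpose P = mat 1" using PR by (metis matrix_transpose_mul transpose_mat)
  have recover: "A = P ** (R ** A ** transpose R) ** transpose P" for A :: "real ^ 'n ^ 'n"
  proof -
    have "P ** (R ** A ** transpose R) ** transpose P = (P ** R) ** A ** (transpose R ** transpose P)"
      by (simp add: matrix_mul_assoc)
    then show ?thesis by (simp add: PR PRt)
  qed
  show ?thesis
  proof (rule that)
    show "invertible P" using PR by (auto simp: invertible_def)
    show "M = P ** transpose P" using recover[of M] by (simp add: RM)
    show "B = P ** diag_mat (\<lambda>i. \<beta> (f i)) ** transpose P" using recover[of B] by (simp add: RB)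
  qed
qed

lemma diag_mat_mult: "diag_mat a ** diag_mat b = diag_mat (\<lambda>i. a i * b i)"
  by (auto simp: diag_mat_def matrix_matrix_mult_def vec_eq_iff if_distrib[of "\<lambda>x. _ * x"] cong: if_cong)

lemma diag_congruence_entry:
  "(P ** diag_mat d ** transpose P) $ i $ j = (\<Sum>k\<in>UNIV. P $ i $ k * d k * P $ j $ k)"
  by (simp add: diag_mat_def matrix_matrix_mult_def transpose_def if_distrib[of "\<lambda>x. _ * x"] cong: if_cong)

lemma diag_mat_one: "diag_mat (\<lambda>_. 1) = mat 1"
  and transpose_diag_mat: "transpose (diag_mat a) = diag_mat a"
  by (auto simp: diag_mat_def vec_eq_iff mat_def transpose_def)

lemma det_diag_mat: "det (diag_mat d) = (\<Prod>i\<in>UNIV. d i)" by (subst det_diagonal) (auto simp: diag_mat_def)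

lemma trace_diag_mat: "trace (diag_mat d) = (\<Sum>i\<in>UNIV. d i)" by (simp add: trace_def diag_mat_def)

lemma diag_mat_congruence_pos:
  fixes P :: "real ^ 'n ^ 'n"
  assumes P: "invertible P" and pd: "pos_def (P ** diag_mat d ** transpose P)"
  shows "0 < d i"
proof -
  define w where "w = transpose (matrix_inv P) *v axis i 1"
  have "transpose P ** transpose (matrix_inv P) = mat 1"
    using matrix_inv_mult(2)[OF P] by (metis matrix_transpose_mul transpose_mat)
  then have Pw: "transpose P *v w = axis i 1" by (simp only: w_def matrix_vector_mul_assoc matrix_vector_mul_lid)
  have "w ~= 0"
  proof
    assume "w = 0"
    then have "axis i (1::real) = 0" using Pw by simp
    then show False by simp
  qed
  then have "0 < w \<bullet> ((P ** diag_mat d ** transpose P) *v w)" by (rule pos_def_pos[OF pd])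
  also have "(P ** diag_mat d ** transpose P) *v w = P *v (diag_mat d *v axis i 1)"
    by (simp only: Pw flip: matrix_vector_mul_assoc)
  also have "w \<bullet> (P *v (diag_mat d *v axis i 1)) = (transpose P *v w) \<bullet> (diag_mat d *v axis i 1)"
    by (rule inner_matrix_transpose)
  also have "... = axis i 1 \<bullet> (diag_mat d *v axis i 1)" by (simp only: Pw)
  also have "... = d i" by (simp add: matrix_vector_mult_basis column_def inner_axis' diag_mat_def)
  finally show ?thesis .
qed

lemma det_congruence: "det (P ** D ** transpose P) = (det P)^2 * det D" for P D :: "real ^ 'n ^ 'n"
  by (simp add: det_mul power2_eq_square)

lemma pos_def_det_pos:
  fixes A :: "real ^ 'n ^ 'n"
  assumes "pos_def A" shows "0 < det A"
proof -
  obtain P :: "real ^ 'n ^ 'n" and d where "invertible P" "A = P ** transpose P"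
    using simultaneous_diagonalization[OF assms pos_def_symmetric[OF assms]] by metis
  then have "det A = (det P)^2" "det P ~= 0" by (simp_all add: det_mul invertible_det_nz power2_eq_square)
  then show ?thesis by simp
qed

text \<open>Concavity of \<open>ln det\<close> through its tangent plane at \<open>M\<close>. After
  simultaneous diagonalisation it reduces to \<open>ln d <= d - 1\<close> for each
  eigenvalue.\<close>

lemma ln_det_tangent:
  fixes M B :: "real ^ 'n ^ 'n"
  assumes M: "pos_def M" and B: "pos_def B"
  shows "ln (det B) <= ln (det M) + trace (matrix_inv M ** B) - real CARD('n)"
proof -
  obtain P :: "real ^ 'n ^ 'n" and d where P: "invertible P" "M = P ** transpose P" "B = P ** diag_mat d ** transpose P"
    using simultaneous_diagonalization[OF M pos_def_symmetric[OF B]] .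
  have d: "0 < d i" for i using diag_mat_congruence_pos[OF P(1)] B P(3) by metis
  have dP: "(det P)^2 > 0" using P(1) by (simp add: invertible_det_nz)
  have detM: "det M = (det P)^2" by (simp add: P(2) det_mul power2_eq_square)
  have detB: "det B = (det P)^2 * (\<Prod>i\<in>UNIV. d i)" by (simp add: P(3) det_congruence det_diag_mat)
  have "ln (det B) = ln (det M) + (\<Sum>i\<in>UNIV. ln (d i))"
    unfolding detB detM using dP d d[THEN less_imp_neq, symmetric] by (simp add: ln_mult ln_prod)
  also have "... <= ln (det M) + (\<Sum>i\<in>UNIV. d i - 1)" using d by (intro add_left_mono sum_mono ln_le_minus_one)
  also have "(\<Sum>i\<in>UNIV. d i - 1) = trace (diag_mat d) - real CARD('n)" by (simp add: sum_subtractf trace_diag_mat)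
  also have "trace (diag_mat d) = trace (matrix_inv M ** B)"
  proof -
    define Q where "Q = matrix_inv P"
    have Q: "P ** Q = mat 1" "Q ** P = mat 1" using matrix_inv_mult[OF P(1)] by (simp_all add: Q_def)
    then have Qt: "transpose Q ** transpose P = mat 1" "transpose P ** transpose Q = mat 1"
      by (metis matrix_transpose_mul transpose_mat)+
    have "matrix_inv M = transpose Q ** Q"
    proof (rule matrix_inv_eqI)
      have "M ** (transpose Q ** Q) = P ** (transpose P ** transpose Q) ** Q" by (simp add: P(2) matrix_mul_assoc)
      then show "M ** (transpose Q ** Q) = mat 1" by (simp add: Q Qt)
      have "(transpose Q ** Q) ** M = transpose Q ** (Q ** P) ** transpose P" by (simp add: P(2) matrix_mul_assoc)
      then show "(transpose Q ** Q) ** M = mat 1" by (simp add: Q Qt)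
    qed
    then have "matrix_inv M ** B = transpose Q ** ((Q ** P) ** diag_mat d ** transpose P)"
      by (simp add: P(3) matrix_mul_assoc)
    also have "(Q ** P) ** diag_mat d ** transpose P = diag_mat d ** transpose P" by (simp add: Q)
    finally have "trace (matrix_inv M ** B) = trace (transpose Q ** (diag_mat d ** transpose P))" by simp
    also have "... = trace ((diag_mat d ** transpose P) ** transpose Q)" by (rule trace_mul_sym)
    also have "... = trace (diag_mat d ** (transpose P ** transpose Q))" by (simp add: matrix_mul_assoc)
    finally show ?thesis by (simp add: Qt)
  qed
  finally show ?thesis by simp
qed

lemma hs_norm_sq_transpose: "hs_norm_sq (transpose A) = hs_norm_sq A"
  unfolding hs_norm_sq_def transpose_def by (subst sum.swap) simp

lemma hs_norm_sq_columns: "hs_norm_sq A = (\<Sum>j\<in>UNIV. nsq (A *v axis j 1))"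
  unfolding hs_norm_sq_def matrix_vector_mult_basis column_def norm_vec_def L2_set_def
  by (subst sum.swap) (simp add: sum_nonneg)

lemma hs_norm_sq_Basis: "hs_norm_sq A = (\<Sum>i\<in>Basis. nsq (A *v i))" for A :: "real ^ 'n ^ 'n"
proof -
  have B: "(Basis :: (real ^ 'n) set) = (\<lambda>i. axis i 1) ` UNIV" by (auto simp: Basis_vec_def)
  have "inj (\<lambda>i :: 'n. axis i (1::real))" by (auto simp: inj_on_def axis_eq_axis)
  then show ?thesis unfolding B hs_norm_sq_columns by (subst sum.reindex) auto
qed

lemma hs_norm_sq_contraction_left:
  assumes "!!v. norm (P *v v) <= norm v" shows "hs_norm_sq (P ** A) <= hs_norm_sq A"
  unfolding hs_norm_sq_columns using assms by (intro sum_mono power_mono) (auto simp flip: matrix_vector_mul_assoc)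

lemma hs_norm_sq_diag: "hs_norm_sq (diag_mat d) = (\<Sum>i\<in>UNIV. (d i)^2)"
  by (simp add: hs_norm_sq_def diag_mat_def if_distrib[of "\<lambda>x. x^2"] cong: if_cong)

lemma contraction_transpose:
  fixes P :: "real ^ 'n ^ 'n"
  assumes "!!v. norm (transpose P *v v) <= norm v" shows "norm (P *v v) <= norm v"
proof -
  have "nsq (P *v v) = (P *v v) \<bullet> (P *v v)" by (simp add: power2_norm_eq_inner)
  also have "... = (transpose P *v (P *v v)) \<bullet> v" by (rule inner_matrix_transpose)
  also have "... <= norm (transpose P *v (P *v v)) * norm v" by (rule norm_cauchy_schwarz)
  also have "... <= norm (P *v v) * norm v" using assms by (intro mult_right_mono) auto
  finally show ?thesis by (cases "P *v v = 0") (auto simp: power2_eq_square)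
qed

text \<open>One family \<open>d\<close> has to serve all \<open>t\<close> and \<open>\<mu>\<close>
  at once, because \<open>t\<close> is differentiated with \<open>d\<close> held fixed; hence a
  single predicate from which \<open>d\<close> can be chosen. The last clause is the form in which
  the eigenvalues meet the Poincare inequality.\<close>

definition segment_eigenvalues :: "real => real ^ 'n ^ 'n => real ^ 'n ^ 'n => ('n => real) => bool" where
  "segment_eigenvalues \<kappa> A0 A1 d \<longleftrightarrow> (\<forall>i. \<kappa> <= d i \<and> \<kappa> * d i <= 1) \<and>
    (\<forall>t. (\<forall>i. 0 < 1 - t + t * d i) -->
      ln (det ((1 - t) *. A0 + t *. A1)) = ln (det A0) + (\<Sum>i\<in>UNIV. ln (1 - t + t * d i))) \<and>
    (\<forall>t \<mu>. 0 <= t --> t <= 1 --> hs_norm_sq ((A1 - A0) - \<mu> *. ((1 - t) *. A0 + t *. A1))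
       <= (\<Sum>i\<in>UNIV. ((d i - 1) / (1 - t + t * d i) - \<mu>)^2))"

text \<open>Along a segment of positive definite contractions, the logarithmic determinant is an explicit function of
  the generalised eigenvalues \<open>d\<close>, with derivative \<open>\<Sum>c\<close> and second derivative \<open>-\<Sum>c\<^sup>2\<close>.\<close>

theorem ln_det_segment:
  fixes A0 A1 :: "real ^ 'n ^ 'n"
  assumes A0: "pos_def A0" and A1: "pos_def A1"
    and c0: "!!v. norm (A0 *v v) <= norm v" and c1: "!!v. norm (A1 *v v) <= norm v"
    and k: "0 < \<kappa>" and k0: "!!v. \<kappa> * nsq v <= v \<bullet> (A0 *v v)" and k1: "!!v. \<kappa> * nsq v <= v \<bullet> (A1 *v v)"
  shows "\<exists>d. segment_eigenvalues \<kappa> A0 A1 d"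
proof -
  obtain P :: "real ^ 'n ^ 'n" and d where P: "invertible P" "A0 = P ** transpose P" "A1 = P ** diag_mat d ** transpose P"
    using simultaneous_diagonalization[OF A0 pos_def_symmetric[OF A1]] .
  have d: "0 < d i" for i using diag_mat_congruence_pos[OF P(1)] A1 P(3) by metis
  have dP: "(det P)^2 > 0" using P(1) by (simp add: invertible_det_nz)
  have A0': "A0 = P ** diag_mat (\<lambda>_. 1) ** transpose P" by (simp add: P(2) diag_mat_one)
  have comb: "a *. A0 + b *. A1 = P ** diag_mat (\<lambda>i. a + b * d i) ** transpose P" for a b
    unfolding A0' P(3) vec_eq_iff
    by (simp add: diag_congruence_entry sum_distrib_left algebra_simps flip: sum.distrib)
  show ?thesis unfolding segment_eigenvalues_def
  proof (intro exI[of _ d] conjI allI impI)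
    fix i
    \<comment> \<open>The vector with \<open>transpose P *v w = axis i 1\<close>: the forms of
      \<open>A0\<close> and \<open>A1\<close> at \<open>w\<close> are 1 and \<open>d i\<close>. Both
      lie between \<open>\<kappa> * nsq w\<close> and \<open>nsq w\<close>, which bounds
      \<open>d i\<close> on either side.\<close>
    define w where "w = transpose (matrix_inv P) *v axis i 1"
    have "transpose P ** transpose (matrix_inv P) = mat 1"
      using matrix_inv_mult[OF P(1)] by (metis matrix_transpose_mul transpose_mat)
    then have Pw: "transpose P *v w = axis i 1" by (simp only: w_def matrix_vector_mul_assoc matrix_vector_mul_lid)
    have form: "w \<bullet> ((P ** X ** transpose P) *v w) = X $ i $ i" for X
    proof -
      have "w \<bullet> ((P ** X ** transpose P) *v w) = w \<bullet> (P *v (X *v (transpose P *v w)))" by (simp only: matrix_vector_mul_assoc matrix_mul_assoc)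
      also have "... = (transpose P *v w) \<bullet> (X *v (transpose P *v w))" by (rule inner_matrix_transpose)
      also have "... = X $ i $ i" by (simp only: Pw) (simp add: inner_axis inner_commute[of "axis i 1"] matrix_vector_mult_basis column_def)
      finally show ?thesis .
    qed
    have w0: "w \<bullet> (A0 *v w) = 1" unfolding A0' form by (simp add: diag_mat_def)
    have w1: "w \<bullet> (A1 *v w) = d i" unfolding P(3) form by (simp add: diag_mat_def)
    have u: "w \<bullet> (B *v w) <= nsq w" if "!!v. norm (B *v v) <= norm v" for B
      using norm_cauchy_schwarz[of w "B *v w"] mult_left_mono[OF that[of w], of "norm w"] by (simp add: power2_eq_square)
    have "\<kappa> * 1 <= \<kappa> * nsq w" using u[OF c0] k unfolding w0 by (intro mult_left_mono) auto
    then show "\<kappa> <= d i" using k1[of w] unfolding w1 by simp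
    have "\<kappa> * d i <= \<kappa> * nsq w" using u[OF c1] k unfolding w1 by (intro mult_left_mono) auto
    then show "\<kappa> * d i <= 1" using k0[of w] unfolding w0 by simp
  next
    fix t :: real assume "\<forall>i. 0 < 1 - t + t * d i"
    then have D: "!!i. 0 < 1 - t + t * d i" by blast
    show "ln (det ((1 - t) *. A0 + t *. A1)) = ln (det A0) + (\<Sum>i\<in>UNIV. ln (1 - t + t * d i))"
      unfolding comb det_congruence det_diag_mat using dP D D[THEN less_imp_neq, symmetric]
      by (simp add: P(2) det_mul ln_mult ln_prod flip: power2_eq_square)
  next
    fix t :: real assume t: "0 <= t" "t <= 1"
    let ?D = "\<lambda>i. 1 - t + t * d i"
    have D: "0 < ?D i" for i
    proof (cases "t = 0")
      case False then have "0 < t * d i" using t d by simp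
      then show ?thesis using t by linarith
    qed simp
    fix \<mu> :: real
    define P' where "P' = P ** diag_mat (\<lambda>i. sqrt (?D i))"
    have tP': "transpose P' = diag_mat (\<lambda>i. sqrt (?D i)) ** transpose P" by (simp add: P'_def matrix_transpose_mul transpose_diag_mat)
    have PE: "P' ** diag_mat E ** transpose P' = P ** diag_mat (\<lambda>i. E i * ?D i) ** transpose P" for E
    proof -
      have "P' ** diag_mat E ** transpose P' = P ** (diag_mat (\<lambda>i. sqrt (?D i)) ** diag_mat E ** diag_mat (\<lambda>i. sqrt (?D i))) ** transpose P"
        by (simp add: P'_def tP'[unfolded P'_def] matrix_mul_assoc)
      also have "diag_mat (\<lambda>i. sqrt (?D i)) ** diag_mat E ** diag_mat (\<lambda>i. sqrt (?D i)) = diag_mat (\<lambda>i. E i * ?D i)"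
        unfolding diag_mat_mult using D by (intro arg_cong[where f=diag_mat] ext) (simp add: less_imp_le)
      finally show ?thesis .
    qed
    have At: "(1 - t) *. A0 + t *. A1 = P' ** transpose P'" using PE[of "\<lambda>_. 1"] by (simp add: comb diag_mat_one)
    have ct: "norm (((1 - t) *. A0 + t *. A1) *v v) <= norm v" for v
    proof -
      have "norm (((1 - t) *. A0 + t *. A1) *v v) <= (1 - t) * norm (A0 *v v) + t * norm (A1 *v v)"
        unfolding matrix_vector_mult_add_rdistrib scaleR_matrix_vector_assoc[symmetric] using t
        by (intro order_trans[OF norm_triangle_ineq]) auto
      also have "... <= (1 - t) * norm v + t * norm v" using t c0 c1 by (intro add_mono mult_left_mono) auto
      finally show ?thesis by (simp add: algebra_simps)
    qed
    have tc: "norm (transpose P' *v v) <= norm v" for v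
    proof -
      have "nsq (transpose P' *v v) = v \<bullet> (P' *v (transpose P' *v v))"
        by (simp add: inner_matrix_transpose power2_norm_eq_inner)
      also have "... = v \<bullet> (((1 - t) *. A0 + t *. A1) *v v)" by (simp only: At matrix_vector_mul_assoc)
      also have "... <= norm v * norm (((1 - t) *. A0 + t *. A1) *v v)" by (rule norm_cauchy_schwarz)
      also have "... <= nsq v" using ct[of v] by (simp add: power2_eq_square mult_left_mono)
      finally show ?thesis by (rule power2_le_imp_le) simp
    qed
    have pc: "norm (P' *v v) <= norm v" for v by (rule contraction_transpose[OF tc])
    define E where "E i = (d i - 1) / ?D i - \<mu>" for i
    have "(A1 - A0) - \<mu> *. ((1 - t) *. A0 + t *. A1) = (- 1 - \<mu> * (1 - t)) *. A0 + (1 - \<mu> * t) *. A1"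
      by (simp add: algebra_simps)
    also have "... = P ** diag_mat (\<lambda>i. E i * ?D i) ** transpose P" unfolding comb
    proof (intro arg_cong[where f="\<lambda>X. P ** diag_mat X ** transpose P"] ext)
      fix i show "- 1 - \<mu> * (1 - t) + (1 - \<mu> * t) * d i = E i * ?D i"
      proof -
        have "((d i - 1) / X - \<mu>) * X = d i - 1 - \<mu> * X" if "X > 0" for X using that by (simp add: field_simps)
        from this[OF D] show ?thesis by (simp add: E_def) (simp add: algebra_simps)
      qed
    qed
    also have "... = P' ** (diag_mat E ** transpose P')" by (simp add: PE[symmetric] matrix_mul_assoc)
    finally have "hs_norm_sq ((A1 - A0) - \<mu> *. ((1 - t) *. A0 + t *. A1)) <= hs_norm_sq (diag_mat E ** transpose P')"
      using hs_norm_sq_contraction_left[OF pc] by simp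
    also have "... = hs_norm_sq (P' ** diag_mat E)"
      by (subst hs_norm_sq_transpose[symmetric]) (simp add: matrix_transpose_mul transpose_diag_mat)
    also have "... <= hs_norm_sq (diag_mat E)" by (rule hs_norm_sq_contraction_left[OF pc])
    finally show "hs_norm_sq ((A1 - A0) - \<mu> *. ((1 - t) *. A0 + t *. A1)) <= (\<Sum>i\<in>UNIV. ((d i - 1) / ?D i - \<mu>)^2)"
      by (simp add: hs_norm_sq_diag E_def)
  qed
qed

section \<open>The nonlinear remainder of a smoothed map\<close>

lemma nn_integral_le_of_tendsto:
  fixes f :: "nat => 'a => real"
  assumes [measurable]: "!!k. f k \<in> borel_measurable M" and lim: "!!x. (\<lambda>k. f k x) ----> g x"
    and le: "!!k. (\<integral>\<^sup>+x. f k x \<partial>M) <= ennreal (c k)" and c: "c ----> C"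
  shows "(\<integral>\<^sup>+x. g x \<partial>M) <= ennreal C"
proof -
  have "(\<integral>\<^sup>+x. g x \<partial>M) = (\<integral>\<^sup>+x. liminf (\<lambda>k. ennreal (f k x)) \<partial>M)"
    by (intro nn_integral_cong lim_imp_Liminf[symmetric] tendsto_ennrealI lim) simp
  also have "... <= liminf (\<lambda>k. \<integral>\<^sup>+x. f k x \<partial>M)" by (rule nn_integral_liminf) measurable
  also have "... <= liminf (\<lambda>k. ennreal (c k))" by (intro Liminf_mono always_eventually allI le)
  also have "... = ennreal C" by (intro lim_imp_Liminf tendsto_ennrealI c) simp
  finally show ?thesis .
qed

lemma integral_mix:
  fixes f :: "'a::euclidean_space => 'b::{banach, second_countable_topology}"
  assumes a: "0 < a" "a < 1" and f: "integrable gauss f"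
  shows "integrable gauss2 (\<lambda>p. f (a *. fst p + sqrt (1 - a^2) *. snd p))"
    and "(\<integral>p. f (a *. fst p + sqrt (1 - a^2) *. snd p) \<partial>gauss2) = (\<oint>x. f x)"
proof -
  have [measurable]: "f \<in> borel_funs" using f by auto
  have "a^2 <= 1" using a by (simp add: abs_square_le_1)
  then have d: "distr gauss2 borel (\<lambda>p. a *. fst p + sqrt (1 - a^2) *. snd p) = (gauss :: 'a measure)"
    using a by (intro distr_gauss_mix) auto
  show "integrable gauss2 (\<lambda>p. f (a *. fst p + sqrt (1 - a^2) *. snd p))"
    using f by (subst (asm) d[symmetric]) (subst (asm) integrable_distr_eq, auto)
  show "(\<integral>p. f (a *. fst p + sqrt (1 - a^2) *. snd p) \<partial>gauss2) = (\<oint>x. f x)"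
    by (subst d[symmetric], subst integral_distr) auto
qed

lemma ou_linear_term_integrals:
  fixes D :: "'a::euclidean_space => 'b::euclidean_space"
  assumes D: "linear D"
  shows "integrable gauss D" "(\<oint>z. D z) = 0"
proof -
  have bl: "bounded_linear D" using D by (simp add: linear_conv_bounded_linear)
  have i: "integrable gauss (\<lambda>z::'a. z)" by (rule integrable_gauss_linear[where C=1]) auto
  show "integrable gauss D" using integrable_bounded_linear[OF bl i] .
  show "(\<oint>z. D z) = 0" using integral_bounded_linear[OF bl i] by (simp add: integral_gauss_id linear_0[OF D])
qed

text \<open>As a function of \<open>z\<close>, the part of \<open>f (rot a x z)\<close> left after
  removing its constant and linear Hermite components. It measures how far \<open>f\<close> is from
  being affine at the scale of the smoothing.\<close>

definition ou_residual :: "real => ('a::euclidean_space => 'b::euclidean_space) => 'a => 'a => 'b" where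
  "ou_residual a f x z = f (rot a x z) - ou a f x - sqrt (1 - a^2) *. oud a f x z"

lemma ou_measurable: "L-lipschitz_on UNIV f ==> 0 < a ==> a < 1 ==> ou a f \<in> borel_funs"
  by (rule lipschitz_measurable[OF ou_lipschitz])

lemma oud_measurable: "L-lipschitz_on UNIV f ==> 0 < a ==> a < 1 ==> (\<lambda>x. oud a f x v) \<in> borel_funs"
  by (rule borel_measurable_continuous_onI[OF oud_continuous])

lemma oud_measurable_pair:
  assumes lip: "L-lipschitz_on UNIV f" and a: "0 < a" "a < 1"
    and [measurable]: "g \<in> borel_measurable M" "h \<in> borel_measurable M"
  shows "(\<lambda>p. oud a f (g p) (h p)) \<in> borel_measurable M"
proof -
  note L = oud_linear[OF lip a]
  have "oud a f x z = (\<Sum>i\<in>Basis. (z \<bullet> i) *. oud a f x i)" for x z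
  proof -
    have "oud a f x z = oud a f x (\<Sum>i\<in>Basis. (z \<bullet> i) *. i)"
      by (rule arg_cong[where f="oud a f x"]) (rule euclidean_representation[symmetric])
    also have "... = (\<Sum>i\<in>Basis. oud a f x ((z \<bullet> i) *. i))" by (rule linear_sum[OF L])
    finally show ?thesis by (simp only: linear_scale[OF L])
  qed
  then have "(\<lambda>p. oud a f (g p) (h p)) = (\<lambda>p. \<Sum>i\<in>Basis. (h p \<bullet> i) *. oud a f (g p) i)" by (intro ext) blast
  moreover have [measurable]: "(\<lambda>p. oud a f (g p) i) \<in> borel_measurable M" for i
    by (rule measurable_compose[OF assms(4) oud_measurable[OF lip a]])
  ultimately show ?thesis by simp
qed

lemma ou_residual_measurable:
  assumes lip: "L-lipschitz_on UNIV f" and a: "0 < a" "a < 1"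
  shows "(\<lambda>p. ou_residual a f (fst p) (snd p)) \<in> borel_measurable gauss2"
    "ou_residual a f x \<in> borel_measurable gauss"
proof -
  note [measurable] = lipschitz_measurable[OF lip] ou_measurable[OF lip a] oud_measurable_pair[OF lip a]
  show "(\<lambda>p. ou_residual a f (fst p) (snd p)) \<in> borel_measurable gauss2"
    "ou_residual a f x \<in> borel_measurable gauss" unfolding ou_residual_def[abs_def] by measurable
qed

text \<open>Energy of the derivative at smoothing level \<open>r\<close>. For 1-Lipschitz maps it
  increases with \<open>r\<close> and is bounded by the dimension, so its increments become small
  somewhere below \<open>r = 1\<close>.\<close>

definition dirichlet :: "('a::euclidean_space => 'b::euclidean_space) => real => real" where
  "dirichlet f r = (\<oint>y. (\<Sum>i\<in>Basis. nsq (oud r f y i)))"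

context
  fixes f :: "'a::euclidean_space => 'b::euclidean_space"
  assumes lip: "1-lipschitz_on UNIV f"
begin

lemma oud_le_one: "0 < r ==> r < 1 ==> i \<in> Basis ==> norm (oud r f y i) <= 1"
  using oud_norm_le[OF lip, of r y i] by simp

lemma oud_sq_integrable:
  assumes r: "0 < r" "r < 1" and i: "i \<in> Basis"
  shows "integrable gauss (\<lambda>y. nsq (oud r f y i))"
proof (rule gauss.integrable_const_bound[where B=1])
  note [measurable] = oud_measurable[OF lip r]
  show "(\<lambda>y. nsq (oud r f y i)) \<in> borel_measurable gauss" by measurable
  show "AE y in gauss. norm (nsq (oud r f y i)) <= 1" using oud_le_one[OF r i] by (auto simp: power_le_one)
qed

lemma dirichlet_eq: "0 < r ==> r < 1 ==> dirichlet f r = (\<Sum>i\<in>Basis. \<integral>y. nsq (oud r f y i) \<partial>gauss)"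
  unfolding dirichlet_def by (simp add: oud_sq_integrable)

lemma dirichlet_le: assumes r: "0 < r" "r < 1" shows "dirichlet f r <= DIM('a)"
proof -
  have "(\<oint>y. nsq (oud r f y i)) <= 1" if i: "i \<in> Basis" for i
  proof -
    have "(\<oint>y. nsq (oud r f y i)) <= (\<integral>y. 1 \<partial>(gauss :: 'a measure))"
      using oud_le_one[OF r i] by (intro integral_mono oud_sq_integrable[OF r i]) (auto simp: power_le_one)
    then show ?thesis using gauss.prob_space[where 'a='a] by simp
  qed
  then have "(\<Sum>i\<in>(Basis::'a set). \<integral>y. nsq (oud r f y i) \<partial>gauss) <= (\<Sum>i\<in>(Basis::'a set). 1)" by (intro sum_mono)
  then show ?thesis by (simp add: dirichlet_eq[OF r])
qed

text \<open>Orthogonality of martingale increments: \<open>oud (a * r) f x\<close> is the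
  conditional mean given \<open>x\<close>, so second moments subtract.\<close>

lemma oud_conditional_variance:
  assumes a: "0 < a" "a < 1" and r: "0 < r" "r < 1"
  shows "(\<oint>x. (\<Sum>i\<in>Basis. \<integral>z. nsq (oud r f (rot a x z) i - oud (a * r) f x i) \<partial>gauss))
      = dirichlet f r - dirichlet f (a * r)"
    and "integrable gauss (\<lambda>x. (\<Sum>i\<in>Basis. \<integral>z. nsq (oud r f (rot a x z) i - oud (a * r) f x i) \<partial>gauss))"
proof -
  let ?b = "sqrt (1 - a^2)"
  have ar: "0 < a * r" "a * r < 1" using a r mult_strict_mono[of a 1 r 1] by auto
  note [measurable] = oud_measurable[OF lip r] oud_measurable[OF lip ar]
  let ?o = "\<lambda>i x z. oud r f (rot a x z) i" and ?V = "\<lambda>x. \<Sum>i\<in>Basis. \<integral>z. nsq (oud r f (rot a x z) i - oud (a * r) f x i) \<partial>gauss"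
  have zi: "integrable gauss (\<lambda>z. nsq (?o i x z))" if i: "i \<in> Basis" for x i
    by (rule gauss.integrable_const_bound[where B=1]) (use oud_le_one[OF r i] in \<open>auto simp: power_le_one\<close>)
  have v: "(\<oint>z. nsq (?o i x z - oud (a * r) f x i))
     = (\<oint>z. nsq (?o i x z)) - nsq (oud (a * r) f x i)" if i: "i \<in> Basis" for x i
    unfolding gauss.variance_expand(1)[OF oud_semigroup(1)[OF lip a r] zi[OF i]] oud_semigroup(2)[OF lip a r, symmetric]
    by (simp add: power2_norm_eq_inner)
  have m: "integrable gauss (\<lambda>x. \<integral>z. nsq (?o i x z) \<partial>gauss)"
    "(\<oint>x. \<oint>z. nsq (?o i x z)) = (\<oint>y. nsq (oud r f y i))" if i: "i \<in> Basis" for i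
    using gauss2.integral_fst'[OF integral_mix(1)[OF a oud_sq_integrable[OF r i]]]
      gauss2.integrable_fst'[OF integral_mix(1)[OF a oud_sq_integrable[OF r i]]]
      integral_mix(2)[OF a oud_sq_integrable[OF r i]] by simp_all
  show "integrable gauss (\<lambda>x. ?V x)"
    using v m(1) oud_sq_integrable[OF ar] by (intro Bochner_Integration.integrable_sum) simp
  have "(\<oint>x. ?V x)
    = (\<oint>x. (\<Sum>i\<in>Basis. (\<oint>z. nsq (?o i x z)) - nsq (oud (a * r) f x i)))" using v by simp
  also have "... = (\<Sum>i\<in>Basis. (\<oint>y. nsq (oud r f y i)) - (\<oint>x. nsq (oud (a * r) f x i)))"
    using m oud_sq_integrable[OF ar] by simp
  finally show "(\<oint>x. ?V x) = dirichlet f r - dirichlet f (a * r)"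
    by (simp add: dirichlet_eq[OF r] dirichlet_eq[OF ar] sum_subtractf)
qed

lemma dirichlet_mono:
  assumes s: "0 < s" "s <= r" "r < 1" shows "dirichlet f s <= dirichlet f r"
proof (cases "s = r")
  case False
  have a: "0 < s / r" "s / r < 1" and r: "0 < r" "r < 1" using s False by auto
  have "0 <= (\<oint>x. (\<Sum>i\<in>Basis. \<integral>z. nsq (oud r f ((s / r) *. x + sqrt (1 - (s / r)^2) *. z) i - oud ((s / r) * r) f x i) \<partial>gauss))"
    by (intro Bochner_Integration.integral_nonneg sum_nonneg) auto
  then show ?thesis using oud_conditional_variance(1)[OF a r] r by simp
qed simp

lemma ou_commute:
  assumes a: "0 < a" "a < 1" and r: "0 < r" "r < 1"
  shows "ou a (ou r f) = ou r (ou a f)"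
  using ou_semigroup[OF lip a r] ou_semigroup[OF lip r a] by (auto simp: mult.commute)

lemma oud_ou:
  assumes a: "0 < a" "a < 1" and r: "0 < r" "r < 1"
  shows "oud a (ou r f) x v = r *. oud (a * r) f x v" "oud a (ou r f) x v = r *. ou r (\<lambda>y. oud a f y v) x"
proof -
  note d = oud_of_derivative(2)[OF ou_lipschitz[OF lip r] a ou_has_derivative[OF lip r]]
  show 1: "oud a (ou r f) x v = r *. oud (a * r) f x v" unfolding d oud_semigroup(2)[OF lip a r] by simp
  show "oud a (ou r f) x v = r *. ou r (\<lambda>y. oud a f y v) x"
    unfolding 1 mult.commute[of a r] oud_semigroup(2)[OF lip r a] by (simp add: ou_def)
qed

text \<open>Poincare inequality in \<open>z\<close> for fixed \<open>x\<close>. Subtracting the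
  linear component makes the gradient in \<open>z\<close> equal to \<open>sqrt (1 - a^2) * r\<close>
  times the deviation of \<open>oud r f\<close> from its conditional mean, whose energy is a
  Dirichlet increment. The extra smoothing by \<open>r\<close> supplies the
  differentiability.\<close>

lemma ou_residual_bound:
  assumes a: "0 < a" "a < 1" and r: "0 < r" "r < 1"
  shows "(\<integral>\<^sup>+p. ennreal (nsq (ou_residual a (ou r f) (fst p) (snd p))) \<partial>gauss2)
    <= ennreal (5 / 4 * (1 - a^2) * (dirichlet f r - dirichlet f (a * r)))"
proof -
  let ?b = "sqrt (1 - a^2)" and ?g = "ou r f"
  have b: "?b^2 = 1 - a^2" by (rule ou_b_sq[OF lip a])
  have ar: "0 < a * r" "a * r < 1" using a r mult_strict_mono[of a 1 r 1] by auto
  note lg = ou_lipschitz[OF lip r]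
  define W where "W x = (\<Sum>i\<in>Basis. \<integral>z. nsq (oud r f (rot a x z) i - oud (a * r) f x i) \<partial>gauss)" for x
  have inner: "(\<integral>\<^sup>+z. ennreal (nsq (ou_residual a ?g x z)) \<partial>gauss) <= ennreal (5 / 4 * (1 - a^2) * W x)" for x
  proof -
    define h where "h z = ?g (rot a x z) - ?b *. oud a ?g x z" for z
    have linD: "linear (\<lambda>z. ?b *. oud a ?g x z)"
      using oud_linear[OF lg a, of x] by (intro linearI) (simp_all add: linear_add linear_scale)
    have dl: "(\<bar>?b\<bar>)-lipschitz_on UNIV (\<lambda>z. ?b *. oud a ?g x z)"
    proof (rule lipschitz_onI)
      fix u v
      have "?b *. oud a ?g x u - ?b *. oud a ?g x v = ?b *. oud a ?g x (u - v)"
        by (simp add: linear_diff[OF oud_linear[OF lg a]] scaleR_diff_right)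
      moreover have "norm (oud a ?g x (u - v)) <= 1 * norm (u - v)"
        using order_trans[OF oud_norm_le[OF lg a, of x "u - v"] mult_right_mono[of "1 * r" 1 "norm (u - v)"]] r by simp
      ultimately show "dist (?b *. oud a ?g x u) (?b *. oud a ?g x v) <= \<bar>?b\<bar> * dist u v"
        by (simp add: dist_norm mult_left_mono)
    qed simp
    then obtain M where hl: "M-lipschitz_on UNIV h"
      using lipschitz_on_diff[OF lipschitz_affine[OF lg] dl] unfolding h_def[abs_def] by blast
    have hd: "(h has_derivative (\<lambda>v. r *. oud r f (rot a x z) (?b *. v) - ?b *. oud a ?g x v)) (at z)" for z
    proof -
      have 1: "((\<lambda>z. a *. x + ?b *. z) has_derivative (\<lambda>v. ?b *. v)) (at z)" by (auto intro!: derivative_eq_intros)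
      have 2: "((\<lambda>z. ?g (rot a x z)) has_derivative (\<lambda>v. r *. oud r f (rot a x z) (?b *. v))) (at z)"
        by (rule has_derivative_compose[OF 1 ou_has_derivative[OF lip r]])
      have 3: "((\<lambda>z. ?b *. oud a ?g x z) has_derivative (\<lambda>z. ?b *. oud a ?g x z)) (at z)"
        by (rule linear_imp_has_derivative[OF linD])
      show ?thesis unfolding h_def[abs_def] by (rule has_derivative_diff[OF 2 3])
    qed
    have eh: "(\<oint>z. h z) = ou a ?g x"
      unfolding h_def using ou_linear_term_integrals[OF linD] ou_integrable[OF lg a, of x]
      by (subst Bochner_Integration.integral_diff) (auto simp: ou_def)
    have res: "ou_residual a ?g x z = h z - (\<oint>z. h z)" for z unfolding eh by (simp add: ou_residual_def h_def)
    have vi: "integrable gauss (\<lambda>z. nsq (h z - (\<oint>z. h z)))"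
      by (rule gauss.variance_expand(2)[OF integrable_gauss_lipschitz[OF hl]])
    have di: "integrable gauss (\<lambda>z. nsq (oud r f (rot a x z) i - oud (a * r) f x i))" if i: "i \<in> Basis" for i
    proof (rule gauss.variance_expand(2)[OF oud_semigroup(1)[OF lip a r]])
      note [measurable] = oud_measurable[OF lip r]
      show "integrable gauss (\<lambda>z. nsq (oud r f (rot a x z) i))"
        by (rule gauss.integrable_const_bound[where B=1]) (use oud_le_one[OF r i] in \<open>auto simp: power_le_one\<close>)
    qed
    have "(\<oint>z. nsq (h z - (\<oint>z. h z)))
      <= 5 / 4 * (\<oint>z. (\<Sum>i\<in>Basis. nsq (r *. oud r f (rot a x z) (?b *. i) - ?b *. oud a ?g x i)))"
      by (rule gauss_poincare[OF hl hd])
    also have "... = 5 / 4 * (\<oint>z. (\<Sum>i\<in>Basis. ((1 - a^2) * r^2) * nsq (oud r f (rot a x z) i - oud (a * r) f x i)))"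
    proof -
      have "r *. oud r f (rot a x z) (?b *. i) - ?b *. oud a ?g x i
        = (?b * r) *. (oud r f (rot a x z) i - oud (a * r) f x i)" for z i
        unfolding oud_ou(1)[OF a r] linear_scale[OF oud_linear[OF lip r]] by (simp add: scaleR_diff_right)
      then show ?thesis by (simp add: power_mult_distrib b[unfolded power2_abs])
    qed
    also have "... = 5 / 4 * ((1 - a^2) * r^2 * W x)" unfolding W_def using di by (simp add: sum_distrib_left)
    also have "... <= 5 / 4 * ((1 - a^2) * 1 * W x)"
    proof -
      have "0 <= W x" unfolding W_def by (intro sum_nonneg Bochner_Integration.integral_nonneg) auto
      moreover have "0 <= 1 - a^2" using a by (simp add: abs_square_le_1)
      moreover have "r^2 <= 1" using r by (simp add: abs_square_le_1)
      ultimately show ?thesis by (intro mult_left_mono mult_right_mono) auto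
    qed
    finally have "(\<oint>z. nsq (h z - (\<oint>z. h z))) <= 5 / 4 * (1 - a^2) * W x" by (simp only: mult_1_right mult.assoc)
    then show ?thesis unfolding res using nn_integral_eq_integral[OF vi] by (simp add: ennreal_leI)
  qed
  have W0: "0 <= W x" for x unfolding W_def by (intro sum_nonneg Bochner_Integration.integral_nonneg) auto
  have a2: "0 <= 1 - a^2" using a by (simp add: abs_square_le_1)
  have [measurable]: "(\<lambda>p. ou_residual a ?g (fst p) (snd p)) \<in> borel_measurable gauss2"
    by (rule ou_residual_measurable(1)[OF lg a])
  have "(\<integral>\<^sup>+p. ennreal (nsq (ou_residual a ?g (fst p) (snd p))) \<partial>gauss2)
     = (\<integral>\<^sup>+x. \<integral>\<^sup>+z. ennreal (nsq (ou_residual a ?g x z)) \<partial>gauss \<partial>gauss)"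
    by (subst gauss.nn_integral_fst[symmetric]) auto
  also have "... <= (\<integral>\<^sup>+x. ennreal (5 / 4 * (1 - a^2) * W x) \<partial>gauss)" by (intro nn_integral_mono inner)
  also have "... = ennreal (\<oint>x. 5 / 4 * (1 - a^2) * W x)"
    using oud_conditional_variance(2)[OF a r] W0 a2 unfolding W_def[symmetric] by (intro nn_integral_eq_integral) auto
  also have "(\<oint>x. 5 / 4 * (1 - a^2) * W x) = 5 / 4 * (1 - a^2) * (dirichlet f r - dirichlet f (a * r))"
    unfolding oud_conditional_variance(1)[OF a r, symmetric] W_def by simp
  finally show ?thesis .
qed

text \<open>Fatou's lemma as \<open>r\<close> tends to 1. The increment is replaced with the cruder
  \<open>B - dirichlet f a0\<close>, which by monotonicity serves all \<open>r\<close> with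
  \<open>a * r >= a0\<close>.\<close>

lemma ou_residual_bound_limit:
  assumes a: "0 < a" "a < 1" and a0: "0 < a0" "a0 < a" and B: "!!r. 0 < r ==> r < 1 ==> dirichlet f r <= B"
  shows "(\<integral>\<^sup>+p. ennreal (nsq (ou_residual a f (fst p) (snd p))) \<partial>gauss2)
    <= ennreal (5 / 4 * (1 - a^2) * (B - dirichlet f a0))"
proof -
  let ?b = "sqrt (1 - a^2)"
  \<comment> \<open>A sequence tending to 1 from below that never drops under
    \<open>a0 / a\<close>.\<close>
  define r where "r k = 1 - (1 - a0 / a) / real (k + 2)" for k :: nat
  have q: "0 < 1 - a0 / a" "1 - a0 / a < 1" using a0 a by auto
  have r: "0 < r k" "r k < 1" "a0 <= a * r k" for k
  proof -
    have "(1 - a0 / a) / real (k + 2) <= (1 - a0 / a) / 1" using q by (intro divide_left_mono) auto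
    then have r1: "a0 / a <= r k" by (simp add: r_def)
    then show "0 < r k" using a0 a by (meson divide_pos_pos less_le_trans order_less_trans)
    show "r k < 1" using q by (simp add: r_def)
    show "a0 <= a * r k" using r1 a by (simp add: divide_le_eq mult.commute)
  qed
  have "r ----> 1 - 0" unfolding r_def
    by (intro tendsto_intros tendsto_divide_0[OF tendsto_const] filterlim_at_top_imp_at_infinity
        filterlim_compose[OF filterlim_real_sequentially filterlim_add_const_nat_at_top])
  then have rl: "filterlim r (at_left 1) sequentially"
    using r(2) by (auto simp: filterlim_at intro!: always_eventually dest: less_imp_neq)
  have lim: "(\<lambda>k. ou_residual a (ou (r k) f) x z) ----> ou_residual a f x z" for x z
  proof -
    have 1: "(\<lambda>k. ou (r k) f y) ----> f y" for y by (rule filterlim_compose[OF ou_tendsto[OF lip] rl])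
    have 2: "(\<lambda>k. ou a (ou (r k) f) x) ----> ou a f x"
      unfolding ou_commute[OF a r(1,2)] by (rule filterlim_compose[OF ou_tendsto[OF ou_lipschitz[OF lip a]] rl])
    have "(\<lambda>k. r k *. ou (r k) (\<lambda>y. oud a f y z) x) ----> 1 *. oud a f x z"
    proof (intro tendsto_intros)
      show "r ----> 1" using \<open>r ----> 1 - 0\<close> by simp
      let ?m = "\<oint>z. norm (z::'a)"
      have "((1 * a * norm z / ?b) * ?m)-lipschitz_on UNIV (\<lambda>y. oud a f y z)"
      proof (rule lipschitz_onI)
        show "dist (oud a f u z) (oud a f v z) <= 1 * a * norm z / ?b * ?m * dist u v" for u v
          unfolding dist_norm by (rule oud_lipschitz[OF lip a])
        have "0 <= ?m" by (intro Bochner_Integration.integral_nonneg) simp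
        then show "0 <= 1 * a * norm z / ?b * ?m"
          using a ou_b_pos[OF lip a] by (intro mult_nonneg_nonneg divide_nonneg_nonneg) (auto simp del: real_sqrt_ge_0_iff real_sqrt_gt_0_iff)
      qed
      then show "(\<lambda>k. ou (r k) (\<lambda>y. oud a f y z) x) ----> oud a f x z" by (rule filterlim_compose[OF ou_tendsto rl])
    qed
    then have 3: "(\<lambda>k. oud a (ou (r k) f) x z) ----> oud a f x z" unfolding oud_ou(2)[OF a r(1,2)] by simp
    show ?thesis unfolding ou_residual_def by (intro tendsto_intros 1 2 3)
  qed
  have [measurable]: "(\<lambda>p. ou_residual a (ou (r k) f) (fst p) (snd p)) \<in> borel_measurable gauss2" for k
    by (rule ou_residual_measurable(1)[OF ou_lipschitz[OF lip r(1,2)] a])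
  show ?thesis
  proof (rule nn_integral_le_of_tendsto[OF _ _ _ tendsto_const])
    show "(\<lambda>k. nsq (ou_residual a (ou (r k) f) (fst p) (snd p))) ----> nsq (ou_residual a f (fst p) (snd p))" for p
      by (intro tendsto_intros lim)
    fix k
    have a2: "0 <= 1 - a^2" using a by (simp add: abs_square_le_1)
    have ar: "a * r k < 1" using a r[of k] mult_strict_mono[of a 1 "r k" 1] by auto
    note ou_residual_bound[OF a r(1,2)]
    also have "ennreal (5 / 4 * (1 - a^2) * (dirichlet f (r k) - dirichlet f (a * r k))) <= ennreal (5 / 4 * (1 - a^2) * (B - dirichlet f a0))"
      using a2 B[OF r(1,2)] dirichlet_mono[OF a0(1) r(3) ar] by (intro ennreal_leI mult_left_mono diff_mono) auto
    finally show "(\<integral>\<^sup>+p. nsq (ou_residual a (ou (r k) f) (fst p) (snd p)) \<partial>gauss2)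
      <= ennreal (5 / 4 * (1 - a^2) * (B - dirichlet f a0))" .
  qed measurable
qed

end

section \<open>Change of variables for the Gaussian measure\<close>

text \<open>The library's change of variables theorem needs a well-ordered index type.\<close>

typedef 'n ordered_index = "{..<CARD('n::finite)}" by (rule exI[of _ 0]) simp

instantiation ordered_index :: (finite) "{finite, wellorder}"
begin

definition less_eq_ordered_index :: "'a ordered_index => 'a ordered_index => bool" where
  "x <= y \<longleftrightarrow> Rep_ordered_index x <= Rep_ordered_index y"

definition less_ordered_index :: "'a ordered_index => 'a ordered_index => bool" where
  "x < y \<longleftrightarrow> Rep_ordered_index x < Rep_ordered_index y"

instance
proof
  have "(UNIV :: 'a ordered_index set) = Abs_ordered_index ` {..<CARD('a)}" by (auto intro: Abs_ordered_index_cases)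
  then show "finite (UNIV :: 'a ordered_index set)" by (metis finite_imageI finite_lessThan)
  fix x y z :: "'a ordered_index" and P :: "'a ordered_index => bool"
  show "x < y \<longleftrightarrow> x <= y \<and> \<not> y <= x" "x <= x" "x <= y ==> y <= z ==> x <= z" "x <= y \<or> y <= x"
    by (auto simp: less_eq_ordered_index_def less_ordered_index_def)
  show "x <= y ==> y <= x ==> x = y" by (simp add: less_eq_ordered_index_def Rep_ordered_index_inject)
  show "(!!x. (!!y. y < x ==> P y) ==> P x) ==> P x"
    using measure_induct_rule[of Rep_ordered_index P x] by (simp add: less_ordered_index_def)
qed

end

lemma card_ordered_index: "CARD('n ordered_index) = CARD('n::finite)"
  using type_definition.card[OF type_definition_ordered_index[where 'n='n]] by simp

section \<open>Relabelling of coordinates\<close>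

lemma det_reindex:
  fixes A :: "real ^ 'n ^ 'n" and \<sigma> :: "'m::finite => 'n"
  assumes \<sigma>: "bij \<sigma>"
  shows "det (\<chi> i j. A $ \<sigma> i $ \<sigma> j) = det A"
proof -
  let ?c = "\<lambda>p. \<sigma> \<circ> p \<circ> inv \<sigma>"
  have inv: "inv \<sigma> (\<sigma> i) = i" "\<sigma> (inv \<sigma> j) = j" for i j using \<sigma> by (simp_all add: bij_is_inj bij_is_surj surj_f_inv_f)
  have b: "bij_betw ?c {p. p permutes UNIV} {p. p permutes UNIV}"
    using bij_betw_permutations[of \<sigma> UNIV UNIV] \<sigma> by (simp add: comp_def)
  have "det A = (\<Sum>p\<in>{p. p permutes UNIV}. of_int (sign (?c p)) * (\<Prod>i\<in>UNIV. A $ i $ ?c p i))"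
    unfolding det_def by (rule sum.reindex_bij_betw[OF b, symmetric])
  also have "... = (\<Sum>p\<in>{p. p permutes UNIV}. of_int (sign p) * (\<Prod>i\<in>UNIV. A $ \<sigma> i $ \<sigma> (p i)))"
  proof (rule sum.cong[OF refl])
    fix p :: "'m => 'm" assume "p \<in> {p. p permutes UNIV}"
    then have p: "p permutes UNIV" by simp
    have "map_permutation UNIV \<sigma> p = ?c p" using \<sigma> by (simp add: map_permutation_def bij_is_surj fun_eq_iff)
    then have s: "sign (?c p) = sign p" using sign_map_permutation[of \<sigma> UNIV p] \<sigma> p by (simp add: bij_is_inj)
    have "(\<Prod>i\<in>UNIV. A $ i $ ?c p i) = (\<Prod>i\<in>UNIV. A $ \<sigma> i $ ?c p (\<sigma> i))"
      using prod.reindex_bij_betw[OF \<sigma>, of "\<lambda>i. A $ i $ ?c p i"] by simp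
    then show "of_int (sign (?c p)) * (\<Prod>i\<in>UNIV. A $ i $ ?c p i) = of_int (sign p) * (\<Prod>i\<in>UNIV. A $ \<sigma> i $ \<sigma> (p i))"
      using s by (simp add: inv)
  qed
  finally show ?thesis by (simp add: det_def)
qed

definition reindex_vec :: "('m => 'n) => real ^ 'n => real ^ 'm" where
  "reindex_vec \<sigma> x = (\<chi> i. x $ \<sigma> i)"

lemma linear_reindex_vec: "linear (reindex_vec \<sigma>)" by (rule linearI) (simp_all add: reindex_vec_def vec_eq_iff)

lemma Basis_vec_axis: "(Basis :: (real ^ 'n) set) = (\<lambda>i. axis i 1) ` UNIV" by (auto simp: Basis_vec_def)

lemma prod_Basis_vec: "(\<Prod>b\<in>(Basis :: (real ^ 'n) set). f b) = (\<Prod>i\<in>UNIV. f (axis i 1))"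
proof -
  have "inj (\<lambda>i :: 'n. axis i (1::real))" by (auto simp: inj_on_def axis_eq_axis)
  then show ?thesis unfolding Basis_vec_axis by (subst prod.reindex) auto
qed

context
  fixes \<sigma> :: "'m::finite => 'n::finite"
  assumes \<sigma>: "bij \<sigma>"
begin

lemma reindex_vec_inverse: "reindex_vec \<sigma> (reindex_vec (inv \<sigma>) y) = y" "reindex_vec (inv \<sigma>) (reindex_vec \<sigma> x) = x"
  using \<sigma> by (simp_all add: reindex_vec_def bij_is_inj bij_is_surj surj_f_inv_f)

lemma norm_reindex_vec: "norm (reindex_vec \<sigma> x) = norm x" unfolding norm_vec_def L2_set_def reindex_vec_def
  using sum.reindex_bij_betw[OF \<sigma>, of "\<lambda>i. nsq (x $ i)"] by simp

lemma lborel_reindex: "distr lborel borel (reindex_vec \<sigma>) = lborel"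
proof (rule lborel_eqI[symmetric])
  fix l u :: "real ^ 'm" assume lu: "!!b. b \<in> Basis ==> l \<bullet> b <= u \<bullet> b"
  have [measurable]: "reindex_vec \<sigma> \<in> borel_funs"
    by (intro borel_measurable_continuous_onI linear_continuous_on linear_conv_bounded_linear[THEN iffD1] linear_reindex_vec)
  have ax: "l $ i <= u $ i" for i using lu[of "axis i 1"] by (simp add: inner_axis)
  have s: "\<sigma> (inv \<sigma> i) = i" "inv \<sigma> (\<sigma> j) = j" for i j using \<sigma> by (simp_all add: bij_is_inj bij_is_surj surj_f_inv_f)
  have "reindex_vec \<sigma> -` box l u = box (reindex_vec (inv \<sigma>) l) (reindex_vec (inv \<sigma>) u)"
    unfolding box_def Basis_vec_axis by (auto simp: inner_axis reindex_vec_def s) (metis s)+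
  then have "emeasure (distr lborel borel (reindex_vec \<sigma>)) (box l u) = emeasure lborel (box (reindex_vec (inv \<sigma>) l) (reindex_vec (inv \<sigma>) u))"
    by (subst emeasure_distr) auto
  also have "... = ennreal (\<Prod>b\<in>Basis. (reindex_vec (inv \<sigma>) u - reindex_vec (inv \<sigma>) l) \<bullet> b)"
    by (rule emeasure_lborel_box) (auto simp: Basis_vec_axis inner_axis reindex_vec_def ax)
  also have "(\<Prod>b\<in>Basis. (reindex_vec (inv \<sigma>) u - reindex_vec (inv \<sigma>) l) \<bullet> b) = (\<Prod>i\<in>UNIV. u $ inv \<sigma> i - l $ inv \<sigma> i)"
    by (simp add: prod_Basis_vec inner_axis reindex_vec_def)
  also have "... = (\<Prod>i\<in>UNIV. u $ i - l $ i)"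
    using prod.reindex_bij_betw[OF bij_imp_bij_inv[OF \<sigma>], of "\<lambda>i. u $ i - l $ i"] by simp
  also have "... = (\<Prod>b\<in>Basis. (u - l) \<bullet> b)" by (simp add: prod_Basis_vec inner_axis)
  finally show "emeasure (distr lborel borel (reindex_vec \<sigma>)) (box l u) = ennreal (\<Prod>b\<in>Basis. (u - l) \<bullet> b)" .
qed simp

lemma matrix_reindex: "matrix (reindex_vec \<sigma> \<circ> f \<circ> reindex_vec (inv \<sigma>)) = (\<chi> i j. matrix f $ \<sigma> i $ \<sigma> j)"
proof -
  have "reindex_vec (inv \<sigma>) (axis j 1) = (axis (\<sigma> j) 1 :: real ^ 'n)" for j
    using \<sigma> by (auto simp: reindex_vec_def axis_def vec_eq_iff bij_is_inj bij_is_surj surj_f_inv_f)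
  then show ?thesis by (simp add: matrix_def reindex_vec_def)
qed

end

text \<open>The range of \<open>g\<close> is obtained only as a Lebesgue set, hence the Borel
  superset \<open>C\<close> and the inequality in the conclusion.\<close>

lemma gauss_change_of_variables_ordered:
  fixes g :: "real ^ 'm::{finite,wellorder} => real ^ 'm::_"
  assumes der: "!!x. (g has_derivative g' x) (at x)" and inj: "inj g"
    and C: "range g \<subseteq> C" "C \<in> sets borel"
  shows "(\<integral>+x. ennreal (\<bar>det (matrix (g' x))\<bar> * gauss_density (g x))) <= emeasure gauss C"
proof -
  have "(\<integral>+x. ennreal (gauss_density (x :: real ^ 'm::_))) = 1"
    using nn_integral_gauss[of "\<lambda>_ :: real ^ 'm::_. 1 :: ennreal"] gauss.emeasure_space_1[where 'a="real ^ 'm::_"] by simp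
  then have i: "integrable lborel (gauss_density :: real ^ 'm::_ => real)" by (intro integrableI_nonneg) auto
  \<comment> \<open>The change of variables is for vector-valued integrands; scalars enter as
    \<open>real ^ 1\<close>.\<close>
  let ?h = "\<lambda>x. vec (gauss_density x) :: real ^ 1"
  have R: "range g \<in> sets lebesgue"
    using der by (intro differentiable_image_in_sets_lebesgue) (auto simp: differentiable_on_def differentiable_def)
  have "gauss_density absolutely_integrable_on (UNIV :: (real ^ 'm::_) set)"
    using i by (simp add: set_integrable_def integrable_completion)
  then have gi: "gauss_density absolutely_integrable_on range g" by (rule set_integrable_subset) (use R in auto)
  define I where "I = integral (range g) gauss_density"
  have "(\<lambda>x. \<bar>det (matrix (g' x))\<bar> *. ?h (g x)) absolutely_integrable_on UNIV \<and>
      integral UNIV (\<lambda>x. \<bar>det (matrix (g' x))\<bar> *. ?h (g x)) = vec I \<longleftrightarrow>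
      ?h absolutely_integrable_on range g \<and> integral (range g) ?h = vec I"
    by (rule has_absolute_integral_change_of_variables) (use der inj in auto)
  moreover have "?h absolutely_integrable_on range g \<and> integral (range g) ?h = vec I"
    using gi by (simp add: absolutely_integrable_on_1_iff integral_on_1_eq I_def)
  ultimately have "(\<lambda>x. \<bar>det (matrix (g' x))\<bar> * gauss_density (g x)) absolutely_integrable_on UNIV"
    "integral UNIV (\<lambda>x. \<bar>det (matrix (g' x))\<bar> * gauss_density (g x)) = I"
    by (simp_all add: absolutely_integrable_on_1_iff integral_on_1_eq)
  then have "((\<lambda>x. \<bar>det (matrix (g' x))\<bar> * gauss_density (g x)) has_integral I) UNIV"
    by (simp add: has_integral_iff absolutely_integrable_on_def)
  from nn_integral_has_integral_lebesgue'[OF _ this]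
  have "(\<integral>+x. ennreal (\<bar>det (matrix (g' x))\<bar> * gauss_density (g x))) = ennreal I" by simp
  also have "... = (\<integral>+x. ennreal (gauss_density x) * indicator (range g) x)"
    using gi unfolding I_def by (intro nn_integral_has_integral_lebesgue'[symmetric] integrable_integral) (auto simp: absolutely_integrable_on_def)
  also have "... <= (\<integral>+x. ennreal (gauss_density x) * indicator C x)"
    using C(1) by (intro nn_integral_mono) (auto split: split_indicator)
  also have "... = emeasure gauss C" using C(2) by (simp add: gauss_def emeasure_density)
  finally show ?thesis .
qed

text \<open>Conjugation by the relabelling preserves norms, Lebesgue measure and
  determinants.\<close>

theorem gauss_change_of_variables:
  fixes g :: "real ^ 'n => real ^ 'n"
  assumes der: "!!x. (g has_derivative g' x) (at x)" and inj: "inj g"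
    and C: "range g \<subseteq> C" "C \<in> sets borel" and m: "(\<lambda>x. det (matrix (g' x))) \<in> borel_funs"
  shows "(\<integral>+x. ennreal (\<bar>det (matrix (g' x))\<bar> * gauss_density (g x))) <= emeasure gauss C"
proof -
  obtain \<sigma> :: "'n ordered_index => 'n" where \<sigma>: "bij \<sigma>"
    using finite_same_card_bij[of "UNIV :: 'n ordered_index set" "UNIV :: 'n set"] card_ordered_index[where 'n='n] by auto
  note i = bij_imp_bij_inv[OF \<sigma>]
  have ii: "inv (inv \<sigma>) = \<sigma>" by (rule inv_inv_eq[OF \<sigma>])
  let ?r = "reindex_vec \<sigma>" and ?s = "reindex_vec (inv \<sigma>)"
  have bl: "bounded_linear ?r" "bounded_linear ?s" using linear_reindex_vec linear_conv_bounded_linear by blast+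
  have rm [measurable]: "?r \<in> borel_funs" "?s \<in> borel_funs"
    using bl by (auto intro: borel_measurable_continuous_onI linear_continuous_on)
  have gm [measurable]: "g \<in> borel_funs"
    using has_derivative_continuous[OF der] by (intro borel_measurable_continuous_onI continuous_at_imp_continuous_on) auto
  have nd: "gauss_density (?s y) = gauss_density y" "gauss_density (?r x) = gauss_density x" for x y
    using norm_reindex_vec[OF i, of y] norm_reindex_vec[OF \<sigma>, of x] card_ordered_index[where 'n='n]
    by (simp_all add: gauss_density_def)
  have "(\<integral>+x. ennreal (\<bar>det (matrix (g' x))\<bar> * gauss_density (g x)))
     = (\<integral>+y. ennreal (\<bar>det (matrix (g' (?s y)))\<bar> * gauss_density (g (?s y))))"
    using m by (subst lborel_reindex[OF i, symmetric]) (subst nn_integral_distr, auto)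
  also have "... = (\<integral>+y. ennreal (\<bar>det (matrix (?r \<circ> g' (?s y) \<circ> ?s))\<bar> * gauss_density ((?r \<circ> g \<circ> ?s) y)))"
    by (simp add: matrix_reindex[OF \<sigma>] det_reindex[OF \<sigma>] nd)
  also have "... <= emeasure gauss (?s -` C)"
  proof (rule gauss_change_of_variables_ordered)
    fix y
    have "((\<lambda>y. ?r (g (?s y))) has_derivative (\<lambda>v. ?r (g' (?s y) (?s v)))) (at y)"
      by (rule has_derivative_compose[OF has_derivative_compose[OF bounded_linear_imp_has_derivative[OF bl(2)] der] bounded_linear_imp_has_derivative[OF bl(1)]])
    then show "(?r \<circ> g \<circ> ?s has_derivative ?r \<circ> g' (?s y) \<circ> ?s) (at y)" by (simp add: o_def)
    show "inj (?r \<circ> g \<circ> ?s)" using inj reindex_vec_inverse[OF \<sigma>] by (intro inj_compose) (auto intro: inj_on_inverseI)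
    show "range (?r \<circ> g \<circ> ?s) \<subseteq> ?s -` C" using C reindex_vec_inverse[OF \<sigma>] by auto
    show "?s -` C \<in> sets borel" using measurable_sets[OF rm(2) C(2)] by simp
  qed
  also have "emeasure gauss (?s -` C) = emeasure gauss C"
  proof -
    have "emeasure gauss C = (\<integral>\<^sup>+x. ennreal (gauss_density x) * indicator C x \<partial>distr lborel borel ?s)"
      using C(2) by (simp add: gauss_def emeasure_density lborel_reindex[OF i])
    also have "... = (\<integral>+y. ennreal (gauss_density y) * indicator (?s -` C) y)"
      using C(2) by (subst nn_integral_distr) (auto simp: nd indicator_def)
    also have "... = emeasure gauss (?s -` C)"
      using measurable_sets[OF rm(2) C(2)] by (simp add: gauss_def emeasure_density)
    finally show ?thesis ..
  qed
  finally show ?thesis .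
qed

section \<open>An entropy lower bound for the log-determinant\<close>

definition ou_mat :: "real => (real ^ 'n => real ^ 'n) => real ^ 'n => real ^ 'n ^ 'n" where
  "ou_mat a T x = matrix (oud a T x)"

lemma transpose_matrix_symmetric:
  fixes f :: "real ^ 'n => real ^ 'n"
  assumes "!!v w. f v \<bullet> w = v \<bullet> f w"
  shows "transpose (matrix f) = matrix f"
proof -
  have "f (axis i 1) $ j = f (axis j 1) $ i" for i j
    using assms[of "axis i 1" "axis j 1"] by (simp add: inner_axis inner_commute[of "axis i 1"])
  then show ?thesis by (simp add: transpose_def matrix_def)
qed

text \<open>The smoothed derivative has no uniform lower bound, so it is shifted by
  \<open>\<kappa>\<close>. The inverse then costs \<open>1 / \<kappa>\<close> on general vectors,
  but nothing on the range of \<open>N\<close>: the first bound is spent on the remainder, the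
  second on the linear part.\<close>

lemma shifted_matrix_bounds:
  fixes N :: "real ^ 'n ^ 'n"
  assumes sym: "transpose N = N" and nn: "!!v. 0 <= (N *v v) \<bullet> v" and k: "0 < \<kappa>"
  shows "pos_def (N +. \<kappa>)"
    and "norm (matrix_inv (N +. \<kappa>) *v v) <= norm v / \<kappa>"
    and "norm (matrix_inv (N +. \<kappa>) *v (N *v v)) <= norm v"
proof -
  let ?A = "N +. \<kappa>" and ?S = "matrix_inv (N +. \<kappa>)"
  have Av: "?A *v w = N *v w + \<kappa> *. w" for w
    by (simp add: matrix_vector_mult_add_rdistrib scaleR_matrix_vector_assoc[symmetric])
  have "transpose ?A = ?A" using sym by (simp add: vec_eq_iff transpose_def mat_def)
  moreover have "0 < w \<bullet> (?A *v w)" if "w ~= 0" for w using nn[of w] k that unfolding Av inner_add_right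
    by (intro add_nonneg_pos) (auto simp: inner_commute)
  ultimately show pd: "pos_def ?A" by (simp add: pos_def_def)
  then have "invertible ?A" using pos_def_det_pos[OF pd] by (simp add: invertible_det_nz)
  then have AS: "?A *v (?S *v w) = w" for w by (simp add: matrix_vector_mul_assoc matrix_inv_mult)
  show "norm (?S *v v) <= norm v / \<kappa>"
  proof -
    define w where "w = ?S *v v"
    have e: "N *v w + \<kappa> *. w = v" using AS[of v] by (simp add: w_def Av)
    have "\<kappa> * nsq w <= (N *v w) \<bullet> w + \<kappa> * (w \<bullet> w)" using nn[of w] by (simp add: power2_norm_eq_inner)
    also have "... = v \<bullet> w" unfolding e[symmetric] by (simp add: inner_add_left)
    also have "... <= norm v * norm w" by (rule norm_cauchy_schwarz)
    finally have "(\<kappa> * norm w) * norm w <= norm v * norm w" by (simp add: power2_eq_square)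
    then have "\<kappa> * norm w <= norm v" by (cases "w = 0") auto
    then show ?thesis using k by (simp add: w_def pos_le_divide_eq mult.commute)
  qed
  show "norm (?S *v (N *v v)) <= norm v"
  proof -
    define w where "w = ?S *v (N *v v)"
    have e: "N *v w + \<kappa> *. w = N *v v" using AS[of "N *v v"] by (simp add: w_def Av)
    then have "N *v (v - w) = \<kappa> *. w" by (simp add: algebra_simps)
    then have "0 <= \<kappa> * (w \<bullet> (v - w))" using nn[of "v - w"] by simp
    then have "w \<bullet> w <= w \<bullet> v" using k by (simp add: zero_le_mult_iff inner_diff_right)
    also have "... <= norm w * norm v" by (rule norm_cauchy_schwarz)
    finally have "norm w * norm w <= norm v * norm w" by (simp add: dot_square_norm power2_eq_square mult.commute)
    then show ?thesis by (cases "w = 0") (auto simp: w_def)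
  qed
qed

lemma norm_sum_sq_le:
  fixes u v :: "'a::real_inner"
  assumes \<eta>: "0 < \<eta>"
  shows "nsq (u + v) <= (1 + \<eta>) * nsq u + (1 + 1 / \<eta>) * nsq v"
proof -
  have "0 <= nsq (sqrt \<eta> *. u - (1 / sqrt \<eta>) *. v)" by simp
  also have "... = \<eta> * (u \<bullet> u) - 2 * (u \<bullet> v) + (v \<bullet> v) / \<eta>"
    using \<eta> by (simp add: power2_norm_eq_inner inner_diff_right inner_commute)
  finally show ?thesis by (simp add: power2_norm_eq_inner inner_commute algebra_simps)
qed

text \<open>Jensen's inequality by way of \<open>1 + u <= exp u\<close>. Both changes of variables
  below end with it.\<close>

lemma (in prob_space) integral_le_zero_of_exp_le_one:
  assumes f: "integrable M f" and e: "(\<integral>\<^sup>+x. ennreal (exp (f x)) \<partial>M) <= 1"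
  shows "(\<integral>x. f x \<partial>M) <= 0"
proof -
  have i: "integrable M (\<lambda>x. exp (f x))" using f e by (intro integrableI_nonneg) (auto intro: le_less_trans)
  have "(\<integral>x. 1 + f x \<partial>M) <= (\<integral>x. exp (f x) \<partial>M)" using f i by (intro integral_mono) auto
  also have "... <= 1" using e nn_integral_eq_integral[OF i] by simp
  finally show ?thesis using f prob_space by simp
qed

lemma trace_le_norm:
  fixes M :: "real ^ 'n ^ 'n"
  assumes "!!v. norm (M *v v) <= c * norm v"
  shows "trace M <= c * CARD('n)"
proof -
  have "M $ i $ i <= c" for i
  proof -
    have "M $ i $ i = (M *v axis i 1) $ i" by (simp add: matrix_vector_mult_basis column_def)
    also have "... <= norm (M *v axis i 1)" using component_le_norm_cart[of "M *v axis i 1" i] by linarith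
    also have "... <= c" using assms[of "axis i 1"] by simp
    finally show ?thesis .
  qed
  then have "trace M <= (\<Sum>i\<in>(UNIV::'n set). c)" unfolding trace_def by (intro sum_mono)
  then show ?thesis by (simp add: mult.commute)
qed

lemma pos_def_mat_1: "pos_def (mat 1 :: real ^ 'n ^ 'n)" by (auto simp: pos_def_def)

lemma ln_det_upper:
  fixes A :: "real ^ 'n ^ 'n"
  assumes A: "pos_def A" and c: "!!v. norm (A *v v) <= c * norm v"
  shows "ln (det A) <= (c - 1) * CARD('n)"
proof -
  have "matrix_inv (mat 1) = (mat 1 :: real ^ 'n ^ 'n)" by (rule matrix_inv_eqI) simp_all
  then show ?thesis using ln_det_tangent[OF pos_def_mat_1 A] trace_le_norm[OF c] by (simp add: algebra_simps)
qed

lemma ln_det_lower: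
  fixes A :: "real ^ 'n ^ 'n"
  assumes A: "pos_def A" and k: "!!v. norm (matrix_inv A *v v) <= norm v / \<kappa>"
  shows "(1 - 1 / \<kappa>) * CARD('n) <= ln (det A)"
  using ln_det_tangent[OF A pos_def_mat_1] trace_le_norm[of "matrix_inv A" "1 / \<kappa>"] k by (simp add: algebra_simps)

lemma det_measurable [measurable (raw)]:
  fixes A :: "'a => real ^ 'n ^ 'n"
  assumes [measurable]: "!!i j. (\<lambda>x. A x $ i $ j) \<in> borel_measurable M"
  shows "(\<lambda>x. det (A x)) \<in> borel_measurable M" unfolding det_def by measurable

locale gaussian_transport =
  fixes \<phi> :: "real ^ 'n => real" and T :: "real ^ 'n => real ^ 'n" and K :: "(real ^ 'n) set"
  assumes smooth: "one_smooth \<phi> T" and K [measurable]: "K \<in> sets borel" and K_pos: "0 < measure gauss K"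
    and law: "distr gauss borel T = density lborel (\<lambda>y. ennreal (indicator K y * gauss_density y / measure gauss K))"
begin

lemma lip: "1-lipschitz_on UNIV T" by (rule one_smooth_lipschitz[OF smooth])

lemma T_measurable [measurable]: "T \<in> borel_funs" by (rule lipschitz_measurable[OF lip])

lemma ou_mat_mult: "0 < a ==> a < 1 ==> ou_mat a T x *v v = oud a T x v"
  unfolding ou_mat_def by (rule fun_cong[OF matrix_vector_mul(2)[OF oud_linear[OF lip]]])

lemma ou_mat_symmetric: "0 < a ==> a < 1 ==> transpose (ou_mat a T x) = ou_mat a T x"
  unfolding ou_mat_def using oud_symmetric[OF smooth] by (intro transpose_matrix_symmetric) auto

lemma ou_mat_nonneg: "0 < a ==> a < 1 ==> 0 <= (ou_mat a T x *v v) \<bullet> v"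
  using oud_nonneg[OF smooth] by (simp add: ou_mat_mult)

lemma ou_mat_contraction: "0 < a ==> a < 1 ==> norm (ou_mat a T x *v v) <= norm v"
  using oud_norm_le[OF lip] by (simp add: ou_mat_mult)

lemma ou_mat_continuous: "0 < a ==> a < 1 ==> continuous_on UNIV (\<lambda>x. ou_mat a T x $ i $ j)"
  unfolding ou_mat_def matrix_def using oud_continuous[OF lip] by (simp add: continuous_on_component)

text \<open>For fixed \<open>x\<close> the affine map \<open>G\<close> undoes the linearisation of
  \<open>z \<mapsto> T (a *. x + b *. z)\<close>. The exponent is such that, after substituting
  \<open>X = a *. x + b *. z\<close> and pushing forward by \<open>T\<close>, the Gaussian factors
  and the measure of \<open>K\<close> cancel; the rest is the Gaussian mass covered by
  \<open>G\<close>, restricted to \<open>K\<close>.\<close>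

lemma entropy_pointwise_exp:
  fixes x :: "real ^ 'n"
  assumes a: "0 < a" "a < 1" and k: "0 < \<kappa>"
  defines "b \<equiv> sqrt (1 - a^2)" and "A \<equiv> ou_mat a T x +. \<kappa>"
  shows "(\<integral>\<^sup>+z. ennreal (exp (ln (measure gauss K) - ln (det A)
       - nsq ((1 / b) *. (matrix_inv A *v (T (a *. x + b *. z) - ou a T x))) / 2
       - nsq (a *. x + b *. z) / 2 + nsq (T (a *. x + b *. z)) / 2 + nsq z / 2)) \<partial>gauss) <= 1"
proof -
  have b: "0 < b" unfolding b_def by (rule ou_b_pos[OF lip a])
  note pd = shifted_matrix_bounds(1)[OF ou_mat_symmetric[OF a] ou_mat_nonneg[OF a] k, of x, folded A_def]
  have dA: "0 < det A" by (rule pos_def_det_pos[OF pd])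
  let ?S = "matrix_inv A" and ?g = "gauss_density :: real ^ 'n => real"
  have inv: "invertible A" using dA by (simp add: invertible_det_nz)
  have dS: "det ?S = 1 / det A"
    using matrix_inv_mult(1)[OF inv] dA by (metis det_I det_mul less_irrefl nonzero_eq_divide_eq mult.commute)
  define G where "G y = (1 / b) *. (?S *v (y - ou a T x))" for y
  let ?G = "\<lambda>v. (1 / b) *. (matrix_inv A *v v)"
  have Gd: "(G has_derivative ?G) (at y)" for y
  proof -
    have "((\<lambda>y. ?S *v (y - ou a T x)) has_derivative (\<lambda>v. ?S *v v)) (at y)"
      by (rule has_derivative_compose[OF _ linear_imp_has_derivative[OF matrix_vector_mul_linear]])
        (auto intro!: derivative_eq_intros)
    then show ?thesis unfolding G_def[abs_def] by (rule has_derivative_scaleR_right)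
  qed
  have [measurable]: "G \<in> borel_funs"
    using has_derivative_continuous[OF Gd] by (intro borel_measurable_continuous_onI continuous_at_imp_continuous_on) auto
  have Gi: "inj G"
  proof (rule injI)
    fix u v assume "G u = G v"
    then have "?S *v (u - ou a T x) = ?S *v (v - ou a T x)" using b by (simp add: G_def)
    then have "A *v (?S *v (u - ou a T x)) = A *v (?S *v (v - ou a T x))" by simp
    then show "u = v" by (simp add: matrix_vector_mul_assoc matrix_inv_mult[OF inv])
  qed
  have mG: "matrix ?G = (1 / b) *. ?S" by (simp add: matrix_def vec_eq_iff matrix_vector_mul_component inner_axis)
  have dG: "det (matrix ?G) = (1 / b) ^ CARD('n) * (1 / det A)"
    unfolding mG dS[symmetric] by (simp add: det_def sum_distrib_left mult_ac prod_dividef power_one_over)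
  let ?T = "\<lambda>z. T (a *. x + b *. z)" and ?y = "\<lambda>z. a *. x + b *. z" and ?c = "measure gauss K / det A" and ?l = "ln (measure gauss K) - ln (det A)"
  define F where "F X = (1 / b) ^ CARD('n) * (?c * ?g (G (T X)) * ?g X / ?g (T X))" for X
  have [measurable]: "F \<in> borel_funs" unfolding F_def[abs_def] by measurable
  let ?E = "\<lambda>z. ?l - nsq (G (?T z)) / 2 - nsq (?y z) / 2 + nsq (?T z) / 2 + nsq z / 2" and ?k = "\<lambda>y. (1 / b) ^ CARD('n) * (?c * ?g (G y) / ?g y)"
  have "(\<integral>\<^sup>+z. ennreal (exp (?E z)) \<partial>gauss)
    = (\<integral>+z. ennreal (b ^ CARD('n)) * ennreal (F (?y z)))"
  proof (subst nn_integral_gauss, measurable, rule nn_integral_cong)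
    fix z :: "real ^ 'n"
    have "?g z * exp (?E z)
     = b ^ CARD('n) * F (?y z)"
    proof -
      have e: "exp l * (C * exp u) * (C * exp v) / (C * exp w) = C * exp y * exp t"
        if "C > 0" "l + u + v = w + y + t" for C l u v w y t :: real
        using that by (simp add: field_simps flip: exp_add)
      have "?c = exp (?l)" using K_pos dA by (simp add: exp_diff)
      then show ?thesis using b e[of "(2 * pi) powr (- (real DIM(real ^ 'n) / 2))" "?l"
            "- nsq (G (?T z)) / 2" "- nsq (?y z) / 2"
            "- nsq (?T z) / 2" "- nsq z / 2"
            "?E z"] unfolding F_def gauss_density_def by (simp add: power_one_over)
    qed
    then show "ennreal (?g z) * ennreal (exp (?E z))
      = ennreal (b ^ CARD('n)) * ennreal (F (?y z))" using b by (simp flip: ennreal_mult')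
  qed
  also have "... = (\<integral>+X. ennreal (F X))"
    using b by (subst nn_integral_lborel_affine[of "\<lambda>X. ennreal (F X)" b "a *. x"]) (auto simp: nn_integral_cmult)
  also have "... = (\<integral>\<^sup>+X. ennreal ((1 / b) ^ CARD('n) * (?c * ?g (G (T X)) / ?g (T X))) \<partial>gauss)"
    using b dA by (subst nn_integral_gauss, measurable, intro nn_integral_cong)
      (simp add: F_def flip: ennreal_mult')
  also have "... = (\<integral>\<^sup>+y. ennreal (?k y) \<partial>distr gauss borel T)" by (subst nn_integral_distr) auto
  also have "... = (\<integral>+y. ennreal (indicator K y * gauss_density y / measure gauss K)
       * ennreal (?k y))" unfolding law by (subst nn_integral_density) auto
  also have "... <= (\<integral>+y. ennreal (\<bar>det (matrix ?G)\<bar> * ?g (G y)))"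
  proof (rule nn_integral_mono)
    fix y :: "real ^ 'n"
    have "indicator K y * ?g y / measure gauss K * (?k y)
      = indicator K y * ((1 / b) ^ CARD('n) * (1 / det A) * ?g (G y))" using K_pos gauss_density_pos[of y] by simp
    also have "... <= 1 * ((1 / b) ^ CARD('n) * (1 / det A) * ?g (G y))" using b dA by (intro mult_right_mono) auto
    finally show "ennreal (indicator K y * ?g y / measure gauss K)
       * ennreal (?k y)
      <= ennreal (\<bar>det (matrix ?G)\<bar> * ?g (G y))" unfolding dG using b dA by (subst ennreal_mult'[symmetric]) auto
  qed
  also have "... <= emeasure gauss (UNIV :: (real ^ 'n) set)" by (rule gauss_change_of_variables[OF Gd Gi]) auto
  also have "... = 1" using gauss.emeasure_space_1[where 'a="real ^ 'n"] by simp
  finally show ?thesis unfolding G_def .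
qed

text \<open>Jensen applied to the exponential bound. The point is to control \<open>W z\<close>, the
  image of \<open>T\<close> under \<open>G\<close>: its linear part is a contraction of
  \<open>z\<close>, and the rest is \<open>ou_residual\<close> divided by
  \<open>\<kappa> * b\<close>. Young's inequality with weight \<open>\<eta>\<close> separates
  them.\<close>

lemma entropy_pointwise:
  fixes x :: "real ^ 'n" and \<eta> :: real
  assumes a: "0 < a" "a < 1" and k: "0 < \<kappa>" and \<eta>: "0 < \<eta>"
  defines "b \<equiv> sqrt (1 - a^2)"
  shows "ln (measure gauss K) - (\<oint>z. nsq (a *. x + b *. z)) / 2 + (\<oint>z. nsq (T (a *. x + b *. z))) / 2
      - \<eta> * CARD('n) / 2 - (1 + 1 / \<eta>) / (\<kappa>^2 * b^2) * (\<oint>z. nsq (ou_residual a T x z)) / 2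
    <= ln (det (ou_mat a T x +. \<kappa>))"
proof -
  let ?T = "\<lambda>z. T (a *. x + b *. z)" and ?R = "ou_residual a T x" and ?c = "(1 + 1 / \<eta>) / (\<kappa>^2 * b^2)" and ?y = "\<lambda>z. a *. x + b *. z"
  define A where "A = ou_mat a T x +. \<kappa>"
  define W where "W z = (1 / b) *. (matrix_inv A *v (?T z - ou a T x))" for z
  have b: "0 < b" unfolding b_def by (rule ou_b_pos[OF lip a])
  note sb = shifted_matrix_bounds[OF ou_mat_symmetric[OF a] ou_mat_nonneg[OF a] k, of x, folded A_def]
  let ?d = "\<lambda>z. ?T z - ou a T x"
  have bnd: "nsq (W z) <= (1 + \<eta>) * nsq z + ?c * nsq (?R z)" for z
  proof -
    have "?d z = b *. (ou_mat a T x *v z) + ?R z" by (simp add: ou_mat_mult[OF a] ou_residual_def b_def)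
    then have "W z = matrix_inv A *v (ou_mat a T x *v z) + (1 / b) *. (matrix_inv A *v ?R z)"
      using b by (simp add: W_def matrix_vector_right_distrib scaleR_add_right matrix_vector_mult_scaleR)
    then have "nsq (W z) <= (1 + \<eta>) * nsq (matrix_inv A *v (ou_mat a T x *v z))
        + (1 + 1 / \<eta>) * nsq ((1 / b) *. (matrix_inv A *v ?R z))" by (simp only: norm_sum_sq_le[OF \<eta>])
    also have "... <= (1 + \<eta>) * nsq z + (1 + 1 / \<eta>) * (norm (?R z) / (\<kappa> * b))^2"
    proof (intro add_mono mult_left_mono power_mono)
      have "norm ((1 / b) *. (matrix_inv A *v ?R z)) = norm (matrix_inv A *v ?R z) / b" using b by simp
      also have "... <= (norm (?R z) / \<kappa>) / b" using b by (intro divide_right_mono sb(2)) simp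
      finally show "norm ((1 / b) *. (matrix_inv A *v ?R z)) <= norm (?R z) / (\<kappa> * b)" by simp
    qed (use sb(3) \<eta> in auto)
    finally show ?thesis by (simp add: power_divide power_mult_distrib)
  qed
  have li: "(1 * \<bar>b\<bar>)-lipschitz_on UNIV (\<lambda>z. ?T z)" by (rule lipschitz_affine[OF lip])
  have i1: "integrable gauss (\<lambda>z. nsq (?T z))" by (rule integrable_gauss_lipschitz(2)[OF li])
  have i2: "integrable gauss (\<lambda>z. nsq (?y z))" by (rule integrable_gauss_lipschitz(2)[OF lipschitz_affine[OF lipschitz_ident]])
  have i3: "integrable gauss (\<lambda>z :: real ^ 'n. nsq z)" by (rule integrable_gauss_lipschitz(2)[OF lipschitz_ident])
  have [measurable]: "?R \<in> borel_funs" using ou_residual_measurable(2)[OF lip a, of x] by simp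
  have i4: "integrable gauss (\<lambda>z. nsq (?R z))"
  proof (rule Bochner_Integration.integrable_bound)
    show "integrable gauss (\<lambda>z. 2 * nsq (?d z) + 2 * nsq z)"
    proof (intro Bochner_Integration.integrable_add integrable_mult_right i3)
      have "(1 * \<bar>b\<bar> + 0)-lipschitz_on UNIV ?d" by (rule lipschitz_on_diff[OF li]) (rule lipschitz_onI, auto)
      then show "integrable gauss (\<lambda>z. nsq (?d z))" by (rule integrable_gauss_lipschitz(2))
    qed
    show "AE z in gauss. norm (nsq (?R z)) <= norm (2 * nsq (?d z) + 2 * nsq z)"
    proof (rule AE_I2)
      fix z
      have "?R z = (?d z) + (- (b *. oud a T x z))" by (simp add: ou_residual_def b_def)
      then have "nsq (?R z) <= 2 * nsq (?d z) + 2 * nsq (b *. oud a T x z)"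
        using norm_sum_sq_le[of 1 "?d z" "- (b *. oud a T x z)"] by simp
      also have "nsq (b *. oud a T x z) <= nsq z"
      proof (rule power_mono)
        have "b <= 1" unfolding b_def by simp
        then show "norm (b *. oud a T x z) <= norm z"
          using b oud_norm_le[OF lip a, of x z] mult_mono[of b 1 "norm (oud a T x z)" "norm z"] by simp
      qed simp
      finally show "norm (nsq (?R z)) <= norm (2 * nsq (?d z) + 2 * nsq z)" by simp
    qed
  qed simp
  have i5: "integrable gauss (\<lambda>z. nsq (W z))"
  proof (rule Bochner_Integration.integrable_bound)
    show "integrable gauss (\<lambda>z. (1 + \<eta>) * nsq z + ?c * nsq (?R z))"
      by (intro Bochner_Integration.integrable_add integrable_mult_right i3 i4)
    have "continuous_on UNIV W" unfolding W_def[abs_def]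
      by (intro continuous_intros linear_continuous_on_compose[OF _ matrix_vector_mul_linear] lipschitz_on_continuous_on[OF li])
    from borel_measurable_continuous_onI[OF this] have [measurable]: "W \<in> borel_funs" .
    show "(\<lambda>z. nsq (W z)) \<in> borel_measurable gauss" by measurable
    show "AE z in gauss. norm (nsq (W z)) <= norm ((1 + \<eta>) * nsq z + ?c * nsq (?R z))"
      using bnd by (auto intro: order_trans[OF _ abs_ge_self])
  qed
  have W: "(\<oint>z. nsq (W z)) <= (1 + \<eta>) * CARD('n) + ?c * (\<oint>z. nsq (?R z))"
  proof -
    have "(\<oint>z. nsq (W z)) <= (\<oint>z. (1 + \<eta>) * nsq z + ?c * nsq (?R z))"
      by (intro integral_mono i5 Bochner_Integration.integrable_add integrable_mult_right i3 i4 bnd)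
    then show ?thesis using i3 i4 integral_gauss_norm_sq[where 'a="real ^ 'n"] by simp
  qed
  have "(\<oint>z. ln (measure gauss K) - ln (det A) - nsq (W z) / 2
       - nsq (?y z) / 2 + nsq (?T z) / 2 + nsq z / 2) <= 0" by (rule gauss.integral_le_zero_of_exp_le_one)
      (auto intro!: Bochner_Integration.integrable_add integrable_divide_zero i1 i2 i3 i5
        entropy_pointwise_exp[OF a k, of x, folded b_def A_def, folded W_def])
  moreover have "(\<oint>z. ln (measure gauss K) - ln (det A) - nsq (W z) / 2
       - nsq (?y z) / 2 + nsq (?T z) / 2 + nsq z / 2)
    = ln (measure gauss K) - ln (det A) - (\<oint>z. nsq (W z)) / 2 - (\<oint>z. nsq (?y z)) / 2
      + (\<oint>z. nsq (?T z)) / 2 + real CARD('n) / 2"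
    using integral_gauss_norm_sq[where 'a="real ^ 'n"] i1 i2 i3 i5 gauss.prob_space[where 'a="real ^ 'n"] by simp
  moreover have "I <= 0 ==> I = g - A - w / 2 - y / 2 + t / 2 + n / 2 ==> w <= (1 + e) * n + r ==> g - y / 2 + t / 2 - e * n / 2 - r / 2 <= A"
    for I g A w y t n e r :: real by (simp add: distrib_right)
  ultimately show ?thesis using W unfolding A_def[symmetric] by blast
qed

lemma ou_mat_measurable: "0 < a ==> a < 1 ==> (\<lambda>x. ou_mat a T x $ i $ j) \<in> borel_funs"
  by (rule borel_measurable_continuous_onI[OF ou_mat_continuous])

lemma ou_mat_det_measurable:
  assumes a: "0 < a" "a < 1"
  shows "(\<lambda>x. det (ou_mat a T x +. \<kappa>)) \<in> borel_funs"
proof (rule det_measurable)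
  note [measurable] = ou_mat_measurable[OF a]
  show "(\<lambda>x. (ou_mat a T x +. \<kappa>) $ i $ j) \<in> borel_funs" for i j unfolding vector_add_component by measurable
qed

lemma ou_mat_shifted:
  assumes a: "0 < a" "a < 1" and k: "0 < \<kappa>"
  shows "pos_def (ou_mat a T x +. \<kappa>)"
    "(1 - 1 / \<kappa>) * CARD('n) <= ln (det (ou_mat a T x +. \<kappa>))"
    "ln (det (ou_mat a T x +. \<kappa>)) <= \<kappa> * CARD('n)"
    "integrable gauss (\<lambda>x. ln (det (ou_mat a T x +. \<kappa>)))"
proof -
  note sb = shifted_matrix_bounds[OF ou_mat_symmetric[OF a] ou_mat_nonneg[OF a] k]
  let ?M = "\<lambda>x. ou_mat a T x +. \<kappa>"
  have c: "norm ((?M x) *v v) <= (1 + \<kappa>) * norm v" for x v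
  proof -
    have "norm ((?M x) *v v) <= norm (ou_mat a T x *v v) + norm (\<kappa> *. v)"
      unfolding matrix_vector_mult_add_rdistrib scaleR_matrix_vector_assoc[symmetric] matrix_vector_mul_lid by (rule norm_triangle_ineq)
    then show ?thesis using ou_mat_contraction[OF a, of x v] k by (simp add: algebra_simps)
  qed
  show "pos_def (?M x)" by (rule sb(1))
  show l: "(1 - 1 / \<kappa>) * CARD('n) <= ln (det (?M x))" for x by (rule ln_det_lower[OF sb(1) sb(2)])
  show u: "ln (det (?M x)) <= \<kappa> * CARD('n)" for x using ln_det_upper[OF sb(1) c, of x] by simp
  show "integrable gauss (\<lambda>x. ln (det (?M x)))"
  proof (rule gauss.integrable_const_bound)
    show "AE x in gauss. norm (ln (det (?M x))) <= \<bar>(1 - 1 / \<kappa>) * CARD('n)\<bar> + \<bar>\<kappa> * CARD('n)\<bar>"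
      using l u by (intro AE_I2) (smt (verit) real_norm_def)
    note [measurable] = ou_mat_det_measurable[OF a]
    show "(\<lambda>x. ln (det (?M x))) \<in> borel_measurable gauss" by measurable
  qed
qed

text \<open>Integration over \<open>x\<close>. The factor \<open>1 - a^2\<close> in the residual
  bound cancels the \<open>1 / b^2\<close> from the linearisation, so the error is a Dirichlet
  increment alone and can be made small.\<close>

lemma entropy_average:
  fixes \<eta> :: real
  assumes a: "0 < a" "a < 1" and a0: "0 < a0" "a0 < a" and k: "0 < \<kappa>" and \<eta>: "0 < \<eta>"
    and B: "!!r. 0 < r ==> r < 1 ==> dirichlet T r <= B"
  shows "ln (measure gauss K) + (\<oint>x. nsq (T x)) / 2 - CARD('n) / 2
      - \<eta> * CARD('n) / 2 - (1 + 1 / \<eta>) / \<kappa>^2 * (5 / 4 * (B - dirichlet T a0)) / 2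
    <= (\<oint>x. ln (det (ou_mat a T x +. \<kappa>)))"
proof -
  define b where "b = sqrt (1 - a^2)"
  have b: "0 < b" "b^2 = 1 - a^2" unfolding b_def by (rule ou_b_pos[OF lip a]) (rule ou_b_sq[OF lip a])
  have e: "0 <= 5 / 4 * (1 - a^2) * (B - dirichlet T a0)"
    using b a0 a B[of a0] by (intro mult_nonneg_nonneg) (auto simp flip: b(2))
  note R = ou_residual_bound_limit[OF lip a a0 B]
  have [measurable]: "(\<lambda>p. ou_residual a T (fst p) (snd p)) \<in> borel_measurable gauss2"
    by (rule ou_residual_measurable(1)[OF lip a])
  have ri: "integrable gauss2 (\<lambda>p. nsq (ou_residual a T (fst p) (snd p)))"
    using R by (intro integrableI_nonneg) (auto intro: le_less_trans)
  have "ennreal (\<integral>p. nsq (ou_residual a T (fst p) (snd p)) \<partial>gauss2) <= ennreal (5 / 4 * (1 - a^2) * (B - dirichlet T a0))"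
    using R nn_integral_eq_integral[OF ri] by simp
  then have r: "(\<integral>p. nsq (ou_residual a T (fst p) (snd p)) \<partial>gauss2) <= 5 / 4 * (1 - a^2) * (B - dirichlet T a0)"
    using e by simp
  define f1 where "f1 x = (\<oint>z. nsq (a *. x + b *. z))" for x :: "real ^ 'n"
  define f2 where "f2 x = (\<oint>z. nsq (T (a *. x + b *. z)))" for x
  define f3 where "f3 x = (\<oint>z. nsq (ou_residual a T x z))" for x
  note I = lipschitz_ident[where 'a="real ^ 'n"]
  have f1: "integrable gauss f1" "(\<oint>x. f1 x) = CARD('n)"
    using gauss2.integral_fst'[OF integral_mix(1)[OF a integrable_gauss_lipschitz(2)[OF I]]]
      gauss2.integrable_fst'[OF integral_mix(1)[OF a integrable_gauss_lipschitz(2)[OF I]]]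
      integral_mix(2)[OF a integrable_gauss_lipschitz(2)[OF I]] integral_gauss_norm_sq[where 'a="real ^ 'n"]
    unfolding f1_def b_def by simp_all
  have f2: "integrable gauss f2" "(\<oint>x. f2 x) = (\<oint>x. nsq (T x))"
    using gauss2.integral_fst'[OF integral_mix(1)[OF a integrable_gauss_lipschitz(2)[OF lip]]]
      gauss2.integrable_fst'[OF integral_mix(1)[OF a integrable_gauss_lipschitz(2)[OF lip]]]
      integral_mix(2)[OF a integrable_gauss_lipschitz(2)[OF lip]] unfolding f2_def b_def by simp_all
  have f3: "integrable gauss f3" "(\<oint>x. f3 x) <= 5 / 4 * b^2 * (B - dirichlet T a0)"
    using gauss2.integral_fst'[OF ri] gauss2.integrable_fst'[OF ri] r unfolding f3_def b(2) by simp_all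
  let ?c = "(1 + 1 / \<eta>) / (\<kappa>^2 * b^2)"
  have "(\<oint>x. ln (measure gauss K) - f1 x / 2 + f2 x / 2 - \<eta> * CARD('n) / 2 - ?c * f3 x / 2)
    <= (\<oint>x. ln (det (ou_mat a T x +. \<kappa>)))"
    using f1(1) f2(1) f3(1) ou_mat_shifted(4)[OF a k] entropy_pointwise[OF a k \<eta>, folded b_def, folded f1_def f2_def f3_def]
    by (intro integral_mono) auto
  moreover have "(\<oint>x. ln (measure gauss K) - f1 x / 2 + f2 x / 2 - \<eta> * CARD('n) / 2 - ?c * f3 x / 2)
    = ln (measure gauss K) - CARD('n) / 2 + (\<oint>x. nsq (T x)) / 2 - \<eta> * CARD('n) / 2 - ?c * (\<oint>x. f3 x) / 2"
    using f1 f2 f3(1) gauss.prob_space[where 'a="real ^ 'n"] by simp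
  moreover have "?c * (\<oint>x. f3 x) <= (1 + 1 / \<eta>) / \<kappa>^2 * (5 / 4 * (B - dirichlet T a0))"
  proof -
    have "?c * (\<oint>x. f3 x) <= ?c * (5 / 4 * b^2 * (B - dirichlet T a0))" using f3(2) \<eta> by (intro mult_left_mono) auto
    also have "... = (1 + 1 / \<eta>) / \<kappa>^2 * (5 / 4 * (B - dirichlet T a0))"
    proof -
      have "X / (k * c) * (w * c * D) = X / k * (w * D)" if "c ~= 0" for X k c w D :: real using that by simp
      then show ?thesis using b(1) by simp
    qed
    finally show ?thesis .
  qed
  moreover have "I <= J ==> I = g - n / 2 + t / 2 - e / 2 - r / 2 ==> r <= s ==> g + t / 2 - n / 2 - e / 2 - s / 2 <= J"
    for I J g n t e r s :: real by simp
  ultimately show ?thesis by blast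
qed

text \<open>The derivative matrix at level \<open>q * r\<close> is an average of those at level
  \<open>r\<close>. The tangent plane of the concave function \<open>ln det\<close> at the averaged
  matrix has no linear contribution, so stronger smoothing can only raise the mean.\<close>

lemma ln_det_semigroup:
  assumes q: "0 < q" "q < 1" and r: "0 < r" "r < 1" and k: "0 < \<kappa>"
  shows "(\<oint>x. ln (det (ou_mat r T x +. \<kappa>))) <= (\<oint>x. ln (det (ou_mat (q * r) T x +. \<kappa>)))"
proof -
  have qr: "0 < q * r" "q * r < 1" using q r mult_strict_mono[of q 1 r 1] by auto
  define b where "b = sqrt (1 - q^2)"
  let ?L = "\<lambda>y. ln (det (ou_mat r T y +. \<kappa>))"
  note pr = ou_mat_shifted[OF r k] and pq = ou_mat_shifted[OF qr k]
  have mix: "integrable gauss2 (\<lambda>p. ?L (q *. fst p + b *. snd p))"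
    "(\<integral>p. ?L (q *. fst p + b *. snd p) \<partial>gauss2) = (\<oint>x. ?L x)" unfolding b_def by (rule integral_mix[OF q pr(4)])+
  have point: "(\<oint>z. ?L (q *. x + b *. z)) <= ln (det (ou_mat (q * r) T x +. \<kappa>))" for x
  proof -
    let ?M = "ou_mat (q * r) T x +. \<kappa>" and ?N = "\<lambda>z. ou_mat r T (q *. x + b *. z)"
    define S where "S = matrix_inv ?M"
    have inv: "invertible ?M" using pos_def_det_pos[OF pq(1)[of x]] by (simp add: invertible_det_nz)
    have Ni: "integrable gauss (\<lambda>z. ?N z $ i $ j)" and Ne: "(\<oint>z. ?N z $ i $ j) = ou_mat (q * r) T x $ i $ j" for i j
    proof -
      have bl: "bounded_linear (\<lambda>v :: real ^ 'n. v $ i)" by auto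
      show "integrable gauss (\<lambda>z. ?N z $ i $ j)"
        using integrable_bounded_linear[OF bl oud_semigroup(1)[OF lip q r, of x "axis j 1"]] by (simp add: ou_mat_def matrix_def b_def)
      show "(\<oint>z. ?N z $ i $ j) = ou_mat (q * r) T x $ i $ j"
        using integral_bounded_linear[OF bl oud_semigroup(1)[OF lip q r, of x "axis j 1"]] oud_semigroup(2)[OF lip q r, of x "axis j 1"]
        by (simp add: ou_mat_def matrix_def b_def)
    qed
    have tr: "trace (S ** (X +. \<kappa>)) = (\<Sum>i\<in>UNIV. \<Sum>j\<in>UNIV. S $ i $ j * X $ j $ i) + \<kappa> * trace S" for X
      by (simp add: trace_def matrix_matrix_mult_def mat_def distrib_left sum.distrib sum_distrib_left
          if_distrib[of "\<lambda>y. _ * y"] mult.commute cong: if_cong)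
    have "(\<oint>z. ?L (q *. x + b *. z)) <= (\<oint>z. ln (det ?M) + trace (S ** (?N z +. \<kappa>)) - real CARD('n))"
    proof (rule integral_mono)
      show "integrable gauss (\<lambda>z. ?L (q *. x + b *. z))"
      proof (rule gauss.integrable_const_bound)
        show "AE z in gauss. norm (?L (q *. x + b *. z)) <= \<bar>(1 - 1 / \<kappa>) * CARD('n)\<bar> + \<bar>\<kappa> * CARD('n)\<bar>"
          using pr(2,3) by (intro AE_I2) (smt (verit) real_norm_def)
        note [measurable] = ou_mat_det_measurable[OF r]
        have [measurable]: "(\<lambda>y. ?L y) \<in> borel_funs" by measurable
        show "(\<lambda>z. ?L (q *. x + b *. z)) \<in> borel_measurable gauss" by measurable
      qed
      show "integrable gauss (\<lambda>z. ln (det ?M) + trace (S ** (?N z +. \<kappa>)) - real CARD('n))"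
        unfolding tr using Ni by auto
      show "?L (q *. x + b *. z) <= ln (det ?M) + trace (S ** (?N z +. \<kappa>)) - real CARD('n)" for z
        unfolding S_def by (rule ln_det_tangent[OF pq(1) pr(1)])
    qed
    also have "... = ln (det ?M) + trace (S ** ?M) - real CARD('n)"
      unfolding tr using Ni Ne gauss.prob_space[where 'a="real ^ 'n"] by simp
    also have "trace (S ** ?M) = CARD('n)" by (simp only: S_def matrix_inv_mult(2)[OF inv] trace_I)
    finally show ?thesis by simp
  qed
  have "(\<oint>x. ?L x) = (\<oint>x. \<oint>z. ?L (q *. x + b *. z))" using gauss2.integral_fst'[OF mix(1)] mix(2) by simp
  also have "... <= (\<oint>x. ln (det (ou_mat (q * r) T x +. \<kappa>)))"
    using gauss2.integrable_fst'[OF mix(1)] pq(4) point by (intro integral_mono) simp_all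
  finally show ?thesis .
qed

text \<open>The averaged estimate is good only at levels where the Dirichlet energy is almost
  saturated, that is, close to 1. Monotonicity of the mean \<open>ln det\<close> under further
  smoothing brings the bound down to any given \<open>a\<close>.\<close>

theorem entropy_bound:
  assumes a: "0 < a" "a < 1" and k: "0 < \<kappa>"
  shows "ln (measure gauss K) + (\<oint>x. nsq (T x)) / 2 - CARD('n) / 2
    <= (\<oint>x. ln (det (ou_mat a T x +. \<kappa>)))"
proof (rule field_le_epsilon)
  fix e :: real assume e: "0 < e"
  \<comment> \<open>Half of the tolerance \<open>e\<close> goes to
    \<open>\<eta> * CARD('n) / 2\<close>, half to the Dirichlet increment, for which
    \<open>r0\<close> is chosen within \<open>e / c\<close> of the supremum
    \<open>B\<close>.\<close>
  define \<eta> where "\<eta> = e / CARD('n)"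
  have \<eta>: "0 < \<eta>" using e by (simp add: \<eta>_def)
  define c where "c = (1 + 1 / \<eta>) / \<kappa>^2 * (5 / 4)"
  have c: "0 < c" unfolding c_def using \<eta> k by (intro mult_pos_pos divide_pos_pos) (auto intro: add_pos_pos)
  define B where "B = Sup (dirichlet T ` {0<..<1})"
  have bdd: "bdd_above (dirichlet T ` {0<..<1})" using dirichlet_le[OF lip] by (intro bdd_aboveI2) auto
  have B: "dirichlet T r <= B" if "0 < r" "r < 1" for r unfolding B_def using that bdd by (intro cSup_upper) auto
  have "B - e / c < B" using e c by simp
  then obtain r0 where r0: "0 < r0" "r0 < 1" "B - e / c < dirichlet T r0"
      using less_cSup_iff[OF _ bdd, of "B - e / c"] by (auto simp: B_def)
  define a1 where "a1 = (1 + max a r0) / 2"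
  have a1: "max a r0 < a1" "a1 < 1" "0 < a1" using a r0 unfolding a1_def by auto
  have "ln (measure gauss K) + (\<oint>x. nsq (T x)) / 2 - CARD('n) / 2
      - \<eta> * CARD('n) / 2 - (1 + 1 / \<eta>) / \<kappa>^2 * (5 / 4 * (B - dirichlet T r0)) / 2
    <= (\<oint>x. ln (det (ou_mat a1 T x +. \<kappa>)))" using a1 r0 B by (intro entropy_average[OF _ _ _ _ k \<eta>]) auto
  also have "... <= (\<oint>x. ln (det (ou_mat (a / a1 * a1) T x +. \<kappa>)))" using a a1 by (intro ln_det_semigroup k) auto
  also have "a / a1 * a1 = a" using a1 by simp
  finally have 1: "ln (measure gauss K) + (\<oint>x. nsq (T x)) / 2 - CARD('n) / 2
      - \<eta> * CARD('n) / 2 - c * (B - dirichlet T r0) / 2 <= (\<oint>x. ln (det (ou_mat a T x +. \<kappa>)))"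
    by (simp only: c_def mult.assoc)
  have "c * (B - dirichlet T r0) <= c * (e / c)" using r0 c by (intro mult_left_mono) auto
  then have "c * (B - dirichlet T r0) <= e" using c by simp
  moreover have "\<eta> * CARD('n) = e" by (simp add: \<eta>_def)
  ultimately show "ln (measure gauss K) + (\<oint>x. nsq (T x)) / 2 - CARD('n) / 2
    <= (\<oint>x. ln (det (ou_mat a T x +. \<kappa>))) + e" using 1 by linarith
qed

end

section \<open>Concavity along the interpolation\<close>

text \<open>Differentiation under the integral from a uniform quadratic remainder. Measurability and
  integrability of \<open>\<Phi>'\<close> are conclusions, drawn from difference quotients along
  \<open>s k\<close>; this matters because \<open>\<Phi>'\<close> will be built from eigenvalues
  picked by choice.\<close>

lemma (in prob_space) has_derivative_integral_quadratic:
  fixes \<Phi> :: "real => 'a => real"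
  assumes I: "open I" "t \<in> I"
    and m: "!!s. s \<in> I ==> integrable M (\<Phi> s)"
    and q: "!!s x. s \<in> I ==> x \<in> space M ==> \<bar>\<Phi> s x - \<Phi> t x - (s - t) * \<Phi>' x\<bar> <= C * (s - t)^2"
  shows "integrable M \<Phi>'" "((\<lambda>s. \<integral>x. \<Phi> s x \<partial>M) has_real_derivative (\<integral>x. \<Phi>' x \<partial>M)) (at t)"
proof -
  obtain \<delta> where \<delta>: "\<delta> > 0" "!!s. \<bar>s - t\<bar> <= \<delta> ==> s \<in> I"
    using I unfolding open_contains_cball by (auto simp: subset_iff dist_real_def)
  define s where "s k = t + \<delta> / real (Suc k)" for k
  have s: "s k \<in> I" "s k ~= t" for k
    using \<delta>(1) divide_left_mono[of 1 "real (Suc k)" \<delta>] by (auto intro!: \<delta>(2) simp: s_def)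
  note [measurable] = borel_measurable_integrable[OF m[OF s(1)]] borel_measurable_integrable[OF m[OF I(2)]]
  have st: "s ----> t"
    unfolding s_def using tendsto_add[OF tendsto_const LIMSEQ_Suc[OF lim_const_over_n], of t \<delta>] by simp
  have [measurable]: "\<Phi>' \<in> borel_measurable M"
  proof (rule borel_measurable_LIMSEQ_metric)
    fix x assume x: "x \<in> space M"
    show "(\<lambda>k. (\<Phi> (s k) x - \<Phi> t x) / (s k - t)) ----> \<Phi>' x"
    proof (rule LIM_zero_cancel, rule tendsto_0_le[where K=1])
      show "(\<lambda>k. C * (s k - t)) ----> 0" using tendsto_mult_right_zero[OF LIM_zero[OF st], of C] by simp
      show "\<forall>\<^sub>F k in sequentially. norm ((\<Phi> (s k) x - \<Phi> t x) / (s k - t) - \<Phi>' x) <= norm (C * (s k - t)) * 1"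
      proof (intro always_eventually allI)
        fix k
        let ?d = "(\<Phi> (s k) x - \<Phi> t x) / (s k - t) - \<Phi>' x"
        have "?d = (\<Phi> (s k) x - \<Phi> t x - (s k - t) * \<Phi>' x) / (s k - t)" using s(2)[of k] by (simp add: field_simps)
        also have "norm ... <= C * (s k - t)^2 / \<bar>s k - t\<bar>" using q[OF s(1) x] by (simp add: divide_right_mono)
        also have "... <= norm (C * (s k - t)) * 1"
        proof -
          have "C * u^2 / \<bar>u\<bar> = C * \<bar>u\<bar>" if "u ~= 0" for u :: real by (cases "0 < u") (simp_all add: power2_eq_square)
          then show ?thesis using s(2)[of k] by simp
        qed
        finally show "norm (?d) <= norm (C * (s k - t)) * 1" .
      qed
    qed
  qed measurable
  have s0: "s 0 - t = \<delta>" by (simp add: s_def)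
  show i: "integrable M \<Phi>'"
  proof (rule Bochner_Integration.integrable_bound)
    let ?w = "\<lambda>x. \<bar>\<Phi> (s 0) x - \<Phi> t x\<bar> + \<bar>C * \<delta>^2\<bar>"
    show "integrable M (\<lambda>x. ?w x / \<delta>)" using m[OF s(1)] m[OF I(2)] by auto
    show "AE x in M. norm (\<Phi>' x) <= norm (?w x / \<delta>)"
    proof (rule AE_I2)
      fix x assume x: "x \<in> space M"
      have "\<bar>\<delta> * \<Phi>' x\<bar> <= ?w x" using q[OF s(1) x, of 0] unfolding s0 by linarith
      then have "\<bar>\<Phi>' x\<bar> <= ?w x / \<delta>" using \<delta>(1) by (simp add: pos_le_divide_eq mult.commute)
      then show "norm (\<Phi>' x) <= norm (?w x / \<delta>)" using \<delta>(1) by simp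
    qed
  qed measurable
  show "((\<lambda>s. \<integral>x. \<Phi> s x \<partial>M) has_real_derivative (\<integral>x. \<Phi>' x \<partial>M)) (at t)" unfolding has_field_derivative_def
  proof (rule has_derivativeI_quadratic[OF bounded_linear_mult_right \<delta>(1)])
    fix h :: real assume "norm h <= \<delta>"
    then have h: "t + h \<in> I" by (intro \<delta>(2)) simp
    have "(\<integral>x. \<Phi> (t + h) x \<partial>M) - (\<integral>x. \<Phi> t x \<partial>M) - (\<integral>x. \<Phi>' x \<partial>M) * h = (\<integral>x. \<Phi> (t + h) x - \<Phi> t x - h * \<Phi>' x \<partial>M)"
      using m[OF h] m[OF I(2)] i by simp
    also have "norm ... <= (\<integral>x. C * h^2 \<partial>M)"
      proof (rule order_trans[OF integral_norm_bound integral_mono])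
      show "norm (\<Phi> (t + h) x - \<Phi> t x - h * \<Phi>' x) <= C * h^2" if "x \<in> space M" for x using q[OF h that] by simp
    qed (use m[OF h] m[OF I(2)] i in auto)
    also have "... = C * nsq h" using prob_space by simp
    finally show "norm ((\<integral>x. \<Phi> (t + h) x \<partial>M) - (\<integral>x. \<Phi> t x \<partial>M) - (\<integral>x. \<Phi>' x \<partial>M) * h) <= C * nsq h" .
  qed
qed

text \<open>The ratio of the two denominators is \<open>1 + y\<close> with \<open>y\<close> the
  increment of \<open>t\<close> times the slope at \<open>t\<close>. Both remainders are then
  controlled by products of slopes at \<open>s\<close> and \<open>t\<close>, so a bound on slopes
  suffices.\<close>

lemma ln_reciprocal_taylor:
  fixes d M s t :: real
  assumes pos: "0 < 1 - s + s * d" "0 < 1 - t + t * d"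
    and M: "\<bar>(d - 1) / (1 - s + s * d)\<bar> <= M" "\<bar>(d - 1) / (1 - t + t * d)\<bar> <= M"
  shows "\<bar>ln (1 - s + s * d) - ln (1 - t + t * d) - (s - t) * ((d - 1) / (1 - t + t * d))\<bar> <= M^2 * (s - t)^2"
    and "\<bar>(d - 1) / (1 - s + s * d) - (d - 1) / (1 - t + t * d) - (s - t) * (- ((d - 1) / (1 - t + t * d))\<^sup>2)\<bar> <= M ^ 3 * (s - t)^2"
proof -
  define D E where "D = 1 - t + t * d" and "E = 1 - s + s * d"
  define c e where "c = (d - 1) / D" and "e = (d - 1) / E"
  have DE: "0 < D" "0 < E" using pos by (auto simp: D_def E_def)
  have M0: "0 <= M" using M(1) by linarith
  have ED: "E - D = (s - t) * (d - 1)" by (simp add: D_def E_def algebra_simps)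
  define y where "y = (s - t) * c"
  have y1: "1 + y = E / D" using DE ED by (simp add: y_def c_def field_simps)
  then have y0: "0 < 1 + y" using DE by simp
  have l: "ln E - ln D = ln (1 + y)" using DE by (simp add: y1 ln_div)
  have up: "ln (1 + y) <= y" using y0 ln_add_one_self_le_self2[of y] by simp
  have "ln (1 / (1 + y)) <= 1 / (1 + y) - 1" using y0 by (intro ln_le_minus_one) simp
  then have "y / (1 + y) <= ln (1 + y)" using y0 by (simp add: ln_div field_simps)
  moreover have "y / (1 + y) = y - y^2 / (1 + y)" using y0 by (simp add: field_simps power2_eq_square)
  ultimately have "\<bar>ln E - ln D - y\<bar> <= y^2 / (1 + y)" using up l by linarith
  also have "y^2 / (1 + y) = (e * c) * (s - t)^2"
    unfolding y1 using DE by (simp add: y_def c_def e_def field_simps power2_eq_square)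
  also have "... <= M^2 * (s - t)^2"
  proof (rule mult_right_mono)
    have "e * c <= \<bar>e\<bar> * \<bar>c\<bar>" by (simp flip: abs_mult)
    also have "... <= M * M" using M M0 unfolding c_def e_def D_def E_def by (intro mult_mono) auto
    finally show "e * c <= M^2" by (simp add: power2_eq_square)
  qed simp
  finally show "\<bar>ln (1 - s + s * d) - ln (1 - t + t * d) - (s - t) * ((d - 1) / (1 - t + t * d))\<bar> <= M^2 * (s - t)^2"
    by (simp add: y_def c_def D_def E_def)
  have ec: "e - c = - (s - t) * (e * c)"
  proof -
    have "e - c = (d - 1) * (D - E) / (E * D)" using DE by (simp add: e_def c_def field_simps)
    also have "D - E = - ((s - t) * (d - 1))" using ED by linarith
    finally show ?thesis using DE by (simp add: e_def c_def field_simps)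
  qed
  have "e - c + (s - t) * c^2 = - (s - t) * (e * c) + (s - t) * c^2" by (simp only: ec)
  also have "... = - (s - t) * c * (e - c)" by (simp add: algebra_simps power2_eq_square)
  also have "... = (c * c * e) * (s - t)^2" unfolding ec by (simp add: power2_eq_square algebra_simps)
  finally have "\<bar>e - c + (s - t) * c^2\<bar> = \<bar>c\<bar> * \<bar>c\<bar> * \<bar>e\<bar> * (s - t)^2" by (simp only: abs_mult abs_power2)
  also have "... <= M * M * M * (s - t)^2"
    using M M0 unfolding c_def e_def D_def E_def by (intro mult_right_mono mult_mono) auto
  finally show "\<bar>(d - 1) / (1 - s + s * d) - (d - 1) / (1 - t + t * d) - (s - t) * (- ((d - 1) / (1 - t + t * d))\<^sup>2)\<bar> <= M ^ 3 * (s - t)^2"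
    by (simp add: c_def e_def D_def E_def power3_eq_cube)
qed

text \<open>In terms of \<open>h = V / 2 - E ln det\<close>, \<open>p - n * \<mu>\<close> is the
  first derivative and \<open>S + w\<close> the second. Here \<open>p\<close> is half the derivative
  of the variance \<open>V\<close>, \<open>w\<close> the variance of the velocity, \<open>S\<close>
  the mean of the squared slopes, and \<open>z\<close> the Poincare inequality for the velocity
  minus \<open>\<mu>\<close> times the position.\<close>

lemma second_variation_inequality:
  fixes n w V p \<mu> S :: real
  assumes n: "0 < n" and w: "0 <= w" and V: "0 <= V" "V <= 5 / 4 * n" and p: "p^2 <= w * V"
    and z: "w - 2 * \<mu> * p + \<mu>^2 * V <= 5 / 4 * (S - n * \<mu>^2)"
  shows "(n * \<mu> - p)^2 + n / 2 * w <= n * (S + w)"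
proof -
  have S: "n * (n * \<mu>^2 + 4 / 5 * (w - 2 * \<mu> * p + \<mu>^2 * V)) <= n * S"
  proof (rule mult_left_mono)
    have "X <= 5 / 4 * (S - Y) ==> Y + 4 / 5 * X <= S" for X Y :: real by simp
    from this[OF z] show "n * \<mu>^2 + 4 / 5 * (w - 2 * \<mu> * p + \<mu>^2 * V) <= S" .
  qed (use n in simp)
  \<comment> \<open>What is left after inserting the bound on \<open>S\<close>. Completing the
    square in \<open>\<mu>\<close> costs \<open>n * p^2 / (20 * V)\<close>, at most
    \<open>n * w / 20\<close>, and \<open>p^2\<close> costs \<open>5 / 4 * (n * w)\<close>: together
    exactly \<open>13 / 10 * (n * w)\<close>.\<close>
  have "0 <= 13 / 10 * (n * w) + 2 / 5 * (n * \<mu> * p) + 4 / 5 * (n * \<mu>^2 * V) - p^2"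
  proof (cases "V = 0")
    case True
    then have "p = 0" using p by simp
    then show ?thesis using n w True by simp
  next
    case False
    then have V0: "0 < V" using V by simp
    have "p^2 / V <= w" using p V0 by (simp add: pos_divide_le_eq)
    then have "n * (p^2 / V) <= n * w" using n by (intro mult_left_mono) auto
    moreover have "p^2 <= 5 / 4 * (n * w)" using p mult_left_mono[OF V(2) w] by (simp add: mult_ac)
    moreover have "0 <= 4 / 5 * (n * V) * (\<mu> + p / (4 * V))^2" using n V0 by (intro mult_nonneg_nonneg) auto
    moreover have "4 / 5 * (n * V) * (\<mu> + p / (4 * V))^2 = 4 / 5 * (n * \<mu>^2 * V) + 2 / 5 * (n * \<mu> * p) + n * (p^2 / V) / 20"
      using V0 by (simp add: power2_eq_square field_simps)
    moreover have "q <= y ==> p2 <= 5 / 4 * y ==> 0 <= r ==> r = u + v + q / 20 ==> 0 <= 13 / 10 * y + v + u - p2"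
      for q y p2 r u v :: real by simp
    ultimately show ?thesis by blast
  qed
  moreover have "(n * \<mu> - p)^2 = n * n * \<mu>^2 - 2 * (n * \<mu> * p) + p^2" by (simp add: power2_eq_square algebra_simps)
  moreover have "n * (n * \<mu>^2 + 4 / 5 * (w - 2 * \<mu> * p + \<mu>^2 * V))
      = n * n * \<mu>^2 + 4 / 5 * (n * w) - 8 / 5 * (n * \<mu> * p) + 4 / 5 * (n * \<mu>^2 * V)" by (simp add: field_simps)
  moreover have "0 <= 13 / 10 * nw + 2 / 5 * q + 4 / 5 * v - p2 ==> l = m - 2 * q + p2 ==>
      r = m + 4 / 5 * nw - 8 / 5 * q + 4 / 5 * v ==> r <= nS ==> l + nw / 2 <= nS + nw" for nw q v p2 l m r nS :: real by simp
  ultimately have "(n * \<mu> - p)^2 + n * w / 2 <= n * S + n * w" using S by blast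
  then show ?thesis by (simp add: distrib_left)
qed

text \<open>Lower bound at \<open>t\<close> for a function on the unit interval with end values
  \<open>x\<close>, \<open>y\<close> and second derivative at most \<open>- q\<close> times itself;
  the surplus over the chord is what detects equality.\<close>

definition gap_comb :: "real => real => real => real => real" where
  "gap_comb q t x y = (1 - t) * x + t * y + q * min x y * (t * (1 - t)) / 2"

lemma gap_comb_mono: "0 <= q ==> 0 <= t ==> t <= 1 ==> x <= x' ==> y <= y' ==> gap_comb q t x y <= gap_comb q t x' y'"
  unfolding gap_comb_def by (intro add_mono mult_left_mono mult_right_mono divide_right_mono min.mono) auto

lemma gap_comb_scale: "0 < k ==> k * gap_comb q t x y = gap_comb q t (k * x) (k * y)"
proof -
  assume "0 < k"
  then have "min (k * x) (k * y) = k * min x y" by (simp add: min_mult_distrib_left)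
  then show ?thesis unfolding gap_comb_def by (simp add: distrib_left)
qed

lemma gap_comb_pos: assumes "0 <= q" "0 <= t" "t <= 1" "0 < x" "0 < y" shows "0 < gap_comb q t x y"
proof -
  have "0 < (1 - t) * x + t * y" using assms by (cases "t = 0") (auto intro!: add_nonneg_pos)
  moreover have "0 <= q * min x y * (t * (1 - t)) / 2" using assms by (intro divide_nonneg_nonneg mult_nonneg_nonneg) auto
  ultimately show ?thesis unfolding gap_comb_def by linarith
qed

text \<open>Applied to \<open>g = exp (- h / n)\<close>: the uniform bound on \<open>g''\<close> improves plain concavity by a multiple of \<open>t (1 - t)\<close>.\<close>

lemma concave_second_derivative_gap:
  fixes g :: "real => real"
  assumes d1: "!!t. 0 <= t ==> t <= 1 ==> (g has_real_derivative g' t) (at t)"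
    and d2: "!!t. 0 <= t ==> t <= 1 ==> (g' has_real_derivative g'' t) (at t)"
    and c: "0 <= c" and b: "!!t. 0 <= t ==> t <= 1 ==> g'' t <= - c * g t" and g: "!!t. 0 <= g t"
    and t: "0 <= t" "t <= 1"
  shows "gap_comb c t (g 0) (g 1) <= g t"
proof -
  have cc: "(1 - t) * f 0 + t * f 1 <= f t" if f: "concave_on {0..1} f" and t: "0 <= t" "t <= 1" for f and t :: real
    using concave_onD[OF f, of t 0 1] t by simp
  have "concave_on {0..1} g"
  proof (rule f''_le0_imp_concave)
    fix s :: real assume s: "s \<in> {0..1}"
    show "(g has_real_derivative g' s) (at s)" "(g' has_real_derivative g'' s) (at s)"
      using s by (simp_all add: d1 d2)
    show "g'' s <= 0" using b[of s] s mult_nonneg_nonneg[OF c g[of s]] by simp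
  qed simp
  from cc[OF this] have low: "min (g 0) (g 1) <= g s" if s: "0 <= s" "s <= 1" for s
  proof -
    have "min (g 0) (g 1) = (1 - s) * min (g 0) (g 1) + s * min (g 0) (g 1)" by (simp add: algebra_simps)
    also have "... <= (1 - s) * g 0 + s * g 1" using s by (intro add_mono mult_left_mono) auto
    finally show ?thesis using cc[OF \<open>concave_on {0..1} g\<close> s] by linarith
  qed
  \<comment> \<open>Plain concavity keeps \<open>g\<close> above the smaller end value, so
    \<open>g''\<close> is at most the constant \<open>- k\<close>, and \<open>k / 2 * t^2\<close>
    can be added without losing concavity.\<close>
  define k where "k = c * min (g 0) (g 1)"
  have "concave_on {0..1} (\<lambda>t. g t + k / 2 * t^2)"
  proof (rule f''_le0_imp_concave)
    fix s :: real assume s: "s \<in> {0..1}"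
    show "((\<lambda>t. g t + k / 2 * t^2) has_real_derivative (g' s + k * s)) (at s)"
      using s by (auto intro!: derivative_eq_intros d1)
    show "((\<lambda>s. g' s + k * s) has_real_derivative (g'' s + k)) (at s)"
      using s by (auto intro!: derivative_eq_intros d2)
    have "k <= c * g s" unfolding k_def using low[of s] s c by (intro mult_left_mono) auto
    then show "g'' s + k <= 0" using b[of s] s by simp
  qed simp
  from cc[OF this t] show ?thesis unfolding gap_comb_def k_def[symmetric] by (simp add: field_simps power2_eq_square)
qed

definition gauss_var :: "('a::euclidean_space => 'b::euclidean_space) => real" where
  "gauss_var f = (\<oint>x. nsq (f x - (\<oint>y. f y)))"

lemma gauss_var_nonneg: "0 <= gauss_var f" unfolding gauss_var_def by (intro Bochner_Integration.integral_nonneg) auto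

lemma gauss_var_eq:
  assumes "L-lipschitz_on UNIV f"
  shows "gauss_var f = (\<oint>x. nsq (f x)) - nsq (\<oint>x. f x)"
  unfolding gauss_var_def gauss.variance_expand(1)[OF integrable_gauss_lipschitz[OF assms]]
  by (simp add: power2_norm_eq_inner)

text \<open>Only the quadratic dependence on \<open>s\<close> and \<open>t\<close> matters later, so
  the covariance is left as an unnamed coefficient.\<close>

lemma gauss_var_combination:
  fixes u v :: "'a::euclidean_space => 'b::euclidean_space"
  assumes u: "L-lipschitz_on UNIV u" and v: "L'-lipschitz_on UNIV v"
  obtains \<beta> where "!!s t. gauss_var (\<lambda>x. s *. u x + t *. v x) = s^2 * gauss_var u + 2 * s * t * \<beta> + t^2 * gauss_var v"
proof -
  let ?mu = "\<integral>y. u y \<partial>gauss" and ?mv = "\<integral>y. v y \<partial>gauss"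
  note iu = integrable_gauss_lipschitz[OF u] and iv = integrable_gauss_lipschitz[OF v]
  have cu: "L-lipschitz_on UNIV (\<lambda>x. u x - ?mu)" and cv: "L'-lipschitz_on UNIV (\<lambda>x. v x - ?mv)"
    using u v by (auto simp: lipschitz_on_def dist_norm)
  note qu = integrable_gauss_lipschitz(2)[OF cu] and qv = integrable_gauss_lipschitz(2)[OF cv]
  note [measurable] = lipschitz_measurable[OF cu] lipschitz_measurable[OF cv]
  have c: "integrable gauss (\<lambda>x. (u x - ?mu) \<bullet> (v x - ?mv))"
  proof (rule Bochner_Integration.integrable_bound)
    show "integrable gauss (\<lambda>x. nsq (u x - ?mu) + nsq (v x - ?mv))" by (intro Bochner_Integration.integrable_add qu qv)
    show "AE x in gauss. norm ((u x - ?mu) \<bullet> (v x - ?mv)) <= norm (nsq (u x - ?mu) + nsq (v x - ?mv))"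
    proof (rule AE_I2)
      fix x
      have "2 * (p * q) <= p^2 + q^2" for p q :: real using zero_le_power2[of "p - q"] by (simp add: power2_eq_square algebra_simps)
      from this[of "norm (u x - ?mu)" "norm (v x - ?mv)"] Cauchy_Schwarz_ineq2[of "u x - ?mu" "v x - ?mv"]
      have "\<bar>(u x - ?mu) \<bullet> (v x - ?mv)\<bar> <= nsq (u x - ?mu) + nsq (v x - ?mv)" by linarith
      then show "norm ((u x - ?mu) \<bullet> (v x - ?mv)) <= norm (nsq (u x - ?mu) + nsq (v x - ?mv))" by simp
    qed
  qed simp
  show ?thesis
  proof (rule that[of "\<integral>x. (u x - ?mu) \<bullet> (v x - ?mv) \<partial>gauss"])
    fix s t
    have e: "nsq (s *. u x + t *. v x - (s *. ?mu + t *. ?mv))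
        = s^2 * nsq (u x - ?mu) + (2 * s * t) * ((u x - ?mu) \<bullet> (v x - ?mv)) + t^2 * nsq (v x - ?mv)" for x
    proof -
      have "s *. u x + t *. v x - (s *. ?mu + t *. ?mv) = s *. (u x - ?mu) + t *. (v x - ?mv)" by (simp add: scaleR_diff_right)
      moreover have "nsq (s *. U + t *. V) = s^2 * nsq U + (2 * s * t) * (U \<bullet> V) + t^2 * nsq V" for U V :: 'b
        unfolding power2_norm_eq_inner by (simp add: inner_commute power2_eq_square algebra_simps)
      ultimately show ?thesis by simp
    qed
    have m: "(\<oint>y. s *. u y + t *. v y) = s *. ?mu + t *. ?mv" using iu(1) iv(1) by simp
    show "gauss_var (\<lambda>x. s *. u x + t *. v x) = s^2 * gauss_var u + 2 * s * t * (\<oint>x. (u x - ?mu) \<bullet> (v x - ?mv)) + t^2 * gauss_var v"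
      unfolding gauss_var_def m e using qu qv c by simp
  qed
qed

section \<open>A segment between uniformly monotone contractions\<close>

locale contraction_segment =
  fixes f0 f1 :: "real ^ 'n => real ^ 'n" and A0 A1 :: "real ^ 'n => real ^ 'n ^ 'n" and \<kappa> :: real
  assumes kappa: "0 < \<kappa>"
    and lip0: "1-lipschitz_on UNIV f0" and lip1: "1-lipschitz_on UNIV f1"
    and der0: "!!x. (f0 has_derivative (\<lambda>v. A0 x *v v)) (at x)" and der1: "!!x. (f1 has_derivative (\<lambda>v. A1 x *v v)) (at x)"
    and meas0: "!!i j. (\<lambda>x. A0 x $ i $ j) \<in> borel_funs" and meas1: "!!i j. (\<lambda>x. A1 x $ i $ j) \<in> borel_funs"
    and sym0: "!!x. transpose (A0 x) = A0 x" and sym1: "!!x. transpose (A1 x) = A1 x"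
    and coercive0: "!!x v. \<kappa> * nsq v <= v \<bullet> (A0 x *v v)" and coercive1: "!!x v. \<kappa> * nsq v <= v \<bullet> (A1 x *v v)"
begin

definition seg_mat :: "real => real ^ 'n => real ^ 'n ^ 'n" where
  "seg_mat t x = (1 - t) *. A0 x + t *. A1 x"

definition seg_map :: "real => real ^ 'n => real ^ 'n" where
  "seg_map t x = (1 - t) *. f0 x + t *. f1 x"

lemma contraction0: "norm (A0 x *v v) <= norm v" and contraction1: "norm (A1 x *v v) <= norm v"
  using lipschitz_derivative_bound[OF lip0 der0] lipschitz_derivative_bound[OF lip1 der1] by simp_all

lemma pos_def0: "pos_def (A0 x)" and pos_def1: "pos_def (A1 x)"
proof -
  have "0 < v \<bullet> (A0 x *v v)" "0 < v \<bullet> (A1 x *v v)" if "v ~= 0" for v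
    using coercive0[of v x] coercive1[of v x] mult_pos_pos[OF kappa, of "nsq v"] that by auto
  then show "pos_def (A0 x)" "pos_def (A1 x)" using sym0 sym1 by (auto simp: pos_def_def)
qed

text \<open>Chosen separately at each \<open>x\<close>. Measurability of the sums built from it is
  recovered by differentiating the measurable function \<open>ln (det (seg_mat t x))\<close> in
  \<open>t\<close>.\<close>

definition seg_eig :: "real ^ 'n => 'n => real" where
  "seg_eig x = (SOME d. segment_eigenvalues \<kappa> (A0 x) (A1 x) d)"

lemma seg_eig:
  shows "\<kappa> <= seg_eig x i" "\<kappa> * seg_eig x i <= 1"
    and "(!!i. 0 < 1 - t + t * seg_eig x i) ==> ln (det (seg_mat t x)) = ln (det (A0 x)) + (\<Sum>i\<in>UNIV. ln (1 - t + t * seg_eig x i))"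
    and "0 <= t ==> t <= 1 ==> hs_norm_sq ((A1 x - A0 x) - \<mu> *. seg_mat t x)
       <= (\<Sum>i\<in>UNIV. ((seg_eig x i - 1) / (1 - t + t * seg_eig x i) - \<mu>)^2)"
proof -
  have P: "segment_eigenvalues \<kappa> (A0 x) (A1 x) (seg_eig x)" unfolding seg_eig_def
    by (rule someI_ex[OF ln_det_segment[OF pos_def0 pos_def1 contraction0 contraction1 kappa coercive0 coercive1]])
  note P = P[unfolded segment_eigenvalues_def, folded seg_mat_def]
  note P1 = P[THEN conjunct1, rule_format] and P2 = P[THEN conjunct2, THEN conjunct1, rule_format]
    and P3 = P[THEN conjunct2, THEN conjunct2, rule_format]
  show "\<kappa> <= seg_eig x i" "\<kappa> * seg_eig x i <= 1" using P1[of i] by simp_all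
  show "ln (det (seg_mat t x)) = ln (det (A0 x)) + (\<Sum>i\<in>UNIV. ln (1 - t + t * seg_eig x i))"
    if "!!i. 0 < 1 - t + t * seg_eig x i" by (rule P2) (rule that)
  show "hs_norm_sq ((A1 x - A0 x) - \<mu> *. seg_mat t x) <= (\<Sum>i\<in>UNIV. ((seg_eig x i - 1) / (1 - t + t * seg_eig x i) - \<mu>)^2)"
    if t: "0 <= t" "t <= 1" by (rule P3[OF t])
qed

lemma kappa_le_one: "\<kappa> <= 1"
proof -
  have "\<kappa> * \<kappa> <= 1" using seg_eig(1)[of undefined undefined] seg_eig(2)[of undefined undefined] kappa
      mult_left_mono[of \<kappa> "seg_eig undefined undefined" \<kappa>] by linarith
  then show ?thesis using kappa by (metis abs_le_square_iff abs_of_pos one_power2 power2_eq_square zero_less_one)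
qed

text \<open>An open interval around \<open>[0, 1]\<close>, to have two-sided derivatives at the end
  points. The margin \<open>\<kappa> / 2\<close> keeps all denominators above
  \<open>\<kappa> / 2\<close>, because the eigenvalues lie between \<open>\<kappa>\<close> and
  \<open>1 / \<kappa>\<close>.\<close>

definition seg_ivl :: "real set" where "seg_ivl = {- (\<kappa> / 2)<..<1 + \<kappa> / 2}"

definition seg_slope :: "real => real ^ 'n => 'n => real" where
  "seg_slope t x i = (seg_eig x i - 1) / (1 - t + t * seg_eig x i)"

lemma seg_denominator:
  assumes t: "t \<in> seg_ivl" shows "\<kappa> / 2 <= 1 - t + t * seg_eig x i"
proof -
  let ?d = "seg_eig x i"
  note d = seg_eig(1)[of x i] seg_eig(2)[of x i] and k = kappa kappa_le_one
  have d0: "0 <= ?d" using d k by linarith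
  consider "t < 0" | "0 <= t" "t <= 1" | "1 < t" by linarith
  then show ?thesis
  proof cases
    case 1
    then have "- (\<kappa> / 2) * ?d <= t * ?d" using t d0 by (intro mult_right_mono) (auto simp: seg_ivl_def)
    then show ?thesis using 1 d k by simp
  next
    case 2
    have "(1 - t) * \<kappa> + t * \<kappa> <= (1 - t) * 1 + t * ?d" using 2 d k by (intro add_mono mult_left_mono) auto
    then show ?thesis using k by (simp add: algebra_simps)
  next
    case 3
    have "1 * \<kappa> <= t * ?d" using 3 d k by (intro mult_mono) auto
    then show ?thesis using t by (simp add: seg_ivl_def)
  qed
qed

lemma seg_denominator_pos: "t \<in> seg_ivl ==> 0 < 1 - t + t * seg_eig x i"
  using seg_denominator[of t x i] kappa by linarith

lemma seg_slope_bound: assumes t: "t \<in> seg_ivl" shows "\<bar>seg_slope t x i\<bar> <= 2 / \<kappa>^2"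
proof -
  note d = seg_eig(1)[of x i] seg_eig(2)[of x i] and k = kappa kappa_le_one
  have "seg_eig x i <= 1 / \<kappa>" "1 <= 1 / \<kappa>" using d k by (simp_all add: pos_le_divide_eq mult.commute)
  then have "\<bar>seg_eig x i - 1\<bar> <= 1 / \<kappa>" using d k by linarith
  then have "\<bar>seg_slope t x i\<bar> <= (1 / \<kappa>) / (\<kappa> / 2)"
    unfolding seg_slope_def abs_divide using seg_denominator[OF t, of x i] k by (intro frac_le) auto
  then show ?thesis by (simp add: power2_eq_square)
qed

lemma zero_in_seg_ivl: "0 \<in> seg_ivl" and unit_in_seg_ivl: "0 <= t ==> t <= 1 ==> t \<in> seg_ivl" and open_seg_ivl: "open seg_ivl"
  using kappa by (auto simp: seg_ivl_def)

lemma seg_taylor: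
  assumes s: "s \<in> seg_ivl" and t: "t \<in> seg_ivl"
  shows "\<bar>ln (det (seg_mat s x)) - ln (det (seg_mat t x)) - (s - t) * (\<Sum>i\<in>UNIV. seg_slope t x i)\<bar> <= (CARD('n) * (2 / \<kappa>^2)^2) * (s - t)^2"
    and "\<bar>(\<Sum>i\<in>UNIV. seg_slope s x i) - (\<Sum>i\<in>UNIV. seg_slope t x i) - (s - t) * (- (\<Sum>i\<in>UNIV. (seg_slope t x i)^2))\<bar> <= (CARD('n) * (2 / \<kappa>^2) ^ 3) * (s - t)^2"
proof -
  note T = ln_reciprocal_taylor[OF seg_denominator_pos[OF s] seg_denominator_pos[OF t], of x, folded seg_slope_def,
      OF seg_slope_bound[OF s] seg_slope_bound[OF t]]
  have e: "ln (det (seg_mat s x)) - ln (det (seg_mat t x)) - (s - t) * (\<Sum>i\<in>UNIV. seg_slope t x i)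
    = (\<Sum>i\<in>UNIV. ln (1 - s + s * seg_eig x i) - ln (1 - t + t * seg_eig x i) - (s - t) * seg_slope t x i)"
    using seg_eig(3)[OF seg_denominator_pos[OF s]] seg_eig(3)[OF seg_denominator_pos[OF t]]
    by (simp add: sum_subtractf sum_distrib_left)
  have "\<bar>\<Sum>i\<in>UNIV. ln (1 - s + s * seg_eig x i) - ln (1 - t + t * seg_eig x i) - (s - t) * seg_slope t x i\<bar>
      <= (\<Sum>i\<in>(UNIV :: 'n set). (2 / \<kappa>^2)^2 * (s - t)^2)" by (intro order_trans[OF sum_abs] sum_mono T)
  then show "\<bar>ln (det (seg_mat s x)) - ln (det (seg_mat t x)) - (s - t) * (\<Sum>i\<in>UNIV. seg_slope t x i)\<bar> <= (CARD('n) * (2 / \<kappa>^2)^2) * (s - t)^2"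
    unfolding e by simp
  have e': "(\<Sum>i\<in>UNIV. seg_slope s x i) - (\<Sum>i\<in>UNIV. seg_slope t x i) - (s - t) * (- (\<Sum>i\<in>UNIV. (seg_slope t x i)^2))
    = (\<Sum>i\<in>UNIV. seg_slope s x i - seg_slope t x i - (s - t) * (- (seg_slope t x i)\<^sup>2))"
    by (simp add: sum_subtractf sum.distrib sum_distrib_left)
  have "\<bar>\<Sum>i\<in>UNIV. seg_slope s x i - seg_slope t x i - (s - t) * (- (seg_slope t x i)\<^sup>2)\<bar>
      <= (\<Sum>i\<in>(UNIV :: 'n set). (2 / \<kappa>^2) ^ 3 * (s - t)^2)" by (intro order_trans[OF sum_abs] sum_mono T)
  then show "\<bar>(\<Sum>i\<in>UNIV. seg_slope s x i) - (\<Sum>i\<in>UNIV. seg_slope t x i) - (s - t) * (- (\<Sum>i\<in>UNIV. (seg_slope t x i)^2))\<bar> <= (CARD('n) * (2 / \<kappa>^2) ^ 3) * (s - t)^2"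
    unfolding e' by simp
qed

lemma seg_mat_measurable: "(\<lambda>x. seg_mat t x $ i $ j) \<in> borel_funs"
proof -
  note [measurable] = meas0 meas1
  show ?thesis unfolding seg_mat_def vector_add_component vector_scaleR_component by measurable
qed

lemma ln_det_seg_integrable: assumes t: "t \<in> seg_ivl" shows "integrable gauss (\<lambda>x. ln (det (seg_mat t x)))"
proof (rule gauss.integrable_const_bound)
  let ?M = "2 / \<kappa>^2"
  have "(1 - 1 / \<kappa>) * CARD('n) <= ln (det (A0 x))" for x
  proof (rule ln_det_lower[OF pos_def0])
    fix v
    have "transpose (A0 x - \<kappa> *. mat 1) = A0 x - \<kappa> *. mat 1"
      using sym0[of x] by (simp add: vec_eq_iff transpose_def mat_def)
    moreover have "0 <= ((A0 x - \<kappa> *. mat 1) *v v) \<bullet> v" for v using coercive0[of v x]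
      by (simp add: matrix_vector_mult_diff_rdistrib scaleR_matrix_vector_assoc[symmetric] inner_diff_right power2_norm_eq_inner inner_commute)
    ultimately show "norm (matrix_inv (A0 x) *v v) <= norm v / \<kappa>"
      using shifted_matrix_bounds(2)[of "A0 x - \<kappa> *. mat 1" \<kappa> v] kappa by simp
  qed
  moreover have "ln (det (A0 x)) <= 0" for x using ln_det_upper[OF pos_def0, of x 1] contraction0 by simp
  ultimately have b0: "\<bar>ln (det (A0 x))\<bar> <= \<bar>(1 - 1 / \<kappa>) * CARD('n)\<bar>" for x by (smt (verit))
  show "AE x in gauss. norm (ln (det (seg_mat t x))) <= \<bar>(1 - 1 / \<kappa>) * CARD('n)\<bar> + \<bar>t\<bar> * (CARD('n) * ?M) + (CARD('n) * ?M^2) * t^2"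
  proof (rule AE_I2)
    fix x
    have "seg_mat 0 x = A0 x" by (simp add: seg_mat_def)
    then have "\<bar>ln (det (seg_mat t x)) - ln (det (A0 x)) - t * (\<Sum>i\<in>UNIV. seg_slope 0 x i)\<bar> <= (CARD('n) * ?M^2) * t^2"
      using seg_taylor(1)[OF t zero_in_seg_ivl, of x] by simp
    moreover have "\<bar>t * (\<Sum>i\<in>UNIV. seg_slope 0 x i)\<bar> <= \<bar>t\<bar> * (CARD('n) * ?M)"
    proof -
      have "\<bar>\<Sum>i\<in>UNIV. seg_slope 0 x i\<bar> <= (\<Sum>i\<in>(UNIV::'n set). ?M)"
        by (intro order_trans[OF sum_abs] sum_mono seg_slope_bound zero_in_seg_ivl)
      then show ?thesis unfolding abs_mult by (intro mult_left_mono) auto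
    qed
    ultimately show "norm (ln (det (seg_mat t x))) <= \<bar>(1 - 1 / \<kappa>) * CARD('n)\<bar> + \<bar>t\<bar> * (CARD('n) * ?M) + (CARD('n) * ?M^2) * t^2"
      using b0[of x] by simp
  qed
  note [measurable] = det_measurable[OF seg_mat_measurable]
  show "(\<lambda>x. ln (det (seg_mat t x))) \<in> borel_measurable gauss" by measurable
qed

definition seg_lndet :: "real => real" where "seg_lndet t = (\<oint>x. ln (det (seg_mat t x)))"
definition seg_tau :: "real => real" where "seg_tau t = (\<oint>x. (\<Sum>i\<in>UNIV. seg_slope t x i))"
definition seg_sq :: "real => real" where "seg_sq t = (\<oint>x. (\<Sum>i\<in>UNIV. (seg_slope t x i)^2))"

lemma seg_derivatives:
  assumes t: "t \<in> seg_ivl"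
  shows "integrable gauss (\<lambda>x. \<Sum>i\<in>UNIV. seg_slope t x i)" "(seg_lndet has_real_derivative seg_tau t) (at t)"
    "integrable gauss (\<lambda>x. \<Sum>i\<in>UNIV. (seg_slope t x i)^2)" "(seg_tau has_real_derivative - seg_sq t) (at t)"
proof -
  note D = gauss.has_derivative_integral_quadratic[OF open_seg_ivl _ ln_det_seg_integrable seg_taylor(1)]
  have i: "integrable gauss (\<lambda>x. \<Sum>i\<in>UNIV. seg_slope t x i)" if t: "t \<in> seg_ivl" for t
    by (rule D(1)[OF t]) (use t in auto)
  show "integrable gauss (\<lambda>x. \<Sum>i\<in>UNIV. seg_slope t x i)" by (rule i[OF t])
  show "(seg_lndet has_real_derivative seg_tau t) (at t)"
    unfolding seg_lndet_def[abs_def] seg_tau_def by (rule D(2)[OF t]) (use t in auto)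
  note D' = gauss.has_derivative_integral_quadratic[OF open_seg_ivl t i seg_taylor(2)[OF _ t]]
  show "integrable gauss (\<lambda>x. \<Sum>i\<in>UNIV. (seg_slope t x i)^2)" using D'(1) by simp
  show "(seg_tau has_real_derivative - seg_sq t) (at t)" using D'(2) unfolding seg_tau_def[abs_def] seg_sq_def by simp
qed

lemma seg_map_lipschitz: assumes t: "0 <= t" "t <= 1" shows "1-lipschitz_on UNIV (seg_map t)"
proof (rule lipschitz_onI)
  fix x y
  have "norm (seg_map t x - seg_map t y) <= norm ((1 - t) *. (f0 x - f0 y)) + norm (t *. (f1 x - f1 y))"
    unfolding seg_map_def by (rule order_trans[OF _ norm_triangle_ineq]) (simp add: algebra_simps)
  also have "... <= (1 - t) * norm (x - y) + t * norm (x - y)"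
    using t lipschitz_onD[OF lip0, of x y] lipschitz_onD[OF lip1, of x y] by (intro add_mono) (auto simp: dist_norm mult_left_mono)
  finally show "dist (seg_map t x) (seg_map t y) <= 1 * dist x y" by (simp add: dist_norm algebra_simps)
qed simp

lemma seg_map_derivative: "(seg_map t has_derivative (\<lambda>v. seg_mat t x *v v)) (at x)"
proof -
  have "((\<lambda>x. (1 - t) *. f0 x + t *. f1 x) has_derivative (\<lambda>v. (1 - t) *. (A0 x *v v) + t *. (A1 x *v v))) (at x)"
    by (intro has_derivative_add has_derivative_scaleR_right der0 der1)
  then show ?thesis
    by (simp add: seg_map_def[abs_def] seg_mat_def matrix_vector_mult_add_rdistrib scaleR_matrix_vector_assoc[symmetric])
qed

lemma velocity_lipschitz: "(1 + 1)-lipschitz_on UNIV (\<lambda>x. f1 x - f0 x)" by (rule lipschitz_on_diff[OF lip1 lip0])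

text \<open>The Poincare inequality is used twice: on the interpolated contraction, to bound its
  variance by \<open>5 / 4 * n\<close>, and on the velocity corrected by a multiple
  \<open>\<mu>\<close> of the position, where the eigenvalue bound on the Hilbert-Schmidt norm
  enters.\<close>

lemma seg_second_variation:
  assumes t: "0 <= t" "t <= 1"
    and b: "!!r s. gauss_var (\<lambda>x. r *. f0 x + s *. (f1 x - f0 x)) = r^2 * gauss_var f0 + 2 * r * s * \<beta> + s^2 * w"
    and w: "w = gauss_var (\<lambda>x. f1 x - f0 x)"
  shows "(seg_tau t - (\<beta> + t * w))^2 + real CARD('n) / 2 * w <= real CARD('n) * (seg_sq t + w)"
proof -
  let ?n = "real CARD('n)"
  \<comment> \<open>The average slope: it minimises the mean of the squared deviations of the slopes
    from \<open>\<mu>\<close>, leaving \<open>seg_sq t - ?n * \<mu>^2\<close>.\<close>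
  define \<mu> where "\<mu> = seg_tau t / ?n"
  define V where "V = gauss_var (seg_map t)"
  define p where "p = \<beta> + t * w"
  have ts: "t \<in> seg_ivl" by (rule unit_in_seg_ivl[OF t])
  have Vt: "V = gauss_var f0 + 2 * t * \<beta> + t^2 * w"
  proof -
    have "seg_map t = (\<lambda>x. 1 *. f0 x + t *. (f1 x - f0 x))" by (simp add: seg_map_def[abs_def] algebra_simps)
    then show ?thesis unfolding V_def using b[of 1 t] by simp
  qed
  have comb: "gauss_var (\<lambda>x. r *. seg_map t x + s *. (f1 x - f0 x)) = r^2 * V + 2 * r * s * p + s^2 * w" for r s
  proof -
    have "(\<lambda>x. r *. seg_map t x + s *. (f1 x - f0 x)) = (\<lambda>x. r *. f0 x + (r * t + s) *. (f1 x - f0 x))"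
      by (simp add: seg_map_def algebra_simps)
    then show ?thesis using b[of r "r * t + s"] by (simp add: Vt p_def power2_eq_square algebra_simps)
  qed
  have V0: "0 <= V" and w0: "0 <= w" unfolding V_def w by (rule gauss_var_nonneg)+
  \<comment> \<open>Cauchy-Schwarz, recovered from nonnegativity of the quadratic form
    \<open>comb\<close>; \<open>p\<close> is its mixed coefficient.\<close>
  have p2: "p^2 <= w * V"
  proof (cases "V = 0")
    case True
    have "0 <= 2 * r * p + w" for r using comb[of r 1] gauss_var_nonneg[of "\<lambda>x. r *. seg_map t x + 1 *. (f1 x - f0 x)"] True by simp
    moreover have "2 * (- (w + 1) / (2 * p)) * p = - (w + 1)" if "p ~= 0" using that by simp
    ultimately have "p = 0" by (smt (verit))
    then show ?thesis using True by simp
  next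
    case False
    then have "0 < V" using V0 by simp
    have "0 <= p^2 * V - 2 * p * V * p + V^2 * w"
      using comb[of "- p" V] gauss_var_nonneg[of "\<lambda>x. - p *. seg_map t x + V *. (f1 x - f0 x)"] by simp
    then have "V * p^2 <= V * (w * V)" by (simp add: power2_eq_square algebra_simps)
    then show ?thesis using \<open>0 < V\<close> by simp
  qed
  have V1: "V <= 5 / 4 * ?n"
  proof -
    have "V <= 5 / 4 * (\<oint>x. (\<Sum>i\<in>Basis. nsq (seg_mat t x *v i)))"
      unfolding V_def gauss_var_def by (rule gauss_poincare[OF seg_map_lipschitz[OF t] seg_map_derivative])
    also have "(\<oint>x. (\<Sum>i\<in>Basis. nsq (seg_mat t x *v i))) <= (\<integral>x. ?n \<partial>(gauss :: (real ^ 'n) measure))"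
    proof (rule Bochner_Integration.integral_mono')
      fix x
      have "(\<Sum>i\<in>(Basis :: (real ^ 'n) set). nsq (seg_mat t x *v i)) <= (\<Sum>i\<in>(Basis :: (real ^ 'n) set). 1)"
      proof (rule sum_mono)
        fix i :: "real ^ 'n" assume i: "i \<in> Basis"
        have "norm (seg_mat t x *v i) <= 1"
          using lipschitz_derivative_bound[OF seg_map_lipschitz[OF t] seg_map_derivative[of t x], of i] norm_Basis[OF i] by simp
        then show "nsq (seg_mat t x *v i) <= 1" by (simp add: power_le_one)
      qed
      then show "(\<Sum>i\<in>Basis. nsq (seg_mat t x *v i)) <= ?n" by simp
    qed auto
    finally show ?thesis using gauss.prob_space[where 'a="real ^ 'n"] by simp
  qed
  have z: "w - 2 * \<mu> * p + \<mu>^2 * V <= 5 / 4 * (seg_sq t - ?n * \<mu>^2)"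
  proof -
    let ?z = "\<lambda>x. (- \<mu>) *. seg_map t x + 1 *. (f1 x - f0 x)"
    let ?B = "\<lambda>x. (A1 x - A0 x) - \<mu> *. seg_mat t x" and ?s = "\<lambda>x. \<Sum>i\<in>UNIV. (seg_slope t x i - \<mu>)^2" and ?S = "\<lambda>x. \<Sum>i\<in>Basis. nsq (((A1 x - A0 x) - \<mu> *. seg_mat t x) *v i)"
    have zd: "(?z has_derivative (\<lambda>v. ?B x *v v)) (at x)" for x
    proof -
      have "(?z has_derivative (\<lambda>v. (- \<mu>) *. (seg_mat t x *v v) + 1 *. (A1 x *v v - A0 x *v v))) (at x)"
        by (intro has_derivative_add has_derivative_diff has_derivative_scaleR_right der0 der1 seg_map_derivative)
      moreover have "?B x *v v = (- \<mu>) *. (seg_mat t x *v v) + 1 *. (A1 x *v v - A0 x *v v)" for v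
        by (simp add: matrix_vector_mult_diff_rdistrib scaleR_matrix_vector_assoc[symmetric])
      ultimately show ?thesis by simp
    qed
    have zl: "(\<bar>- \<mu>\<bar> * 1 + \<bar>1\<bar> * (1 + 1))-lipschitz_on UNIV ?z"
      by (intro lipschitz_on_add lipschitz_on_cmult seg_map_lipschitz[OF t] velocity_lipschitz)
    note D = seg_derivatives[OF ts]
    have e: "?s x = (\<Sum>i\<in>UNIV. (seg_slope t x i)^2) - 2 * \<mu> * (\<Sum>i\<in>UNIV. seg_slope t x i) + ?n * \<mu>^2" for x
      by (simp add: power2_diff sum.distrib sum_subtractf sum_distrib_left mult_ac)
    have "w - 2 * \<mu> * p + \<mu>^2 * V = gauss_var ?z" using comb[of "- \<mu>" 1] by simp
    also have "... <= 5 / 4 * (\<oint>x. ?S x)" unfolding gauss_var_def by (rule gauss_poincare[OF zl zd])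
    also have "(\<oint>x. ?S x) <= (\<oint>x. ?s x)"
    proof (rule Bochner_Integration.integral_mono')
      show "integrable gauss (\<lambda>x. ?s x)" unfolding e using D(1,3) by auto
      show "?S x <= ?s x" for x unfolding hs_norm_sq_Basis[symmetric] seg_slope_def by (rule seg_eig(4)[OF t])
      show "0 <= ?s x" for x by (intro sum_nonneg) auto
    qed
    also have "(\<oint>x. ?s x) = seg_sq t - 2 * \<mu> * seg_tau t + ?n * \<mu>^2"
      unfolding e seg_sq_def seg_tau_def using D(1,3) gauss.prob_space[where 'a="real ^ 'n"] by simp
    also have "... = seg_sq t - ?n * \<mu>^2" by (simp add: \<mu>_def power2_eq_square)
    finally show ?thesis by simp
  qed
  have "(?n * \<mu> - p)^2 + ?n / 2 * w <= ?n * (seg_sq t + w)"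
    by (rule second_variation_inequality[OF _ w0 V0 V1 p2 z]) simp
  then show ?thesis by (simp add: \<mu>_def p_def)
qed

text \<open>Here \<open>g = exp (- h / n)\<close>, so \<open>n^2 * g'' / g\<close> is the square of
  \<open>h'\<close> minus \<open>n * h''\<close>, which \<open>seg_second_variation\<close> bounds
  by \<open>- n * w / 2\<close>.\<close>

theorem seg_gap:
  defines "g \<equiv> \<lambda>t. exp ((seg_lndet t - gauss_var (seg_map t) / 2) / CARD('n))"
  assumes t: "0 <= t" "t <= 1"
  shows "gap_comb (gauss_var (\<lambda>x. f1 x - f0 x) / (2 * real CARD('n))) t (g 0) (g 1) <= g t"
proof -
  let ?n = "real CARD('n)"
  define w where "w = gauss_var (\<lambda>x. f1 x - f0 x)"
  obtain \<beta> where b: "!!r s. gauss_var (\<lambda>x. r *. f0 x + s *. (f1 x - f0 x)) = r^2 * gauss_var f0 + 2 * r * s * \<beta> + s^2 * w"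
    unfolding w_def by (rule gauss_var_combination[OF lip0 velocity_lipschitz]) blast
  have Vt: "gauss_var (seg_map t) = gauss_var f0 + 2 * t * \<beta> + t^2 * w" for t
  proof -
    have "seg_map t = (\<lambda>x. 1 *. f0 x + t *. (f1 x - f0 x))" by (simp add: seg_map_def[abs_def] algebra_simps)
    then show ?thesis using b[of 1 t] by simp
  qed
  let ?p = "\<lambda>t. \<beta> + t * w"
  let ?g1 = "\<lambda>t. g t * ((seg_tau t - ?p t) / ?n)"
  let ?g2 = "\<lambda>t. g t * ((seg_tau t - ?p t) / ?n) * ((seg_tau t - ?p t) / ?n) + g t * ((- seg_sq t - w) / ?n)"
  have w0: "0 <= w" unfolding w_def by (rule gauss_var_nonneg)
  have gd: "(g has_real_derivative ?g1 s) (at s)" if s: "0 <= s" "s <= 1" for s unfolding g_def Vt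
    by (auto intro!: derivative_eq_intros seg_derivatives(2)[OF unit_in_seg_ivl[OF s]]) (simp add: field_simps)
  show ?thesis unfolding w_def[symmetric]
  proof (rule concave_second_derivative_gap[where g' = ?g1 and g'' = ?g2])
    fix s :: real assume s: "0 <= s" "s <= 1"
    show "(g has_real_derivative ?g1 s) (at s)" by (rule gd[OF s])
    have "((\<lambda>s. (seg_tau s - ?p s) / ?n) has_real_derivative ((- seg_sq s - w) / ?n)) (at s)"
      by (auto intro!: derivative_eq_intros seg_derivatives(4)[OF unit_in_seg_ivl[OF s]])
    from DERIV_mult[OF gd[OF s] this] show "(?g1 has_real_derivative ?g2 s) (at s)" by (simp add: algebra_simps)
    have v: "(seg_tau s - ?p s)^2 - ?n * (seg_sq s + w) <= - (?n / 2 * w)"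
      using seg_second_variation[OF s b w_def] by linarith
    have "?g2 s = g s / ?n^2 * ((seg_tau s - ?p s)^2 - ?n * (seg_sq s + w))"
      by (simp add: power2_eq_square field_simps)
    also have "... <= g s / ?n^2 * (- (?n / 2 * w))" using v by (intro mult_left_mono) (auto simp: g_def)
    also have "... = - (w / (2 * ?n)) * g s" by (simp add: power2_eq_square mult.commute)
    finally show "?g2 s <= - (w / (2 * ?n)) * g s" .
  qed (use t w0 in \<open>auto simp: g_def\<close>)
qed

end

section \<open>The inequality for smoothed transport maps\<close>

lemma tendsto_det:
  fixes A :: "'a => real ^ 'n ^ 'n"
  assumes "!!i j. ((\<lambda>k. A k $ i $ j) \<longlongrightarrow> B $ i $ j) F"
  shows "((\<lambda>k. det (A k)) \<longlongrightarrow> det B) F" unfolding det_def by (intro tendsto_intros assms)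

lemma det_scale: "det (c *. A) = c ^ CARD('n) * det A" for A :: "real ^ 'n ^ 'n"
  unfolding det_def by (simp add: prod.distrib sum_distrib_left mult_ac)

lemma (in prob_space) integral_in_closed_convex:
  fixes f :: "'a => 'b::euclidean_space"
  assumes C: "closed C" "convex C" and f: "integrable M f" and fC: "!!x. x \<in> space M ==> f x \<in> C"
  shows "(\<integral>x. f x \<partial>M) \<in> C"
proof (rule ccontr)
  assume "(\<integral>x. f x \<partial>M) \<notin> C"
  then obtain v c where v: "v \<bullet> (\<integral>x. f x \<partial>M) < c" "!!y. y \<in> C ==> c < v \<bullet> y"
    using separating_hyperplane_closed_point[OF C(2,1)] by blast
  have "c = (\<integral>x. c \<partial>M)" using prob_space by simp
  also have "... <= (\<integral>x. v \<bullet> f x \<partial>M)" using f fC v(2) by (intro integral_mono) (auto intro: less_imp_le)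
  also have "... = v \<bullet> (\<integral>x. f x \<partial>M)" using f by simp
  finally show False using v(1) by simp
qed

lemma inj_of_pos_def_derivative:
  fixes g :: "real ^ 'n => real ^ 'n"
  assumes d: "!!x. (g has_derivative g' x) (at x)" and p: "!!x v. v ~= 0 ==> 0 < v \<bullet> g' x v"
  shows "inj g"
proof (rule injI, rule ccontr)
  fix x y assume e: "g x = g y" and n: "x ~= y"
  define \<psi> where "\<psi> s = (x - y) \<bullet> g (y + s *. (x - y))" for s :: real
  have D: "(\<psi> has_real_derivative (x - y) \<bullet> g' (y + s *. (x - y)) (x - y)) (at s)" for s
  proof -
    have "((\<lambda>s. y + s *. (x - y)) has_derivative (\<lambda>h. h *. (x - y))) (at s)" by (auto intro!: derivative_eq_intros)
    from has_derivative_inner_right[OF has_derivative_compose[OF this d], of "x - y"]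
    have "(\<psi> has_derivative (\<lambda>h. (x - y) \<bullet> g' (y + s *. (x - y)) (h *. (x - y)))) (at s)" by (simp add: \<psi>_def[abs_def])
    then show ?thesis using linear_scale[OF has_derivative_linear[OF d[of "y + s *. (x - y)"]]]
      by (simp add: has_field_derivative_def mult_commute_abs)
  qed
  have "\<psi> 0 < \<psi> 1"
  proof (rule DERIV_pos_imp_increasing[of 0 1 \<psi>])
    fix s :: real
    show "\<exists>D. (\<psi> has_real_derivative D) (at s) \<and> 0 < D"
      using D[of s] p[of "x - y" "y + s *. (x - y)"] n by (intro exI[of _ "(x - y) \<bullet> g' (y + s *. (x - y)) (x - y)"]) simp
  qed simp
  then show False using e by (simp add: \<psi>_def)
qed

section \<open>Range, nondegeneracy and regularisation of one transport map\<close>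

context gaussian_transport
begin

lemma transport_AE: "AE x in gauss. T x \<in> K"
proof -
  have "AE y in density lborel (\<lambda>y. ennreal (indicator K y * gauss_density y / measure gauss K)). y \<in> K"
    by (subst AE_density) (auto split: split_indicator)
  then have "AE y in distr gauss borel T. y \<in> K" unfolding law .
  then show ?thesis by (subst (asm) AE_distr_iff) auto
qed

text \<open>Almost every value lies in \<open>K\<close>; the distance of \<open>T x\<close> to
  \<open>K\<close> is continuous in \<open>x\<close>, and the Gaussian has full support.\<close>

lemma transport_in_closure: "T x \<in> closure K"
proof -
  have ne: "K ~= {}" using K_pos by auto
  have c: "continuous_on UNIV (\<lambda>x. min 1 (infdist (T x) K))"
    by (intro continuous_intros lipschitz_on_continuous_on[OF lip])
  have [measurable]: "(\<lambda>x. min 1 (infdist (T x) K)) \<in> borel_funs" by (rule borel_measurable_continuous_onI[OF c])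
  have i: "integrable gauss (\<lambda>x. min 1 (infdist (T x) K))"
    by (rule gauss.integrable_const_bound[where B=1]) (auto simp: infdist_nonneg)
  have "(\<oint>x. min 1 (infdist (T x) K)) = (\<integral>x. 0 \<partial>(gauss :: (real ^ 'n) measure))"
    using transport_AE by (intro integral_cong_AE) auto
  then have "min 1 (infdist (T x) K) = 0" by (intro gauss_full_support[OF c _ i]) (auto simp: infdist_nonneg)
  then show ?thesis using ne by (auto simp: in_closure_iff_infdist_zero)
qed

lemma ou_in_closure:
  assumes "convex K" "0 < a" "a < 1" shows "ou a T x \<in> closure K" unfolding ou_def
  by (intro gauss.integral_in_closed_convex ou_integrable[OF lip assms(2,3)])
    (auto simp: transport_in_closure assms(1))

text \<open>A constant component would confine the law of \<open>T\<close> to a hyperplane, but that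
  law has a density.\<close>

lemma transport_not_degenerate:
  assumes v: "v ~= 0" shows "\<exists>x. T x \<bullet> v ~= c"
proof (rule ccontr)
  assume "\<not> ?thesis"
  then have h: "T x \<in> {y. v \<bullet> y = c}" for x by (simp add: inner_commute)
  have m: "{y. v \<bullet> y = c} \<in> sets borel" using closed_hyperplane[of v c] by (rule borel_closed)
  have "negligible {y. v \<bullet> y = c}" using v by (intro negligible_hyperplane) simp
  then have "emeasure lborel {y. v \<bullet> y = c} = 0" by (simp add: negligible_iff_null_sets null_sets_def)
  then have ae: "AE y in lborel. y \<notin> {y. v \<bullet> y = c}" by (intro AE_not_in) (simp add: null_sets_def)
  have "AE y in density lborel (\<lambda>y. ennreal (indicator K y * gauss_density y / measure gauss K)). y \<notin> {y. v \<bullet> y = c}"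
    using ae by (subst AE_density) auto
  then have "AE x in gauss. T x \<notin> {y. v \<bullet> y = c}" unfolding law[symmetric] by (subst (asm) AE_distr_iff) auto
  then have "AE x in gauss. False" using h by simp
  then show False by simp
qed

lemma ou_mat_pos: "0 < a ==> a < 1 ==> v ~= 0 ==> 0 < v \<bullet> (ou_mat a T x *v v)"
  using oud_pos[OF smooth _ _ _ transport_not_degenerate] by (simp add: ou_mat_mult inner_commute)

text \<open>Adding \<open>\<kappa> *. x\<close> makes the map uniformly monotone, while
  \<open>a + \<kappa> <= 1\<close> keeps it 1-Lipschitz. The derivative is \<open>a\<close> times
  the smoothed matrix shifted by \<open>\<kappa> / a\<close>, so \<open>entropy_bound\<close>
  applies and the factor \<open>a\<close> costs \<open>CARD('n) * ln a\<close>.\<close>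

lemma regularized_bounds:
  assumes a: "0 < a" "a < 1" and k: "0 < \<kappa>" "a + \<kappa> <= 1"
  shows "1-lipschitz_on UNIV (\<lambda>x. ou a T x + \<kappa> *. x)"
    and "((\<lambda>x. ou a T x + \<kappa> *. x) has_derivative (\<lambda>v. (a *. ou_mat a T x +. \<kappa>) *v v)) (at x)"
    and "(\<lambda>x. (a *. ou_mat a T x +. \<kappa>) $ i $ j) \<in> borel_funs"
    and "transpose (a *. ou_mat a T x +. \<kappa>) = a *. ou_mat a T x +. \<kappa>"
    and "\<kappa> * nsq v <= v \<bullet> ((a *. ou_mat a T x +. \<kappa>) *v v)"
    and "CARD('n) * ln a + ln (measure gauss K) + (\<oint>x. nsq (T x)) / 2 - CARD('n) / 2
      <= (\<oint>x. ln (det (a *. ou_mat a T x +. \<kappa>)))"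
proof -
  let ?M = "\<lambda>x. a *. ou_mat a T x +. \<kappa>" and ?f = "\<lambda>x. ou a T x + \<kappa> *. x" and ?N = "\<lambda>x. ou_mat a T x +. (\<kappa> / a)"
  have "(1 * a + \<bar>\<kappa>\<bar> * 1)-lipschitz_on UNIV ?f"
    by (intro lipschitz_on_add lipschitz_on_cmult ou_lipschitz[OF lip a] lipschitz_ident)
  then show "1-lipschitz_on UNIV ?f" by (rule lipschitz_on_le) (use k in auto)
  have mv: "(?M x) *v v = a *. oud a T x v + \<kappa> *. v" for x v
    by (simp add: matrix_vector_mult_add_rdistrib scaleR_matrix_vector_assoc[symmetric] ou_mat_mult[OF a])
  show "(?f has_derivative (\<lambda>v. (?M x) *v v)) (at x)"
    unfolding mv by (intro has_derivative_add ou_has_derivative[OF lip a] has_derivative_scaleR_right has_derivative_ident)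
  note [measurable] = ou_mat_measurable[OF a]
  show "(\<lambda>x. (?M x) $ i $ j) \<in> borel_funs" unfolding vector_add_component vector_scaleR_component by measurable
  show "transpose (?M x) = ?M x" using ou_mat_symmetric[OF a, of x] by (simp add: vec_eq_iff transpose_def mat_def)
  show "\<kappa> * nsq v <= v \<bullet> ((?M x) *v v)"
    using oud_nonneg[OF smooth a, of x v] a unfolding mv inner_commute[of v "a *. oud a T x v + \<kappa> *. v"]
    by (simp add: inner_add_left power2_norm_eq_inner)
  have "ln (det (?M x)) = CARD('n) * ln a + ln (det (?N x))" for x
  proof -
    have e: "?M x = a *. (?N x)" using a by (simp add: scaleR_add_right)
    have "0 < det (?N x)" using a k by (intro pos_def_det_pos ou_mat_shifted(1)) auto
    then show ?thesis unfolding e det_scale using a by (simp add: ln_mult ln_realpow)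
  qed
  moreover have "ln (measure gauss K) + (\<oint>x. nsq (T x)) / 2 - CARD('n) / 2
      <= (\<oint>x. ln (det (?N x)))" using a k by (intro entropy_bound) auto
  ultimately show "CARD('n) * ln a + ln (measure gauss K) + (\<oint>x. nsq (T x)) / 2 - CARD('n) / 2
      <= (\<oint>x. ln (det (?M x)))"
    using ou_mat_shifted(4)[OF a, of "\<kappa> / a"] a k gauss.prob_space[where 'a="real ^ 'n"] by simp
qed

lemma gauss_var_ou_le:
  assumes a: "0 < a" "a < 1"
  shows "gauss_var (ou a T) <= gauss_var T"
proof -
  let ?b = "sqrt (1 - a^2)"
  have i: "integrable gauss2 (\<lambda>p. nsq (T (a *. fst p + ?b *. snd p)))"
    by (rule integral_mix(1)[OF a integrable_gauss_lipschitz(2)[OF lip]])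
  have "(\<oint>x. nsq (ou a T x)) <= (\<oint>x. \<oint>z. nsq (T (rot a x z)))"
  proof (rule integral_mono)
    show "integrable gauss (\<lambda>x. nsq (ou a T x))" by (rule integrable_gauss_lipschitz(2)[OF ou_lipschitz[OF lip a]])
    show "integrable gauss (\<lambda>x. \<integral>z. nsq (T (rot a x z)) \<partial>gauss)" using gauss2.integrable_fst'[OF i] by simp
    fix x
    have l: "(1 * \<bar>?b\<bar>)-lipschitz_on UNIV (\<lambda>z. T (rot a x z))" by (rule lipschitz_affine[OF lip])
    from gauss_var_nonneg[of "\<lambda>z. T (rot a x z)"]
    show "nsq (ou a T x) <= (\<oint>z. nsq (T (rot a x z)))" unfolding gauss_var_eq[OF l] ou_def by simp
  qed
  also have "... = (\<oint>x. nsq (T x))"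
    using gauss2.integral_fst'[OF i] integral_mix(2)[OF a integrable_gauss_lipschitz(2)[OF lip]] by simp
  finally show ?thesis unfolding gauss_var_eq[OF ou_lipschitz[OF lip a]] gauss_var_eq[OF lip] integral_ou[OF lip a] by simp
qed

end

section \<open>Two transport maps smoothed at the same level\<close>

locale transport_pair =
  G0: gaussian_transport \<phi>0 T0 K0 + G1: gaussian_transport \<phi>1 T1 K1
  for \<phi>0 :: "real ^ 'n => real" and T0 K0 and \<phi>1 :: "real ^ 'n => real" and T1 K1 +
  fixes a :: real
  assumes a: "0 < a" "a < 1"
begin

definition mix_mat :: "real => real ^ 'n => real ^ 'n ^ 'n" where
  "mix_mat t x = (1 - t) *. (a *. ou_mat a T0 x) + t *. (a *. ou_mat a T1 x)"

definition mix_map :: "real => real ^ 'n => real ^ 'n" where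
  "mix_map t x = (1 - t) *. ou a T0 x + t *. ou a T1 x"

definition speed :: real where "speed = gauss_var (\<lambda>x. ou a T1 x - ou a T0 x)"

text \<open>The value of \<open>exp (- h / n)\<close> guaranteed at an end point by the entropy
  bound, when the variance there is \<open>V\<close>.\<close>

definition level :: "(real ^ 'n => real ^ 'n) => (real ^ 'n) set => real => real" where
  "level T K V = exp ((CARD('n) * ln a + ln (measure gauss K) + (\<oint>x. nsq (T x)) / 2 - CARD('n) / 2 - V / 2) / CARD('n))"

lemma mix_map_lipschitz: "0 <= t ==> t <= 1 ==> 1-lipschitz_on UNIV (mix_map t)"
proof -
  assume t: "0 <= t" "t <= 1"
  have "(\<bar>1 - t\<bar> * (1 * a) + \<bar>t\<bar> * (1 * a))-lipschitz_on UNIV (mix_map t)" unfolding mix_map_def[abs_def]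
    by (intro lipschitz_on_add lipschitz_on_cmult ou_lipschitz[OF G0.lip a] ou_lipschitz[OF G1.lip a])
  moreover have "\<bar>1 - t\<bar> * (1 * a) + \<bar>t\<bar> * (1 * a) <= 1" using t a by (simp add: algebra_simps)
  ultimately show ?thesis by (rule lipschitz_on_le)
qed

text \<open>The abstract segment estimate applied to the regularised maps. Adding the same
  \<open>\<kappa> *. x\<close> to both leaves their difference, hence \<open>speed\<close>,
  unchanged.\<close>

lemma regularized:
  assumes k: "0 < \<kappa>" "a + \<kappa> <= 1" and t: "0 <= t" "t <= 1"
  defines "V \<equiv> \<lambda>f. gauss_var (\<lambda>x. f x + \<kappa> *. x)"
  defines "l \<equiv> \<lambda>T K. level T K (V (ou a T))"
  shows "integrable gauss (\<lambda>x. ln (det (mix_mat t x +. \<kappa>)))"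
    and "ln (det (mix_mat t x +. \<kappa>)) <= 0"
    and "CARD('n) * ln (gap_comb (speed / (2 * real CARD('n))) t (l T0 K0) (l T1 K1))
        + V (mix_map t) / 2 <= (\<oint>x. ln (det (mix_mat t x +. \<kappa>)))"
proof -
  interpret contraction_segment "\<lambda>x. ou a T0 x + \<kappa> *. x" "\<lambda>x. ou a T1 x + \<kappa> *. x"
    "\<lambda>x. a *. ou_mat a T0 x +. \<kappa>" "\<lambda>x. a *. ou_mat a T1 x +. \<kappa>" \<kappa>
    using G0.regularized_bounds[OF a k] G1.regularized_bounds[OF a k] k by unfold_locales
  let ?n = "real CARD('n)"
  have sm: "seg_mat s x = mix_mat s x +. \<kappa>" for s x unfolding seg_mat_def mix_mat_def by (simp add: algebra_simps)
  have sp: "seg_map s = (\<lambda>x. mix_map s x + \<kappa> *. x)" for s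
    unfolding seg_map_def[abs_def] mix_map_def by (simp add: algebra_simps)
  show i: "integrable gauss (\<lambda>x. ln (det (mix_mat t x +. \<kappa>)))"
    using ln_det_seg_integrable[OF unit_in_seg_ivl[OF t]] unfolding sm .
  have pd: "pos_def (seg_mat t x)"
  proof -
    have "transpose (seg_mat t x) = seg_mat t x"
      using sym0[of x] sym1[of x] by (simp add: seg_mat_def vec_eq_iff transpose_def)
    moreover have "0 < v \<bullet> (seg_mat t x *v v)" if "v ~= 0" for v
    proof -
      have "(1 - t) * (\<kappa> * nsq v) + t * (\<kappa> * nsq v) <= v \<bullet> (seg_mat t x *v v)" unfolding seg_mat_def
        by (subst matrix_vector_mult_add_rdistrib, unfold scaleR_matrix_vector_assoc[symmetric] inner_add_right inner_scaleR_right,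
            intro add_mono mult_left_mono coercive0 coercive1) (use t in simp_all)
      moreover have "(1 - t) * (\<kappa> * nsq v) + t * (\<kappa> * nsq v) = \<kappa> * nsq v" by (simp add: algebra_simps)
      moreover have "0 < \<kappa> * nsq v" using that k by simp
      ultimately show ?thesis by linarith
    qed
    ultimately show ?thesis by (simp add: pos_def_def)
  qed
  show "ln (det (mix_mat t x +. \<kappa>)) <= 0"
    using ln_det_upper[OF pd, of 1] lipschitz_derivative_bound[OF seg_map_lipschitz[OF t] seg_map_derivative[of t x]] by (simp add: sm)
  define g where "g s = exp ((seg_lndet s - gauss_var (seg_map s) / 2) / ?n)" for s
  have sg: "gap_comb (gauss_var (\<lambda>x. ou a T1 x + \<kappa> *. x - (ou a T0 x + \<kappa> *. x)) / (2 * ?n)) t (g 0) (g 1) <= g t"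
    unfolding g_def by (rule seg_gap[OF t])
  have g0: "l T0 K0 <= g 0"
  proof -
    have "mix_mat 0 x +. \<kappa> = a *. ou_mat a T0 x +. \<kappa>" "mix_map 0 = ou a T0" for x by (simp_all add: mix_mat_def mix_map_def[abs_def])
    then show ?thesis using G0.regularized_bounds(6)[OF a k]
      unfolding g_def l_def V_def level_def seg_lndet_def sm sp by (simp add: divide_right_mono)
  qed
  have g1: "l T1 K1 <= g 1"
  proof -
    have "mix_mat 1 x +. \<kappa> = a *. ou_mat a T1 x +. \<kappa>" "mix_map 1 = ou a T1" for x by (simp_all add: mix_mat_def mix_map_def[abs_def])
    then show ?thesis using G1.regularized_bounds(6)[OF a k]
      unfolding g_def l_def V_def level_def seg_lndet_def sm sp by (simp add: divide_right_mono)
  qed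
  let ?R = "gap_comb (speed / (2 * ?n)) t (l T0 K0) (l T1 K1)"
  have s0: "0 <= speed / (2 * ?n)" by (simp add: speed_def gauss_var_nonneg)
  have "?R <= gap_comb (speed / (2 * ?n)) t (g 0) (g 1)" by (rule gap_comb_mono[OF s0 t g0 g1])
  also have "... <= g t" using sg by (simp add: speed_def)
  finally have R: "?R <= g t" .
  have "0 < ?R" by (rule gap_comb_pos[OF s0 t]) (simp_all add: l_def level_def)
  then have "ln ?R <= ln (g t)" using R by simp
  also have "... = (seg_lndet t - gauss_var (seg_map t) / 2) / ?n" by (simp add: g_def)
  finally have "?n * ln ?R <= seg_lndet t - gauss_var (seg_map t) / 2" by (simp add: pos_le_divide_eq mult.commute)
  then show "?n * ln ?R + V (mix_map t) / 2 <= (\<oint>x. ln (det (mix_mat t x +. \<kappa>)))"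
    unfolding seg_lndet_def sm sp V_def by linarith
qed

lemma mix_mat_pos_def: assumes t: "0 <= t" "t <= 1" shows "pos_def (mix_mat t x)"
proof -
  have "transpose (mix_mat t x) = mix_mat t x"
    using G0.ou_mat_symmetric[OF a, of x] G1.ou_mat_symmetric[OF a, of x] by (simp add: mix_mat_def vec_eq_iff transpose_def)
  moreover have "0 < v \<bullet> (mix_mat t x *v v)" if v: "v ~= 0" for v
  proof -
    have p: "0 < a * (v \<bullet> (ou_mat a T0 x *v v))" "0 < a * (v \<bullet> (ou_mat a T1 x *v v))"
      using G0.ou_mat_pos[OF a v] G1.ou_mat_pos[OF a v] a by auto
    have "v \<bullet> (mix_mat t x *v v) = (1 - t) * (a * (v \<bullet> (ou_mat a T0 x *v v))) + t * (a * (v \<bullet> (ou_mat a T1 x *v v)))"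
      by (simp add: mix_mat_def matrix_vector_mult_add_rdistrib scaleR_matrix_vector_assoc[symmetric] inner_add_right)
    also have "... > 0"
    proof (cases "t = 0")
      case False
      then have "0 < t" using t by simp
      from mult_pos_pos[OF this p(2)] mult_nonneg_nonneg[OF _ less_imp_le[OF p(1)], of "1 - t"] t show ?thesis by linarith
    qed (use p in simp)
    finally show ?thesis .
  qed
  ultimately show ?thesis by (simp add: pos_def_def)
qed

lemma tendsto_regularized_var:
  assumes f: "L-lipschitz_on UNIV f" and k: "k ----> 0"
  shows "(\<lambda>j. gauss_var (\<lambda>x :: real ^ 'n. f x + k j *. x)) ----> gauss_var f"
proof (rule gauss_var_combination[OF f])
  show "1-lipschitz_on UNIV (\<lambda>z::real ^ 'n. z)" by (rule lipschitz_ident)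
  fix \<beta> assume b: "!!s t. gauss_var (\<lambda>x. s *. f x + t *. x) = s^2 * gauss_var f + 2 * s * t * \<beta> + t^2 * gauss_var (\<lambda>z :: real ^ 'n. z)"
  have "(\<lambda>j. 1^2 * gauss_var f + 2 * 1 * k j * \<beta> + (k j)^2 * gauss_var (\<lambda>z :: real ^ 'n. z))
     ----> 1^2 * gauss_var f + 2 * 1 * 0 * \<beta> + 0^2 * gauss_var (\<lambda>z :: real ^ 'n. z)" by (intro tendsto_intros k)
  moreover have "gauss_var (\<lambda>x. f x + k j *. x) = 1^2 * gauss_var f + 2 * 1 * k j * \<beta> + (k j)^2 * gauss_var (\<lambda>z :: real ^ 'n. z)" for j
    using b[of 1 "k j"] by simp
  ultimately show ?thesis by simp
qed

text \<open>Without the shift \<open>\<kappa>\<close> the determinants are positive but not bounded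
  away from 0. As contractions make all logarithms nonpositive, Fatou's lemma yields both
  integrability and the inequality in the limit.\<close>

lemma ln_det_mix:
  assumes t: "0 <= t" "t <= 1"
  defines "l \<equiv> \<lambda>T K. level T K (gauss_var (ou a T))"
  shows "integrable gauss (\<lambda>x. ln (det (mix_mat t x)))"
    and "CARD('n) * ln (gap_comb (speed / (2 * real CARD('n))) t (l T0 K0) (l T1 K1))
        + gauss_var (mix_map t) / 2 <= (\<oint>x. ln (det (mix_mat t x)))"
proof -
  let ?n = "real CARD('n)"
  \<comment> \<open>Shifts tending to 0 that leave \<open>a + k j <= 1\<close> from the first index
    on.\<close>
  define k where "k j = (1 - a) / real (Suc j)" for j
  have k: "0 < k j" "a + k j <= 1" for j using a divide_left_mono[of 1 "real (Suc j)" "1 - a"] by (auto simp: k_def)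
  have k0: "k ----> 0" unfolding k_def by (rule LIMSEQ_Suc[OF lim_const_over_n])
  let ?D = "\<lambda>x. ln (det (mix_mat t x))" and ?d = "\<lambda>j x. ln (det (mix_mat t x +. k j))"
  define V where "V j f = gauss_var (\<lambda>x :: real ^ 'n. f x + k j *. x)" for j f
  define L where "L j T K = level T K (V j (ou a T))" for j T K
  define B where "B j = ?n * ln (gap_comb (speed / (2 * ?n)) t (L j T0 K0) (L j T1 K1)) + V j (mix_map t) / 2" for j
  let ?R = "gap_comb (speed / (2 * ?n)) t (l T0 K0) (l T1 K1)"
  define B0 where "B0 = ?n * ln ?R + gauss_var (mix_map t) / 2"
  note reg = regularized[OF k t, folded V_def, folded L_def, folded B_def]
  have "0 <= speed / (2 * ?n)" by (simp add: speed_def gauss_var_nonneg)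
  from gap_comb_pos[OF this t] have R0: "0 < ?R" by (simp add: l_def level_def)
  have lim: "B ----> B0"
  proof -
    have "(\<lambda>j. V j (ou a T0)) ----> gauss_var (ou a T0)" "(\<lambda>j. V j (ou a T1)) ----> gauss_var (ou a T1)"
      "(\<lambda>j. V j (mix_map t)) ----> gauss_var (mix_map t)"
      unfolding V_def by (rule tendsto_regularized_var[OF _ k0], rule ou_lipschitz[OF G0.lip a] ou_lipschitz[OF G1.lip a] mix_map_lipschitz[OF t])+
    then show ?thesis using R0 unfolding B_def[abs_def] B0_def L_def l_def level_def gap_comb_def
      by (intro tendsto_intros) auto
  qed
  have neg: "!!x. ?D x <= 0" and pt: "!!x. (\<lambda>j. ?d j x) ----> ?D x"
  proof -
    fix x
    have "(\<lambda>j. det (mix_mat t x +. k j)) ----> det (mix_mat t x)"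
    proof (rule tendsto_det)
      have "(\<lambda>j. mix_mat t x $ r $ c + k j * (mat 1 :: real ^ 'n ^ 'n) $ r $ c) ----> mix_mat t x $ r $ c + 0 * (mat 1 :: real ^ 'n ^ 'n) $ r $ c" for r c
        by (intro tendsto_intros k0)
      then show "(\<lambda>j. (mix_mat t x +. k j) $ r $ c) ----> mix_mat t x $ r $ c" for r c by simp
    qed
    then show pt: "(\<lambda>j. ?d j x) ----> ?D x"
      using pos_def_det_pos[OF mix_mat_pos_def[OF t, of x]] by (intro tendsto_ln) auto
    show "?D x <= 0" by (rule LIMSEQ_le_const2[OF pt]) (use reg(2) in blast)
  qed
  note [measurable] = borel_measurable_integrable[OF reg(1)]
  have [measurable]: "(\<lambda>x. ?D x) \<in> borel_measurable gauss"
    by (rule borel_measurable_LIMSEQ_metric[OF _ pt]) measurable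
  have fin: "(\<integral>\<^sup>+x. - ?D x \<partial>gauss) <= ennreal (- B0)"
  proof (rule nn_integral_le_of_tendsto[OF _ tendsto_minus[OF pt] _ tendsto_minus[OF lim]])
    fix j
    have "(\<integral>\<^sup>+x. - ?d j x \<partial>gauss) = ennreal (\<oint>x. - ?d j x)" using reg(1,2) by (intro nn_integral_eq_integral) auto
    also have "... <= ennreal (- B j)" using reg(1,3)[of j] by (intro ennreal_leI) simp
    finally show "(\<integral>\<^sup>+x. - ?d j x \<partial>gauss) <= ennreal (- B j)" .
  qed measurable
  have i: "integrable gauss (\<lambda>x. - ?D x)" using fin neg by (intro integrableI_nonneg) (auto intro: le_less_trans)
  then show "integrable gauss (\<lambda>x. ?D x)" by simp
  have "ennreal (\<oint>x. - ?D x) <= ennreal (- B0)" using fin neg nn_integral_eq_integral[OF i] by simp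
  moreover have "0 <= - B0"
  proof (rule LIMSEQ_le_const[OF tendsto_minus[OF lim]])
    have "B j <= 0" for j
      using reg(3)[of j] Bochner_Integration.integral_nonneg[of gauss "\<lambda>x. - ?d j x"] reg(2) by simp
    then show "\<exists>N. \<forall>j\<ge>N. 0 <= - B j" by auto
  qed
  ultimately have "(\<oint>x. - ?D x) <= - B0" by simp
  then show "?n * ln ?R + gauss_var (mix_map t) / 2 <= (\<oint>x. ?D x)" by (simp add: B0_def)
qed

end

context transport_pair
begin

lemma mix_map_derivative: "(mix_map t has_derivative (\<lambda>v. mix_mat t x *v v)) (at x)"
proof -
  have "(mix_map t has_derivative (\<lambda>v. (1 - t) *. (a *. oud a T0 x v) + t *. (a *. oud a T1 x v))) (at x)"
    unfolding mix_map_def[abs_def]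
    by (intro has_derivative_add has_derivative_scaleR_right ou_has_derivative[OF G0.lip a] ou_has_derivative[OF G1.lip a])
  moreover have "mix_mat t x *v v = (1 - t) *. (a *. oud a T0 x v) + t *. (a *. oud a T1 x v)" for v
    by (simp add: mix_mat_def matrix_vector_mult_add_rdistrib scaleR_matrix_vector_assoc[symmetric]
        G0.ou_mat_mult[OF a] G1.ou_mat_mult[OF a])
  ultimately show ?thesis by simp
qed

text \<open>\<open>mix_map t\<close> is injective with positive definite derivative, so its change
  of variables bounds the Gaussian mean of \<open>exp \<psi>\<close> by the measure of
  \<open>C\<close>; Jensen then gives the logarithmic form. The term \<open>CARD('n) / 2\<close> is
  the second moment of the reference Gaussian.\<close>

lemma mix_map_volume:
  assumes t: "0 <= t" "t <= 1" and C: "range (mix_map t) \<subseteq> C" "C \<in> sets borel"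
  shows "0 < measure gauss C"
    and "(\<oint>x. ln (det (mix_mat t x))) - (\<oint>x. nsq (mix_map t x)) / 2 + CARD('n) / 2 <= ln (measure gauss C)"
proof -
  note lip = mix_map_lipschitz[OF t] and i = ln_det_mix(1)[OF t]
  note pos = pos_def_det_pos[OF mix_mat_pos_def[OF t]]
  have [measurable]: "mix_map t \<in> borel_funs" by (rule lipschitz_measurable[OF lip])
  have dm [measurable]: "(\<lambda>x. det (mix_mat t x)) \<in> borel_funs"
  proof (rule det_measurable)
    note [measurable] = G0.ou_mat_measurable[OF a] G1.ou_mat_measurable[OF a]
    show "(\<lambda>x. mix_mat t x $ r $ c) \<in> borel_funs" for r c
      unfolding mix_mat_def vector_add_component vector_scaleR_component by measurable
  qed
  define \<psi> where "\<psi> x = ln (det (mix_mat t x)) - nsq (mix_map t x) / 2 + nsq x / 2" for x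
  have \<psi>m [measurable]: "\<psi> \<in> borel_funs" unfolding \<psi>_def[abs_def] by measurable
  have inj: "inj (mix_map t)"
    by (rule inj_of_pos_def_derivative[OF mix_map_derivative]) (rule pos_def_pos[OF mix_mat_pos_def[OF t]])
  let ?I = "\<integral>\<^sup>+x. ennreal (exp (\<psi> x)) \<partial>gauss" and ?m = "measure gauss C"
  have "?I
    = (\<integral>+x. ennreal (\<bar>det (matrix (\<lambda>v. mix_mat t x *v v))\<bar> * gauss_density (mix_map t x)))"
  proof (subst nn_integral_gauss, measurable, rule nn_integral_cong)
    fix x
    have "gauss_density x * exp (\<psi> x) = \<bar>det (mix_mat t x)\<bar> * gauss_density (mix_map t x)"
    proof -
      have "exp (- nsq x / 2) * exp (\<psi> x) = exp (ln (det (mix_mat t x))) * exp (- nsq (mix_map t x) / 2)"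
        unfolding \<psi>_def by (simp flip: exp_add)
      then show ?thesis using pos[of x] by (simp add: gauss_density_def)
    qed
    then show "ennreal (gauss_density x) * ennreal (exp (\<psi> x)) = ennreal (\<bar>det (matrix (\<lambda>v. mix_mat t x *v v))\<bar> * gauss_density (mix_map t x))"
      by (simp flip: ennreal_mult')
  qed
  also have "... <= emeasure gauss C" by (rule gauss_change_of_variables[OF mix_map_derivative inj C]) simp
  finally have le: "?I <= ennreal (?m)" by (simp add: gauss.emeasure_eq_measure)
  show Cp: "0 < ?m"
  proof (rule ccontr)
    assume "\<not> ?thesis"
    then have "?m = 0" using measure_nonneg[of gauss C] by linarith
    then have "?I = 0" using le by simp
    then have "AE x in gauss. ennreal (exp (\<psi> x)) = 0" by (subst (asm) nn_integral_0_iff_AE) auto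
    then have "AE x in (gauss :: (real ^ 'n) measure). False" by simp
    then show False by simp
  qed
  have int: "integrable gauss (\<lambda>x. nsq (mix_map t x))" "integrable gauss (\<lambda>x :: real ^ 'n. nsq x)"
    by (rule integrable_gauss_lipschitz(2)[OF lip], rule integrable_gauss_lipschitz(2)[OF lipschitz_ident])
  have "(\<oint>x. \<psi> x - ln (?m)) <= 0"
  proof (rule gauss.integral_le_zero_of_exp_le_one)
    show "integrable gauss (\<lambda>x. \<psi> x - ln (?m))" unfolding \<psi>_def using i int by auto
    have "(\<integral>\<^sup>+x. ennreal (exp (\<psi> x - ln (?m))) \<partial>gauss) = (\<integral>\<^sup>+x. ennreal (1 / ?m) * ennreal (exp (\<psi> x)) \<partial>gauss)"
      using Cp by (intro nn_integral_cong) (simp add: exp_diff flip: ennreal_mult')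
    also have "... = ennreal (1 / ?m) * ?I" by (rule nn_integral_cmult) simp
    also have "... <= ennreal (1 / ?m) * ennreal (?m)" by (intro mult_left_mono le) simp
    also have "... = 1" using Cp by (simp flip: ennreal_mult')
    finally show "(\<integral>\<^sup>+x. ennreal (exp (\<psi> x - ln (?m))) \<partial>gauss) <= 1" .
  qed
  moreover have "(\<oint>x. \<psi> x - ln (?m))
    = (\<oint>x. ln (det (mix_mat t x))) - (\<oint>x. nsq (mix_map t x)) / 2 + CARD('n) / 2 - ln (?m)"
    unfolding \<psi>_def using i int integral_gauss_norm_sq[where 'a="real ^ 'n"] gauss.prob_space[where 'a="real ^ 'n"] by simp
  ultimately show "(\<oint>x. ln (det (mix_mat t x))) - (\<oint>x. nsq (mix_map t x)) / 2 + CARD('n) / 2 <= ln (?m)" by linarith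
qed

end

text \<open>The quantity of the theorem in exponential form, ready for comparison with logarithmic
  estimates. The point \<open>b\<close> is a parameter, since for the interpolated set it is not the
  barycenter of that set.\<close>

definition tilted_root :: "(real ^ 'n) set => real ^ 'n => real" where
  "tilted_root K b = exp ((ln (measure gauss K) + nsq b / 2) / CARD('n))"

context transport_pair
begin

text \<open>Second moments enter from the changes of variables and variances from the concavity
  argument; their difference is the squared norm of the mean, the origin of the factor
  \<open>exp (nsq b / (2 * n))\<close>. The terms \<open>CARD('n) / 2\<close> cancel between end
  points and interior, leaving \<open>a\<close> as the price of smoothing.\<close>

theorem smoothed_inequality:
  assumes cv: "convex K0" "convex K1" and t: "0 <= t" "t <= 1"
    and C: "C \<in> sets borel" "!!x y. x \<in> closure K0 ==> y \<in> closure K1 ==> (1 - t) *. x + t *. y \<in> C"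
  defines "R0 \<equiv> tilted_root K0 (\<oint>x. T0 x)" and "R1 \<equiv> tilted_root K1 (\<oint>x. T1 x)"
  shows "0 < measure gauss C"
    and "a * gap_comb (speed / (2 * real CARD('n))) t R0 R1
      <= tilted_root C ((1 - t) *. (\<oint>x. T0 x) + t *. (\<oint>x. T1 x))"
proof -
  let ?n = "real CARD('n)"
  define bt where "bt = (1 - t) *. (\<oint>x. T0 x) + t *. (\<oint>x. T1 x)"
  define l where "l T K = level T K (gauss_var (ou a T))" for T K
  have "range (mix_map t) \<subseteq> C"
    using C(2) G0.ou_in_closure[OF cv(1) a] G1.ou_in_closure[OF cv(2) a] by (auto simp: mix_map_def)
  note vol = mix_map_volume[OF t this C(1)]
  show "0 < measure gauss C" by (rule vol(1))
  have mean: "(\<oint>x. mix_map t x) = bt" unfolding mix_map_def bt_def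
    using integrable_gauss_lipschitz(1)[OF ou_lipschitz[OF G0.lip a]] integrable_gauss_lipschitz(1)[OF ou_lipschitz[OF G1.lip a]]
    by (simp add: integral_ou[OF G0.lip a] integral_ou[OF G1.lip a])
  \<comment> \<open>Smoothing lowers the variance and keeps the mean, so replacing the variance of
    \<open>ou a T\<close> with that of \<open>T\<close> loses in the right direction.\<close>
  have lev: "a * exp (- 1 / 2) * tilted_root K (\<oint>x. T x) <= l T K"
    if "gauss_var (ou a T) <= gauss_var T" "1-lipschitz_on UNIV T" for T K
  proof -
    have "a * exp (- 1 / 2) * tilted_root K (\<oint>x. T x)
      = exp (ln a + (- 1 / 2) + (ln (measure gauss K) + nsq (\<oint>x. T x) / 2) / ?n)"
      unfolding tilted_root_def exp_add using a by simp
    also have "... <= l T K"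
    proof -
      have "(?n * x + g + E / 2 - ?n / 2 - V / 2) / ?n = x + (- 1 / 2) + (g + (E - V) / 2) / ?n" for x g E V
        by (simp add: field_simps)
      moreover have "(ln (measure gauss K) + b / 2) / ?n <= (ln (measure gauss K) + c / 2) / ?n" if "b <= c" for b c
        using that by (intro divide_right_mono) auto
      ultimately show ?thesis using that(1) unfolding l_def level_def gauss_var_eq[OF that(2)] by simp
    qed
    finally show ?thesis .
  qed
  have l0: "a * exp (- 1 / 2) * R0 <= l T0 K0" unfolding R0_def by (rule lev[OF G0.gauss_var_ou_le[OF a] G0.lip])
  have l1: "a * exp (- 1 / 2) * R1 <= l T1 K1" unfolding R1_def by (rule lev[OF G1.gauss_var_ou_le[OF a] G1.lip])
  let ?R = "gap_comb (speed / (2 * ?n)) t (l T0 K0) (l T1 K1)"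
  let ?Q = "gap_comb (speed / (2 * ?n)) t R0 R1"
  have s0: "0 <= speed / (2 * ?n)" by (simp add: speed_def gauss_var_nonneg)
  have Rp: "0 < R0" "0 < R1" by (simp_all add: R0_def R1_def tilted_root_def)
  define k where "k = a * exp (- 1 / 2)"
  have k: "0 < k" using a by (simp add: k_def)
  have kQ: "k * ?Q <= ?R" unfolding gap_comb_scale[OF k] using gap_comb_mono[OF s0 t l0 l1] by (simp add: k_def)
  have R: "0 < ?R" using gap_comb_pos[OF s0 t Rp] k kQ by (meson less_le_trans mult_pos_pos)
  have sum_gap: "r + V / 2 <= e ==> e - q / 2 + m / 2 <= g ==> V = q - b ==> r - b / 2 + m / 2 <= g"
    for r V e q m g b :: real by (simp add: field_simps)
  have "?n * ln ?R + gauss_var (mix_map t) / 2 <= (\<oint>x. ln (det (mix_mat t x)))"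
    unfolding l_def by (rule ln_det_mix(2)[OF t])
  then have "?n * ln ?R - nsq bt / 2 + ?n / 2 <= ln (measure gauss C)"
    using vol(2) gauss_var_eq[OF mix_map_lipschitz[OF t]] unfolding mean using sum_gap[of "?n * ln ?R"] by blast
  then have "ln ?R + 1 / 2 <= (ln (measure gauss C) + nsq bt / 2) / ?n" by (simp add: pos_le_divide_eq algebra_simps)
  have chain: "x <= y ==> x = r ==> q <= r ==> q = s ==> s <= y" for x y r q s :: real by simp
  have "exp (ln ?R + 1 / 2) <= tilted_root C bt" using \<open>ln ?R + 1 / 2 <= _\<close> unfolding tilted_root_def by simp
  moreover have "exp (ln ?R + 1 / 2) = ?R * exp (1 / 2)" using R by (simp add: exp_add)
  moreover have "k * ?Q * exp (1 / 2) <= ?R * exp (1 / 2)" using kQ by (intro mult_right_mono) auto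
  moreover have "k * ?Q * exp (1 / 2) = a * ?Q"
  proof -
    have "k * exp (1 / 2) = a" by (simp add: k_def flip: exp_add)
    moreover have "k * q * exp (1 / 2) = (k * exp (1 / 2)) * q" for q by (simp only: mult_ac)
    ultimately show ?thesis by simp
  qed
  ultimately show "a * ?Q <= tilted_root C ((1 - t) *. (\<oint>x. T0 x) + t *. (\<oint>x. T1 x))"
    unfolding bt_def using chain by blast
qed

end

section \<open>Removing the smoothing, and rigidity\<close>

text \<open>Fatou's lemma as \<open>a\<close> tends to 1 gives zero variance for \<open>f\<close>
  itself, and continuity with full support makes this hold at every point.\<close>

lemma constant_of_smoothed_variance:
  fixes f :: "'a::euclidean_space => 'b::euclidean_space"
  assumes lip: "L-lipschitz_on UNIV f" and c: "!!a. 0 < a ==> a < 1 ==> gauss_var (ou a f) <= c * (1 - a) / a"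
  shows "f x = (\<oint>y. f y)"
proof -
  let ?m = "\<integral>y. f y \<partial>gauss"
  define a where "a k = 1 - 1 / real (k + 2)" for k :: nat
  have a: "0 < a k" "a k < 1" for k by (auto simp: a_def)
  have al: "a ----> 1 - 0" unfolding a_def
    by (intro tendsto_intros tendsto_divide_0[OF tendsto_const] filterlim_at_top_imp_at_infinity
        filterlim_compose[OF filterlim_real_sequentially filterlim_add_const_nat_at_top])
  then have af: "filterlim a (at_left 1) sequentially"
    using a(2) by (auto simp: filterlim_at intro!: always_eventually dest: less_imp_neq)
  note [measurable] = lipschitz_measurable[OF lip] lipschitz_measurable[OF ou_lipschitz[OF lip a]]
  have sq: "integrable gauss (\<lambda>x. nsq (ou (a k) f x - ?m))" for k
    by (rule gauss.variance_expand(2)[OF integrable_gauss_lipschitz[OF ou_lipschitz[OF lip a]]])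
  have gv: "gauss_var (ou (a k) f) = (\<oint>x. nsq (ou (a k) f x - ?m))" for k
    by (simp add: gauss_var_def integral_ou[OF lip a])
  have "(\<integral>\<^sup>+x. nsq (f x - ?m) \<partial>gauss) <= ennreal (c * (1 - 1) / 1)"
  proof (rule nn_integral_le_of_tendsto)
    show "(\<lambda>k. nsq (ou (a k) f x - ?m)) ----> nsq (f x - ?m)" for x
      by (intro tendsto_intros filterlim_compose[OF ou_tendsto[OF lip] af])
    have "(\<integral>\<^sup>+x. nsq (ou (a k) f x - ?m) \<partial>gauss) = ennreal (gauss_var (ou (a k) f))" for k
      unfolding gv by (rule nn_integral_eq_integral[OF sq]) simp
    then show "(\<integral>\<^sup>+x. nsq (ou (a k) f x - ?m) \<partial>gauss) <= ennreal (c * (1 - a k) / a k)" for k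
      by (simp add: ennreal_leI c a)
    show "(\<lambda>k. c * (1 - a k) / a k) ----> c * (1 - 1) / 1" using al by (intro tendsto_intros) auto
  qed measurable
  then have z: "(\<integral>\<^sup>+x. ennreal (nsq (f x - ?m)) \<partial>gauss) = 0" by simp
  have i: "integrable gauss (\<lambda>x. nsq (f x - ?m))"
    by (rule gauss.variance_expand(2)[OF integrable_gauss_lipschitz[OF lip]])
  have "nsq (f x - ?m) = 0"
  proof (rule gauss_full_support[OF _ _ i])
    show "continuous_on UNIV (\<lambda>x. nsq (f x - ?m))" by (intro continuous_intros lipschitz_on_continuous_on[OF lip])
    show "(\<oint>x. nsq (f x - ?m)) = 0" using z nn_integral_eq_integral[OF i] by simp
  qed simp
  then show ?thesis by simp
qed

text \<open>The limit \<open>a\<close> to 1 is taken in a form that retains the variance gap: in the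
  case of equality, the gap at level \<open>a\<close> is forced below a multiple of
  \<open>(1 - a) / a\<close>, so \<open>T1 - T0\<close> is constant.\<close>

lemma transport_inequality:
  fixes \<phi>0 \<phi>1 :: "real ^ 'n => real"
  assumes G: "gaussian_transport \<phi>0 T0 K0" "gaussian_transport \<phi>1 T1 K1"
    and cv: "convex K0" "convex K1" and t: "0 <= t" "t <= 1"
    and C: "C \<in> sets borel" "!!x y. x \<in> closure K0 ==> y \<in> closure K1 ==> (1 - t) *. x + t *. y \<in> C"
  defines "R0 \<equiv> tilted_root K0 (\<oint>x. T0 x)" and "R1 \<equiv> tilted_root K1 (\<oint>x. T1 x)"
    and "RC \<equiv> tilted_root C ((1 - t) *. (\<oint>x. T0 x) + t *. (\<oint>x. T1 x))"
  shows "0 < measure gauss C" and "(1 - t) * R0 + t * R1 <= RC"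
    and "0 < t ==> t < 1 ==> RC = (1 - t) * R0 + t * R1 ==> \<exists>c. \<forall>x. T1 x = T0 x + c"
proof -
  let ?n = "real CARD('n)"
  interpret G0: gaussian_transport \<phi>0 T0 K0 by (rule G(1))
  interpret G1: gaussian_transport \<phi>1 T1 K1 by (rule G(2))
  define f where "f x = T1 x - T0 x" for x
  have lip: "(1 + 1)-lipschitz_on UNIV f" unfolding f_def[abs_def] by (rule lipschitz_on_diff[OF G1.lip G0.lip])
  have main: "a * gap_comb (gauss_var (ou a f) / (2 * ?n)) t R0 R1 <= RC"
    and pos: "0 < measure gauss C" if a: "0 < a" "a < 1" for a
  proof -
    interpret P: transport_pair \<phi>0 T0 K0 \<phi>1 T1 K1 a by unfold_locales (rule a)+
    have "ou a f = (\<lambda>x. ou a T1 x - ou a T0 x)"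
      using ou_integrable[OF G1.lip a] ou_integrable[OF G0.lip a] by (simp add: ou_def[abs_def] f_def)
    then have "P.speed = gauss_var (ou a f)" by (simp add: P.speed_def)
    then show "a * gap_comb (gauss_var (ou a f) / (2 * ?n)) t R0 R1 <= RC"
      using P.smoothed_inequality(2)[OF cv t C] unfolding R0_def R1_def RC_def by simp
    show "0 < measure gauss C" by (rule P.smoothed_inequality(1)[OF cv t C])
  qed
  show "0 < measure gauss C" by (rule pos[of "1 / 2"]) auto
  have R: "0 < R0" "0 < R1" by (simp_all add: R0_def R1_def tilted_root_def)
  define Q where "Q = (1 - t) * R0 + t * R1"
  \<comment> \<open>The surplus of \<open>gap_comb\<close> per unit of variance: a factor
    \<open>1 / (2 * ?n)\<close> from its first argument and \<open>1 / 2\<close> from its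
    definition.\<close>
  define M where "M = min R0 R1 * (t * (1 - t)) / (4 * ?n)"
  have M0: "0 <= M" unfolding M_def using R t by (intro divide_nonneg_nonneg mult_nonneg_nonneg) auto
  have main': "a * (Q + gauss_var (ou a f) * M) <= RC" if a: "0 < a" "a < 1" for a
    using main[OF a] by (simp add: gap_comb_def Q_def M_def mult.assoc)
  show "(1 - t) * R0 + t * R1 <= RC" unfolding Q_def[symmetric]
  proof (rule field_le_mult_one_interval)
    fix a :: real assume a: "0 < a" "a < 1"
    have "a * Q <= a * (Q + gauss_var (ou a f) * M)" using a mult_nonneg_nonneg[OF gauss_var_nonneg M0] by (intro mult_left_mono) auto
    then show "a * Q <= RC" using main'[OF a] by linarith
  qed
  show "\<exists>c. \<forall>x. T1 x = T0 x + c" if t': "0 < t" "t < 1" and e: "RC = (1 - t) * R0 + t * R1"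
  proof -
    have M: "0 < M" unfolding M_def using R t' by (intro divide_pos_pos mult_pos_pos) auto
    have "gauss_var (ou a f) <= (Q / M) * (1 - a) / a" if a: "0 < a" "a < 1" for a
    proof -
      have "a * (Q + gauss_var (ou a f) * M) <= Q" using main'[OF a] e by (simp add: Q_def)
      then have "gauss_var (ou a f) * (a * M) <= Q * (1 - a)" by (simp add: algebra_simps)
      then have "gauss_var (ou a f) <= Q * (1 - a) / (a * M)" using a M by (simp add: pos_le_divide_eq)
      then show ?thesis by (simp add: mult.commute)
    qed
    from constant_of_smoothed_variance[OF lip this] have "f x = (\<oint>y. f y)" for x .
    then have "T1 x = T0 x + (\<oint>y. f y)" for x unfolding f_def by (metis add.commute diff_add_cancel)
    then show ?thesis by blast
  qed
qed

section \<open>Rigidity of translated conditional Gaussians\<close>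

lemma distr_density_translate:
  fixes m :: "'a::euclidean_space => ennreal"
  assumes [measurable]: "m \<in> borel_funs"
  shows "distr (density lborel m) borel (\<lambda>x. x + c) = density lborel (\<lambda>y. m (y - c))"
proof (rule measure_eqI)
  fix A assume "A \<in> sets (distr (density lborel m) borel (\<lambda>x. x + c))"
  then have [measurable]: "A \<in> sets borel" by simp
  have A': "(\<lambda>x. x + c) -` A \<in> sets borel" using measurable_sets[of "\<lambda>x. x + c" borel borel A] by simp
  have "emeasure (distr (density lborel m) borel (\<lambda>x. x + c)) A = (\<integral>+x. m x * indicator ((\<lambda>x. x + c) -` A) x)"
    using A' by (simp add: emeasure_distr emeasure_density)
  also have "... = (\<integral>+x. m (c + 1 *. x - c) * indicator A (c + 1 *. x))"
    by (intro nn_integral_cong) (simp add: indicator_def add.commute)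
  also have "... = (\<integral>+y. m (y - c) * indicator A y)"
    by (subst nn_integral_lborel_affine[of "\<lambda>y. m (y - c) * indicator A y" 1 c]) auto
  also have "... = emeasure (density lborel (\<lambda>y. m (y - c))) A" by (simp add: emeasure_density)
  finally show "emeasure (distr (density lborel m) borel (\<lambda>x. x + c)) A = emeasure (density lborel (\<lambda>y. m (y - c))) A" .
qed simp

lemma negligible_hyperplane_AE:
  fixes v :: "'a::euclidean_space"
  assumes "v ~= 0" shows "AE y in lborel. v \<bullet> y ~= c"
proof -
  have m: "{y. v \<bullet> y = c} \<in> sets borel" using closed_hyperplane[of v c] by (rule borel_closed)
  have "negligible {y. v \<bullet> y = c}" using assms by (intro negligible_hyperplane) simp
  then have "{y. v \<bullet> y = c} \<in> null_sets lborel" by (simp add: negligible_iff_null_sets null_sets_def)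
  from AE_not_in[OF this] show ?thesis by simp
qed

text \<open>The density of \<open>gauss\<close> conditioned on \<open>K1\<close> is the translate by \<open>c\<close> of the one of \<open>K0\<close>;
  the ratio of the two Gaussian factors is constant only when \<open>c = 0\<close>.\<close>

lemma transport_rigidity:
  fixes \<phi>0 \<phi>1 :: "real ^ 'n => real"
  assumes G: "gaussian_transport \<phi>0 T0 K0" "gaussian_transport \<phi>1 T1 K1"
    and c: "!!x. T1 x = T0 x + c"
  shows "AE y in lborel. y \<in> K0 \<longleftrightarrow> y \<in> K1"
proof -
  interpret G0: gaussian_transport \<phi>0 T0 K0 by (rule G(1))
  interpret G1: gaussian_transport \<phi>1 T1 K1 by (rule G(2))
  let ?m = "\<lambda>K y. indicator K y * gauss_density y / measure gauss K :: real"
  note [measurable] = G0.K G1.K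
  have "density lborel (\<lambda>y. ennreal (?m K1 y)) = distr (distr gauss borel T0) borel (\<lambda>x. x + c)"
    unfolding G1.law[symmetric] c[abs_def] by (subst distr_distr) (auto simp: o_def c)
  also have "... = density lborel (\<lambda>y. ennreal (?m K0 (y - c)))"
    unfolding G0.law by (rule distr_density_translate) measurable
  finally have "AE y in lborel. ennreal (?m K1 y) = ennreal (?m K0 (y - c))"
    by (intro sigma_finite_measure.density_unique[OF sigma_finite_lborel]) auto
  then have ae: "AE y in lborel. ?m K1 y = ?m K0 (y - c)" by eventually_elim (subst (asm) ennreal_inj, auto)
  define r where "r = ln (measure gauss K0) - ln (measure gauss K1)"
  have key: "y - c \<in> K0" "c \<bullet> y = r + nsq c / 2"
    if y: "y \<in> K1" and e: "?m K1 y = ?m K0 (y - c)" for y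
  proof -
    have p: "0 < ?m K1 y" using y G1.K_pos gauss_density_pos[of y] by simp
    show k: "y - c \<in> K0" using p unfolding e by (auto split: split_indicator_asm)
    have "gauss_density y / measure gauss K1 = gauss_density (y - c) / measure gauss K0" using e y k by simp
    then have "exp (- nsq y / 2) / measure gauss K1 = exp (- nsq (y - c) / 2) / measure gauss K0"
      by (simp add: gauss_density_def flip: times_divide_eq_right)
    then have "ln (exp (- nsq y / 2) / measure gauss K1) = ln (exp (- nsq (y - c) / 2) / measure gauss K0)" by simp
    then have "- nsq y / 2 - ln (measure gauss K1) = - nsq (y - c) / 2 - ln (measure gauss K0)"
      using G0.K_pos G1.K_pos by (simp add: ln_div)
    moreover have "nsq (y - c) = nsq y - 2 * (c \<bullet> y) + nsq c"
      by (simp add: power2_norm_eq_inner inner_diff_right inner_commute)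
    ultimately show "c \<bullet> y = r + nsq c / 2" by (simp add: r_def field_simps)
  qed
  \<comment> \<open>For \<open>c ~= 0\<close> the fact \<open>key\<close> would confine almost all
    of \<open>K1\<close> to one hyperplane, against its positive measure.\<close>
  have c0: "c = 0"
  proof (rule ccontr)
    assume "c ~= 0"
    from negligible_hyperplane_AE[OF this, of "r + nsq c / 2"] ae
    have "AE y in lborel. y \<notin> K1" by eventually_elim (use key in blast)
    then have "AE y in gauss. y \<notin> K1" unfolding gauss_def by (subst AE_density) auto
    then have "measure gauss K1 = 0" by (subst (asm) gauss.prob_eq_0[symmetric]) auto
    then show False using G1.K_pos by simp
  qed
  from ae show ?thesis
  proof eventually_elim
    case (elim y)
    then have e: "?m K1 y = ?m K0 (y - c)" .
    have g: "0 < gauss_density y" by (rule gauss_density_pos)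
    show ?case
    proof
      show "y \<in> K1" if "y \<in> K0" using e that c0 g G0.K_pos by (cases "y \<in> K1") auto
      show "y \<in> K0" if "y \<in> K1" using e that c0 g G1.K_pos by (cases "y \<in> K0") auto
    qed
  qed
qed

section \<open>Conditioned Gaussian measures of convex sets\<close>

text \<open>On \<open>K\<close> the density is a multiple of the Gaussian one, for which the
  log-concavity condition is an equality; convexity of \<open>K\<close> is what keeps the
  intermediate point inside.\<close>

lemma gaussian_transport_exists:
  fixes K :: "(real ^ 'n) set"
  assumes cv: "convex K" and K [measurable]: "K \<in> sets borel" and pos: "0 < measure gauss K"
  obtains \<phi> T where "gaussian_transport \<phi> T K"
proof -
  define m where "m y = indicator K y * gauss_density y / measure gauss K" for y
  have mm [measurable]: "m \<in> borel_funs" unfolding m_def[abs_def] by measurable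
  have m0: "0 <= m y" for y by (simp add: m_def)
  have lc: "gauss_logconcave m" unfolding gauss_logconcave_def
  proof (intro conjI allI impI m0 mm)
    fix x y :: "real ^ 'n" and t :: real assume t: "0 < t" "t < 1"
    show "m x powr (1 - t) * m y powr t * exp (t * (1 - t) * nsq (x - y) / 2) <= m ((1 - t) *. x + t *. y)"
    proof (cases "x \<in> K \<and> y \<in> K")
      case False
      then have "m x powr (1 - t) * m y powr t = 0" by (auto simp: m_def)
      then show ?thesis using m0[of "(1 - t) *. x + t *. y"] by auto
    next
      case True
      define l where "l = ln ((2 * pi) powr (- (real CARD('n) / 2)) / measure gauss K)"
      have c: "0 < (2 * pi) powr (- (real CARD('n) / 2)) / measure gauss K" using pos by simp
      have el: "exp l = (2 * pi) powr (- (real CARD('n) / 2)) / measure gauss K" unfolding l_def using c by (rule exp_ln)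
      have e: "m z = exp (l - nsq z / 2)" if "z \<in> K" for z
      proof -
        have "exp (l - nsq z / 2) = exp l * exp (- nsq z / 2)" by (simp flip: exp_add)
        then show ?thesis using that by (simp add: m_def gauss_density_def el)
      qed
      have "(1 - t) *. x + t *. y \<in> K" using True t cv by (intro convexD) auto
      note ee = e[OF conjunct1[OF True]] e[OF conjunct2[OF True]] e[OF this]
      have "nsq ((1 - t) *. x + t *. y) = (1 - t) * nsq x + t * nsq y - t * (1 - t) * nsq (x - y)"
        by (rule norm_sq_convex_comb)
      then have "(1 - t) * (l - nsq x / 2) + t * (l - nsq y / 2) + t * (1 - t) * nsq (x - y) / 2
        = l - nsq ((1 - t) *. x + t *. y) / 2" by (simp add: field_simps)
      then show ?thesis unfolding ee powr_def by (simp flip: exp_add)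
    qed
  qed
  define \<mu> where "\<mu> = density lborel (\<lambda>y. ennreal (m y))"
  have dg: "density gauss f = density lborel (\<lambda>y. ennreal (gauss_density y) * f y)"
    if "f \<in> borel_funs" for f :: "real ^ 'n => ennreal"
    unfolding gauss_def using that by (subst density_density_eq) auto
  have \<mu>: "\<mu> = density gauss (\<lambda>y. ennreal (indicator K y / measure gauss K))"
    unfolding \<mu>_def by (subst dg) (auto simp: m_def mult.commute simp flip: ennreal_mult')
  have "exp_moments \<mu>"
  proof (intro exp_moments.intro prob_spaceI exp_moments_axioms.intro)
    have "emeasure \<mu> (space \<mu>) = (\<integral>\<^sup>+y. ennreal (1 / measure gauss K) * indicator K y \<partial>gauss)"
      unfolding \<mu> by (subst emeasure_density) (auto intro!: nn_integral_cong split: split_indicator)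
    also have "... = ennreal (1 / measure gauss K) * ennreal (measure gauss K)"
      by (subst nn_integral_cmult_indicator) (auto simp: gauss.emeasure_eq_measure)
    also have "... = 1" using pos by (simp flip: ennreal_mult')
    finally show "emeasure \<mu> (space \<mu>) = 1" .
    show "sets \<mu> = sets borel" by (simp add: \<mu>_def)
    fix p :: "real ^ 'n"
    have "integrable gauss (\<lambda>y. (indicator K y / measure gauss K) *. exp (p \<bullet> y))"
    proof (rule Bochner_Integration.integrable_bound)
      show "integrable gauss (\<lambda>y. (1 / measure gauss K) * exp (p \<bullet> y))"
        using integrable_gauss_exp by (intro integrable_mult_right) auto
    qed (auto simp: pos split: split_indicator)
    then show "integrable \<mu> (\<lambda>y. exp (p \<bullet> y))" unfolding \<mu> by (subst integrable_density) auto
  qed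
  from contractive_transport_exists[OF lc \<mu>_def this] obtain \<phi> T where "one_smooth \<phi> T" "distr gauss borel T = \<mu>" .
  then have "gaussian_transport \<phi> T K" using K pos by unfold_locales (simp_all add: \<mu>_def m_def)
  then show ?thesis by (rule that)
qed

section \<open>Comparison with the completed Gaussian measure\<close>

lemma gauss_measure_density: "gauss_measure = density lebesgue (\<lambda>x :: real ^ 'n. ennreal (gauss_density x))"
  by (simp add: gauss_measure_def gauss_density_def)

lemma sets_gauss_measure [simp]: "sets (gauss_measure :: (real ^ 'n) measure) = sets lebesgue"
  by (simp add: gauss_measure_def)

lemma gauss_density_lebesgue_measurable [measurable]: "gauss_density \<in> borel_measurable lebesgue"
  by (rule measurable_completion) simp

lemma emeasure_gauss_measure:
  assumes "A \<in> sets lebesgue"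
  shows "emeasure gauss_measure A = (\<integral>+x. ennreal (gauss_density x) * indicator A x)"
  using assms unfolding gauss_measure_density by (subst emeasure_density) (auto simp: nn_integral_completion)

lemma emeasure_gauss_measure_borel: "A \<in> sets borel ==> emeasure gauss_measure A = emeasure gauss A"
  by (simp add: emeasure_gauss_measure gauss_def emeasure_density)

lemma measure_gauss_measure_borel: "A \<in> sets borel ==> measure gauss_measure A = measure gauss A"
  by (simp add: measure_def emeasure_gauss_measure_borel)

lemma convex_sets_lebesgue:
  fixes K :: "'a::euclidean_space set"
  assumes "convex K"
  shows "negligible (closure K - K)" "K \<in> sets lebesgue"
proof -
  show n: "negligible (closure K - K)"
    by (rule negligible_subset[OF negligible_convex_frontier[OF assms]]) (use interior_subset in \<open>auto simp: frontier_def\<close>)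
  have "closure K \<in> sets lebesgue" by simp
  moreover have "K = closure K - (closure K - K)" using closure_subset[of K] by blast
  ultimately show "K \<in> sets lebesgue" using negligible_imp_sets[OF n] by (metis sets.Diff)
qed

text \<open>The frontier of a convex set is null. Hence the Minkowski combination, possibly not
  Borel, can be traded for its closure, a Borel set that contains the values of the interpolated
  maps.\<close>

lemma measure_gauss_measure_convex:
  fixes K :: "(real ^ 'n) set"
  assumes "convex K" shows "measure gauss_measure K = measure gauss (closure K)"
proof -
  note c = convex_sets_lebesgue[OF assms]
  have "emeasure gauss_measure (closure K - K) = (\<integral>\<^sup>+x. ennreal (gauss_density x) * indicator (closure K - K) x \<partial>lebesgue)"
    using negligible_imp_sets[OF c(1)] by (simp add: emeasure_gauss_measure nn_integral_completion)
  also have "... = 0" using c(1) by (intro nn_integral_null_set) (simp add: negligible_iff_null_sets)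
  finally have "closure K - K \<in> null_sets gauss_measure" using negligible_imp_sets[OF c(1)] by auto
  then have "emeasure gauss_measure (K \<union> (closure K - K)) = emeasure gauss_measure K"
    using c(2) by (intro emeasure_Un_null_set) auto
  moreover have "K \<union> (closure K - K) = closure K" using closure_subset[of K] by blast
  ultimately show ?thesis by (simp add: measure_def emeasure_gauss_measure_borel)
qed

text \<open>Rewrites conditioning on the completed sigma-algebra as the Borel density that appears
  as the law of the transport map, so that the barycenter becomes the Gaussian mean of the
  map.\<close>

lemma barycenter_eq_integral:
  fixes K :: "(real ^ 'n) set"
  assumes K [measurable]: "K \<in> sets borel" and pos: "0 < measure gauss K"
  shows "barycenter K = (\<integral>y. y \<partial>density lborel (\<lambda>y. ennreal (indicator K y * gauss_density y / measure gauss K)))"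
proof -
  let ?m = "\<lambda>y. indicator K y * gauss_density y / measure gauss K"
  have e: "emeasure gauss_measure K = ennreal (measure gauss K)"
    by (simp add: emeasure_gauss_measure_borel gauss.emeasure_eq_measure)
  have [measurable]: "K \<in> sets lebesgue" by simp
  have "ennreal (gauss_density y) * (indicator K y / ennreal (measure gauss K)) = ennreal (?m y)" for y
  proof -
    have "indicator K y / ennreal (measure gauss K) = ennreal (indicator K y / measure gauss K)"
      using divide_ennreal[of 1 "measure gauss K"] pos by (simp split: split_indicator)
    then show ?thesis by (simp flip: ennreal_mult')
  qed
  then have "gauss_cond K = density lebesgue (\<lambda>y. ennreal (?m y))"
    unfolding gauss_cond_def uniform_measure_def e unfolding gauss_measure_density by (subst density_density_eq) auto
  then have "barycenter K = (\<integral>y. ?m y *. y \<partial>lebesgue)"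
    unfolding barycenter_def by (simp, subst integral_density) (auto intro!: measurable_completion)
  also have "... = (\<integral>y. ?m y *. y \<partial>lborel)" by (rule integral_completion) measurable
  also have "... = (\<integral>y. y \<partial>density lborel (\<lambda>y. ennreal (?m y)))" by (subst integral_density) auto
  finally show ?thesis .
qed

lemma (in gaussian_transport) barycenter_eq: "barycenter K = (\<oint>x. T x)"
  unfolding barycenter_eq_integral[OF K K_pos] law[symmetric] by (subst integral_distr) auto

lemma barycenter_cong:
  fixes K0 K1 :: "(real ^ 'n) set"
  assumes "K0 \<in> sets borel" "K1 \<in> sets borel" "0 < measure gauss K0" "measure gauss K0 = measure gauss K1"
    and "AE y in lborel. y \<in> K0 \<longleftrightarrow> y \<in> K1"
  shows "barycenter K0 = barycenter K1"
proof -
  note [measurable] = assms(1,2)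
  have "density lborel (\<lambda>y. ennreal (indicator K0 y * gauss_density y / measure gauss K0))
    = density lborel (\<lambda>y. ennreal (indicator K1 y * gauss_density y / measure gauss K1))"
    using assms(5) by (intro density_cong) (auto simp: assms(4) indicator_def)
  then show ?thesis using assms by (simp add: barycenter_eq_integral)
qed

lemma convex_interior_nonempty:
  fixes K :: "(real ^ 'n) set"
  assumes cv: "convex K" and K: "K \<in> sets borel" and pos: "0 < measure gauss K"
  shows "interior K ~= {}"
proof
  assume "interior K = {}"
  then have "negligible K"
    using negligible_subset[OF negligible_convex_frontier[OF cv], of K] closure_subset by (auto simp: frontier_def)
  then have "K \<in> null_sets lborel" using K by (simp add: negligible_iff_null_sets null_sets_def)
  then have "AE y in gauss. y \<notin> K" unfolding gauss_def by (subst AE_density) (auto dest!: AE_not_in)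
  then have "measure gauss K = 0" using K by (subst (asm) gauss.prob_eq_0[symmetric]) auto
  then show False using pos by simp
qed

text \<open>The part of the interior of \<open>K0\<close> outside \<open>closure K1\<close> is open
  and null, hence empty; a convex set with interior points is recovered, up to closure, from its
  interior.\<close>

lemma closure_subset_of_AE:
  fixes K0 K1 :: "(real ^ 'n) set"
  assumes cv: "convex K0" and ne: "interior K0 ~= {}" and ae: "AE y in lborel. y \<in> K0 \<longleftrightarrow> y \<in> K1"
  shows "closure K0 \<subseteq> closure K1"
proof -
  have o: "open (interior K0 - closure K1)" by (intro open_Diff) auto
  have "AE y in lborel. y \<notin> interior K0 - closure K1"
    using ae by eventually_elim (use interior_subset closure_subset in blast)
  then have "interior K0 - closure K1 \<in> null_sets lborel" by (subst AE_iff_null_sets) auto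
  then have "negligible (interior K0 - closure K1)" by (simp add: negligible_iff_null_sets null_sets_def)
  then have "interior K0 - closure K1 = {}" using o open_not_negligible by blast
  then have "closure (interior K0) \<subseteq> closure K1" by (intro closure_minimal) auto
  then show ?thesis using convex_closure_interior[OF cv ne] by simp
qed

lemma tilted_root_eq:
  fixes K :: "(real ^ 'n) set"
  assumes "0 < measure gauss K"
  shows "tilted_root K b = exp (nsq b / (2 * real CARD('n))) * measure gauss K powr (1 / real CARD('n))"
  using assms by (simp add: tilted_root_def powr_def add_divide_distrib flip: exp_add)

text \<open>Convex sets with the same closure have the same interior, and each interior point is the
  combination of two copies of itself.\<close>

lemma closure_minkowski_comb_same:
  fixes K0 K1 :: "'a::euclidean_space set"
  assumes cv: "convex K0" "convex K1" and ne: "interior K0 ~= {}" and e: "closure K0 = closure K1" and t: "0 <= t" "t <= 1"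
  shows "closure (minkowski_comb t K0 K1) = closure K0"
proof
  have "minkowski_comb t K0 K1 \<subseteq> closure K0"
  proof
    fix z assume "z \<in> minkowski_comb t K0 K1"
    then obtain x y where "z = (1 - t) *. x + t *. y" "x \<in> closure K0" "y \<in> closure K0"
      using closure_subset[of K0] closure_subset[of K1] e by (auto simp: minkowski_comb_def)
    then show "z \<in> closure K0" using convexD[OF convex_closure[OF cv(1)]] t by auto
  qed
  then show "closure (minkowski_comb t K0 K1) \<subseteq> closure K0" by (rule closure_minimal) simp
  have "interior K0 = interior K1" using convex_interior_closure[OF cv(1)] convex_interior_closure[OF cv(2)] e by simp
  have "interior K0 \<subseteq> minkowski_comb t K0 K1"
  proof
    fix x assume x: "x \<in> interior K0"
    then have "x \<in> K0" "x \<in> K1" using \<open>interior K0 = interior K1\<close> interior_subset by blast+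
    moreover have "x = (1 - t) *. x + t *. x" by simp
    ultimately show "x \<in> minkowski_comb t K0 K1" unfolding minkowski_comb_def by blast
  qed
  then have "closure (interior K0) \<subseteq> closure (minkowski_comb t K0 K1)" by (rule closure_mono)
  then show "closure K0 \<subseteq> closure (minkowski_comb t K0 K1)" using convex_closure_interior[OF cv(1) ne] by simp
qed

lemma convex_minkowski_comb: "convex A ==> convex B ==> convex (minkowski_comb t A B)"
proof -
  assume "convex A" "convex B"
  then have "convex (\<Union>x\<in>(*.) (1 - t) ` A. \<Union>y\<in>(*.) t ` B. {x + y})" by (intro convex_sums convex_scaling)
  moreover have "(\<Union>x\<in>(*.) (1 - t) ` A. \<Union>y\<in>(*.) t ` B. {x + y}) = minkowski_comb t A B"
    unfolding minkowski_comb_def by auto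
  ultimately show ?thesis by simp
qed

lemma closure_minkowski_comb_mem:
  assumes "x \<in> closure A" "y \<in> closure B"
  shows "(1 - t) *. x + t *. (y :: 'a::real_normed_vector) \<in> closure (minkowski_comb t A B)"
proof -
  obtain u v where u: "!!k. u k \<in> A" "u ----> x" and v: "!!k. v k \<in> B" "v ----> y"
    using assms unfolding closure_sequential by blast
  have "(\<lambda>k. (1 - t) *. u k + t *. v k) ----> (1 - t) *. x + t *. y" by (intro tendsto_intros u v)
  moreover have "(1 - t) *. u k + t *. v k \<in> minkowski_comb t A B" for k
    unfolding minkowski_comb_def using u(1) v(1) by blast
  ultimately show ?thesis unfolding closure_sequential by (intro exI conjI allI)
qed

theorem corollary1p6:
  fixes K0 K1 :: "(real ^ 'n) set"
  assumes "convex K0" and "K0 \<in> sets borel" and "measure gauss_measure K0 > 0"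
    and "convex K1" and "K1 \<in> sets borel" and "measure gauss_measure K1 > 0"
  shows
    "let n = real CARD('n);
         K = (\<lambda>t. minkowski_comb t K0 K1);
         b = (\<lambda>t. (1 - t) *\<^sub>R barycenter K0 + t *\<^sub>R barycenter K1);
         lhs = (\<lambda>t. exp ((norm (b t))\<^sup>2 / (2 * n)) * measure gauss_measure (K t) powr (1 / n));
         rhs = (\<lambda>t. (1 - t) * (exp ((norm (barycenter K0))\<^sup>2 / (2 * n))
                                  * measure gauss_measure K0 powr (1 / n))
                   + t * (exp ((norm (barycenter K1))\<^sup>2 / (2 * n))
                            * measure gauss_measure K1 powr (1 / n)))
     in (\<forall>t\<in>{0..1}. lhs t \<ge> rhs t)
      \<and> ((\<exists>t\<in>{0<..<1}. lhs t = rhs t) \<longleftrightarrow> closure K0 = closure K1)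
      \<and> (closure K0 = closure K1 \<longrightarrow> (\<forall>t\<in>{0..1}. lhs t = rhs t))
      \<and> (barycenter K0 = barycenter K1 \<longrightarrow>
           (\<forall>t\<in>{0..1}. measure gauss_measure (K t) powr (1 / n)
              \<ge> (1 - t) * measure gauss_measure K0 powr (1 / n)
                + t * measure gauss_measure K1 powr (1 / n)))"
proof -
  define n where "n = real CARD('n)"
  define K where "K t = minkowski_comb t K0 K1" for t
  define b where "b t = (1 - t) *. barycenter K0 + t *. barycenter K1" for t
  let ?m = "\<lambda>S. measure gauss_measure S powr (1 / n)"
  define lhs where "lhs t = exp (nsq (b t) / (2 * n)) * ?m (K t)" for t
  define r where "r S = exp (nsq (barycenter S) / (2 * n)) * ?m S" for S :: "(real ^ 'n) set"
  define rhs where "rhs t = (1 - t) * r K0 + t * r K1" for t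
  have K0: "K0 \<in> sets borel" "0 < measure gauss K0" and K1: "K1 \<in> sets borel" "0 < measure gauss K1"
    using assms by (simp_all add: measure_gauss_measure_borel)
  obtain \<phi>0 T0 where G0: "gaussian_transport \<phi>0 T0 K0" using gaussian_transport_exists[OF assms(1) K0] .
  obtain \<phi>1 T1 where G1: "gaussian_transport \<phi>1 T1 K1" using gaussian_transport_exists[OF assms(4) K1] .
  have b0: "barycenter K0 = (\<oint>x. T0 x)" by (rule gaussian_transport.barycenter_eq[OF G0])
  have b1: "barycenter K1 = (\<oint>x. T1 x)" by (rule gaussian_transport.barycenter_eq[OF G1])
  have r: "tilted_root S (barycenter S) = r S" if "S \<in> sets borel" "0 < measure gauss S" for S
    using that by (simp add: tilted_root_eq r_def n_def measure_gauss_measure_borel)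
  have mK: "measure gauss_measure (K t) = measure gauss (closure (K t))" for t
    unfolding K_def by (rule measure_gauss_measure_convex[OF convex_minkowski_comb[OF assms(1,4)]])
  \<comment> \<open>The transport inequality is used with the closure of \<open>K t\<close> as
    target: it is Borel, has the same Gaussian measure as \<open>K t\<close>, and contains all
    combinations of points of the two closures.\<close>
  have trans: "rhs t <= lhs t" and rigid: "0 < t ==> t < 1 ==> lhs t = rhs t ==> \<exists>c. \<forall>x. T1 x = T0 x + c"
    if t: "0 <= t" "t <= 1" for t
  proof -
    have C: "closure (K t) \<in> sets borel" by simp
    note I = transport_inequality[OF G0 G1 assms(1,4) t C closure_minkowski_comb_mem[of _ K0 _ K1 t, folded K_def],
        folded b0 b1, folded b_def, unfolded r[OF K0] r[OF K1]]
    have "tilted_root (closure (K t)) (b t) = lhs t" using I(1) by (simp add: tilted_root_eq lhs_def mK n_def)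
    with I(2,3) show "rhs t <= lhs t" "0 < t ==> t < 1 ==> lhs t = rhs t ==> \<exists>c. \<forall>x. T1 x = T0 x + c"
      by (simp_all add: rhs_def)
  qed
  have eq: "lhs t = rhs t" if e: "closure K0 = closure K1" and t: "0 <= t" "t <= 1" for t
  proof -
    have ne: "interior K0 ~= {}" by (rule convex_interior_nonempty[OF assms(1) K0])
    have cK: "closure (K t) = closure K0" unfolding K_def by (rule closure_minkowski_comb_same[OF assms(1,4) ne e t])
    have m: "measure gauss_measure (K t) = measure gauss_measure K0" "measure gauss_measure K0 = measure gauss_measure K1"
      unfolding mK cK by (simp_all add: measure_gauss_measure_convex assms(1,4) e)
    \<comment> \<open>Each set differs from the common closure by a null set. Measures and
      barycenters therefore agree, and both sides reduce to the same expression.\<close>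
    have "AE y in lebesgue. y \<in> K0 \<longleftrightarrow> y \<in> K1"
    proof -
      have n: "AE y in lebesgue. y \<notin> closure S - S" if "convex S" for S :: "(real ^ 'n) set"
        using convex_sets_lebesgue(1)[OF that] unfolding negligible_iff_null_sets by (rule AE_not_in)
      from n[OF assms(1)] n[OF assms(4)] show ?thesis by eventually_elim (use e closure_subset in blast)
    qed
    then have ae: "AE y in lborel. y \<in> K0 \<longleftrightarrow> y \<in> K1" by (simp add: AE_completion_iff)
    have "barycenter K0 = barycenter K1"
      using barycenter_cong[OF K0(1) K1(1) K0(2) _ ae] m(2) K0 K1 by (simp add: measure_gauss_measure_borel)
    then have "b t = barycenter K0" "r K1 = r K0" using m(2) by (simp_all add: b_def r_def)
    then show ?thesis using m(1) by (simp add: lhs_def rhs_def r_def algebra_simps)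
  qed
  have rig: "closure K0 = closure K1" if t: "0 < t" "t < 1" and e: "lhs t = rhs t" for t
  proof -
    obtain c where "!!x. T1 x = T0 x + c" using rigid[of t] t e by auto
    then have ae: "AE y in lborel. y \<in> K0 \<longleftrightarrow> y \<in> K1" by (rule transport_rigidity[OF G0 G1])
    then have ae': "AE y in lborel. y \<in> K1 \<longleftrightarrow> y \<in> K0" by eventually_elim auto
    show ?thesis using closure_subset_of_AE[OF assms(1) convex_interior_nonempty[OF assms(1) K0] ae]
        closure_subset_of_AE[OF assms(4) convex_interior_nonempty[OF assms(4) K1] ae'] by blast
  qed
  have centered: "(1 - t) * ?m K0 + t * ?m K1
      <= ?m (K t)"
    if e: "barycenter K0 = barycenter K1" and t: "0 <= t" "t <= 1" for t
  proof -
    \<comment> \<open>With equal barycenters \<open>b t\<close> does not depend on \<open>t\<close>,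
      so this positive factor is common to all three terms and can be cancelled.\<close>
    define q where "q = exp (nsq (barycenter K0) / (2 * n))"
    have "b t = barycenter K0" using e by (simp add: b_def)
    then have "q * ((1 - t) * ?m K0 + t * ?m K1)
        <= q * ?m (K t)" using trans[OF t] e by (simp add: lhs_def rhs_def r_def q_def algebra_simps)
    moreover have "0 < q" by (simp add: q_def)
    ultimately show ?thesis by simp
  qed
  have half: "(1 / 2 :: real) \<in> {0<..<1}" by simp
  have 1: "\<forall>t\<in>{0..1}. rhs t <= lhs t" using trans by simp
  have 2: "(\<exists>t\<in>{0<..<1}. lhs t = rhs t) \<longleftrightarrow> closure K0 = closure K1" using rig eq[of "1 / 2"] half by auto
  have 3: "closure K0 = closure K1 --> (\<forall>t\<in>{0..1}. lhs t = rhs t)" using eq by simp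
  have 4: "barycenter K0 = barycenter K1 --> (\<forall>t\<in>{0..1}. (1 - t) * ?m K0
      + t * ?m K1 <= ?m (K t))" using centered by simp
  show ?thesis using 1 2 3 4 unfolding Let_def lhs_def rhs_def r_def b_def K_def n_def by (intro conjI)
qed

end
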